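(* Fix integers $d\ge 3$ and $k\ge 2$. For all real numbers $d=\mu_1\ge \mu_2\ge\dots\ge\mu_k\ge 2\sqrt{d-1}$, there exists a sequence of $d$-regular finite simple graphs $\mathcal G_1,\mathcal G_2,\dots$ such that $\lim_{i\to\infty}\lambda_j(\mathcal G_i)=\mu_j$ for all $1\le j\le k$.
   Context: For a finite graph $\mathcal G$ on $N$ vertices, $\lambda_1(\mathcal G)\ge\lambda_2(\mathcal G)\ge\dots\ge\lambda_N(\mathcal G)$ denote the eigenvalues of its adjacency matrix, counted with multiplicity. *)

theory Defs
  imports
    "HOL-Computational_Algebra.Fundamental_Theorem_Algebra"
    "Graph_Theory.Pair_Digraph"
    "Jordan_Normal_Form.Char_Poly"
begin

text \<open>
  A finite simple graph is an instance of the locale \<^locale>\<open>pair_graph\<close>: a finite vertex set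
  with a finite, symmetric, loop-free set of ordered pairs as arcs, so that an edge
  between \<open>u\<close> and \<open>v\<close> is present as both arcs \<open>(u, v)\<close> and \<open>(v, u)\<close>.  Hence the
  degree of a vertex is its out-degree.
\<close>

definition regular_graph :: "nat \<Rightarrow> 'a pair_pre_digraph \<Rightarrow> bool" where
  "regular_graph d G \<longleftrightarrow> (\<forall>v \<in> pverts G. out_degree (with_proj G) v = d)"

text \<open>
  Rows and columns are indexed by \<open>0, \<dots>, N - 1\<close>; index \<open>i\<close> stands for the \<open>i\<close>-th vertex in
  increasing order.
\<close>

definition adjacency_matrix :: "'a :: linorder pair_pre_digraph \<Rightarrow> real mat" where
  "adjacency_matrix G =
     (let vs = sorted_list_of_set (pverts G); N = card (pverts G)
      in mat N N (\<lambda>(i, j). if (vs ! i, vs ! j) \<in> parcs G then 1 else 0))"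

text \<open>
  Multiplicities are those of the roots of the characteristic polynomial; for a real
  symmetric matrix they coincide with the dimensions of the eigenspaces.
\<close>

definition adjacency_eigenvalues :: "'a :: linorder pair_pre_digraph \<Rightarrow> real list" where
  "adjacency_eigenvalues G =
     rev (sorted_list_of_multiset (proots (char_poly (adjacency_matrix G))))"

text \<open>
  The \<open>j\<close>-th largest eigenvalue, with \<open>j\<close> starting from 1.  It is meaningful only for
  \<open>1 \<le> j \<le> N\<close>, where \<open>N\<close> is the number of vertices; outside this range the value is unspecified.
\<close>

definition graph_eigenvalue :: "nat \<Rightarrow> 'a :: linorder pair_pre_digraph \<Rightarrow> real" where
  "graph_eigenvalue j G = adjacency_eigenvalues G ! (j - 1)"

lemma adjacency_matrix_carrier [simp]:
  "adjacency_matrix G \<in> carrier_mat (card (pverts G)) (card (pverts G))"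
  by (simp add: adjacency_matrix_def Let_def)

lemma adjacency_matrix_symmetric:
  assumes "pair_graph G" "i < card (pverts G)" "j < card (pverts G)"
  shows "adjacency_matrix G $$ (i, j) = adjacency_matrix G $$ (j, i)"
proof -
  interpret pair_graph G by fact
  have "(u, v) \<in> parcs G \<longleftrightarrow> (v, u) \<in> parcs G" for u v
    using sym_arcs by (auto simp: symmetric_def sym_def)
  then show ?thesis
    using assms(2,3) by (simp add: adjacency_matrix_def Let_def)
qed

lemma real_symmetric_eigenvalue_real:
  fixes A :: "real mat" and z :: complex
  assumes A: "A \<in> carrier_mat n n"
    and sym: "\<And>i j. i < n \<Longrightarrow> j < n \<Longrightarrow> A $$ (i, j) = A $$ (j, i)"
    and ev: "eigenvalue (map_mat complex_of_real A) z"
  shows "z \<in> \<real>"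
proof -
  obtain v where v: "v \<in> carrier_vec n" "v \<noteq> 0\<^sub>v n"
    and Av: "map_mat complex_of_real A *\<^sub>v v = z \<cdot>\<^sub>v v"
    using ev A unfolding eigenvalue_def eigenvector_def by auto
  have row: "(\<Sum>j<n. of_real (A $$ (i, j)) * v $ j) = z * v $ i" if "i < n" for i
  proof -
    have "(map_mat complex_of_real A *\<^sub>v v) $ i = z * v $ i"
      using Av v that by simp
    then show ?thesis
      using A v that by (simp add: scalar_prod_def atLeast0LessThan)
  qed
  define S where "S = (\<Sum>i<n. \<Sum>j<n. cnj (v $ i) * of_real (A $$ (i, j)) * v $ j)"
  define r where "r = (\<Sum>i<n. (cmod (v $ i))\<^sup>2)"
  have "S = (\<Sum>i<n. cnj (v $ i) * (z * v $ i))"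
    unfolding S_def by (rule sum.cong) (auto simp: row[symmetric] sum_distrib_left mult.assoc)
  also have "\<dots> = z * of_real r"
    by (simp add: r_def sum_distrib_left complex_norm_square mult_ac del: of_real_power)
  finally have S: "S = z * of_real r" .
  have "cnj S = (\<Sum>i<n. \<Sum>j<n. cnj (v $ j) * of_real (A $$ (i, j)) * v $ i)"
    by (simp add: S_def mult_ac)
  also have "\<dots> = (\<Sum>j<n. \<Sum>i<n. cnj (v $ j) * of_real (A $$ (i, j)) * v $ i)"
    by (rule sum.swap)
  also have "\<dots> = S"
    unfolding S_def by (intro sum.cong) (auto simp: sym)
  finally have "cnj z * of_real r = z * of_real r"
    using S by simp
  moreover have "r \<noteq> 0"
  proof
    assume "r = 0"
    then have "\<forall>i<n. v $ i = 0"
      unfolding r_def by (subst (asm) sum_nonneg_eq_0_iff) auto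
    then have "v = 0\<^sub>v n" using v(1) by auto
    then show False using v(2) by simp
  qed
  ultimately show ?thesis
    by (simp add: Reals_cnj_iff)
qed

lemma length_adjacency_eigenvalues:
  assumes "pair_graph G"
  shows "length (adjacency_eigenvalues G) = card (pverts G)"
proof -
  define n where "n = card (pverts G)"
  define A where "A = adjacency_matrix G"
  have A: "A \<in> carrier_mat n n"
    unfolding A_def n_def by simp
  let ?C = "map_mat complex_of_real A"
  have C: "?C \<in> carrier_mat n n" using A by simp
  obtain as where as: "char_poly ?C = (\<Prod>a\<leftarrow>as. [:- a, 1:])" "length as = n"
    using char_poly_factorized[OF C] by blast
  have "a \<in> \<real>" if "a \<in> set as" for a
  proof -
    have "poly (char_poly ?C) a = 0"
      using that unfolding as(1) poly_prod_list prod_list_zero_iff by force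
    then have "eigenvalue ?C a"
      using eigenvalue_root_char_poly[OF C] by simp
    then show ?thesis
      using real_symmetric_eigenvalue_real[OF A] adjacency_matrix_symmetric[OF assms]
      unfolding A_def n_def by blast
  qed
  then have Re: "as = map (complex_of_real \<circ> Re) as"
    by (intro map_idI[symmetric]) simp
  interpret h: map_poly_inj_comm_ring_hom complex_of_real ..
  have "map_poly complex_of_real (char_poly A) = char_poly ?C"
    by (rule of_real_hom.char_poly_hom[OF A, symmetric])
  also have "\<dots> = map_poly complex_of_real (\<Prod>a\<leftarrow>map Re as. [:- a, 1:])"
    unfolding as(1) by (subst Re) (simp add: h.hom_prod_list o_def)
  finally have "char_poly A = (\<Prod>a\<leftarrow>map Re as. [:- a, 1:])"
    by simp
  moreover have "proots (\<Prod>a\<leftarrow>xs. [:- a, 1:]) = mset xs" for xs :: "real list"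
  proof (induction xs)
    case (Cons x xs)
    have "(\<Prod>a\<leftarrow>xs. [:- a, 1:]) \<noteq> 0"
      by (auto simp: prod_list_zero_iff)
    then show ?case using Cons by (simp add: proots_mult del: mult_pCons_left)
  qed simp
  ultimately have "proots (char_poly A) = mset (map Re as)"
    by metis
  moreover have "length (sorted_list_of_multiset M) = size M" for M :: "real multiset"
    by (metis mset_sorted_list_of_multiset size_mset)
  ultimately show ?thesis
    using as(2) by (simp add: adjacency_eigenvalues_def A_def n_def)
qed

lemma graph_eigenvalue_antimono:
  assumes "pair_graph G" "1 \<le> i" "i \<le> j" "j \<le> card (pverts G)"
  shows "graph_eigenvalue j G \<le> graph_eigenvalue i G"
proof -
  have "sorted (rev (adjacency_eigenvalues G))"
    by (simp add: adjacency_eigenvalues_def)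
  then show ?thesis
    using assms length_adjacency_eigenvalues[OF assms(1)]
    unfolding graph_eigenvalue_def by (intro sorted_rev_nth_mono) auto
qed

end

theory Submission
  imports Defs "Jordan_Normal_Form.Schur_Decomposition"
begin

text \<open>
  By a small perturbation we may assume that \<open>\<mu> 1 > \<dots> > \<mu> k > 2 * sqrt (d - 1)\<close>.  Take a random \<open>N\<close>-fold lift of the
  complete graph on \<open>d + 1\<close> vertices and lift it once more by \<open>k\<close>, permuting the \<open>k\<close> sheets along every edge by an
  independent random involution.  Let \<open>\<tau> j\<close> be the eigenvalues of the averaged involution.  Closed nonbacktracking walks
  of length \<open>n\<close> running around a cycle contribute about \<open>(\<Sum>j<k. (\<tau> j * (d - 1)) ^ n)\<close> to the expected trace of the \<open>n\<close>-th
  Dickson polynomial of the adjacency matrix, as if there were \<open>k\<close> additional eigenvalues \<open>\<alpha> + (d - 1) / \<alpha>\<close> with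
  \<open>\<alpha> = \<tau> j * (d - 1)\<close>.  Since the expected traces are rational functions of \<open>1 / N\<close>, Markov's inequality for polynomials
  makes this estimate effective for polynomials whose degree grows with \<open>N\<close>, including approximate indicators of the
  complement of \<open>[- 2 * sqrt (d - 1), 2 * sqrt (d - 1)]\<close>.  Hence on average there are \<open>k\<close> eigenvalues outside this interval,
  all of them near the predicted values.  A second moment computation with the \<open>k\<close> eigenvectors of the averaged
  involution as test vectors shows that no predicted value is missed.  Averages over initial segments of the
  \<open>k\<close> sheets realise every choice of \<open>1 = \<tau> 0 \<ge> \<tau> 1 \<ge> \<dots> \<ge> 0\<close>.
\<close>

hide_const (open) module.smult

section \<open>Dickson polynomials and nonbacktracking walks\<close>

text \<open>Two facts make Dickson polynomials the right basis. Since D_n(a + s/a) = a^n + (s/a)^n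
  with s = d - 1, a term \<alpha>^n in closed walk counts reads as an eigenvalue \<alpha> +
  s/\<alpha>, and \<alpha> in (sqrt s, s] sweeps out (2 sqrt s, d]. And a polynomial bounded by S on
  the bulk has n-th Dickson coefficient at most S / (sqrt s)^n, so errors of size n (sqrt s)^n in
  the counts, such as those from walks that run around a cycle several times, cost only S times a
  power of the degree. The bulk holds of order N eigenvalues, so a test polynomial must be far below
  1/N there while being close to 1 beyond it. Its degree therefore has to grow with N, and limits
  for fixed polynomials do not suffice. Traces control eigenvalues only on average: a lift might
  have two eigenvalues near one predicted value and none near another. The quadratic forms exclude
  this, since they concentrate in mean square and would be small without an eigenvalue near their
  own value.\<close>

fun dickson :: "real \<Rightarrow> nat \<Rightarrow> real poly" where
  "dickson s 0 = [:2:]"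
| "dickson s (Suc 0) = [:0, 1:]"
| "dickson s (Suc (Suc n)) = [:0, 1:] * dickson s (Suc n) - smult s (dickson s n)"

lemma poly_dickson_add:
  assumes "a * b = s"
  shows "poly (dickson s n) (a + b) = a ^ n + b ^ n"
  using assms
  by (induction s n rule: dickson.induct) (auto simp: algebra_simps power2_eq_square)

lemma poly_dickson_cos:
  assumes "s \<ge> 0"
  shows "poly (dickson s n) (2 * sqrt s * cos t) = 2 * sqrt s ^ n * cos (real n * t)"
proof (induction n rule: induct_nat_012)
  case (ge2 n)
  have c: "cos (real (Suc (Suc n)) * t) = 2 * cos t * cos (real (Suc n) * t) - cos (real n * t)"
  proof -
    have "real (Suc (Suc n)) * t = real (Suc n) * t + t" "real n * t = real (Suc n) * t - t"
      by (simp_all add: algebra_simps)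
    then show ?thesis by (simp only: cos_add cos_diff) (simp add: algebra_simps)
  qed
  let ?x = "2 * sqrt s * cos t"
  have "poly (dickson s (Suc (Suc n))) ?x =
      ?x * poly (dickson s (Suc n)) ?x - s * poly (dickson s n) ?x"
    by simp
  also have "\<dots> = ?x * (2 * sqrt s ^ Suc n * cos (real (Suc n) * t))
      - (sqrt s * sqrt s) * (2 * sqrt s ^ n * cos (real n * t))"
    unfolding ge2 using assms by simp
  finally have eq: "poly (dickson s (Suc (Suc n))) ?x = \<dots>" .
  show ?case unfolding eq c by (simp add: algebra_simps)
qed auto

lemma degree_dickson_le: "degree (dickson s n) \<le> n"
proof (induction s n rule: dickson.induct)
  case (3 s n)
  show ?case
    using 3 by (auto intro!: degree_diff_le degree_mult_le[THEN order_trans]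
        order_trans[OF degree_smult_le])
qed auto

lemma coeff_dickson: "n > 0 \<Longrightarrow> coeff (dickson s n) n = 1"
proof (induction s n rule: dickson.induct)
  case (3 s n)
  have "coeff (dickson s n) (Suc (Suc n)) = 0"
    using degree_dickson_le[of s n] by (simp add: coeff_eq_0)
  then show ?case using 3 by simp
qed auto

lemma dickson_expansion:
  assumes "degree g \<le> q"
  shows "\<exists>b. g = (\<Sum>n\<le>q. smult (b n) (dickson s n))"
  using assms
proof (induction q arbitrary: g)
  case 0
  then obtain c where "g = [:c:]" by (auto elim: degree_eq_zeroE)
  then show ?case by (intro exI[of _ "\<lambda>_. c / 2"]) simp
next
  case (Suc q)
  define r where "r = g - smult (coeff g (Suc q)) (dickson s (Suc q))"
  have "degree r \<le> q"
  proof (rule degree_le, intro allI impI)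
    fix i assume "q < i"
    then consider "i = Suc q" | "i > Suc q" by linarith
    then show "coeff r i = 0"
    proof cases
      case 2
      then have "coeff g i = 0" "coeff (dickson s (Suc q)) i = 0"
        using Suc.prems degree_dickson_le[of s "Suc q"] by (auto intro!: coeff_eq_0)
      then show ?thesis by (simp add: r_def)
    qed (simp add: r_def coeff_dickson)
  qed
  then obtain b where b: "r = (\<Sum>n\<le>q. smult (b n) (dickson s n))" using Suc.IH by blast
  have "g = r + smult (coeff g (Suc q)) (dickson s (Suc q))" by (simp add: r_def)
  also have "\<dots> = (\<Sum>n\<le>Suc q. smult ((b(Suc q := coeff g (Suc q))) n) (dickson s n))"
    using b by simp
  finally show ?case by blast
qed

section \<open>Coefficient bounds in the Dickson basis\<close>

lemma sum_cos_roots_unity: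
  assumes "0 < m" "m < L"
  shows "(\<Sum>j<L. cos (2 * pi * real j * real m / real L)) = 0"
proof -
  define x where "x = 2 * pi * real m / real L"
  have x: "0 < x" "x < 2 * pi" using assms by (auto simp: x_def field_simps)
  have ne: "cis x \<noteq> 1"
  proof
    assume "cis x = 1"
    then have "cos x = 1" by (metis cis.simps(1) one_complex.simps(1))
    then obtain n :: int where n: "x = real_of_int n * (2 * pi)"
      using cos_one_2pi_int by (auto simp: mult.assoc)
    then have "0 < real_of_int n" "real_of_int n < 1"
      using x by (auto simp: zero_less_mult_iff)
    then have "0 < n" "n < 1" by simp_all
    then show False by simp
  qed
  have "(\<Sum>j<L. cis x ^ j) = (cis x ^ L - 1) / (cis x - 1)"
    by (rule geometric_sum[OF ne])
  also have "cis x ^ L = 1"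
  proof -
    have "cis x ^ L = cis (2 * pi * real m)"
      using assms unfolding x_def DeMoivre by (simp add: field_simps)
    also have "\<dots> = 1" by (rule cis_multiple_2pi) simp
    finally show ?thesis .
  qed
  finally have "Re (\<Sum>j<L. cis x ^ j) = 0" by simp
  then show ?thesis by (simp add: DeMoivre x_def algebra_simps)
qed

text \<open>Discrete Fourier inversion: along x = 2 sqrt s cos t the polynomial becomes a cosine
  polynomial, and each of its coefficients is an average of values on the bulk.\<close>

lemma dickson_coeff_bound:
  assumes s: "s > 0" and g: "g = (\<Sum>n\<le>q. smult (b n) (dickson s n))"
    and S: "\<And>x. \<bar>x\<bar> \<le> 2 * sqrt s \<Longrightarrow> \<bar>poly g x\<bar> \<le> S"
    and n: "n \<le> q"
  shows "\<bar>b n\<bar> * sqrt s ^ n \<le> S"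
proof -
  \<comment> \<open>Equispaced angles replace the orthogonality integral: \<open>L\<close> exceeds
    every frequency m + n \<le> 2q that occurs, so the discrete sums are exact.\<close>
  define L where "L = 2 * q + 1"
  define t where "t j = 2 * pi * real j / real L" for j :: nat
  have L: "L > 0" by (simp add: L_def)
  have orth: "(\<Sum>j<L. cos (real m * t j) * cos (real n * t j)) =
     (if m = n then if n = 0 then L else L / 2 else 0)" if m: "m \<le> q" for m
  proof -
    define u where "u = (if m \<le> n then n - m else m - n)"
    have "cos (real m * t j) * cos (real n * t j) =
       (cos (2 * pi * real j * real (m + n) / real L) + cos (2 * pi * real j * real u / real L)) / 2" for j
    proof -
      have e: "2 * pi * real j * real (m + n) / real L = real m * t j + real n * t j"
        by (simp add: t_def field_simps add_divide_distrib)
      have "cos (2 * pi * real j * real u / real L) = cos (real m * t j - real n * t j)"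
      proof (cases "m \<le> n")
        case True
        then have "2 * pi * real j * real u / real L = - (real m * t j - real n * t j)"
          by (simp add: t_def u_def field_simps of_nat_diff diff_divide_distrib)
        then show ?thesis by (metis cos_minus)
      next
        case False
        then have "2 * pi * real j * real u / real L = real m * t j - real n * t j"
          by (simp add: t_def u_def field_simps of_nat_diff diff_divide_distrib)
        then show ?thesis by simp
      qed
      then show ?thesis unfolding e by (simp add: cos_add cos_diff)
    qed
    then have eq: "(\<Sum>j<L. cos (real m * t j) * cos (real n * t j)) =
        ((\<Sum>j<L. cos (2 * pi * real j * real (m + n) / real L))
         + (\<Sum>j<L. cos (2 * pi * real j * real u / real L))) / 2"
      by (simp only: flip: sum_divide_distrib sum.distrib)
    have z1: "(\<Sum>j<L. cos (2 * pi * real j * real (m + n) / real L)) = 0" if "m + n > 0"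
      using that m n by (intro sum_cos_roots_unity) (auto simp: L_def)
    have z2: "(\<Sum>j<L. cos (2 * pi * real j * real u / real L)) = 0" if "u > 0"
      using that m n by (intro sum_cos_roots_unity) (auto simp: L_def u_def)
    have "u = 0 \<longleftrightarrow> m = n" by (auto simp: u_def)
    then show ?thesis unfolding eq using z1 z2 by (cases "m = n"; cases "n = 0") auto
  qed
  have val: "poly g (2 * sqrt s * cos (t j)) = (\<Sum>m\<le>q. b m * (2 * sqrt s ^ m * cos (real m * t j)))" for j
    using s unfolding g by (simp add: poly_sum poly_dickson_cos)
  have "(\<Sum>j<L. poly g (2 * sqrt s * cos (t j)) * cos (real n * t j)) =
     (\<Sum>m\<le>q. 2 * b m * sqrt s ^ m * (\<Sum>j<L. cos (real m * t j) * cos (real n * t j)))"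
    unfolding val by (subst sum_distrib_right, subst sum.swap) (simp add: sum_distrib_left algebra_simps)
  also have "\<dots> = 2 * b n * sqrt s ^ n * (if n = 0 then L else L / 2)"
  proof -
    have "2 * b m * sqrt s ^ m * (\<Sum>j<L. cos (real m * t j) * cos (real n * t j)) =
      (if m = n then 2 * b n * sqrt s ^ n * (if n = 0 then L else L / 2) else 0)" if "m \<le> q" for m
      unfolding orth[OF that] by simp
    then show ?thesis using n by simp
  qed
  finally have eq: "(\<Sum>j<L. poly g (2 * sqrt s * cos (t j)) * cos (real n * t j)) =
     2 * b n * sqrt s ^ n * (if n = 0 then L else L / 2)" .
  have "\<bar>\<Sum>j<L. poly g (2 * sqrt s * cos (t j)) * cos (real n * t j)\<bar> \<le> (\<Sum>j<L. S)"
  proof (rule order_trans[OF sum_abs], rule sum_mono)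
    fix j
    have "\<bar>poly g (2 * sqrt s * cos (t j))\<bar> \<le> S"
      using s by (intro S) (simp add: abs_mult)
    then show "\<bar>poly g (2 * sqrt s * cos (t j)) * cos (real n * t j)\<bar> \<le> S"
      by (metis abs_cos_le_one abs_ge_zero abs_mult mult_left_le order_trans)
  qed
  then have "\<bar>2 * b n * sqrt s ^ n * (if n = 0 then L else L / 2)\<bar> \<le> L * S"
    unfolding eq by simp
  then have B: "2 * (\<bar>b n\<bar> * sqrt s ^ n) * (if n = 0 then L else L / 2) \<le> L * S"
    using s by (simp add: abs_mult split: if_splits)
  show ?thesis
  proof (cases "n = 0")
    case True
    then have "L * (2 * \<bar>b n\<bar>) \<le> L * S" using B by (simp add: algebra_simps)
    then have "2 * \<bar>b n\<bar> \<le> S" using L by simp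
    then show ?thesis using True by simp
  next
    case False
    then have "L * (\<bar>b n\<bar> * sqrt s ^ n) \<le> L * S" using B by (simp add: algebra_simps)
    then show ?thesis using L by simp
  qed
qed

section \<open>Markov-type inequalities and extrapolation to 0 from the points 1/N\<close>

lemma abs_sin_mult_le: "\<bar>sin (real n * x)\<bar> \<le> real n * \<bar>sin x\<bar>"
proof (induction n)
  case (Suc n)
  have "\<bar>sin (real (Suc n) * x)\<bar> = \<bar>sin (real n * x) * cos x + cos (real n * x) * sin x\<bar>"
    by (simp only: of_nat_Suc ring_distribs mult_1 sin_add) (simp add: add.commute sin_add algebra_simps)
  also have "\<dots> \<le> \<bar>sin (real n * x)\<bar> * \<bar>cos x\<bar> + \<bar>cos (real n * x)\<bar> * \<bar>sin x\<bar>"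
    by (metis abs_mult abs_triangle_ineq)
  also have "\<dots> \<le> \<bar>sin (real n * x)\<bar> * 1 + 1 * \<bar>sin x\<bar>"
    by (intro add_mono mult_mono) auto
  also have "\<dots> \<le> real (Suc n) * \<bar>sin x\<bar>" using Suc by (simp add: algebra_simps)
  finally show ?case .
qed simp

text \<open>With x = 2 cos a and y = 2 cos b the difference of the values is a product of sines of
  n(a + b)/2 and n(b - a)/2; each of the two costs one factor n.\<close>

lemma dickson_one_lipschitz:
  assumes "\<bar>x\<bar> \<le> 2" "\<bar>y\<bar> \<le> 2"
  shows "\<bar>poly (dickson 1 n) x - poly (dickson 1 n) y\<bar> \<le> (real n)\<^sup>2 * \<bar>x - y\<bar>"
proof -
  define a b where "a = arccos (x / 2)" and "b = arccos (y / 2)"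
  have x: "x = 2 * cos a" and y: "y = 2 * cos b"
    using assms by (auto simp: a_def b_def cos_arccos_abs)
  have p: "poly (dickson 1 n) (2 * cos t) = 2 * cos (real n * t)" for t
    using poly_dickson_cos[of 1 n t] by simp
  have d: "cos u - cos v = 2 * (sin ((u + v) / 2) * sin ((v - u) / 2))" for u v :: real
    using cos_diff_cos[of u v] by simp
  have "\<bar>poly (dickson 1 n) x - poly (dickson 1 n) y\<bar>
      = 4 * (\<bar>sin (real n * ((a + b) / 2))\<bar> * \<bar>sin (real n * ((b - a) / 2))\<bar>)"
  proof -
    have "poly (dickson 1 n) x - poly (dickson 1 n) y = 2 * (cos (real n * a) - cos (real n * b))"
      unfolding x y p by simp
    also have "\<dots> = 4 * (sin (real n * ((a + b) / 2)) * sin (real n * ((b - a) / 2)))"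
      unfolding d by (simp add: algebra_simps add_divide_distrib diff_divide_distrib)
    finally show ?thesis by (simp add: abs_mult)
  qed
  also have "\<dots> \<le> 4 * ((real n * \<bar>sin ((a + b) / 2)\<bar>) * (real n * \<bar>sin ((b - a) / 2)\<bar>))"
    by (intro mult_left_mono mult_mono abs_sin_mult_le) auto
  also have "\<dots> = (real n)\<^sup>2 * \<bar>x - y\<bar>"
  proof -
    have "x - y = 4 * (sin ((a + b) / 2) * sin ((b - a) / 2))"
      unfolding x y using d[of a b] by simp
    then show ?thesis by (simp add: abs_mult power2_eq_square)
  qed
  finally show ?thesis .
qed

lemma sum_squares_le_cube: "(\<Sum>n\<le>D. (real n)\<^sup>2) \<le> real D ^ 3"
proof (induction D)
  case (Suc D)
  have "(\<Sum>n\<le>Suc D. (real n)\<^sup>2) \<le> real D ^ 3 + (real (Suc D))\<^sup>2" using Suc by simp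
  also have "\<dots> \<le> real (Suc D) ^ 3" by (simp add: power2_eq_square power3_eq_cube algebra_simps)
  finally show ?case .
qed simp

text \<open>A Markov inequality with the exponent 3 in place of 2, which the Dickson coefficients give for free.\<close>

lemma polynomial_lipschitz:
  fixes P :: "real poly"
  assumes deg: "degree P \<le> D" and h: "h > 0"
    and S: "\<And>x. 0 \<le> x \<Longrightarrow> x \<le> h \<Longrightarrow> \<bar>poly P x\<bar> \<le> S"
    and x: "0 \<le> x" "x \<le> h" and y: "0 \<le> y" "y \<le> h"
  shows "\<bar>poly P x - poly P y\<bar> \<le> 4 * real D ^ 3 * S / h * \<bar>x - y\<bar>"
proof -
  \<comment> \<open>The affine substitution sends [-2, 2], the bulk of \<open>dickson 1\<close>,
    onto [0, h], so that \<open>S\<close> bounds every Dickson coefficient of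
    \<open>Q\<close>.\<close>
  define Q where "Q = pcompose P [:h / 2, h / 4:]"
  have "degree Q \<le> D"
    using deg h by (simp add: Q_def degree_pcompose)
  then obtain b where b: "Q = (\<Sum>n\<le>D. smult (b n) (dickson 1 n))"
    using dickson_expansion by blast
  have Qb: "\<bar>poly Q u\<bar> \<le> S" if "\<bar>u\<bar> \<le> 2 * sqrt 1" for u
  proof -
    have "0 \<le> h / 2 + u * (h / 4)" "h / 2 + u * (h / 4) \<le> h"
    proof -
      have "h / 2 + u * (h / 4) = (2 + u) * (h / 4)" "h - (h / 2 + u * (h / 4)) = (2 - u) * (h / 4)"
        by (simp_all add: algebra_simps)
      moreover have "(2 + u) * (h / 4) \<ge> 0" "(2 - u) * (h / 4) \<ge> 0"
        using that h by (auto intro!: mult_nonneg_nonneg)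
      ultimately show "0 \<le> h / 2 + u * (h / 4)" "h / 2 + u * (h / 4) \<le> h" by linarith+
    qed
    then show ?thesis using S by (simp add: Q_def poly_pcompose)
  qed
  have bS: "\<bar>b n\<bar> \<le> S" if "n \<le> D" for n
    using dickson_coeff_bound[OF _ b Qb that] by simp
  have lip: "\<bar>poly Q u - poly Q v\<bar> \<le> S * real D ^ 3 * \<bar>u - v\<bar>" if uv: "\<bar>u\<bar> \<le> 2" "\<bar>v\<bar> \<le> 2" for u v
  proof -
    have "S \<ge> 0" using Qb[of 0] by simp
    have "\<bar>poly Q u - poly Q v\<bar> = \<bar>\<Sum>n\<le>D. b n * (poly (dickson 1 n) u - poly (dickson 1 n) v)\<bar>"
      unfolding b by (simp add: poly_sum right_diff_distrib sum_subtractf)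
    also have "\<dots> \<le> (\<Sum>n\<le>D. S * ((real n)\<^sup>2 * \<bar>u - v\<bar>))"
    proof (rule order_trans[OF sum_abs], rule sum_mono)
      fix n assume "n \<in> {..D}"
      then show "\<bar>b n * (poly (dickson 1 n) u - poly (dickson 1 n) v)\<bar> \<le> S * ((real n)\<^sup>2 * \<bar>u - v\<bar>)"
        unfolding abs_mult using bS dickson_one_lipschitz[OF uv] \<open>S \<ge> 0\<close>
        by (intro mult_mono) auto
    qed
    also have "\<dots> = S * \<bar>u - v\<bar> * (\<Sum>n\<le>D. (real n)\<^sup>2)"
      by (simp add: sum_distrib_left algebra_simps)
    also have "\<dots> \<le> S * \<bar>u - v\<bar> * real D ^ 3"
      using \<open>S \<ge> 0\<close> by (intro mult_left_mono sum_squares_le_cube) auto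
    finally show ?thesis by (simp add: algebra_simps)
  qed
  define u v where "u = 4 * x / h - 2" and "v = 4 * y / h - 2"
  have uv: "\<bar>u\<bar> \<le> 2" "\<bar>v\<bar> \<le> 2" using x y h by (auto simp: u_def v_def abs_le_iff field_simps)
  have "poly Q u = poly P x" "poly Q v = poly P y"
    using h by (auto simp: Q_def poly_pcompose u_def v_def field_simps)
  moreover have "\<bar>u - v\<bar> = 4 / h * \<bar>x - y\<bar>"
  proof -
    have "u - v = 4 / h * (x - y)" using h by (simp add: u_def v_def field_simps)
    then show ?thesis using h by (simp only: abs_mult abs_divide)
  qed
  ultimately show ?thesis using lip[OF uv] by (simp add: field_simps)
qed

lemma polynomial_derivative_bound:
  fixes P :: "real poly"
  assumes deg: "degree P \<le> D" and h: "h > 0"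
    and S: "\<And>x. 0 \<le> x \<Longrightarrow> x \<le> h \<Longrightarrow> \<bar>poly P x\<bar> \<le> S"
    and x: "0 \<le> x" "x \<le> h"
  shows "\<bar>poly (pderiv P) x\<bar> \<le> 4 * real D ^ 3 * S / h"
proof (rule ccontr)
  assume neg: "\<not> ?thesis"
  define B where "B = 4 * real D ^ 3 * S / h"
  have big: "B < \<bar>poly (pderiv P) x\<bar>" using neg by (simp add: B_def)
  have "isCont (\<lambda>x. \<bar>poly (pderiv P) x\<bar>) x" by (intro continuous_intros)
  then have "\<forall>\<^sub>F z in at x. B < \<bar>poly (pderiv P) z\<bar>"
    unfolding isCont_def using big by (rule order_tendstoD(1))
  then obtain e where e0: "e > 0" "\<And>z. z \<noteq> x \<Longrightarrow> dist z x < e \<Longrightarrow> B < \<bar>poly (pderiv P) z\<bar>"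
    unfolding eventually_at by auto
  have e: "e > 0" "\<And>z. \<bar>z - x\<bar> < e \<Longrightarrow> B < \<bar>poly (pderiv P) z\<bar>"
    using e0 big by (metis dist_real_def)+
  \<comment> \<open>The interval lies on one side of \<open>x\<close>, which may be an endpoint of
    [0, h].\<close>
  obtain a c where ac: "a < c" "0 \<le> a" "c \<le> h" "\<And>z. a < z \<Longrightarrow> z < c \<Longrightarrow> \<bar>z - x\<bar> < e"
  proof (cases "x < h")
    case True
    then show ?thesis using e x h by (intro that[of x "min h (x + e)"]) (auto simp: min_def split: if_splits)
  next
    case False
    then show ?thesis using e x h by (intro that[of "max 0 (x - e)" x]) (auto simp: max_def split: if_splits)
  qed
  obtain z where z: "a < z" "z < c" "poly P c - poly P a = (c - a) * poly (pderiv P) z"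
    using poly_MVT[OF ac(1)] by blast
  have "\<bar>poly P c - poly P a\<bar> \<le> B * \<bar>c - a\<bar>"
    unfolding B_def using ac by (intro polynomial_lipschitz[OF deg h S]) auto
  moreover have "B * \<bar>c - a\<bar> < \<bar>c - a\<bar> * \<bar>poly (pderiv P) z\<bar>"
    using e(2)[OF ac(4)[OF z(1,2)]] ac(1) by (simp add: mult.commute)
  ultimately show False unfolding z(3) by (simp add: abs_mult)
qed

text \<open>Below 1/M consecutive reciprocals are at most 1/M^2 apart. M \<ge> 8 D^3 makes the
  Lipschitz bound on such a gap at most half of the maximum of |P|, so bounds at the reciprocals
  control P on all of [0, 1/M] up to a factor 2. Two derivative bounds then control the second
  derivative, and two mean values compare N P(1/N) with P'(0).\<close>

lemma inverse_nat_extrapolation: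
  fixes P :: "real poly" and M N :: nat
  assumes deg: "degree P \<le> D" and D: "D \<ge> 1" and M: "M \<ge> 8 * D ^ 3"
    and P0: "poly P 0 = 0"
    and S: "\<And>N. N \<ge> M \<Longrightarrow> \<bar>poly P (1 / real N)\<bar> \<le> S"
    and N: "N \<ge> M"
  shows "\<bar>real N * poly P (1 / real N) - poly (pderiv P) 0\<bar> \<le> 32 * real M ^ 2 * real D ^ 6 * S / real N"
proof -
  have "D ^ 3 \<ge> 1" using D by simp
  then have M0: "M > 0" "N > 0" using M N by linarith+
  have M8: "real M \<ge> 8 * real D ^ 3" using M by (metis of_nat_mono of_nat_mult of_nat_numeral of_nat_power)
  define h where "h = 1 / real M"
  have h: "h > 0" using M0 by (simp add: h_def)
  have S0: "S \<ge> 0" using S[OF order_refl] by linarith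
  have "\<exists>z\<in>{0..h}. \<forall>y\<in>{0..h}. \<bar>poly P y\<bar> \<le> \<bar>poly P z\<bar>"
    using h by (intro continuous_attains_sup) (auto intro!: continuous_intros)
  then obtain z where z: "0 \<le> z" "z \<le> h" and zmax: "\<And>y. 0 \<le> y \<Longrightarrow> y \<le> h \<Longrightarrow> \<bar>poly P y\<bar> \<le> \<bar>poly P z\<bar>"
    by auto
  define T where "T = \<bar>poly P z\<bar>"
  have T: "T \<le> 2 * S"
  proof (cases "z = 0")
    case True
    then show ?thesis using P0 S0 by (simp add: T_def)
  next
    case False
    define K where "K = nat \<lfloor>1 / z\<rfloor>"
    have zM: "1 / z \<ge> real M" using z False M0 by (simp add: h_def field_simps)
    have K1: "real K \<le> 1 / z" "1 / z < real K + 1"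
      using z False by (auto simp: K_def of_nat_nat)
    have KM: "K \<ge> M" using zM by (simp add: K_def le_nat_floor)
    then have K0: "real K > 0" using M0 by simp
    have zK: "z \<le> 1 / real K" "1 / (real K + 1) \<le> z"
      using K1 K0 z False by (auto simp: field_simps)
    have "\<bar>z - 1 / real K\<bar> \<le> 1 / real K - 1 / (real K + 1)" using zK by linarith
    also have "\<dots> = 1 / (real K * (real K + 1))" using K0 by (simp add: field_simps)
    also have "\<dots> \<le> 1 / (real M * real M)"
      using KM M0 by (intro divide_left_mono mult_mono mult_pos_pos) auto
    finally have zd: "\<bar>z - 1 / real K\<bar> \<le> 1 / (real M * real M)" .
    have Kh: "1 / real K \<le> h" using KM M0 unfolding h_def by (intro divide_left_mono) auto
    have "\<bar>poly P z - poly P (1 / real K)\<bar> \<le> 4 * real D ^ 3 * T / h * \<bar>z - 1 / real K\<bar>"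
      unfolding T_def by (rule polynomial_lipschitz[OF deg h zmax z _ Kh]) auto
    also have "\<dots> \<le> 4 * real D ^ 3 * T / h * (1 / (real M * real M))"
      using h by (intro mult_left_mono zd) (auto simp: T_def)
    also have "\<dots> = 4 * real D ^ 3 / real M * T"
      using M0 by (simp add: h_def)
    also have "\<dots> \<le> 1 / 2 * T"
      using M8 M0 by (intro mult_right_mono) (auto simp: field_simps T_def)
    finally have "T \<le> \<bar>poly P (1 / real K)\<bar> + T / 2" unfolding T_def by linarith
    then show ?thesis using S[OF KM] by linarith
  qed
  have b0: "\<bar>poly P y\<bar> \<le> 2 * S" if "0 \<le> y" "y \<le> h" for y
    using zmax[OF that] T by (simp add: T_def)
  define S1 where "S1 = 4 * real D ^ 3 * (2 * S) / h"
  have b1: "\<bar>poly (pderiv P) y\<bar> \<le> S1" if "0 \<le> y" "y \<le> h" for y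
    unfolding S1_def using that by (intro polynomial_derivative_bound[OF deg h b0]) auto
  have deg1: "degree (pderiv P) \<le> D" using deg by (simp add: degree_pderiv)
  define S2 where "S2 = 4 * real D ^ 3 * S1 / h"
  have b2: "\<bar>poly (pderiv (pderiv P)) y\<bar> \<le> S2" if "0 \<le> y" "y \<le> h" for y
    unfolding S2_def using that by (intro polynomial_derivative_bound[OF deg1 h b1]) auto
  have S2: "S2 = 32 * real M ^ 2 * real D ^ 6 * S"
    by (simp add: S2_def S1_def h_def power2_eq_square power_numeral_reduce)
  have Nh: "1 / real N \<le> h" using N M0 unfolding h_def by (intro divide_left_mono) auto
  have N1: "0 < 1 / real N" using M0 by simp
  obtain x where x: "0 < x" "x < 1 / real N" "poly P (1 / real N) - poly P 0 = (1 / real N - 0) * poly (pderiv P) x"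
    using poly_MVT[OF N1] by blast
  obtain y where y: "0 < y" "y < x" "poly (pderiv P) x - poly (pderiv P) 0 = (x - 0) * poly (pderiv (pderiv P)) y"
    using poly_MVT[OF x(1)] by blast
  have "real N * poly P (1 / real N) = poly (pderiv P) x" using x(3) P0 M0 by (simp add: field_simps)
  then have "\<bar>real N * poly P (1 / real N) - poly (pderiv P) 0\<bar> = x * \<bar>poly (pderiv (pderiv P)) y\<bar>"
    using y x by (simp add: abs_mult)
  also have "\<dots> \<le> 1 / real N * S2"
    using x y Nh by (intro mult_mono b2) auto
  finally show ?thesis using S2 by simp
qed

section \<open>Growth of the polynomials off the bulk\<close>

lemma poly_dickson_uminus: "poly (dickson s n) (- x) = (- 1) ^ n * poly (dickson s n) x"
  by (induction s n rule: dickson.induct) (auto simp: algebra_simps)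

text \<open>On the bulk this is the cosine formula. Beyond it x = a + b with ab = s and b \<le> a,
  and a \<le> g because t + s/t increases for t \<ge> sqrt s; negative x follow by parity.\<close>

lemma dickson_growth:
  assumes s: "s > 0" and g: "g \<ge> sqrt s" and x: "\<bar>x\<bar> \<le> g + s / g"
  shows "\<bar>poly (dickson s n) x\<bar> \<le> 2 * g ^ n"
proof -
  have g0: "g > 0" using s g by (meson less_le_trans real_sqrt_gt_zero)
  have nonneg: "\<bar>poly (dickson s n) x\<bar> \<le> 2 * g ^ n" if x: "0 \<le> x" "x \<le> g + s / g" for x
  proof (cases "x \<le> 2 * sqrt s")
    case True
    have c: "x = 2 * sqrt s * cos (arccos (x / (2 * sqrt s)))"
    proof -
      have "0 \<le> x / (2 * sqrt s)" "x / (2 * sqrt s) \<le> 1" using True x s by (simp_all add: field_simps)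
      then have "cos (arccos (x / (2 * sqrt s))) = x / (2 * sqrt s)" by (intro cos_arccos) linarith+
      then show ?thesis using s by simp
    qed
    have "\<bar>poly (dickson s n) x\<bar> = 2 * sqrt s ^ n * \<bar>cos (real n * arccos (x / (2 * sqrt s)))\<bar>"
      using s by (subst c, subst poly_dickson_cos) (auto simp: abs_mult)
    also have "\<dots> \<le> 2 * sqrt s ^ n * 1" using s by (intro mult_left_mono) auto
    also have "\<dots> \<le> 2 * g ^ n * 1" using s g g0 by (intro mult_mono power_mono) auto
    finally show ?thesis by simp
  next
    case False
    define r where "r = sqrt (x\<^sup>2 - 4 * s)"
    have x2: "x\<^sup>2 \<ge> (2 * sqrt s)\<^sup>2" using False s by (intro power_mono) auto
    then have r: "r\<^sup>2 = x\<^sup>2 - 4 * s" "r \<ge> 0" using s by (auto simp: r_def power_mult_distrib)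
    define a b where "a = (x + r) / 2" and "b = (x - r) / 2"
    have ab: "a * b = s" "a + b = x"
      using r by (auto simp: a_def b_def field_simps power2_eq_square)
    have a: "a > 0" using False r s by (simp add: a_def add_pos_nonneg less_le_trans[of 0 "2 * sqrt s" x])
    have b0: "b > 0" using ab a s by (metis zero_less_mult_pos)
    have ba: "b \<le> a" using r by (simp add: a_def b_def)
    have ag: "a \<le> g"
    proof (rule ccontr)
      assume ag: "\<not> a \<le> g"
      have "s < a * g"
      proof -
        have "s = sqrt s * sqrt s" using s by simp
        also have "\<dots> \<le> g * g" using g s g0 by (intro mult_mono) auto
        also have "\<dots> < a * g" using ag g0 by simp
        finally show ?thesis .
      qed
      then have "0 < (a - g) * (a * g - s)" using ag by (intro mult_pos_pos) auto
      moreover have "(a - g) * (a * g - s) = (a + s / a - (g + s / g)) * (a * g)"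
        using a g0 by (simp add: field_simps power2_eq_square)
      ultimately have "0 < a + s / a - (g + s / g)" using a g0 by (metis mult_pos_pos zero_less_mult_pos2)
      moreover have "s / a = b" using ab a by (simp add: field_simps)
      ultimately show False using x ab by simp
    qed
    have eq: "poly (dickson s n) x = a ^ n + b ^ n" using poly_dickson_add[OF ab(1)] ab(2) by simp
    have "a ^ n \<le> g ^ n" "b ^ n \<le> g ^ n" using a b0 ba ag by (auto intro: power_mono)
    then show ?thesis unfolding eq using a b0 by simp
  qed
  show ?thesis
  proof (cases "x \<ge> 0")
    case False
    then have "\<bar>poly (dickson s n) (- x)\<bar> \<le> 2 * g ^ n" using x by (intro nonneg) auto
    then show ?thesis by (simp add: poly_dickson_uminus abs_mult)
  qed (use nonneg x in auto)
qed

text \<open>Inserted into the adjacency operator of an (s + 1)-regular graph these count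
  nonbacktracking walks of length n. Going from length 1 to length 2, all s + 1 first steps can be
  undone, later only s of them; hence the separate case.\<close>

fun nbpoly :: "real \<Rightarrow> nat \<Rightarrow> real poly" where
  "nbpoly s 0 = 1"
| "nbpoly s (Suc 0) = [:0, 1:]"
| "nbpoly s (Suc (Suc 0)) = [:- (s + 1), 0, 1:]"
| "nbpoly s (Suc (Suc (Suc n))) = [:0, 1:] * nbpoly s (Suc (Suc n)) - smult s (nbpoly s (Suc n))"

text \<open>Both sides obey the same recursion and agree at the start. In
  \<open>trace_dickson\<close> the left side meets the recursion that stripping tails gives for
  closed walks.\<close>

lemma nbpoly_dickson:
  "nbpoly s (n + 3) - smult s (nbpoly s (n + 1)) = dickson s (n + 3) - dickson s (n + 1)"
proof (induction n rule: induct_nat_012)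
  case (ge2 n)
  have e: "Suc (Suc n) + 3 = Suc (Suc (Suc (Suc (Suc n))))" "Suc n + 3 = Suc (Suc (Suc (Suc n)))"
    "n + 3 = Suc (Suc (Suc n))" "Suc (Suc n) + 1 = Suc (Suc (Suc n))" "Suc n + 1 = Suc (Suc n)" "n + 1 = Suc n"
    by simp_all
  define X :: "real poly" where "X = [:0, 1:]"
  have "nbpoly s (Suc (Suc n) + 3) - smult s (nbpoly s (Suc (Suc n) + 1))
      = X * (nbpoly s (Suc n + 3) - smult s (nbpoly s (Suc n + 1)))
        - smult s (nbpoly s (n + 3) - smult s (nbpoly s (n + 1)))"
    unfolding e nbpoly.simps(4) X_def[symmetric]
    by (simp add: algebra_simps smult_diff_right smult_add_right del: nbpoly.simps mult_pCons_left)
  also have "\<dots> = dickson s (Suc (Suc n) + 3) - dickson s (Suc (Suc n) + 1)"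
    unfolding ge2 unfolding e dickson.simps(3) X_def[symmetric]
    by (simp add: algebra_simps smult_diff_right smult_add_right del: dickson.simps mult_pCons_left)
  finally show ?case .
qed (simp_all add: numeral_3_eq_3 algebra_simps)

text \<open>Climbing by two with \<open>nbpoly_dickson\<close> multiplies the old bound by s \<le>
  g^2 and adds two Dickson terms of at most 2 g^n each, which is where the linear factor comes
  from.\<close>

lemma nbpoly_growth:
  assumes s: "s > 0" and g: "g \<ge> sqrt s" and g1: "g \<ge> 1" and x: "\<bar>x\<bar> \<le> g + s / g"
  shows "\<bar>poly (nbpoly s n) x\<bar> \<le> (2 * real n + 4) * g ^ n"
proof (induction n rule: less_induct)
  case (less n)
  note D = dickson_growth[OF s g x]
  have sg: "s \<le> g\<^sup>2" using s g by (metis less_imp_le power_mono real_sqrt_ge_zero real_sqrt_pow2)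
  consider "n = 0" | "n = 1" | "n = 2" | m where "n = m + 3"
  proof (cases "n < 3")
    case False
    then show ?thesis using that(4)[of "n - 3"] by simp
  qed (use that in linarith)
  then show ?case
  proof cases
    case 1 then show ?thesis by simp
  next
    case 2
    then show ?thesis using D[of 1] g1 by simp
  next
    case 3
    have "poly (nbpoly s 2) x = poly (dickson s 2) x + (s - 1)"
      by (simp add: numeral_2_eq_2 algebra_simps)
    then have "\<bar>poly (nbpoly s 2) x\<bar> \<le> \<bar>poly (dickson s 2) x\<bar> + \<bar>s - 1\<bar>" by linarith
    also have "\<dots> \<le> 2 * g\<^sup>2 + g\<^sup>2"
      using D[of 2] sg s one_le_power[OF g1, of 2] by (intro add_mono) linarith+
    finally show ?thesis using 3 zero_le_power2[of g] by simp
  next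
    case (4 m)
    have "poly (nbpoly s (m + 3)) x = s * poly (nbpoly s (m + 1)) x
        + (poly (dickson s (m + 3)) x - poly (dickson s (m + 1)) x)"
      using arg_cong[OF nbpoly_dickson[of s m], of "\<lambda>p. poly p x"] by simp
    then have "\<bar>poly (nbpoly s (m + 3)) x\<bar> \<le> \<bar>s * poly (nbpoly s (m + 1)) x\<bar>
        + (\<bar>poly (dickson s (m + 3)) x\<bar> + \<bar>poly (dickson s (m + 1)) x\<bar>)"
      by linarith
    also have "\<dots> = s * \<bar>poly (nbpoly s (m + 1)) x\<bar>
        + (\<bar>poly (dickson s (m + 3)) x\<bar> + \<bar>poly (dickson s (m + 1)) x\<bar>)"
      using s by (simp add: abs_mult)
    also have "\<dots> \<le> g\<^sup>2 * ((2 * real (m + 1) + 4) * g ^ (m + 1)) + (2 * g ^ (m + 3) + 2 * g ^ (m + 3))"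
    proof (intro add_mono mult_mono sg D)
      show "\<bar>poly (nbpoly s (m + 1)) x\<bar> \<le> (2 * real (m + 1) + 4) * g ^ (m + 1)"
        using 4 by (intro less) simp
      have "g ^ (m + 1) \<le> g ^ (m + 3)" using g1 by (intro power_increasing) auto
      then show "\<bar>poly (dickson s (m + 1)) x\<bar> \<le> 2 * g ^ (m + 3)" using D[of "m + 1"] by linarith
    qed (use s in auto)
    also have "\<dots> = (2 * real n + 4) * g ^ n"
      unfolding 4 by (simp add: power2_eq_square power3_eq_cube power_add algebra_simps)
    finally show ?thesis using 4 by simp
  qed
qed

section \<open>Polynomial approximations of a step function\<close>

definition smoothstep :: "real poly" where
  "smoothstep = [:0, 0, 3, - 2:]"

lemma degree_smoothstep: "degree smoothstep = 3"
  by (simp add: smoothstep_def)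

lemma poly_smoothstep: "poly smoothstep y = 3 * y\<^sup>2 - 2 * y ^ 3"
  by (simp add: smoothstep_def power2_eq_square power3_eq_cube algebra_simps)

text \<open>0 and 1 are critical fixed points of 3y^2 - 2y^3, so one iteration roughly squares the
  distance to them, while the degree only triples.\<close>

lemma smoothstep_iterate:
  fixes y :: real
  assumes "0 \<le> y" "y \<le> 1"
  defines "f \<equiv> \<lambda>n. (poly smoothstep ^^ n) y"
  shows "0 \<le> f n \<and> f n \<le> 1 \<and> 3 * f n \<le> (3 * y) ^ 2 ^ n \<and> 3 * (1 - f n) \<le> (3 * (1 - y)) ^ 2 ^ n"
proof (induction n)
  case 0
  then show ?case using assms by simp
next
  case (Suc n)
  define z where "z = f n"
  have IH: "0 \<le> z" "z \<le> 1" "3 * z \<le> (3 * y) ^ 2 ^ n" "3 * (1 - z) \<le> (3 * (1 - y)) ^ 2 ^ n"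
    using Suc by (auto simp: z_def)
  have fS: "f (Suc n) = 3 * z\<^sup>2 - 2 * z ^ 3" by (simp add: f_def z_def poly_smoothstep)
  have e1: "f (Suc n) = z\<^sup>2 * (1 + 2 * (1 - z))"
    unfolding fS by (simp add: power2_eq_square power3_eq_cube algebra_simps)
  have e2: "1 - f (Suc n) = (1 - z)\<^sup>2 * (1 + 2 * z)"
    unfolding fS by (simp add: power2_eq_square power3_eq_cube algebra_simps)
  have "3 * f (Suc n) \<le> (3 * z)\<^sup>2" unfolding fS using IH by (simp add: power_mult_distrib)
  also have "\<dots> \<le> ((3 * y) ^ 2 ^ n)\<^sup>2" using IH by (intro power_mono) auto
  finally have a: "3 * f (Suc n) \<le> (3 * y) ^ 2 ^ Suc n" by (simp only: power_mult[symmetric] power_Suc mult.commute)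
  have "3 * (1 - f (Suc n)) \<le> (3 * (1 - z))\<^sup>2"
  proof -
    have "(1 - z)\<^sup>2 * (1 + 2 * z) \<le> (1 - z)\<^sup>2 * 3" using IH by (intro mult_left_mono) auto
    then have "3 * ((1 - z)\<^sup>2 * (1 + 2 * z)) \<le> (1 - z)\<^sup>2 * 9" by linarith
    then show ?thesis unfolding e2 power_mult_distrib by simp
  qed
  also have "\<dots> \<le> ((3 * (1 - y)) ^ 2 ^ n)\<^sup>2" using IH by (intro power_mono) auto
  finally have b: "3 * (1 - f (Suc n)) \<le> (3 * (1 - y)) ^ 2 ^ Suc n" by (simp only: power_mult[symmetric] power_Suc mult.commute)
  have "0 \<le> f (Suc n)" unfolding e1 using IH by simp
  moreover have "0 \<le> 1 - f (Suc n)" unfolding e2 using IH by simp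
  ultimately show ?case using a b by simp
qed

text \<open>The polynomial is 1 - (1 - u)^B with u = (x/c)^(2m), as in proofs of the
  Stone-Weierstrass theorem; Bernoulli's inequality serves on both sides. From the levels 1/6 and
  5/6 the iteration of \<open>smoothstep\<close> contracts, since three times the distance to 0 or 1
  is at most 1/2.\<close>

lemma coarse_step_polynomial:
  fixes a b c :: real
  assumes "0 < a" "a < b" "b \<le> c"
  obtains P :: "real poly" where
    "\<And>x. \<bar>x\<bar> \<le> c \<Longrightarrow> 0 \<le> poly P x \<and> poly P x \<le> 1"
    "\<And>x. \<bar>x\<bar> \<le> a \<Longrightarrow> poly P x \<le> 1 / 6"
    "\<And>x. b \<le> \<bar>x\<bar> \<Longrightarrow> \<bar>x\<bar> \<le> c \<Longrightarrow> poly P x \<ge> 5 / 6"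
proof -
  define r where "r = b / a"
  have r: "r > 1" using assms by (simp add: r_def)
  obtain m where m: "r ^ m > 12" using real_arch_pow[OF r] by blast
  \<comment> \<open>The geometric mean of the values of u at a and at b. As r^m > 12, these two are
    below w/12 and above 12w, and B is about 1/w, so B u is at most 1/6 or at least 12.\<close>
  define w where "w = (a * b / c\<^sup>2) ^ m"
  have w: "0 < w" "w \<le> 1"
  proof -
    have "a * b \<le> c * c" using assms by (intro mult_mono) auto
    then show "w \<le> 1" using assms unfolding w_def
      by (intro power_le_one) (auto simp: power2_eq_square field_simps)
  qed (use assms in \<open>simp add: w_def\<close>)
  define B where "B = nat \<lceil>1 / w\<rceil>"
  have B: "real B \<ge> 1 / w" "real B \<le> 2 / w"
  proof -
    have "1 / w \<ge> 1" using w by simp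
    then show "real B \<ge> 1 / w" "real B \<le> 2 / w"
    proof -
      have "real B = real_of_int \<lceil>1 / w\<rceil>" using w by (simp add: B_def)
      moreover have "2 / w = 1 / w + 1 / w" by simp
      ultimately show "real B \<ge> 1 / w" "real B \<le> 2 / w"
        using of_int_ceiling_le_add_one[of "1 / w"] le_of_int_ceiling[of "1 / w"] \<open>1 / w \<ge> 1\<close> by linarith+
    qed
  qed
  define P :: "real poly" where "P = 1 - (1 - monom ((1 / c\<^sup>2) ^ m) (2 * m)) ^ B"
  define u where "u x = ((x / c)\<^sup>2) ^ m" for x
  have P: "poly P x = 1 - (1 - u x) ^ B" for x
    by (simp add: P_def u_def poly_monom power_mult power_divide power_mult_distrib)
  have u: "0 \<le> u x" "u x \<le> 1" if "\<bar>x\<bar> \<le> c" for x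
  proof -
    have "(x / c)\<^sup>2 \<le> 1" using that assms abs_le_square_iff[of x c] by (simp add: power_divide)
    then show "0 \<le> u x" "u x \<le> 1" by (auto simp: u_def intro: power_le_one)
  qed
  have key: "w = (a / c)^(2*m) * r ^ m" "(b / c)^(2*m) = w * r ^ m"
    using assms unfolding w_def r_def
    by (simp_all add: power_divide power_mult_distrib power_mult[symmetric] field_simps flip: power_add)
      (simp_all add: mult_2 mult_2_right power_add field_simps)
  show ?thesis
  proof (rule that)
    fix x :: real assume x: "\<bar>x\<bar> \<le> c"
    show "0 \<le> poly P x \<and> poly P x \<le> 1" using u[OF x] unfolding P by (auto intro: power_le_one)
  next
    fix x :: real assume x: "\<bar>x\<bar> \<le> a"
    then have xc: "\<bar>x\<bar> \<le> c" using assms by linarith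
    have "u x \<le> (a / c)^(2*m)"
      unfolding u_def power_mult[symmetric]
    proof -
      have "\<bar>x / c\<bar> ^ (2 * m) \<le> (a / c) ^ (2 * m)" using x assms
        by (intro power_mono) (auto simp: divide_right_mono)
      then show "(x / c) ^ (2 * m) \<le> (a / c) ^ (2 * m)" by (simp add: power_even_abs flip: abs_divide)
    qed
    also have "\<dots> \<le> w / 12"
    proof -
      have "(a / c)^(2*m) * 12 \<le> (a / c)^(2*m) * r ^ m" using m assms by (intro mult_left_mono) auto
      then show ?thesis using key(1) by simp
    qed
    finally have ux: "u x \<le> w / 12" .
    have "1 - real B * u x \<le> (1 - u x) ^ B"
      using Bernoulli_inequality[of "- u x" B] u[OF xc] by (simp add: algebra_simps)
    moreover have "real B * u x \<le> 2 / w * (w / 12)" using B ux u[OF xc] w by (intro mult_mono) auto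
    ultimately show "poly P x \<le> 1 / 6" unfolding P using w by simp
  next
    fix x :: real assume x: "b \<le> \<bar>x\<bar>" "\<bar>x\<bar> \<le> c"
    have "w * 12 \<le> w * r ^ m" using m w by (intro mult_left_mono) auto
    also have "\<dots> \<le> u x"
    proof -
      have "(b / c) ^ (2 * m) \<le> \<bar>x / c\<bar> ^ (2 * m)" using x assms
        by (intro power_mono) (auto simp: divide_right_mono)
      then show ?thesis unfolding u_def power_mult[symmetric] key(2)[symmetric] by (simp add: power_even_abs flip: abs_divide)
    qed
    finally have ux: "w * 12 \<le> u x" .
    have "1 / w * (w * 12) \<le> real B * u x" using B ux w by (intro mult_mono) auto
    then have "13 \<le> 1 + real B * u x" using w by simp
    also have "\<dots> \<le> (1 + u x) ^ B" using Bernoulli_inequality[of "u x" B] u[OF x(2)] by simp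
    finally have big: "13 \<le> (1 + u x) ^ B" .
    have "(1 - u x) ^ B * 13 \<le> (1 - u x) ^ B * (1 + u x) ^ B"
      using u[OF x(2)] big by (intro mult_left_mono) auto
    also have "\<dots> = (1 - (u x)\<^sup>2) ^ B" by (simp add: power_mult_distrib[symmetric] power2_eq_square algebra_simps)
    also have "\<dots> \<le> 1" using u[OF x(2)] by (intro power_le_one) (auto simp: power_le_one)
    finally show "poly P x \<ge> 5 / 6" unfolding P by simp
  qed
qed

text \<open>Iterating \<open>smoothstep\<close> j times gives error 2^-(2^j) at degree of order 3^j.
  This beats every power of the degree, which suffices because N will be a power of the
  degree.\<close>

lemma step_polynomials:
  fixes a b c :: real
  assumes "0 < a" "a < b" "b \<le> c"
  obtains D :: nat and h :: "nat \<Rightarrow> real poly" where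
    "\<And>j. degree (h j) \<le> D * 3 ^ j"
    "\<And>j x. \<bar>x\<bar> \<le> c \<Longrightarrow> 0 \<le> poly (h j) x \<and> poly (h j) x \<le> 1"
    "\<And>j x. \<bar>x\<bar> \<le> a \<Longrightarrow> poly (h j) x \<le> (1 / 2) ^ 2 ^ j"
    "\<And>j x. b \<le> \<bar>x\<bar> \<Longrightarrow> \<bar>x\<bar> \<le> c \<Longrightarrow> poly (h j) x \<ge> 1 - (1 / 2) ^ 2 ^ j"
proof -
  obtain P :: "real poly" where P:
    "\<And>x. \<bar>x\<bar> \<le> c \<Longrightarrow> 0 \<le> poly P x \<and> poly P x \<le> 1"
    "\<And>x. \<bar>x\<bar> \<le> a \<Longrightarrow> poly P x \<le> 1 / 6"
    "\<And>x. b \<le> \<bar>x\<bar> \<Longrightarrow> \<bar>x\<bar> \<le> c \<Longrightarrow> poly P x \<ge> 5 / 6"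
    using coarse_step_polynomial[OF assms] by blast
  define h where "h j = (pcompose smoothstep ^^ j) P" for j
  have h: "poly (h j) x = (poly smoothstep ^^ j) (poly P x)" for j x
    by (induction j) (auto simp: h_def poly_pcompose)
  show ?thesis
  proof (rule that[of h "degree P"])
    fix j show "degree (h j) \<le> degree P * 3 ^ j"
      by (induction j) (auto simp: h_def degree_pcompose degree_smoothstep)
  next
    fix j and x :: real assume x: "\<bar>x\<bar> \<le> c"
    note s = smoothstep_iterate[of "poly P x" j, folded h]
    show "0 \<le> poly (h j) x \<and> poly (h j) x \<le> 1" using s P(1)[OF x] by auto
  next
    fix j and x :: real assume x: "\<bar>x\<bar> \<le> a"
    then have p: "0 \<le> poly P x" "poly P x \<le> 1" using P(1)[of x] assms by auto
    note s = smoothstep_iterate[OF p, of j, folded h]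
    have "(3 * poly P x) ^ 2 ^ j \<le> (1 / 2) ^ 2 ^ j" using p P(2)[OF x] by (intro power_mono) auto
    then show "poly (h j) x \<le> (1 / 2) ^ 2 ^ j" using s by linarith
  next
    fix j and x :: real assume x: "b \<le> \<bar>x\<bar>" "\<bar>x\<bar> \<le> c"
    then have p: "0 \<le> poly P x" "poly P x \<le> 1" using P(1)[of x] assms by auto
    note s = smoothstep_iterate[OF p, of j, folded h]
    have "(3 * (1 - poly P x)) ^ 2 ^ j \<le> (1 / 2) ^ 2 ^ j" using p P(3)[OF x] by (intro power_mono) auto
    then show "poly (h j) x \<ge> 1 - (1 / 2) ^ 2 ^ j"
    proof -
      have "(0 :: real) \<le> (1 / 2) ^ 2 ^ j" by simp
      moreover have "3 * (1 - poly (h j) x) \<le> (1 / 2) ^ 2 ^ j"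
        using s \<open>(3 * (1 - poly P x)) ^ 2 ^ j \<le> (1 / 2) ^ 2 ^ j\<close> by (blast intro: order_trans)
      moreover have "1 - e \<le> y" if "0 \<le> e" "3 * (1 - y) \<le> e" for e y :: real using that by (simp add: algebra_simps)
      ultimately show ?thesis by blast
    qed
  qed
qed

section \<open>Nonbacktracking walks in lifts of the complete graph\<close>

definition nonbacktracking :: "nat list \<Rightarrow> bool" where
  "nonbacktracking us \<longleftrightarrow> (\<forall>i. i + 1 < length us \<longrightarrow> us ! i \<noteq> us ! (i + 1)) \<and>
     (\<forall>i. i + 2 < length us \<longrightarrow> us ! i \<noteq> us ! (i + 2))"

definition nbwords :: "nat \<Rightarrow> nat \<Rightarrow> nat list set" where
  "nbwords d n = {us. length us = n + 1 \<and> set us \<subseteq> {..d} \<and> nonbacktracking us}"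

definition closed_nbwords :: "nat \<Rightarrow> nat \<Rightarrow> nat list set" where
  "closed_nbwords d n = {us \<in> nbwords d n. last us = hd us}"

text \<open>Index n is index 0 again, so the extra condition forbids backtracking at the base point:
  these are the closed words without a tail.\<close>

definition cyclic_nbwords :: "nat \<Rightarrow> nat \<Rightarrow> nat list set" where
  "cyclic_nbwords d n = {us \<in> closed_nbwords d n. us ! 1 \<noteq> us ! (n - 1)}"

fun transport :: "(nat \<Rightarrow> nat \<Rightarrow> 'f \<Rightarrow> 'f) \<Rightarrow> nat list \<Rightarrow> 'f \<Rightarrow> 'f" where
  "transport \<phi> (u # v # us) y = transport \<phi> (v # us) (\<phi> u v y)"
| "transport \<phi> us y = y"

lemma finite_nbwords [simp]: "finite (nbwords d n)"
proof -
  have "nbwords d n \<subseteq> {us. set us \<subseteq> {..d} \<and> length us = n + 1}" by (auto simp: nbwords_def)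
  then show ?thesis by (rule finite_subset) (simp add: finite_lists_length_eq)
qed

lemma finite_closed_nbwords [simp]: "finite (closed_nbwords d n)"
  by (simp add: closed_nbwords_def)

lemma finite_cyclic_nbwords [simp]: "finite (cyclic_nbwords d n)"
  by (simp add: cyclic_nbwords_def)

lemma all_nat_split: "(\<forall>i. P i) \<longleftrightarrow> P 0 \<and> (\<forall>i. P (Suc i))"
  by (metis not0_implies_Suc)

lemma nonbacktracking_Cons:
  "nonbacktracking (u # us) \<longleftrightarrow> (us \<noteq> [] \<longrightarrow> u \<noteq> us ! 0) \<and> (length us > 1 \<longrightarrow> u \<noteq> us ! 1) \<and> nonbacktracking us"
  unfolding nonbacktracking_def
  by (subst all_nat_split, subst (2) all_nat_split) (auto simp: numeral_2_eq_2)

lemma nonbacktracking_rev: "nonbacktracking (rev us) \<longleftrightarrow> nonbacktracking us"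
proof -
  have *: "nonbacktracking (rev us)" if "nonbacktracking us" for us
    unfolding nonbacktracking_def
  proof (intro conjI allI impI)
    fix i assume i: "i + 1 < length (rev us)"
    define j where "j = length us - Suc (Suc i)"
    have j: "j + 1 < length us" "length us - Suc i = j + 1" using i by (auto simp: j_def)
    have "us ! j \<noteq> us ! (j + 1)" using that j by (simp add: nonbacktracking_def)
    then show "rev us ! i \<noteq> rev us ! (i + 1)" using i j by (simp add: rev_nth j_def)
  next
    fix i assume i: "i + 2 < length (rev us)"
    define j where "j = length us - Suc (i + 2)"
    have j: "j + 2 < length us" "length us - Suc i = j + 2" using i by (auto simp: j_def)
    have "us ! j \<noteq> us ! (j + 2)" using that j by (simp add: nonbacktracking_def)
    then show "rev us ! i \<noteq> rev us ! (i + 2)" using i j by (simp add: rev_nth j_def)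
  qed
  show ?thesis using *[of us] *[of "rev us"] by auto
qed

lemma nonbacktracking_snoc:
  assumes "length us > 1"
  shows "nonbacktracking (us @ [a]) \<longleftrightarrow> a \<noteq> last us \<and> a \<noteq> us ! (length us - 2) \<and> nonbacktracking us"
proof -
  have "nonbacktracking (us @ [a]) \<longleftrightarrow> nonbacktracking (a # rev us)"
    by (subst nonbacktracking_rev[symmetric]) simp
  also have "\<dots> \<longleftrightarrow> a \<noteq> last us \<and> a \<noteq> us ! (length us - 2) \<and> nonbacktracking us"
    using assms by (cases "us = []")
      (auto simp: nonbacktracking_Cons nonbacktracking_rev rev_nth last_conv_nth numeral_2_eq_2)
  finally show ?thesis .
qed

lemma nonbacktracking_enclose:
  assumes "length us > 1"
  shows "nonbacktracking (a # us @ [b]) \<longleftrightarrow> a \<noteq> us ! 0 \<and> a \<noteq> us ! 1 \<and> b \<noteq> last us \<and> b \<noteq> us ! (length us - 2) \<and>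
     nonbacktracking us"
proof -
  have "us \<noteq> []" using assms by auto
  then show ?thesis
    using assms by (subst nonbacktracking_Cons, subst nonbacktracking_snoc) (auto simp: nth_append)
qed

text \<open>A lift of the complete graph on \<open>{..d}\<close>: its vertices are the pairs of \<open>u \<le> d\<close> and \<open>y \<in> F\<close>, and \<open>(u, y)\<close> is
  adjacent to \<open>(v, \<phi> u v y)\<close> for all \<open>v \<noteq> u\<close>.  As the base graph is complete, a walk in the lift is given by its
  projection together with its starting point.\<close>

locale complete_lift =
  fixes d :: nat and F :: "'f set" and \<phi> :: "nat \<Rightarrow> nat \<Rightarrow> 'f \<Rightarrow> 'f"
  assumes d: "d \<ge> 3" and finF: "finite F"
    and \<phi>_in: "\<And>u v y. u \<le> d \<Longrightarrow> v \<le> d \<Longrightarrow> u \<noteq> v \<Longrightarrow> y \<in> F \<Longrightarrow> \<phi> u v y \<in> F"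
    and \<phi>_inv: "\<And>u v y. u \<le> d \<Longrightarrow> v \<le> d \<Longrightarrow> u \<noteq> v \<Longrightarrow> y \<in> F \<Longrightarrow> \<phi> v u (\<phi> u v y) = y"
begin

definition s :: real where "s = real d - 1"

lemma s_ge_2: "s \<ge> 2" using d by (simp add: s_def)

definition adj :: "(nat \<Rightarrow> 'f \<Rightarrow> real) \<Rightarrow> nat \<Rightarrow> 'f \<Rightarrow> real" where
  "adj f u y = (\<Sum>v\<in>{..d} - {u}. f v (\<phi> u v y))"

definition nbsum :: "nat \<Rightarrow> (nat \<Rightarrow> 'f \<Rightarrow> real) \<Rightarrow> nat \<Rightarrow> 'f \<Rightarrow> real" where
  "nbsum n f u y = (\<Sum>us | us \<in> nbwords d n \<and> hd us = u. f (last us) (transport \<phi> us y))"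

text \<open>The adjacency operator inserted into a polynomial.\<close>

definition opoly :: "real poly \<Rightarrow> (nat \<Rightarrow> 'f \<Rightarrow> real) \<Rightarrow> nat \<Rightarrow> 'f \<Rightarrow> real" where
  "opoly p f u y = (\<Sum>i\<le>degree p. coeff p i * (adj ^^ i) f u y)"

lemma adj_cong:
  assumes "\<And>u y. u \<le> d \<Longrightarrow> y \<in> F \<Longrightarrow> f u y = g u y" "u \<le> d" "y \<in> F"
  shows "adj f u y = adj g u y"
  unfolding adj_def using assms by (intro sum.cong) (auto intro!: assms \<phi>_in)

lemma adj_add: "adj (\<lambda>u y. f u y + g u y) = (\<lambda>u y. adj f u y + adj g u y)"
  by (intro ext) (simp add: adj_def sum.distrib)

lemma adj_scale: "adj (\<lambda>u y. c * f u y) = (\<lambda>u y. c * adj f u y)"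
  by (intro ext) (simp add: adj_def sum_distrib_left)

lemma adj_sum: "adj (\<lambda>u y. \<Sum>i\<in>I. g i u y) = (\<lambda>u y. \<Sum>i\<in>I. adj (g i) u y)"
  unfolding adj_def by (intro ext) (rule sum.swap)

lemma opoly_altdef:
  assumes "degree p \<le> n"
  shows "opoly p f u y = (\<Sum>i\<le>n. coeff p i * (adj ^^ i) f u y)"
  unfolding opoly_def using assms
  by (intro sum.mono_neutral_left) (auto simp: coeff_eq_0)

lemma opoly_add: "opoly (p + q) f u y = opoly p f u y + opoly q f u y"
proof -
  define n where "n = max (degree p) (degree q)"
  have "degree (p + q) \<le> n" by (simp add: n_def degree_add_le)
  then show ?thesis
    using opoly_altdef[of "p + q" n] opoly_altdef[of p n] opoly_altdef[of q n]
    by (simp add: n_def sum.distrib algebra_simps)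
qed

lemma opoly_smult: "opoly (Polynomial.smult c p) f u y = c * opoly p f u y"
  using opoly_altdef[OF degree_smult_le, of c p f u y]
  by (simp add: opoly_def sum_distrib_left mult.assoc)

lemma opoly_diff: "opoly (p - q) f u y = opoly p f u y - opoly q f u y"
proof -
  have "p - q = p + Polynomial.smult (-1) q" by simp
  then show ?thesis by (simp only: opoly_add opoly_smult)
qed

lemma opoly_zero [simp]: "opoly 0 f u y = 0"
  by (simp add: opoly_def)

lemma opoly_pCons: "opoly (pCons c p) f u y = c * f u y + adj (opoly p f) u y"
proof -
  have "opoly (pCons c p) f u y = (\<Sum>i\<le>Suc (degree p). coeff (pCons c p) i * (adj ^^ i) f u y)"
    by (intro opoly_altdef) (simp add: degree_pCons_le)
  also have "\<dots> = c * f u y + (\<Sum>i\<le>degree p. coeff p i * adj ((adj ^^ i) f) u y)"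
    by (subst sum.atMost_Suc_shift) simp
  also have "(\<Sum>i\<le>degree p. coeff p i * adj ((adj ^^ i) f) u y) = adj (opoly p f) u y"
    unfolding opoly_def by (simp add: adj_sum adj_scale)
  finally show ?thesis .
qed

lemma opoly_linear: "opoly p (\<lambda>u y. f u y + c * g u y) u y = opoly p f u y + c * opoly p g u y"
proof -
  have "(adj ^^ i) (\<lambda>u y. f u y + c * g u y) = (\<lambda>u y. (adj ^^ i) f u y + c * (adj ^^ i) g u y)" for i
    by (induction i) (simp_all add: adj_add adj_scale)
  then show ?thesis by (simp add: opoly_def sum.distrib sum_distrib_left algebra_simps)
qed

lemma opoly_X_mult: "opoly ([:0, 1:] * p) f u y = adj (opoly p f) u y"
  using opoly_pCons[of 0 p f u y] by simp

lemma opoly_one [simp]: "opoly 1 f = f"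
  by (intro ext) (simp add: opoly_def)

lemma opoly_mult: "opoly (p * q) f = opoly p (opoly q f)"
proof (induction p)
  case (pCons c p)
  have "opoly (pCons c p * q) f u y = opoly (pCons c p) (opoly q f) u y" for u y
    using pCons.IH by (simp add: opoly_add opoly_smult opoly_pCons)
  then show ?case by blast
qed (intro ext, simp)

lemma opoly_eigen:
  assumes "\<And>u y. u \<le> d \<Longrightarrow> y \<in> F \<Longrightarrow> adj f u y = c * f u y" "u \<le> d" "y \<in> F"
  shows "opoly p f u y = poly p c * f u y"
  using assms(2,3)
proof (induction p arbitrary: u y)
  case (pCons a p)
  have "adj (opoly p f) u y = adj (\<lambda>u y. poly p c * f u y) u y"
    using pCons by (intro adj_cong) auto
  also have "\<dots> = poly p c * (c * f u y)" using assms(1) pCons.prems by (simp add: adj_scale)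
  finally show ?case by (simp add: opoly_pCons algebra_simps)
qed simp

lemma nbwordsD:
  assumes "us \<in> nbwords d n"
  shows "length us = n + 1" "us \<noteq> []" "hd us \<le> d" "last us \<le> d" "i \<le> n \<Longrightarrow> us ! i \<le> d"
proof -
  show l: "length us = n + 1" using assms by (simp add: nbwords_def)
  then show ne: "us \<noteq> []" by auto
  have sub: "set us \<subseteq> {..d}" using assms by (simp add: nbwords_def)
  show "hd us \<le> d" "last us \<le> d" using sub ne hd_in_set[OF ne] last_in_set[OF ne] by blast+
  show "i \<le> n \<Longrightarrow> us ! i \<le> d" using sub l nth_mem[of i us] by (auto dest!: subsetD)
qed

lemma transport_Cons: "us \<noteq> [] \<Longrightarrow> transport \<phi> (u # us) y = transport \<phi> us (\<phi> u (hd us) y)"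
  by (cases us) auto

lemma transport_in:
  "nonbacktracking us \<Longrightarrow> set us \<subseteq> {..d} \<Longrightarrow> y \<in> F \<Longrightarrow> transport \<phi> us y \<in> F"
proof (induction us arbitrary: y)
  case (Cons u us)
  show ?case
  proof (cases us)
    case (Cons v vs)
    then have "transport \<phi> us (\<phi> u v y) \<in> F"
      using Cons.prems by (intro Cons.IH \<phi>_in) (auto simp: nonbacktracking_Cons)
    then show ?thesis using Cons by simp
  qed (use Cons.prems in simp)
qed simp

lemma transport_snoc: "us \<noteq> [] \<Longrightarrow> transport \<phi> (us @ [a]) y = \<phi> (last us) a (transport \<phi> us y)"
  by (induction \<phi> us y rule: transport.induct) auto

text \<open>A first step to v followed by a walk of length n + 1 either goes on without backtracking
  or returns to u at once. In the second case the two steps cancel by \<open>\<phi>_inv\<close> and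
  leave a walk of length n. The coefficient counts the admissible v: all d neighbours for n = 0,
  otherwise all but the next letter.\<close>

lemma adj_nbsum:
  assumes u: "u \<le> d" and y: "y \<in> F"
  shows "adj (nbsum (Suc n) f) u y = nbsum (Suc (Suc n)) f u y
    + (if n = 0 then real d else s) * nbsum n f u y"
proof -
  define W where "W = {vs \<in> nbwords d (Suc n). hd vs \<noteq> u}"
  define t where "t us = f (last us) (transport \<phi> us y)" for us
  have finW: "finite W" by (simp add: W_def)
  have "adj (nbsum (Suc n) f) u y =
     (\<Sum>v\<in>{..d} - {u}. \<Sum>vs | vs \<in> nbwords d (Suc n) \<and> hd vs = v. t (u # vs))"
    unfolding adj_def nbsum_def t_def
    by (intro sum.cong refl) (auto simp: transport_Cons dest: nbwordsD)
  also have "\<dots> = (\<Sum>vs\<in>W. t (u # vs))"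
  proof -
    have "(\<Sum>vs\<in>W. t (u # vs)) = (\<Sum>v\<in>hd ` W. \<Sum>vs | vs \<in> W \<and> hd vs = v. t (u # vs))"
      by (rule sum.group[OF finW, symmetric]) (use finW in auto)
    also have "\<dots> = (\<Sum>v\<in>{..d} - {u}. \<Sum>vs | vs \<in> W \<and> hd vs = v. t (u # vs))"
    proof (rule sum.mono_neutral_left)
      show "hd ` W \<subseteq> {..d} - {u}" by (auto simp: W_def dest: nbwordsD)
      show "\<forall>i\<in>{..d} - {u} - hd ` W. (\<Sum>vs | vs \<in> W \<and> hd vs = i. t (u # vs)) = 0"
        by (intro ballI sum.neutral) auto
    qed simp
    also have "\<dots> = (\<Sum>v\<in>{..d} - {u}. \<Sum>vs | vs \<in> nbwords d (Suc n) \<and> hd vs = v. t (u # vs))"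
      by (intro sum.cong refl) (auto simp: W_def)
    finally show ?thesis ..
  qed
  also have "\<dots> = (\<Sum>vs | vs \<in> W \<and> vs ! 1 \<noteq> u. t (u # vs)) + (\<Sum>vs | vs \<in> W \<and> vs ! 1 = u. t (u # vs))"
  proof -
    have "W = {vs \<in> W. vs ! 1 \<noteq> u} \<union> {vs \<in> W. vs ! 1 = u}" by auto
    then show ?thesis using finW by (subst sum.union_disjoint[symmetric]) auto
  qed
  also have "(\<Sum>vs | vs \<in> W \<and> vs ! 1 \<noteq> u. t (u # vs)) = nbsum (Suc (Suc n)) f u y"
    unfolding nbsum_def t_def
  proof (rule sum.reindex_bij_witness[of _ tl "(#) u"])
    fix us assume us: "us \<in> {us \<in> nbwords d (Suc (Suc n)). hd us = u}"
    then obtain a b cs where abc: "us = u # a # b # cs"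
      by (auto simp: nbwords_def length_Suc_conv)
    show "u # tl us = us" using abc by simp
    show "tl us \<in> {vs \<in> W. vs ! 1 \<noteq> u}"
      using us unfolding abc W_def nbwords_def by (auto simp: nonbacktracking_Cons)
  next
    fix vs assume vs: "vs \<in> {vs \<in> W. vs ! 1 \<noteq> u}"
    then obtain a b cs where abc: "vs = a # b # cs"
      by (auto simp: W_def nbwords_def length_Suc_conv)
    show "tl (u # vs) = vs" by simp
    show "u # vs \<in> {us \<in> nbwords d (Suc (Suc n)). hd us = u}"
      using vs u unfolding abc W_def nbwords_def by (auto simp: nonbacktracking_Cons)
    show "f (last (u # vs)) (transport \<phi> (u # vs) y) = f (last (u # vs)) (transport \<phi> (u # vs) y)" ..
  qed
  also have "(\<Sum>vs | vs \<in> W \<and> vs ! 1 = u. t (u # vs)) =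
      (\<Sum>(ws, v)\<in>(SIGMA ws:{ws \<in> nbwords d n. hd ws = u}. {v. v \<le> d \<and> v \<noteq> u \<and> (n > 0 \<longrightarrow> v \<noteq> ws ! 1)}). t ws)"
  proof (rule sum.reindex_bij_witness[of _ "\<lambda>(ws, v). v # ws" "\<lambda>vs. (tl vs, hd vs)"])
    fix vs assume vs: "vs \<in> {vs \<in> W. vs ! 1 = u}"
    then obtain a b cs where abc: "vs = a # b # cs"
      by (auto simp: W_def nbwords_def length_Suc_conv)
    have h: "a \<le> d" "a \<noteq> u" "b = u" using vs unfolding abc by (auto simp: W_def nbwords_def)
    show "(case (tl vs, hd vs) of (ws, v) \<Rightarrow> v # ws) = vs" using abc by simp
    show "(tl vs, hd vs) \<in> (SIGMA ws:{ws \<in> nbwords d n. hd ws = u}. {v. v \<le> d \<and> v \<noteq> u \<and> (n > 0 \<longrightarrow> v \<noteq> ws ! 1)})"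
      using vs unfolding abc W_def nbwords_def by (auto simp: nonbacktracking_Cons)
    have "\<phi> a u (\<phi> u a y) = y" using h u y by (intro \<phi>_inv) auto
    then show "(case (tl vs, hd vs) of (ws, v) \<Rightarrow> t ws) = t (u # vs)"
      using h by (simp add: abc t_def)
  next
    fix p assume p: "p \<in> (SIGMA ws:{ws \<in> nbwords d n. hd ws = u}. {v. v \<le> d \<and> v \<noteq> u \<and> (n > 0 \<longrightarrow> v \<noteq> ws ! 1)})"
    then obtain v b cs where abc: "p = (b # cs, v)"
      by (cases p) (auto simp: nbwords_def length_Suc_conv)
    show "(tl (case p of (ws, v) \<Rightarrow> v # ws), hd (case p of (ws, v) \<Rightarrow> v # ws)) = p"
      by (simp add: abc)
    show "(case p of (ws, v) \<Rightarrow> v # ws) \<in> {vs \<in> W. vs ! 1 = u}"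
      using p unfolding abc W_def nbwords_def by (auto simp: nonbacktracking_Cons)
  qed
  also have "\<dots> = (\<Sum>ws | ws \<in> nbwords d n \<and> hd ws = u. real (card {v. v \<le> d \<and> v \<noteq> u \<and> (n > 0 \<longrightarrow> v \<noteq> ws ! 1)}) * t ws)"
    by (subst sum.Sigma[symmetric]) auto
  also have "\<dots> = (\<Sum>ws | ws \<in> nbwords d n \<and> hd ws = u. (if n = 0 then real d else s) * t ws)"
  proof (intro sum.cong refl)
    fix ws assume ws: "ws \<in> {ws \<in> nbwords d n. hd ws = u}"
    show "real (card {v. v \<le> d \<and> v \<noteq> u \<and> (n > 0 \<longrightarrow> v \<noteq> ws ! 1)}) * t ws = (if n = 0 then real d else s) * t ws"
    proof (cases "n = 0")
      case True
      then have "{v. v \<le> d \<and> v \<noteq> u \<and> (n > 0 \<longrightarrow> v \<noteq> ws ! 1)} = {..d} - {u}" by auto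
      then show ?thesis using True u by simp
    next
      case False
      have "ws ! 1 \<le> d" using ws False nbwordsD(5)[of ws n 1] by auto
      moreover have "ws ! 1 \<noteq> u"
        using ws False unfolding nbwords_def nonbacktracking_def
        by (cases ws) (auto dest!: spec[of _ 0])
      moreover have "{v. v \<le> d \<and> v \<noteq> u \<and> (n > 0 \<longrightarrow> v \<noteq> ws ! 1)} = {..d} - {u, ws ! 1}" using False by auto
      ultimately have "card {v. v \<le> d \<and> v \<noteq> u \<and> (n > 0 \<longrightarrow> v \<noteq> ws ! 1)} = d + 1 - 2"
        using u by (simp add: card_Diff_subset)
      then show ?thesis using False d by (simp add: s_def of_nat_diff)
    qed
  qed
  also have "\<dots> = (if n = 0 then real d else s) * nbsum n f u y"
    by (simp add: nbsum_def t_def sum_distrib_left)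
  finally show ?thesis .
qed

lemma nbsum_0: "u \<le> d \<Longrightarrow> nbsum 0 f u y = f u y"
proof -
  assume "u \<le> d"
  then have "{us \<in> nbwords d 0. hd us = u} = {[u]}"
    by (auto simp: nbwords_def length_Suc_conv nonbacktracking_def)
  then show ?thesis by (simp add: nbsum_def)
qed

lemma nbsum_1: "u \<le> d \<Longrightarrow> nbsum (Suc 0) f u y = adj f u y"
proof -
  assume "u \<le> d"
  then have *: "{us \<in> nbwords d (Suc 0). hd us = u} = (\<lambda>v. [u, v]) ` ({..d} - {u})"
    by (auto simp: nbwords_def length_Suc_conv nonbacktracking_Cons nonbacktracking_def image_iff)
  show ?thesis unfolding nbsum_def * adj_def by (subst sum.reindex) (auto simp: inj_on_def)
qed

lemma opoly_nbpoly:
  assumes "u \<le> d" "y \<in> F"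
  shows "opoly (nbpoly s n) f u y = nbsum n f u y"
  using assms
proof (induction n arbitrary: u y rule: less_induct)
  case (less n)
  consider "n = 0" | "n = Suc 0" | "n = Suc (Suc 0)" | m where "n = Suc (Suc (Suc m))"
    by (metis not0_implies_Suc)
  then show ?case
  proof cases
    case 1 then show ?thesis using less.prems by (simp add: nbsum_0)
  next
    case 2 then show ?thesis using less.prems by (simp add: nbsum_1 opoly_pCons adj_def)
  next
    case 3
    have "adj (adj f) u y = adj (nbsum (Suc 0) f) u y"
      using less.prems by (intro adj_cong) (auto simp: nbsum_1)
    then have "adj (adj f) u y = nbsum 2 f u y + real d * f u y"
      using adj_nbsum[of u y 0] less.prems by (simp add: nbsum_0 numeral_2_eq_2)
    moreover have "opoly [:- (s + 1), 0, 1:] f u y = adj (adj f) u y - real d * f u y"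
    proof -
      have "[:- (s + 1), 0, 1:] = [:0, 1:] * ([:0, 1:] * 1) - Polynomial.smult (real d) 1"
        by (simp add: s_def one_pCons)
      then show ?thesis
        by (simp only: opoly_diff opoly_smult) (simp add: opoly_pCons adj_def)
    qed
    ultimately show ?thesis using 3 by (simp add: numeral_2_eq_2)
  next
    case (4 m)
    have "opoly (nbpoly s n) f u y =
        adj (opoly (nbpoly s (Suc (Suc m))) f) u y - s * opoly (nbpoly s (Suc m)) f u y"
      unfolding 4 nbpoly.simps(4) opoly_diff opoly_X_mult opoly_smult ..
    also have "adj (opoly (nbpoly s (Suc (Suc m))) f) u y = adj (nbsum (Suc (Suc m)) f) u y"
      using less 4 by (intro adj_cong) auto
    also have "\<dots> = nbsum n f u y + s * nbsum (Suc m) f u y"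
      using adj_nbsum[of u y "Suc m" f] less.prems 4 by simp
    also have "opoly (nbpoly s (Suc m)) f u y = nbsum (Suc m) f u y"
      using less 4 by auto
    finally show ?thesis by simp
  qed
qed

definition point :: "nat \<Rightarrow> 'f \<Rightarrow> nat \<Rightarrow> 'f \<Rightarrow> real" where
  "point u y = (\<lambda>v z. if v = u \<and> z = y then 1 else 0)"

definition trace :: "real poly \<Rightarrow> real" where
  "trace p = (\<Sum>u\<le>d. \<Sum>y\<in>F. opoly p (point u y) u y)"

definition fixcount :: "nat list \<Rightarrow> real" where
  "fixcount us = real (card {y \<in> F. transport \<phi> us y = y})"

text \<open>Closed walks of the lift, sorted by their projection: \<open>C\<close> excludes those
  with a tail, \<open>T\<close> below admits them.\<close>

definition C :: "nat \<Rightarrow> real" where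
  "C n = (\<Sum>us\<in>cyclic_nbwords d n. fixcount us)"

definition T :: "nat \<Rightarrow> real" where
  "T n = (\<Sum>us\<in>closed_nbwords d n. fixcount us)"

lemma trace_add: "trace (p + q) = trace p + trace q"
  by (simp add: trace_def opoly_add sum.distrib)

lemma trace_smult: "trace (Polynomial.smult c p) = c * trace p"
  by (simp add: trace_def opoly_smult sum_distrib_left)

lemma trace_diff: "trace (p - q) = trace p - trace q"
  by (simp add: trace_def opoly_diff sum_subtractf)

lemma trace_sum: "trace (\<Sum>i\<in>I. p i) = (\<Sum>i\<in>I. trace (p i))"
proof (induction I rule: infinite_finite_induct)
  case (insert i I) then show ?case by (simp add: trace_add)
qed (simp_all add: trace_def)

lemma trace_const: "trace [:c:] = c * (real (d + 1) * card F)"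
  by (simp add: trace_def opoly_def point_def sum_distrib_left)

lemma trace_nbpoly: "trace (nbpoly s n) = T n"
proof -
  have "trace (nbpoly s n) = (\<Sum>u\<le>d. \<Sum>y\<in>F. nbsum n (point u y) u y)"
    unfolding trace_def by (intro sum.cong refl opoly_nbpoly) auto
  also have "\<dots> = (\<Sum>u\<le>d. \<Sum>us | us \<in> nbwords d n \<and> hd us = u. \<Sum>y\<in>F. point u y (last us) (transport \<phi> us y))"
    unfolding nbsum_def by (intro sum.cong refl) (rule sum.swap)
  also have "\<dots> = (\<Sum>u\<le>d. \<Sum>us | us \<in> nbwords d n \<and> hd us = u. if last us = hd us then fixcount us else 0)"
  proof (intro sum.cong refl)
    fix u us assume "us \<in> {us \<in> nbwords d n. hd us = u}"
    then have "(\<Sum>y\<in>F. point u y (last us) (transport \<phi> us y)) =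
       (\<Sum>y\<in>F. if last us = hd us \<and> transport \<phi> us y = y then 1 else 0)"
      by (intro sum.cong) (auto simp: point_def)
    also have "\<dots> = (if last us = hd us then fixcount us else 0)"
      using finF by (simp add: fixcount_def Int_def flip: sum.inter_filter)
    finally show "(\<Sum>y\<in>F. point u y (last us) (transport \<phi> us y)) = \<dots>" .
  qed
  also have "\<dots> = (\<Sum>us\<in>nbwords d n. if last us = hd us then fixcount us else 0)"
    by (rule sum.group) (auto dest: nbwordsD)
  also have "\<dots> = T n" by (simp add: T_def closed_nbwords_def sum.inter_filter)
  finally show ?thesis .
qed

text \<open>Transport along the longer word is conjugate, by the first step, to transport along
  \<open>us\<close>, so the fixed points correspond.\<close>

lemma fixcount_enclose:
  assumes us: "us \<in> closed_nbwords d n" and a: "a \<le> d" "a \<noteq> hd us"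
  shows "fixcount (a # us @ [a]) = fixcount us"
proof -
  define h where "h = hd us"
  have ne: "us \<noteq> []" and hl: "last us = h" and h: "h \<le> d" and nb: "nonbacktracking us" "set us \<subseteq> {..d}"
    using us nbwordsD[of us n] by (auto simp: closed_nbwords_def h_def nbwords_def)
  have tr: "transport \<phi> (a # us @ [a]) y = \<phi> h a (transport \<phi> us (\<phi> a h y))" for y
    using ne hl transport_Cons[of "us @ [a]" a y] transport_snoc[of us a] by (simp add: h_def)
  have "bij_betw (\<phi> a h) {y \<in> F. transport \<phi> (a # us @ [a]) y = y} {y \<in> F. transport \<phi> us y = y}"
  proof (rule bij_betwI[where g = "\<phi> h a"])
    show "\<phi> a h \<in> {y \<in> F. transport \<phi> (a # us @ [a]) y = y} \<rightarrow> {y \<in> F. transport \<phi> us y = y}"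
    proof
      fix y assume y: "y \<in> {y \<in> F. transport \<phi> (a # us @ [a]) y = y}"
      then have z: "\<phi> a h y \<in> F" using a h by (intro \<phi>_in) (auto simp: h_def)
      have "\<phi> a h (\<phi> h a (transport \<phi> us (\<phi> a h y))) = \<phi> a h y" using y tr by simp
      then have "transport \<phi> us (\<phi> a h y) = \<phi> a h y"
        using transport_in[OF nb z] a h by (subst (asm) \<phi>_inv) (auto simp: h_def)
      then show "\<phi> a h y \<in> {y \<in> F. transport \<phi> us y = y}" using z by simp
    qed
    show "\<phi> h a \<in> {y \<in> F. transport \<phi> us y = y} \<rightarrow> {y \<in> F. transport \<phi> (a # us @ [a]) y = y}"
      using a h by (auto simp: tr \<phi>_inv h_def intro!: \<phi>_in)
  qed (use a h in \<open>auto simp: \<phi>_inv h_def\<close>)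
  then show ?thesis unfolding fixcount_def by (simp add: bij_betw_same_card)
qed

lemma T_small: "T (Suc 0) = 0" "T 2 = 0"
proof -
  have "closed_nbwords d (Suc 0) = {}" "closed_nbwords d 2 = {}"
    by (auto simp: closed_nbwords_def nbwords_def length_Suc_conv numeral_2_eq_2 nonbacktracking_Cons)
  then show "T (Suc 0) = 0" "T 2 = 0" by (simp_all add: T_def)
qed

lemma C_small: "C (Suc 0) = 0" "C 2 = 0"
proof -
  have "closed_nbwords d (Suc 0) = {}" "closed_nbwords d 2 = {}"
    by (auto simp: closed_nbwords_def nbwords_def length_Suc_conv numeral_2_eq_2 nonbacktracking_Cons)
  then show "C (Suc 0) = 0" "C 2 = 0" by (simp_all add: C_def cyclic_nbwords_def)
qed

text \<open>A closed word fails to be cyclically nonbacktracking exactly when it has a tail; stripping the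
  first and last letter gives a recursion.\<close>

lemma T_C_recursion: "T (n + 2) - C (n + 2) = (s - 1) * C n + s * (T n - C n)" if n: "n \<ge> 1"
proof -
  define R where "R m = {us \<in> closed_nbwords d m. us ! 1 = us ! (m - 1)}" for m
  have TC: "T m - C m = (\<Sum>us\<in>R m. fixcount us)" for m
  proof -
    have "closed_nbwords d m = cyclic_nbwords d m \<union> R m" "cyclic_nbwords d m \<inter> R m = {}"
      by (auto simp: cyclic_nbwords_def R_def)
    then have "T m = C m + (\<Sum>us\<in>R m. fixcount us)"
      unfolding T_def C_def by (subst sum.union_disjoint[symmetric]) (auto simp: R_def)
    then show ?thesis by simp
  qed
  consider "n \<le> 2" | "n \<ge> 3" by linarith
  then show ?thesis
  proof cases
    case 1
    \<comment> \<open>Without its first and last letter such a word would be a closed word of length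
      n \<le> 2, and there is none.\<close>
    have "R (n + 2) = {}"
    proof (rule equals0I)
      fix us assume us: "us \<in> R (n + 2)"
      then have "nonbacktracking us" "length us = n + 3" "us ! 1 = us ! (n + 1)"
        by (auto simp: R_def closed_nbwords_def nbwords_def)
      moreover have "n = 1 \<or> n = 2" using n 1 by linarith
      ultimately show False unfolding nonbacktracking_def by (auto simp: numeral_2_eq_2)
    qed
    then have "T (n + 2) - C (n + 2) = 0" unfolding TC by simp
    moreover have "n = Suc 0 \<or> n = 2" using n 1 by linarith
    then have "T n = 0" "C n = 0" using T_small C_small by auto
    ultimately show ?thesis by simp
  next
    case 2
    \<comment> \<open>The letters that may enclose \<open>vs\<close>. Three letters are excluded, or
      only two if \<open>vs\<close> itself has a tail; this produces the coefficients s - 1 and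
      s.\<close>
    define A where "A vs = {a. a \<le> d \<and> a \<noteq> hd vs \<and> a \<noteq> vs ! 1 \<and> a \<noteq> vs ! (n - 1)}" for vs
    have "(\<Sum>us\<in>R (n + 2). fixcount us) = (\<Sum>(vs, a)\<in>(SIGMA vs:closed_nbwords d n. A vs). fixcount vs)"
    proof (rule sum.reindex_bij_witness[of _ "\<lambda>(vs, a). a # vs @ [a]" "\<lambda>us. (butlast (tl us), hd us)"])
      fix us assume us: "us \<in> R (n + 2)"
      then have l: "length us = n + 3" by (auto simp: R_def closed_nbwords_def nbwords_def)
      obtain a ws where aw: "us = a # ws" using l by (cases us) auto
      have "ws \<noteq> []" using l aw by auto
      then obtain vs b where vb: "ws = vs @ [b]" by (metis rev_exhaust)
      have us': "us = a # vs @ [b]" and lv: "length vs = n + 1" using aw vb l by auto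
      have "b = a" using us unfolding us' by (auto simp: R_def closed_nbwords_def)
      then have us': "us = a # vs @ [a]" using us' by simp
      have lv1: "length vs > 1" using lv 2 by simp
      have v0: "vs ! 0 = hd vs" and vl: "vs ! n = last vs"
        using lv hd_conv_nth[of vs] last_conv_nth[of vs] by (cases vs, auto)+
      have nb: "nonbacktracking vs" "a \<noteq> vs ! 0" "a \<noteq> vs ! 1" "a \<noteq> vs ! (n - 1)" "a \<le> d" "set vs \<subseteq> {..d}"
        using us lv1 lv unfolding us' R_def closed_nbwords_def nbwords_def
        by (auto simp: nonbacktracking_enclose)
      have "us ! 1 = us ! (n + 1)" using us by (simp add: R_def)
      then have hl: "hd vs = last vs" using lv v0 vl by (simp add: us' nth_append)
      show w: "(case (butlast (tl us), hd us) of (vs, a) \<Rightarrow> a # vs @ [a]) = us"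
        by (simp add: us' butlast_append)
      have m: "vs \<in> closed_nbwords d n" "a \<in> A vs" using nb lv hl v0 by (auto simp: closed_nbwords_def nbwords_def A_def)
      then show "(butlast (tl us), hd us) \<in> (SIGMA vs:closed_nbwords d n. A vs)"
        by (simp add: us' butlast_append)
      show "(case (butlast (tl us), hd us) of (vs, a) \<Rightarrow> fixcount vs) = fixcount us"
        using fixcount_enclose[OF m(1)] m(2) by (simp add: us' butlast_append A_def)
    next
      fix p assume p: "p \<in> (SIGMA vs:closed_nbwords d n. A vs)"
      obtain vs a where va: "p = (vs, a)" by (cases p)
      have vs: "vs \<in> closed_nbwords d n" "a \<in> A vs" using p va by auto
      have lv: "length vs = n + 1" and ne: "vs \<noteq> []" and hl: "last vs = hd vs"
        using vs by (auto simp: closed_nbwords_def dest: nbwordsD)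
      have v0: "vs ! 0 = hd vs" "vs ! n = hd vs" using ne lv hl by (auto simp: hd_conv_nth last_conv_nth)
      show "(butlast (tl (case p of (vs, a) \<Rightarrow> a # vs @ [a])), hd (case p of (vs, a) \<Rightarrow> a # vs @ [a])) = p"
        by (simp add: va butlast_append)
      have "nonbacktracking (a # vs @ [a])"
        using vs lv 2 v0 hl by (subst nonbacktracking_enclose) (auto simp: A_def closed_nbwords_def nbwords_def)
      then show "(case p of (vs, a) \<Rightarrow> a # vs @ [a]) \<in> R (n + 2)"
        using vs lv v0 hl by (auto simp: va R_def closed_nbwords_def nbwords_def A_def nth_append nth_Cons')
    qed
    also have "\<dots> = (\<Sum>vs\<in>closed_nbwords d n. real (card (A vs)) * fixcount vs)"
      by (subst sum.Sigma[symmetric]) (auto simp: A_def)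
    also have "\<dots> = (\<Sum>vs\<in>cyclic_nbwords d n. real (card (A vs)) * fixcount vs)
        + (\<Sum>vs\<in>R n. real (card (A vs)) * fixcount vs)"
    proof -
      have *: "closed_nbwords d n = cyclic_nbwords d n \<union> R n" "cyclic_nbwords d n \<inter> R n = {}"
        by (auto simp: cyclic_nbwords_def R_def)
      have "finite (R n)" by (simp add: R_def)
      then show ?thesis unfolding *(1) using *(2) by (intro sum.union_disjoint) auto
    qed
    also have "\<dots> = (\<Sum>vs\<in>cyclic_nbwords d n. (s - 1) * fixcount vs) + (\<Sum>vs\<in>R n. s * fixcount vs)"
    proof -
      have cA: "real (card (A vs)) = (if vs ! 1 = vs ! (n - 1) then s else s - 1)" if vs: "vs \<in> closed_nbwords d n" for vs
      proof -
        have nb: "vs \<in> nbwords d n" and hl: "last vs = hd vs" using vs by (auto simp: closed_nbwords_def)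
        have lv: "length vs = n + 1" "vs \<noteq> []" using nbwordsD[OF nb] by auto
        have v0: "vs ! 0 = hd vs" "vs ! n = hd vs" using lv hl by (auto simp: hd_conv_nth last_conv_nth)
        have adjacent: "vs ! i \<noteq> vs ! (i + 1)" if "i < n" for i
          using nb lv that unfolding nbwords_def nonbacktracking_def by auto
        have "vs ! 0 \<noteq> vs ! (0 + 1)" "vs ! (n - 1) \<noteq> vs ! ((n - 1) + 1)"
          using 2 by (intro adjacent; simp)+
        then have ne: "vs ! 1 \<noteq> hd vs" "vs ! (n - 1) \<noteq> hd vs" using v0 2 by auto
        have le: "hd vs \<le> d" "vs ! 1 \<le> d" "vs ! (n - 1) \<le> d" using nbwordsD[OF nb] 2 by auto
        have "A vs = {..d} - {hd vs, vs ! 1, vs ! (n - 1)}" by (auto simp: A_def)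
        then have "card (A vs) = d + 1 - card {hd vs, vs ! 1, vs ! (n - 1)}"
          using le by (simp add: card_Diff_subset)
        also have "card {hd vs, vs ! 1, vs ! (n - 1)} = (if vs ! 1 = vs ! (n - 1) then 2 else 3)"
          using ne by (auto simp: card_insert_if)
        finally show ?thesis using d by (simp add: s_def of_nat_diff)
      qed
      show ?thesis
        by (intro arg_cong2[of _ _ _ _ "(+)"] sum.cong refl)
          (auto simp: cA cyclic_nbwords_def R_def)
    qed
    finally have "(\<Sum>us\<in>R (n + 2). fixcount us) = (s - 1) * C n + s * (\<Sum>vs\<in>R n. fixcount vs)"
      by (simp only: C_def sum_distrib_left)
    then show ?thesis by (simp only: TC)
  qed
qed

text \<open>By \<open>nbpoly_dickson\<close> and \<open>T_C_recursion\<close> the difference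
  \<open>trace (dickson s n) - C n\<close> does not change when n grows by two, so it is determined
  by n = 1 and n = 2. This is the Ihara-Bass formula in terms of traces.\<close>

theorem trace_dickson:
  assumes "n \<ge> 1"
  shows "trace (dickson s n) = C n - (if even n then (s - 1) * (real (d + 1) * card F) else 0)"
  using assms
proof (induction n rule: less_induct)
  case (less n)
  consider "n = 1" | "n = 2" | m where "n = m + 3"
  proof (cases "n < 3")
    case False
    then show ?thesis using that(3)[of "n - 3"] by simp
  qed (use less.prems that in linarith)
  then show ?case
  proof cases
    case 1
    have "dickson s 1 = nbpoly s 1" by simp
    then have "trace (dickson s 1) = T 1" by (simp only: trace_nbpoly)
    then show ?thesis using 1 T_small C_small by simp
  next
    case 2
    have "dickson s 2 = nbpoly s 2 - [:s - 1:]" by (simp add: numeral_2_eq_2)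
    then have "trace (dickson s 2) = T 2 - (s - 1) * (real (d + 1) * card F)"
      by (simp only: trace_diff trace_nbpoly trace_const)
    then show ?thesis using 2 T_small C_small by simp
  next
    case (3 m)
    have "dickson s (m + 3) = nbpoly s (m + 3) - Polynomial.smult s (nbpoly s (m + 1)) + dickson s (m + 1)"
      using nbpoly_dickson[of s m] by (metis diff_add_cancel)
    then have "trace (dickson s (m + 3)) = T (m + 3) - s * T (m + 1) + trace (dickson s (m + 1))"
      by (simp only: trace_add trace_diff trace_smult trace_nbpoly)
    moreover have "T (m + 3) - C (m + 3) = (s - 1) * C (m + 1) + s * (T (m + 1) - C (m + 1))"
      using T_C_recursion[of "m + 1"] by (simp add: numeral_eq_Suc)
    ultimately show ?thesis using less.IH[of "m + 1"] 3 by (simp add: algebra_simps)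
  qed
qed

end

text \<open>The trivial lift is the complete graph itself, with eigenvalues d and -1. In its trace
  formula d = s + 1 yields s^n + 1, and -1 lies in the bulk.\<close>

lemma card_cyclic_nbwords:
  assumes d: "d \<ge> 3" and n: "n \<ge> 1"
  shows "\<bar>real (card (cyclic_nbwords d n)) - (real d - 1) ^ n\<bar> \<le> (real d + 2)\<^sup>2 * sqrt (real d - 1) ^ n"
proof -
  interpret complete_lift d "{0 :: nat}" "\<lambda>u v y. y"
    by unfold_locales (use d in auto)
  have C: "C n = real (card (cyclic_nbwords d n))"
  proof -
    have "transport (\<lambda>u v y. y) us y = y" for us and y :: nat
      by (induction "\<lambda>(u :: nat) (v :: nat) (y :: nat). y" us y rule: transport.induct) auto
    then show ?thesis by (simp add: C_def fixcount_def)
  qed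
  have tr: "trace p = poly p (real d) + real d * poly p (- 1)" for p
  proof -
    have one: "opoly p (\<lambda>u y. 1) u 0 = poly p (real d) * 1" if "u \<le> d" for u
      using that by (intro opoly_eigen) (auto simp: adj_def)
    have "opoly p (point u 0) u 0 = (poly p (real d) + real d * poly p (- 1)) / (real d + 1)" if u: "u \<le> d" for u
    proof -
      \<comment> \<open>The part of a point mass orthogonal to the constants, an eigenvector for
        -1.\<close>
      define f where "f = (\<lambda>v (y::nat). point u 0 v y + (- (1 / (real d + 1))) * 1)"
      have fe: "opoly p f u 0 = poly p (- 1) * f u 0"
      proof (rule opoly_eigen)
        fix v and y :: nat assume v: "v \<le> d" and "y \<in> {0}"
        then have y: "y = 0" by simp
        have "adj (point u 0) v y = (\<Sum>w\<in>{..d} - {v}. if w = u then 1 else 0)"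
          using y by (simp add: adj_def point_def)
        also have "\<dots> = 1 - point u 0 v y" using u y by (auto simp: point_def sum.delta')
        finally have ap: "adj (point u 0) v y = 1 - point u 0 v y" .
        have a1: "adj (\<lambda>u y. 1) v y = real d" using v by (simp add: adj_def)
        show "adj f v y = - 1 * f v y"
          unfolding f_def adj_add adj_scale ap a1 by (simp add: field_simps)
      qed (use u in auto)
      have lin: "opoly p f u 0 = opoly p (point u 0) u 0 - 1 / (real d + 1) * opoly p (\<lambda>u y. 1) u 0"
        unfolding f_def opoly_linear by simp
      have "opoly p (point u 0) u 0 = poly p (- 1) * f u 0 + 1 / (real d + 1) * poly p (real d)"
        using fe lin one[OF u] by simp
      moreover have "f u 0 = real d / (real d + 1)" by (simp add: f_def point_def field_simps)
      ultimately show ?thesis by (simp add: add_divide_distrib mult.commute)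
    qed
    then have "trace p = (\<Sum>u\<le>d. (poly p (real d) + real d * poly p (- 1)) / (real d + 1))"
      by (simp add: trace_def)
    also have "\<dots> = (real d + 1) * ((poly p (real d) + real d * poly p (- 1)) / (real d + 1))"
      by (simp del: times_divide_eq_right)
    finally show ?thesis by simp
  qed
  have s: "s = real d - 1" "s > 0" using d by (auto simp: s_def)
  have g1: "sqrt s ^ n \<ge> 1" using s_ge_2 by (intro one_le_power) simp
  have "poly (dickson s n) (s + 1) = s ^ n + 1"
    using poly_dickson_add[of s 1 s n] by simp
  then have dd: "poly (dickson s n) (real d) = s ^ n + 1" by (simp add: s)
  have m1: "\<bar>poly (dickson s n) (- 1)\<bar> \<le> 2 * sqrt s ^ n"
  proof (rule dickson_growth)
    have "sqrt s \<ge> 1" using s_ge_2 by simp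
    then have "1 \<le> sqrt s + sqrt s" by linarith
    then show "\<bar>- 1\<bar> \<le> sqrt s + s / sqrt s" using s(2) by (simp add: real_div_sqrt)
  qed (use s in auto)
  have "C n - s ^ n = 1 + real d * poly (dickson s n) (- 1) + (if even n then (s - 1) * (real d + 1) else 0)"
    using trace_dickson[OF n] unfolding tr dd by (cases "even n") (simp_all add: algebra_simps)
  also have "\<bar>\<dots>\<bar> \<le> 1 + real d * (2 * sqrt s ^ n) + (s - 1) * (real d + 1)"
  proof -
    have "\<bar>real d * poly (dickson s n) (- 1)\<bar> \<le> real d * (2 * sqrt s ^ n)"
      unfolding abs_mult using m1 by (intro mult_mono) auto
    moreover have "0 \<le> (s - 1) * (real d + 1)" using s_ge_2 by simp
    ultimately show ?thesis by auto
  qed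
  also have "\<dots> \<le> 1 * sqrt s ^ n + real d * (2 * sqrt s ^ n) + (s - 1) * (real d + 1) * sqrt s ^ n"
  proof -
    have "(s - 1) * (real d + 1) * 1 \<le> (s - 1) * (real d + 1) * sqrt s ^ n"
      using g1 s_ge_2 by (intro mult_left_mono) auto
    then show ?thesis using g1 by simp
  qed
  also have "\<dots> = (1 + real d * 2 + (s - 1) * (real d + 1)) * sqrt s ^ n" by (simp add: algebra_simps)
  also have "\<dots> \<le> (real d + 2)\<^sup>2 * sqrt s ^ n"
    using g1 d by (intro mult_right_mono) (auto simp: s power2_eq_square algebra_simps)
  finally show ?thesis unfolding C s(1) .
qed

section \<open>Random labelled lifts\<close>

definition falling :: "nat \<Rightarrow> nat \<Rightarrow> real" where
  "falling N m = (\<Prod>j<m. real N - real j)"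

lemma fact_falling: "m \<le> N \<Longrightarrow> fact N = fact (N - m) * falling N m"
proof (induction m)
  case (Suc m)
  have "N - m = Suc (N - Suc m)" using Suc.prems by simp
  then have "(fact (N - m) :: real) = (real N - real m) * fact (N - Suc m)"
    using Suc.prems by (simp add: of_nat_diff)
  then show ?case using Suc by (simp add: falling_def)
qed (simp add: falling_def)

lemma falling_pos: "m \<le> N \<Longrightarrow> falling N m > 0"
  unfolding falling_def by (intro prod_pos) auto

text \<open>Since D and its image have complements of equal size, f extends to a permutation q of A;
  the permutations in question are q composed with those of A - D.\<close>

lemma card_permutes_extending:
  assumes A: "finite A" and D: "D \<subseteq> A" and f: "inj_on f D" "f ` D \<subseteq> A"
  shows "card {p. p permutes A \<and> (\<forall>x\<in>D. p x = f x)} = fact (card A - card D)"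
proof -
  have finD: "finite D" using A D finite_subset by auto
  have "card (A - D) = card (A - f ` D)"
    using A D f finD by (simp add: card_Diff_subset card_image)
  then obtain g where g: "bij_betw g (A - D) (A - f ` D)"
    using A finite_same_card_bij by (metis finite_Diff)
  define q where "q x = (if x \<in> D then f x else if x \<in> A then g x else x)" for x
  have "bij_betw q (D \<union> (A - D)) (f ` D \<union> (A - f ` D))"
  proof (rule bij_betw_combine)
    show "bij_betw q D (f ` D)" using f(1) by (auto simp: q_def bij_betw_def inj_on_def)
    show "bij_betw q (A - D) (A - f ` D)" using g by (rule bij_betw_cong[THEN iffD1, rotated]) (auto simp: q_def)
  qed auto
  then have "bij_betw q A A" using D f(2) by (simp add: Un_absorb1)
  then have q: "q permutes A" using D by (intro bij_imp_permutes) (auto simp: q_def)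
  have "bij_betw (\<lambda>p. q \<circ> p) {p. p permutes (A - D)} {p. p permutes A \<and> (\<forall>x\<in>D. p x = f x)}"
  proof (rule bij_betwI[where g = "\<lambda>p. inv_into UNIV q \<circ> p"])
    show "(\<lambda>p. q \<circ> p) \<in> {p. p permutes (A - D)} \<rightarrow> {p. p permutes A \<and> (\<forall>x\<in>D. p x = f x)}"
    proof
      fix p assume "p \<in> {p. p permutes (A - D)}"
      then have p: "p permutes (A - D)" by simp
      then have "p permutes A" by (rule permutes_subset) auto
      then have "q \<circ> p permutes A" using q by (rule permutes_compose)
      moreover have "(q \<circ> p) x = f x" if "x \<in> D" for x
        using that permutes_not_in[OF p] by (auto simp: q_def)
      ultimately show "q \<circ> p \<in> {p. p permutes A \<and> (\<forall>x\<in>D. p x = f x)}" by blast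
    qed
    show "(\<lambda>p. inv_into UNIV q \<circ> p) \<in> {p. p permutes A \<and> (\<forall>x\<in>D. p x = f x)} \<rightarrow> {p. p permutes (A - D)}"
    proof
      fix p assume "p \<in> {p. p permutes A \<and> (\<forall>x\<in>D. p x = f x)}"
      then have p: "p permutes A" "\<And>x. x \<in> D \<Longrightarrow> p x = f x" by auto
      have ip: "inv_into UNIV q \<circ> p permutes A" using p(1) permutes_inv[OF q] by (rule permutes_compose)
      have "(inv_into UNIV q \<circ> p) x = x" if "x \<in> D" for x
      proof -
        have "p x = q x" using p(2)[OF that] that by (simp add: q_def)
        then show ?thesis using permutes_inverses(2)[OF q] by simp
      qed
      then have "inv_into UNIV q \<circ> p permutes (A - D)"
        using ip by (intro permutes_superset[OF ip]) auto
      then show "inv_into UNIV q \<circ> p \<in> {p. p permutes (A - D)}" by simp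
    qed
  qed (auto simp: fun_eq_iff permutes_inverses[OF q])
  then have "card {p. p permutes A \<and> (\<forall>x\<in>D. p x = f x)} = card {p. p permutes (A - D)}"
    by (simp add: bij_betw_same_card)
  also have "\<dots> = fact (card (A - D))" using A by (intro card_permutations) auto
  finally show ?thesis using D finD by (simp add: card_Diff_subset)
qed

text \<open>A constraint \<open>(e, x, y, l)\<close> asks that the permutation on the base edge \<open>e\<close> sends \<open>x\<close> to \<open>y\<close> and that this arc has label \<open>l\<close>.\<close>

type_synonym 'l constraint = "(nat \<times> nat) \<times> nat \<times> nat \<times> 'l"

abbreviation cedge :: "'l constraint \<Rightarrow> nat \<times> nat" where "cedge c \<equiv> fst c"
abbreviation csrc :: "'l constraint \<Rightarrow> nat" where "csrc c \<equiv> fst (snd c)"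
abbreviation ctgt :: "'l constraint \<Rightarrow> nat" where "ctgt c \<equiv> fst (snd (snd c))"
abbreviation clab :: "'l constraint \<Rightarrow> 'l" where "clab c \<equiv> snd (snd (snd c))"

type_synonym 'l sample = "nat \<times> nat \<Rightarrow> (nat \<Rightarrow> nat) \<times> (nat \<Rightarrow> 'l)"

definition holds :: "'l sample \<Rightarrow> 'l constraint \<Rightarrow> bool" where
  "holds \<omega> c \<longleftrightarrow> fst (\<omega> (cedge c)) (csrc c) = ctgt c \<and> snd (\<omega> (cedge c)) (csrc c) = clab c"

definition consistent :: "'l constraint set \<Rightarrow> bool" where
  "consistent S \<longleftrightarrow> (\<forall>c\<in>S. \<forall>c'\<in>S. cedge c = cedge c' \<longrightarrow> csrc c = csrc c' \<or> ctgt c = ctgt c' \<longrightarrow> c = c')"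

text \<open>A random lift in two stages: a uniformly random \<open>N\<close>-fold lift, and above each of its points another \<open>k\<close> points,
  which are permuted along an arc with label \<open>l\<close> by the involution \<open>pm l\<close>.  The labels are independent with weights \<open>w\<close>.\<close>

locale label_model =
  fixes d k :: nat and \<Lambda> :: "'l set" and w :: "'l \<Rightarrow> real" and pm :: "'l \<Rightarrow> nat \<Rightarrow> nat"
  assumes d: "d \<ge> 3" and fin\<Lambda>: "finite \<Lambda>" and w_nonneg: "\<And>l. l \<in> \<Lambda> \<Longrightarrow> w l \<ge> 0"
    and w_sum: "(\<Sum>l\<in>\<Lambda>. w l) = 1"
    and pm_in: "\<And>l i. l \<in> \<Lambda> \<Longrightarrow> i < k \<Longrightarrow> pm l i < k"
    and pm_inv: "\<And>l i. l \<in> \<Lambda> \<Longrightarrow> i < k \<Longrightarrow> pm l (pm l i) = i"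
begin

definition edges :: "(nat \<times> nat) set" where
  "edges = {(a, b). a < b \<and> b \<le> d}"

lemma finite_edges [simp]: "finite edges"
  by (rule finite_subset[of _ "{..d} \<times> {..d}"]) (auto simp: edges_def)

definition edge_samples :: "nat \<Rightarrow> ((nat \<Rightarrow> nat) \<times> (nat \<Rightarrow> 'l)) set" where
  "edge_samples N = {p. p permutes {..<N}} \<times> ({..<N} \<rightarrow>\<^sub>E \<Lambda>)"

lemma finite_edge_samples [simp]: "finite (edge_samples N)"
  unfolding edge_samples_def using fin\<Lambda> by (auto intro!: finite_cartesian_product finite_permutations finite_PiE)

definition edge_weight :: "nat \<Rightarrow> (nat \<Rightarrow> nat) \<times> (nat \<Rightarrow> 'l) \<Rightarrow> real" where
  "edge_weight N p = (\<Prod>x<N. w (snd p x)) / fact N"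

definition samples :: "nat \<Rightarrow> 'l sample set" where
  "samples N = edges \<rightarrow>\<^sub>E edge_samples N"

lemma finite_samples [simp]: "finite (samples N)"
  unfolding samples_def by (intro finite_PiE) auto

definition sample_weight :: "nat \<Rightarrow> 'l sample \<Rightarrow> real" where
  "sample_weight N \<omega> = (\<Prod>e\<in>edges. edge_weight N (\<omega> e))"

definition expect :: "nat \<Rightarrow> ('l sample \<Rightarrow> real) \<Rightarrow> real" where
  "expect N f = (\<Sum>\<omega>\<in>samples N. sample_weight N \<omega> * f \<omega>)"

lemma sample_weight_nonneg:
  assumes "\<omega> \<in> samples N"
  shows "sample_weight N \<omega> \<ge> 0"
  unfolding sample_weight_def
proof (intro prod_nonneg)
  fix e assume "e \<in> edges"
  then have "\<omega> e \<in> edge_samples N" using assms by (auto simp: samples_def)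
  then have "snd (\<omega> e) x \<in> \<Lambda>" if "x < N" for x
    using that by (auto simp: edge_samples_def mem_Times_iff dest: PiE_mem)
  then have "(\<Prod>x<N. w (snd (\<omega> e) x)) \<ge> 0" by (intro prod_nonneg) (simp add: w_nonneg)
  then show "edge_weight N (\<omega> e) \<ge> 0" by (simp add: edge_weight_def)
qed

text \<open>Permutation and labels are independent. The permutation contributes (N - m)!/N! for m
  constraints; a label contributes its weight at a constrained source and sums to 1
  elsewhere.\<close>

lemma edge_expectation:
  assumes R: "finite R" "\<And>c. c \<in> R \<Longrightarrow> csrc c < N \<and> ctgt c < N \<and> clab c \<in> \<Lambda>"
    and inj: "inj_on csrc R" "inj_on ctgt R"
  shows "(\<Sum>p\<in>edge_samples N. edge_weight N p * of_bool (\<forall>c\<in>R. fst p (csrc c) = ctgt c \<and> snd p (csrc c) = clab c))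
    = (\<Prod>c\<in>R. w (clab c)) / falling N (card R)"
proof -
  define f where "f x = ctgt (the_inv_into R csrc x)" for x
  define g where "g x = clab (the_inv_into R csrc x)" for x
  have fg: "f (csrc c) = ctgt c" "g (csrc c) = clab c" if "c \<in> R" for c
    using the_inv_into_f_f[OF inj(1) that] by (simp_all add: f_def g_def)
  define D where "D = csrc ` R"
  have cD: "card D = card R" using inj(1) by (simp add: D_def card_image)
  have DN: "D \<subseteq> {..<N}" unfolding D_def by (intro image_subsetI) (simp add: R(2))
  have "inj_on (f \<circ> csrc) R" using inj(2) by (rule inj_on_cong[THEN iffD1, rotated]) (simp add: fg)
  then have injf: "inj_on f D" unfolding D_def using comp_inj_on_iff[OF inj(1)] by blast
  have fD: "f ` D = ctgt ` R" unfolding D_def image_image using fg by (intro image_cong) auto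
  have "f ` D \<subseteq> {..<N}" unfolding fD by (intro image_subsetI) (simp add: R(2))
  with injf have perms: "card {p. p permutes {..<N} \<and> (\<forall>x\<in>D. p x = f x)} = fact (N - card R)"
    using card_permutes_extending[of "{..<N}" D f] DN cD by simp
  have cR: "card R \<le> N" using card_mono[OF _ DN] cD by simp
  have "(\<Sum>p\<in>edge_samples N. edge_weight N p * of_bool (\<forall>c\<in>R. fst p (csrc c) = ctgt c \<and> snd p (csrc c) = clab c))
    = (\<Sum>p | p permutes {..<N}. \<Sum>L\<in>{..<N} \<rightarrow>\<^sub>E \<Lambda>. of_bool (\<forall>x\<in>D. p x = f x) / fact N *
        (\<Prod>x<N. w (L x) * of_bool (x \<in> D \<longrightarrow> L x = g x)))"
    unfolding edge_samples_def sum.cartesian_product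
  proof (rule sum.cong[OF refl], clarify)
    fix p :: "nat \<Rightarrow> nat" and L :: "nat \<Rightarrow> 'l" assume "p permutes {..<N}"
    have ob: "(\<Prod>x<M. of_bool (x \<in> D \<longrightarrow> L x = g x) :: real) = of_bool (\<forall>x<M. x \<in> D \<longrightarrow> L x = g x)" for M
      by (induction M) (auto simp: less_Suc_eq)
    have "(\<forall>x<N. x \<in> D \<longrightarrow> L x = g x) \<longleftrightarrow> (\<forall>x\<in>D. L x = g x)"
      using DN by blast
    also have "\<dots> \<longleftrightarrow> (\<forall>c\<in>R. L (csrc c) = clab c)"
      unfolding D_def ball_simps using fg(2) by (intro ball_cong) simp_all
    finally have lab: "(\<forall>x<N. x \<in> D \<longrightarrow> L x = g x) \<longleftrightarrow> (\<forall>c\<in>R. L (csrc c) = clab c)" .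
    have tgt: "(\<forall>x\<in>D. p x = f x) \<longleftrightarrow> (\<forall>c\<in>R. p (csrc c) = ctgt c)"
      unfolding D_def ball_simps using fg(1) by (intro ball_cong) simp_all
    have "of_bool (\<forall>c\<in>R. fst (p, L) (csrc c) = ctgt c \<and> snd (p, L) (csrc c) = clab c) =
        of_bool (\<forall>c\<in>R. p (csrc c) = ctgt c) * (of_bool (\<forall>c\<in>R. L (csrc c) = clab c) :: real)"
      unfolding ball_conj_distrib of_bool_conj by simp
    then show "edge_weight N (p, L) * of_bool (\<forall>c\<in>R. fst (p, L) (csrc c) = ctgt c \<and> snd (p, L) (csrc c) = clab c)
      = of_bool (\<forall>x\<in>D. p x = f x) / fact N * (\<Prod>x<N. w (L x) * of_bool (x \<in> D \<longrightarrow> L x = g x))"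
      unfolding prod.distrib ob lab tgt edge_weight_def by simp
  qed
  also have "\<dots> = (\<Sum>p | p permutes {..<N}. of_bool (\<forall>x\<in>D. p x = f x) / fact N) *
      (\<Sum>L\<in>{..<N} \<rightarrow>\<^sub>E \<Lambda>. \<Prod>x<N. w (L x) * of_bool (x \<in> D \<longrightarrow> L x = g x))"
    unfolding sum_product ..
  also have "(\<Sum>L\<in>{..<N} \<rightarrow>\<^sub>E \<Lambda>. \<Prod>x<N. w (L x) * of_bool (x \<in> D \<longrightarrow> L x = g x)) =
      (\<Prod>x<N. \<Sum>l\<in>\<Lambda>. w l * of_bool (x \<in> D \<longrightarrow> l = g x))"
    by (subst prod_sum_PiE) (auto simp: fin\<Lambda>)
  also have "\<dots> = (\<Prod>x<N. if x \<in> D then w (g x) else 1)"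
  proof (intro prod.cong refl)
    fix x assume "x \<in> {..<N}"
    show "(\<Sum>l\<in>\<Lambda>. w l * of_bool (x \<in> D \<longrightarrow> l = g x)) = (if x \<in> D then w (g x) else 1)"
    proof (cases "x \<in> D")
      case True
      then obtain c where "c \<in> R" "x = csrc c" by (auto simp: D_def)
      then have "g x \<in> \<Lambda>" using R(2)[of c] fg(2)[of c] by simp
      have "(\<Sum>l\<in>\<Lambda>. w l * of_bool (x \<in> D \<longrightarrow> l = g x)) = (\<Sum>l\<in>\<Lambda>. if l = g x then w l else 0)"
        using True by (intro sum.cong) auto
      then show ?thesis using True fin\<Lambda> \<open>g x \<in> \<Lambda>\<close> by simp
    qed (simp add: w_sum)
  qed
  also have "\<dots> = (\<Prod>x\<in>D. w (g x))"
    using DN by (simp add: prod.If_cases Int_absorb1)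
  also have "\<dots> = (\<Prod>c\<in>R. w (clab c))"
    unfolding D_def using inj(1) by (subst prod.reindex) (auto simp: fg)
  also have "(\<Sum>p | p permutes {..<N}. of_bool (\<forall>x\<in>D. p x = f x) / fact N :: real) = fact (N - card R) / fact N"
  proof -
    have "(\<Sum>p | p permutes {..<N}. of_bool (\<forall>x\<in>D. p x = f x) :: real) =
        real (card {p. p permutes {..<N} \<and> (\<forall>x\<in>D. p x = f x)})"
      by (subst sum_of_bool_eq) (auto simp: finite_permutations Int_def)
    then show ?thesis unfolding perms by (simp flip: sum_divide_distrib)
  qed
  also have "\<dots> = 1 / falling N (card R)"
    using fact_falling[OF cR] by (simp add: field_simps)
  finally show ?thesis by simp
qed

definition edge_constraints :: "'l constraint set \<Rightarrow> nat \<times> nat \<Rightarrow> 'l constraint set" where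
  "edge_constraints S e = {c \<in> S. cedge c = e}"

definition probability_value :: "nat \<Rightarrow> 'l constraint set \<Rightarrow> real" where
  "probability_value N S = (if consistent S then
     (\<Prod>c\<in>S. w (clab c)) / (\<Prod>e\<in>edges. falling N (card (edge_constraints S e))) else 0)"

text \<open>The base edges are independent, so the expectation factors over them. Inconsistent
  constraints contradict injectivity of the permutation or uniqueness of images and labels.\<close>

theorem expect_holds:
  assumes S: "finite S" "\<And>c. c \<in> S \<Longrightarrow> cedge c \<in> edges \<and> csrc c < N \<and> ctgt c < N \<and> clab c \<in> \<Lambda>"
  shows "expect N (\<lambda>\<omega>. of_bool (\<forall>c\<in>S. holds \<omega> c)) = probability_value N S"
proof (cases "consistent S")
  case True
  have fin: "finite (edge_constraints S e)" for e using S(1) by (simp add: edge_constraints_def)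
  have edge: "cedge ` S \<subseteq> edges" using S(2) by (intro image_subsetI) simp
  have "expect N (\<lambda>\<omega>. of_bool (\<forall>c\<in>S. holds \<omega> c)) =
     (\<Sum>\<omega>\<in>edges \<rightarrow>\<^sub>E edge_samples N. \<Prod>e\<in>edges. edge_weight N (\<omega> e) *
        of_bool (\<forall>c\<in>edge_constraints S e. fst (\<omega> e) (csrc c) = ctgt c \<and> snd (\<omega> e) (csrc c) = clab c))"
    unfolding expect_def samples_def
  proof (rule sum.cong[OF refl])
    fix \<omega> :: "'l sample"
    have "(\<Prod>e\<in>B. of_bool (Q e) :: real) = of_bool (\<forall>e\<in>B. Q e)" if "finite B" for B :: "(nat \<times> nat) set" and Q
      using that by (induction B) auto
    note this[OF finite_edges]
    moreover have "(\<forall>e\<in>edges. \<forall>c\<in>edge_constraints S e. fst (\<omega> e) (csrc c) = ctgt c \<and> snd (\<omega> e) (csrc c) = clab c)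
      \<longleftrightarrow> (\<forall>c\<in>S. holds \<omega> c)"
      unfolding edge_constraints_def holds_def using edge by blast
    ultimately show "sample_weight N \<omega> * of_bool (\<forall>c\<in>S. holds \<omega> c) = (\<Prod>e\<in>edges. edge_weight N (\<omega> e) *
        of_bool (\<forall>c\<in>edge_constraints S e. fst (\<omega> e) (csrc c) = ctgt c \<and> snd (\<omega> e) (csrc c) = clab c))"
      unfolding prod.distrib sample_weight_def by simp
  qed
  also have "\<dots> = (\<Prod>e\<in>edges. \<Sum>p\<in>edge_samples N. edge_weight N p *
        of_bool (\<forall>c\<in>edge_constraints S e. fst p (csrc c) = ctgt c \<and> snd p (csrc c) = clab c))"
    by (rule prod_sum_PiE[symmetric]) auto
  also have "\<dots> = (\<Prod>e\<in>edges. (\<Prod>c\<in>edge_constraints S e. w (clab c)) / falling N (card (edge_constraints S e)))"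
  proof (intro prod.cong refl edge_expectation fin)
    fix e assume "e \<in> edges"
    show "inj_on csrc (edge_constraints S e)" "inj_on ctgt (edge_constraints S e)"
      using True unfolding consistent_def inj_on_def edge_constraints_def by blast+
  qed (simp add: edge_constraints_def S(2))
  also have "\<dots> = (\<Prod>e\<in>edges. \<Prod>c\<in>edge_constraints S e. w (clab c)) / (\<Prod>e\<in>edges. falling N (card (edge_constraints S e)))"
    by (rule prod_dividef)
  also have "(\<Prod>e\<in>edges. \<Prod>c\<in>edge_constraints S e. w (clab c)) = (\<Prod>c\<in>S. w (clab c))"
    unfolding edge_constraints_def using edge by (intro prod.group S(1) finite_edges)
  finally show ?thesis using True by (simp add: probability_value_def)
next
  case False
  have "of_bool (\<forall>c\<in>S. holds \<omega> c) = (0 :: real)" if \<omega>: "\<omega> \<in> samples N" for \<omega>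
  proof -
    have "consistent S" if h: "\<forall>c\<in>S. holds \<omega> c"
      unfolding consistent_def
    proof (intro ballI impI)
      fix c c' assume c: "c \<in> S" "c' \<in> S" "cedge c = cedge c'" "csrc c = csrc c' \<or> ctgt c = ctgt c'"
      have "holds \<omega> c" "holds \<omega> c'" using h c(1,2) by blast+
      then have hc: "fst (\<omega> (cedge c)) (csrc c) = ctgt c" "snd (\<omega> (cedge c)) (csrc c) = clab c"
        "fst (\<omega> (cedge c)) (csrc c') = ctgt c'" "snd (\<omega> (cedge c)) (csrc c') = clab c'"
        unfolding holds_def c(3)[symmetric] by blast+
      have "\<omega> (cedge c) \<in> edge_samples N" using \<omega> S(2)[OF c(1)] by (auto simp: samples_def)
      then have "fst (\<omega> (cedge c)) permutes {..<N}" by (simp add: edge_samples_def mem_Times_iff)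
      then have inj: "inj (fst (\<omega> (cedge c)))" by (rule permutes_inj)
      have src: "csrc c = csrc c'"
        using c(4)
      proof
        assume "ctgt c = ctgt c'"
        then have "fst (\<omega> (cedge c)) (csrc c) = fst (\<omega> (cedge c)) (csrc c')" using hc(1,3) by simp
        then show ?thesis using inj by (rule injD[rotated])
      qed
      then have "ctgt c = ctgt c'" "clab c = clab c'" using hc by simp_all
      then show "c = c'" using c(3) src by (auto simp: prod_eq_iff)
    qed
    then show ?thesis using False by auto
  qed
  then have "expect N (\<lambda>\<omega>. of_bool (\<forall>c\<in>S. holds \<omega> c)) = 0"
    unfolding expect_def by (intro sum.neutral) simp
  then show ?thesis using False by (simp add: probability_value_def)
qed

lemma expect_const: "expect N (\<lambda>_. c) = c"
proof -
  have "expect N (\<lambda>_. 1) = 1"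
    using expect_holds[of "{}" N] by (simp add: probability_value_def consistent_def edge_constraints_def falling_def)
  then have one: "(\<Sum>\<omega>\<in>samples N. sample_weight N \<omega>) = 1" by (simp add: expect_def)
  have "expect N (\<lambda>_. c) = (\<Sum>\<omega>\<in>samples N. sample_weight N \<omega>) * c"
    unfolding expect_def by (rule sum_distrib_right[symmetric])
  then show ?thesis using one by simp
qed

lemma expect_add: "expect N (\<lambda>\<omega>. f \<omega> + g \<omega>) = expect N f + expect N g"
  unfolding expect_def distrib_left by (rule sum.distrib)

lemma expect_scale: "expect N (\<lambda>\<omega>. c * f \<omega>) = c * expect N f"
  unfolding expect_def sum_distrib_left by (intro sum.cong) auto

lemma expect_sum: "expect N (\<lambda>\<omega>. \<Sum>i\<in>I. f i \<omega>) = (\<Sum>i\<in>I. expect N (f i))"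
  unfolding expect_def sum_distrib_left by (rule sum.swap)

lemma expect_cong: "(\<And>\<omega>. \<omega> \<in> samples N \<Longrightarrow> f \<omega> = g \<omega>) \<Longrightarrow> expect N f = expect N g"
  unfolding expect_def by (intro sum.cong) auto

lemma expect_mono: "(\<And>\<omega>. \<omega> \<in> samples N \<Longrightarrow> f \<omega> \<le> g \<omega>) \<Longrightarrow> expect N f \<le> expect N g"
  unfolding expect_def by (intro sum_mono mult_left_mono sample_weight_nonneg) auto

lemma expect_abs_le:
  assumes "\<And>\<omega>. \<omega> \<in> samples N \<Longrightarrow> \<bar>f \<omega>\<bar> \<le> B"
  shows "\<bar>expect N f\<bar> \<le> B"
proof -
  have "expect N f \<le> expect N (\<lambda>_. B)" "expect N (\<lambda>_. - B) \<le> expect N f"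
    using assms by (auto intro!: expect_mono simp: abs_le_iff minus_le_iff)
  then show ?thesis unfolding expect_const by linarith
qed

lemma expect_exists_le:
  obtains \<omega> where "\<omega> \<in> samples N" "f \<omega> \<le> expect N f"
proof (rule ccontr)
  assume "\<not> thesis"
  then have gt: "\<And>\<omega>. \<omega> \<in> samples N \<Longrightarrow> expect N f < f \<omega>" using that by (meson not_le)
  have "(\<Sum>\<omega>\<in>samples N. sample_weight N \<omega>) = 1" using expect_const[of N 1] by (simp add: expect_def)
  then obtain \<omega> where \<omega>: "\<omega> \<in> samples N" "sample_weight N \<omega> \<noteq> 0"
    by (metis sum.neutral zero_neq_one)
  define m where "m = expect N f"
  have "(\<Sum>\<omega>\<in>samples N. sample_weight N \<omega> * m) < (\<Sum>\<omega>\<in>samples N. sample_weight N \<omega> * f \<omega>)"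
  proof (rule sum_strict_mono_ex1)
    show "\<forall>x\<in>samples N. sample_weight N x * m \<le> sample_weight N x * f x"
    proof
      fix x assume x: "x \<in> samples N"
      have "m \<le> f x" using gt[OF x] by (simp add: m_def)
      then show "sample_weight N x * m \<le> sample_weight N x * f x"
        by (rule mult_left_mono[OF _ sample_weight_nonneg[OF x]])
    qed
    have "sample_weight N \<omega> > 0" using \<omega> sample_weight_nonneg[OF \<omega>(1)] by linarith
    then show "\<exists>a\<in>samples N. sample_weight N a * m < sample_weight N a * f a"
      using gt[OF \<omega>(1)] \<omega>(1) by (intro bexI[of _ \<omega>]) (auto simp: m_def)
  qed simp
  then have "expect N (\<lambda>_. m) < m" by (simp add: expect_def m_def)
  then show False by (simp add: expect_const)
qed

end

text \<open>A closed walk without a tail is indexed periodically, so that no time plays a special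
  role. The colour \<open>ty\<close>, later the base vertex, replaces the usual condition on
  successive arcs: vertices two steps apart have different colours. This form also covers patterns
  of arcs that no permutation can realise.\<close>

locale periodic_walk =
  fixes P :: "nat \<Rightarrow> 'v" and A :: "nat \<Rightarrow> 'a" and ends :: "'a \<Rightarrow> 'v set" and ty :: "'v \<Rightarrow> 'c" and n :: nat
  assumes n: "n > 0" and P_per: "\<And>t. P (t + n) = P t" and A_per: "\<And>t. A (t + n) = A t"
    and ends: "\<And>t. ends (A t) = {P t, P (Suc t)}"
    and ty1: "\<And>t. ty (P t) \<noteq> ty (P (Suc t))" and ty2: "\<And>t. ty (P t) \<noteq> ty (P (Suc (Suc t)))"
begin

lemma P_per_mult: "P (t + c * n) = P t" and A_per_mult: "A (t + c * n) = A t"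
  by (induction c) (simp_all add: P_per A_per add.assoc[symmetric] add.commute[of n] add.left_commute[of n])

lemma range_P: "range P = P ` {..<n}" and range_A: "range A = A ` {..<n}"
proof -
  have "P t = P (t mod n)" "A t = A (t mod n)" for t
    using P_per_mult[of "t mod n" "t div n"] A_per_mult[of "t mod n" "t div n"] by simp_all
  then show "range P = P ` {..<n}" "range A = A ` {..<n}"
    using n by (auto simp: image_iff intro!: bexI[of _ "_ mod n"])
qed

lemma finite_range_P: "finite (range P)" and finite_range_A: "finite (range A)"
  by (simp_all add: range_P range_A)

definition incident :: "'v \<Rightarrow> 'a set" where
  "incident p = {a \<in> range A. p \<in> ends a}"

lemma finite_incident: "finite (incident p)"
  by (rule finite_subset[OF _ finite_range_A]) (auto simp: incident_def)

lemma A_Suc_neq: "A t \<noteq> A (Suc t)"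
proof
  assume "A t = A (Suc t)"
  then have "{P t, P (Suc t)} = {P (Suc t), P (Suc (Suc t))}" using ends by metis
  then show False using ty2[of t] ty1[of t] by (metis insert_iff singletonD)
qed

lemma incident_Suc: "{A t, A (Suc t)} \<subseteq> incident (P (Suc t))"
  by (auto simp: incident_def ends)

lemma P_shift: "\<exists>t'. P t = P (Suc t') \<and> A t = A (Suc t')"
  using P_per[of t] A_per[of t] n by (intro exI[of _ "t + n - 1"]) simp

lemma card_incident_ge: "p \<in> range P \<Longrightarrow> 2 \<le> card (incident p)"
proof -
  assume "p \<in> range P"
  then obtain t where p: "p = P (Suc t)" using P_shift by blast
  have "card {A t, A (Suc t)} = 2" using A_Suc_neq by simp
  then show ?thesis using card_mono[OF finite_incident incident_Suc[of t]] p by simp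
qed

lemma sum_card_incident: "(\<Sum>p\<in>range P. card (incident p)) = 2 * card (range A)"
proof -
  have "(\<Sum>p\<in>range P. card (incident p)) = (\<Sum>p\<in>range P. \<Sum>a\<in>range A. if p \<in> ends a then 1 else 0)"
  proof (intro sum.cong refl)
    fix p show "card (incident p) = (\<Sum>a\<in>range A. if p \<in> ends a then 1 else 0)"
      using sum.inter_filter[OF finite_range_A, of "\<lambda>_. 1 :: nat" "\<lambda>a. p \<in> ends a"] by (simp add: incident_def)
  qed
  also have "\<dots> = (\<Sum>a\<in>range A. \<Sum>p\<in>range P. if p \<in> ends a then 1 else 0)"
    by (rule sum.swap)
  also have "\<dots> = (\<Sum>a\<in>range A. 2)"
  proof (intro sum.cong refl)
    fix a assume "a \<in> range A"
    then obtain t where a: "a = A t" by auto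
    have "(\<Sum>p\<in>range P. if p \<in> ends a then 1 else 0 :: nat) = card {p \<in> range P. p \<in> ends a}"
      using sum.inter_filter[OF finite_range_P, of "\<lambda>_. 1 :: nat" "\<lambda>p. p \<in> ends a"] by simp
    also have "{p \<in> range P. p \<in> ends a} = {P t, P (Suc t)}" by (auto simp: a ends)
    also have "card \<dots> = 2" using ty1[of t] by (subst card_2_iff) metis
    finally show "(\<Sum>p\<in>range P. if p \<in> ends a then 1 else 0 :: nat) = 2" .
  qed
  finally show ?thesis by simp
qed

text \<open>Every vertex meets at least two arcs, so the handshake identity applies. A pattern
  contributes in the order N^(vertices - arcs), hence never more than a constant.\<close>

lemma card_vertices_le_arcs: "card (range P) \<le> card (range A)"
proof -
  have "2 * card (range P) = (\<Sum>p\<in>range P. 2)" by simp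
  also have "\<dots> \<le> (\<Sum>p\<in>range P. card (incident p))" by (intro sum_mono card_incident_ge)
  finally show ?thesis using sum_card_incident by simp
qed

text \<open>If there are as many vertices as arcs, every vertex has degree two, so the walk can only run
  around one cycle; reversing its direction would force a backtracking step in the middle.\<close>

context
  assumes unicyclic: "card (range P) = card (range A)"
begin

lemma incident_eq: "incident (P (Suc t)) = {A t, A (Suc t)}"
proof -
  have c: "card {A t, A (Suc t)} = 2" using A_Suc_neq by simp
  have "card (incident (P (Suc t))) \<le> 2"
  proof (rule ccontr)
    assume a: "\<not> ?thesis"
    have "(\<Sum>p\<in>range P. 2) < (\<Sum>p\<in>range P. card (incident p))"
    proof (intro sum_strict_mono_ex1 finite_range_P)
      show "\<exists>p\<in>range P. 2 < card (incident p)" using a by (intro bexI[of _ "P (Suc t)"]) auto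
    qed (auto intro!: card_incident_ge)
    then show False using sum_card_incident unicyclic by simp
  qed
  then show ?thesis using incident_Suc[of t] finite_incident c by (metis card_seteq)
qed

lemma no_reversal: "a \<le> b \<Longrightarrow> P (Suc a) = P (Suc b) \<Longrightarrow> A (Suc a) \<noteq> A b"
proof (induction "b - a" arbitrary: a b rule: less_induct)
  case less
  show ?case
  proof
    assume AA: "A (Suc a) = A b"
    \<comment> \<open>The two passages run towards each other, and b - a shrinks by two until they
      meet: in a vertex, which is a step undone at once, or across an arc, which would be a
      loop.\<close>
    consider "b = a" | "b = Suc a" | c where "b = Suc c" "Suc a \<le> c"
    proof (cases "b \<le> Suc a")
      case False
      then show ?thesis using that(3)[of "b - 1"] by simp
    qed (use less.prems that in linarith)
    then show False
    proof cases
      case 1 then show ?thesis using AA A_Suc_neq by metis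
    next
      case 2 then show ?thesis using less.prems ty1[of "Suc a"] by metis
    next
      case (3 c)
      have "{P (Suc a), P (Suc (Suc a))} = {P b, P (Suc b)}" using AA ends by metis
      then have "P (Suc (Suc a)) = P b"
        using less.prems ty1[of "Suc a"] by (metis doubleton_eq_iff)
      then have PP: "P (Suc (Suc a)) = P (Suc c)" using 3 by simp
      then have "{A (Suc a), A (Suc (Suc a))} = {A c, A (Suc c)}" using incident_eq by metis
      then have "A (Suc (Suc a)) = A c" using AA 3 A_Suc_neq by (metis doubleton_eq_iff)
      moreover have "c - Suc a < b - a" using 3 by simp
      ultimately show False using less.hyps[OF _ 3(2) PP] by blast
    qed
  qed
qed

lemma deterministic: "P a = P b \<Longrightarrow> A a = A b \<and> P (Suc a) = P (Suc b)"
proof -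
  have *: "A (Suc a) = A (Suc b)" if PP: "P (Suc a) = P (Suc b)" for a b
  proof (rule ccontr)
    assume ne: "A (Suc a) \<noteq> A (Suc b)"
    have "{A a, A (Suc a)} = {A b, A (Suc b)}" using PP incident_eq by metis
    then have "A (Suc a) = A b" using ne by (metis doubleton_eq_iff)
    \<comment> \<open>Adding whole periods to \<open>b\<close> provides the order that
      \<open>no_reversal\<close> requires.\<close>
    moreover have "A b = A (b + a * n)" "P (Suc b) = P (Suc (b + a * n))"
      using A_per_mult[of b a] P_per_mult[of "Suc b" a] by simp_all
    moreover have "a \<le> b + a * n" using n by (simp add: trans_le_add2)
    ultimately show False using no_reversal[of a "b + a * n"] PP by metis
  qed
  assume PP: "P a = P b"
  obtain a' b' where ab: "P a = P (Suc a')" "A a = A (Suc a')" "P b = P (Suc b')" "A b = A (Suc b')"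
    using P_shift by metis
  have AA: "A a = A b" using *[of a' b'] PP ab by metis
  then have "{P a, P (Suc a)} = {P b, P (Suc b)}" using ends by metis
  then show ?thesis using AA PP ty1[of a] by (metis doubleton_eq_iff)
qed

lemma deterministic_add: "P a = P b \<Longrightarrow> P (a + j) = P (b + j)"
  by (induction j) (auto dest: deterministic)

text \<open>Every vertex determines the next step, so the walk is periodic from time 0 on with its
  first return time l, and before that time no vertex repeats.\<close>

theorem cycle_structure:
  obtains l where "l > 0" "l dvd n" "\<And>a b. P a = P b \<longleftrightarrow> a mod l = b mod l"
    "\<And>a b. a mod l = b mod l \<Longrightarrow> A a = A b" "l = card (range P)"
proof -
  define l where "l = (LEAST l. l > 0 \<and> P l = P 0)"
  have "\<exists>l. l > 0 \<and> P l = P 0" using n P_per[of 0] by (intro exI[of _ n]) simp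
  then have l: "l > 0" "P l = P 0" unfolding l_def by (metis (mono_tags, lifting) LeastI_ex)+
  have lmin: "m = 0" if "P m = P 0" "m < l" for m
    using that not_less_Least[of m "\<lambda>l. l > 0 \<and> P l = P 0"] unfolding l_def by auto
  have per: "P (a + c * l) = P a" for a c
  proof (induction c)
    case (Suc c)
    have "P (l + (a + c * l)) = P (0 + (a + c * l))" by (rule deterministic_add) (rule l(2))
    then show ?case using Suc by (simp add: algebra_simps)
  qed simp
  have mod: "P a = P (a mod l)" for a
    using per[of "a mod l" "a div l"] by simp
  have inj: "a = b" if "a \<le> b" "b < l" "P a = P b" for a b
  proof -
    have "P (a + (l - b)) = P (b + (l - b))" by (rule deterministic_add) fact
    then have "P (a + (l - b)) = P 0" using that l by simp
    then have "\<not> a + (l - b) < l" using lmin[of "a + (l - b)"] that by auto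
    then show ?thesis using that by simp
  qed
  have iff: "P a = P b \<longleftrightarrow> a mod l = b mod l" for a b
  proof
    assume "P a = P b"
    then have "P (a mod l) = P (b mod l)" using mod by metis
    then show "a mod l = b mod l"
      using inj[of "a mod l" "b mod l"] inj[of "b mod l" "a mod l"] l(1)
      by (metis mod_less_divisor nat_le_linear)
  qed (metis mod)
  show ?thesis
  proof (rule that[OF l(1) _ iff])
    have "P n = P 0" using P_per[of 0] by simp
    then show "l dvd n" by (simp add: iff dvd_eq_mod_eq_0)
    show "A a = A b" if "a mod l = b mod l" for a b using that deterministic iff by blast
    have "range P = P ` {..<l}"
    proof -
      have "P a \<in> P ` {..<l}" for a using mod[of a] l(1) by (intro image_eqI[of _ _ "a mod l"]) auto
      then show ?thesis by auto
    qed
    moreover have "inj_on P {..<l}" by (auto simp: inj_on_def iff)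
    ultimately show "l = card (range P)" by (simp add: card_image)
  qed
qed

end

end

section \<open>Walks in the random lift\<close>

primrec relabel :: "('l \<Rightarrow> nat \<Rightarrow> nat) \<Rightarrow> (nat \<Rightarrow> 'l) \<Rightarrow> nat \<Rightarrow> nat \<Rightarrow> nat" where
  "relabel pm lb 0 i = i"
| "relabel pm lb (Suc n) i = pm (lb n) (relabel pm lb n i)"

lemma relabel_cong: "(\<And>t. t < n \<Longrightarrow> lb t = lb' t) \<Longrightarrow> relabel pm lb n i = relabel pm lb' n i"
  by (induction n) auto

text \<open>A step against the orientation of its base edge is recorded as the constraint of the
  reversed step, because a sample stores one permutation for each edge.\<close>

definition arc :: "nat list \<Rightarrow> (nat \<Rightarrow> nat) \<Rightarrow> (nat \<Rightarrow> 'l) \<Rightarrow> nat \<Rightarrow> 'l constraint" where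
  "arc us x lb t = (if us ! t < us ! Suc t then ((us ! t, us ! Suc t), x t, x (Suc t), lb t)
     else ((us ! Suc t, us ! t), x (Suc t), x t, lb t))"

context label_model
begin

definition step :: "'l sample \<Rightarrow> nat \<Rightarrow> nat \<Rightarrow> nat \<Rightarrow> nat" where
  "step \<omega> u v x = (if u < v then fst (\<omega> (u, v)) x else inv_into UNIV (fst (\<omega> (v, u))) x)"

text \<open>A label belongs to the undirected arc and is stored at its end over the smaller base
  vertex. One label serves both directions because \<open>pm l\<close> is an involution.\<close>

definition label :: "'l sample \<Rightarrow> nat \<Rightarrow> nat \<Rightarrow> nat \<Rightarrow> 'l" where
  "label \<omega> u v x = (if u < v then snd (\<omega> (u, v)) x else snd (\<omega> (v, u)) (step \<omega> u v x))"

definition lift :: "'l sample \<Rightarrow> nat \<Rightarrow> nat \<Rightarrow> nat \<times> nat \<Rightarrow> nat \<times> nat" where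
  "lift \<omega> u v y = (step \<omega> u v (fst y), pm (label \<omega> u v (fst y)) (snd y))"

definition fiber :: "nat \<Rightarrow> (nat \<times> nat) set" where
  "fiber N = {..<N} \<times> {..<k}"

lemma sample_edge:
  assumes "\<omega> \<in> samples N" "u < v" "v \<le> d"
  shows "fst (\<omega> (u, v)) permutes {..<N}" "x < N \<Longrightarrow> snd (\<omega> (u, v)) x \<in> \<Lambda>"
proof -
  have "\<omega> (u, v) \<in> edge_samples N"
    using assms by (auto simp: samples_def edges_def)
  then show "fst (\<omega> (u, v)) permutes {..<N}" "x < N \<Longrightarrow> snd (\<omega> (u, v)) x \<in> \<Lambda>"
    by (auto simp: edge_samples_def mem_Times_iff)
qed

lemma step_less:
  assumes "\<omega> \<in> samples N" "u \<le> d" "v \<le> d" "u \<noteq> v" "x < N"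
  shows "step \<omega> u v x < N"
proof (cases "u < v")
  case True
  then show ?thesis using sample_edge(1)[OF assms(1) True assms(3)] assms(5)
      permutes_in_image[of "fst (\<omega> (u, v))" "{..<N}" x] by (simp add: step_def)
next
  case False
  then have "v < u" using assms by simp
  then have "inv_into UNIV (fst (\<omega> (v, u))) permutes {..<N}"
    using sample_edge(1)[OF assms(1)] assms(2) permutes_inv by blast
  then show ?thesis using False assms(5) permutes_in_image[of _ "{..<N}" x] by (simp add: step_def)
qed

lemma step_step:
  assumes "\<omega> \<in> samples N" "u \<le> d" "v \<le> d" "u \<noteq> v"
  shows "step \<omega> v u (step \<omega> u v x) = x"
proof (cases "u < v")
  case True
  then show ?thesis using permutes_inverses[OF sample_edge(1)[OF assms(1) True assms(3)]]
    by (simp add: step_def)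
next
  case False
  then have "v < u" using assms by simp
  then show ?thesis using permutes_inverses[OF sample_edge(1)[OF assms(1) _ assms(2)]]
    by (simp add: step_def)
qed

lemma label_step:
  assumes "\<omega> \<in> samples N" "u \<le> d" "v \<le> d" "u \<noteq> v"
  shows "label \<omega> v u (step \<omega> u v x) = label \<omega> u v x"
  using assms(4) step_step[OF assms] by (auto simp: label_def)

lemma label_in:
  assumes "\<omega> \<in> samples N" "u \<le> d" "v \<le> d" "u \<noteq> v" "x < N"
  shows "label \<omega> u v x \<in> \<Lambda>"
proof (cases "u < v")
  case True
  then show ?thesis using sample_edge(2)[OF assms(1) True assms(3) assms(5)] by (simp add: label_def)
next
  case False
  then have "v < u" using assms by simp
  then show ?thesis using sample_edge(2)[OF assms(1) _ assms(2) step_less[OF assms]] False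
    by (simp add: label_def)
qed

lemma complete_lift_lift:
  assumes "\<omega> \<in> samples N"
  shows "complete_lift d (fiber N) (lift \<omega>)"
proof
  fix u v y assume h: "u \<le> d" "v \<le> d" "u \<noteq> v" "y \<in> fiber N"
  have y: "fst y < N" "snd y < k" using h(4) by (auto simp: fiber_def)
  show "lift \<omega> u v y \<in> fiber N"
    using step_less[OF assms h(1-3) y(1)] pm_in[OF label_in[OF assms h(1-3) y(1)] y(2)]
    by (simp add: fiber_def lift_def)
  show "lift \<omega> v u (lift \<omega> u v y) = y"
    using step_step[OF assms h(1-3)] label_step[OF assms h(1-3)] pm_inv[OF label_in[OF assms h(1-3) y(1)] y(2)]
    by (simp add: lift_def)
qed (simp_all add: d fiber_def)

lemma holds_arc:
  assumes "\<omega> \<in> samples N" "us ! t \<le> d" "us ! Suc t \<le> d" "us ! t \<noteq> us ! Suc t"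
  shows "holds \<omega> (arc us x lb t) \<longleftrightarrow> x (Suc t) = step \<omega> (us ! t) (us ! Suc t) (x t)
     \<and> lb t = label \<omega> (us ! t) (us ! Suc t) (x t)"
proof (cases "us ! t < us ! Suc t")
  case True
  then show ?thesis by (auto simp: holds_def arc_def step_def label_def)
next
  case False
  define u v where "u = us ! t" and "v = us ! Suc t"
  have uv: "v < u" "u \<le> d" "\<not> u < v" using False assms by (auto simp: u_def v_def)
  note p = sample_edge(1)[OF assms(1) uv(1,2)]
  have inv: "fst (\<omega> (v, u)) (x (Suc t)) = x t \<longleftrightarrow> x (Suc t) = step \<omega> u v (x t)"
  proof
    assume "fst (\<omega> (v, u)) (x (Suc t)) = x t"
    then show "x (Suc t) = step \<omega> u v (x t)"
      using permutes_inverses(2)[OF p, of "x (Suc t)"] uv by (simp add: step_def)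
  next
    assume "x (Suc t) = step \<omega> u v (x t)"
    then show "fst (\<omega> (v, u)) (x (Suc t)) = x t"
      using permutes_inverses(1)[OF p, of "x t"] uv by (simp add: step_def)
  qed
  have "holds \<omega> (arc us x lb t) \<longleftrightarrow> fst (\<omega> (v, u)) (x (Suc t)) = x t \<and> snd (\<omega> (v, u)) (x (Suc t)) = lb t"
    using uv by (simp add: holds_def arc_def u_def[symmetric] v_def[symmetric])
  also have "\<dots> \<longleftrightarrow> x (Suc t) = step \<omega> u v (x t) \<and> lb t = label \<omega> u v (x t)"
    unfolding inv using uv by (auto simp: label_def)
  finally show ?thesis by (simp add: u_def v_def)
qed

primrec position :: "'l sample \<Rightarrow> nat list \<Rightarrow> nat \<Rightarrow> nat \<Rightarrow> nat" where
  "position \<omega> us x 0 = x"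
| "position \<omega> us x (Suc t) = step \<omega> (us ! t) (us ! Suc t) (position \<omega> us x t)"

definition labels :: "'l sample \<Rightarrow> nat list \<Rightarrow> nat \<Rightarrow> nat \<Rightarrow> 'l" where
  "labels \<omega> us x t = label \<omega> (us ! t) (us ! Suc t) (position \<omega> us x t)"

lemma transport_position:
  assumes "t < length us" "\<omega> \<in> samples N"
  shows "transport (lift \<omega>) (take (Suc t) us) (x, i) = (position \<omega> us x t, relabel pm (labels \<omega> us x) t i)"
proof -
  interpret L: complete_lift d "fiber N" "lift \<omega>" by (rule complete_lift_lift) fact
  show ?thesis using assms(1)
  proof (induction t)
    case 0
    then show ?case by (cases us) auto
  next
    case (Suc t)
    have "take (Suc (Suc t)) us = take (Suc t) us @ [us ! Suc t]"
      using Suc.prems by (rule take_Suc_conv_app_nth)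
    moreover have "take (Suc t) us \<noteq> []" "last (take (Suc t) us) = us ! t"
      using Suc.prems by (auto simp: take_Suc_conv_app_nth[of t us])
    ultimately have "transport (lift \<omega>) (take (Suc (Suc t)) us) (x, i) =
        lift \<omega> (us ! t) (us ! Suc t) (transport (lift \<omega>) (take (Suc t) us) (x, i))"
      by (simp add: L.transport_snoc)
    also have "\<dots> = (position \<omega> us x (Suc t), relabel pm (labels \<omega> us x) (Suc t) i)"
      unfolding Suc.IH[OF Suc_lessD[OF Suc.prems]] by (simp add: lift_def labels_def)
    finally show ?case .
  qed
qed

lemma nbword_nth:
  assumes "us \<in> nbwords d n"
  shows "t \<le> n \<Longrightarrow> us ! t \<le> d" "t < n \<Longrightarrow> us ! t \<noteq> us ! Suc t" "Suc t < n \<Longrightarrow> us ! t \<noteq> us ! Suc (Suc t)"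
proof -
  show "us ! t \<le> d" if "t \<le> n"
  proof -
    have "us ! t \<in> set us" using assms that by (intro nth_mem) (simp add: nbwords_def)
    then show ?thesis using assms by (auto simp: nbwords_def)
  qed
qed (use assms in \<open>auto simp: nbwords_def nonbacktracking_def\<close>)

lemma position_less:
  assumes "\<omega> \<in> samples N" "us \<in> nbwords d n" "x < N" "t \<le> n"
  shows "position \<omega> us x t < N"
  using assms(4)
proof (induction t)
  case (Suc t)
  then show ?case using step_less[OF assms(1)] nbword_nth[OF assms(2)] by simp
qed (use assms in simp)

text \<open>Each starting point a determines its positions and labels, so exactly one pair (x, lb)
  starting at a satisfies all constraints. The indicator thus turns the sum over starting points
  into one over trajectories that do not depend on the sample, and \<open>expect_holds\<close>
  becomes applicable.\<close>

lemma trajectory_sum: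
  fixes g :: "nat \<Rightarrow> nat \<Rightarrow> nat \<times> nat \<Rightarrow> real"
  assumes \<omega>: "\<omega> \<in> samples N" and us: "us \<in> nbwords d n"
  shows "(\<Sum>a<N. \<Sum>i<k. g a i (transport (lift \<omega>) us (a, i))) =
    (\<Sum>x\<in>{..n} \<rightarrow>\<^sub>E {..<N}. \<Sum>lb\<in>{..<n} \<rightarrow>\<^sub>E \<Lambda>.
       of_bool (\<forall>c\<in>arc us x lb ` {..<n}. holds \<omega> c) * (\<Sum>i<k. g (x 0) i (x n, relabel pm lb n i)))"
proof -
  define X where "X = {..n} \<rightarrow>\<^sub>E {..<N}"
  define Y where "Y = {..<n} \<rightarrow>\<^sub>E \<Lambda>"
  have fin: "finite X" "finite Y" using fin\<Lambda> by (auto simp: X_def Y_def intro!: finite_PiE)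
  define H where "H = {z \<in> X \<times> Y. \<forall>c\<in>arc us (fst z) (snd z) ` {..<n}. holds \<omega> c}"
  define G where "G z = (\<Sum>i<k. g (fst z 0) i (fst z n, relabel pm (snd z) n i))" for z :: "(nat \<Rightarrow> nat) \<times> (nat \<Rightarrow> 'l)"
  have Hiff: "(\<forall>c\<in>arc us x lb ` {..<n}. holds \<omega> c) \<longleftrightarrow>
      (\<forall>t<n. x (Suc t) = step \<omega> (us ! t) (us ! Suc t) (x t) \<and> lb t = label \<omega> (us ! t) (us ! Suc t) (x t))" for x lb
  proof -
    have "holds \<omega> (arc us x lb t) \<longleftrightarrow>
        x (Suc t) = step \<omega> (us ! t) (us ! Suc t) (x t) \<and> lb t = label \<omega> (us ! t) (us ! Suc t) (x t)" if "t < n" for t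
      using that nbword_nth[OF us] by (intro holds_arc[OF \<omega>]) auto
    then show ?thesis unfolding ball_simps by auto
  qed
  have len: "length us = Suc n" using us by (simp add: nbwords_def)
  have "(\<Sum>x\<in>X. \<Sum>lb\<in>Y. of_bool (\<forall>c\<in>arc us x lb ` {..<n}. holds \<omega> c) * (\<Sum>i<k. g (x 0) i (x n, relabel pm lb n i)))
     = (\<Sum>z\<in>X \<times> Y. if \<forall>c\<in>arc us (fst z) (snd z) ` {..<n}. holds \<omega> c then G z else 0)"
    unfolding sum.cartesian_product by (intro sum.cong refl) (auto simp: G_def)
  also have "\<dots> = (\<Sum>z\<in>H. G z)"
    unfolding H_def using fin by (intro sum.inter_filter[symmetric]) auto
  also have "\<dots> = (\<Sum>a<N. \<Sum>i<k. g a i (transport (lift \<omega>) us (a, i)))"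
  proof (rule sum.reindex_bij_witness[of _ "\<lambda>a. (restrict (position \<omega> us a) {..n}, restrict (labels \<omega> us a) {..<n})" "\<lambda>z. fst z 0"])
    fix z assume z: "z \<in> H"
    obtain x lb where xl: "z = (x, lb)" by (cases z)
    have xX: "x \<in> X" "lb \<in> Y" using z by (auto simp: H_def xl)
    have st: "x (Suc t) = step \<omega> (us ! t) (us ! Suc t) (x t)" "lb t = label \<omega> (us ! t) (us ! Suc t) (x t)" if "t < n" for t
      using z that unfolding H_def xl Hiff[symmetric] using Hiff by auto
    have pos: "x t = position \<omega> us (x 0) t" if "t \<le> n" for t
      using that by (induction t) (auto simp: st)
    have lab: "lb t = labels \<omega> us (x 0) t" if "t < n" for t
      unfolding labels_def pos[OF less_imp_le[OF that], symmetric] by (rule st(2)[OF that])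
    have x: "x = restrict (position \<omega> us (x 0)) {..n}"
    proof
      fix t show "x t = restrict (position \<omega> us (x 0)) {..n} t"
        by (cases "t \<in> {..n}") (simp_all add: pos[symmetric] PiE_arb[OF xX(1)[unfolded X_def]])
    qed
    have l: "lb = restrict (labels \<omega> us (x 0)) {..<n}"
    proof
      fix t show "lb t = restrict (labels \<omega> us (x 0)) {..<n} t"
        by (cases "t \<in> {..<n}") (simp_all add: lab[symmetric] PiE_arb[OF xX(2)[unfolded Y_def]])
    qed
    show "(restrict (position \<omega> us (fst z 0)) {..n}, restrict (labels \<omega> us (fst z 0)) {..<n}) = z"
      using x[symmetric] l[symmetric] by (simp add: xl)
    show "fst z 0 \<in> {..<N}" using xX by (auto simp: xl X_def)
    have tr: "transport (lift \<omega>) us (x 0, i) = (x n, relabel pm lb n i)" for i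
    proof -
      have "relabel pm lb n i = relabel pm (labels \<omega> us (x 0)) n i" by (rule relabel_cong) (rule lab)
      then show ?thesis
        using transport_position[of n us \<omega> N "x 0" i] len \<omega> pos[OF order_refl, symmetric] by simp
    qed
    show "(\<Sum>i<k. g (fst z 0) i (transport (lift \<omega>) us (fst z 0, i))) = G z"
      by (simp add: G_def xl tr)
  next
    fix a assume a: "a \<in> {..<N}"
    show "fst (restrict (position \<omega> us a) {..n}, restrict (labels \<omega> us a) {..<n}) 0 = a" by simp
    have "restrict (position \<omega> us a) {..n} \<in> X" using position_less[OF \<omega> us] a by (auto simp: X_def)
    moreover have "restrict (labels \<omega> us a) {..<n} \<in> Y"
      using position_less[OF \<omega> us] a label_in[OF \<omega>] nbword_nth[OF us] by (auto simp: Y_def labels_def)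
    ultimately show "(restrict (position \<omega> us a) {..n}, restrict (labels \<omega> us a) {..<n}) \<in> H"
      unfolding H_def by (simp add: Hiff[unfolded ball_simps] labels_def)
  qed
  finally show ?thesis unfolding X_def Y_def ..
qed

end

section \<open>Expected numbers of closed walks\<close>

text \<open>Walks are sorted by their pattern of coincidences: \<open>canon us x t\<close> is the first time at which the walk visits its
  vertex at time \<open>t\<close>.\<close>

definition canon :: "nat list \<Rightarrow> (nat \<Rightarrow> nat) \<Rightarrow> nat \<Rightarrow> nat" where
  "canon us x t = (LEAST s. us ! s = us ! t \<and> x s = x t)"

lemma canon_props: "us ! canon us x t = us ! t" "x (canon us x t) = x t" "canon us x t \<le> t"
proof -
  have "us ! canon us x t = us ! t \<and> x (canon us x t) = x t"
    unfolding canon_def by (rule LeastI[of _ t]) simp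
  then show "us ! canon us x t = us ! t" "x (canon us x t) = x t" by auto
  show "canon us x t \<le> t" unfolding canon_def by (rule Least_le) simp
qed

lemma canon_least: "us ! s = us ! t \<Longrightarrow> x s = x t \<Longrightarrow> canon us x t \<le> s"
  unfolding canon_def by (rule Least_le) simp

lemma canon_eq_iff:
  assumes "us ! s = us ! t"
  shows "canon us x s = canon us x t \<longleftrightarrow> x s = x t"
proof
  assume "canon us x s = canon us x t"
  then show "x s = x t" using canon_props(2)[of x us s] canon_props(2)[of x us t] by simp
next
  assume "x s = x t"
  then show "canon us x s = canon us x t" unfolding canon_def using assms by simp
qed

lemma canon_eqI:
  assumes "us ! s = us ! t" "x s = x t" "\<And>s'. s' < s \<Longrightarrow> us ! s' = us ! t \<Longrightarrow> x s' \<noteq> x t"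
  shows "canon us x t = s"
  unfolding canon_def using assms by (intro Least_equality) (auto simp: not_less[symmetric])

lemma canon_cong:
  assumes "\<And>s. s \<le> t \<Longrightarrow> x s = x' s"
  shows "canon us x t = canon us x' t"
proof (rule canon_eqI)
  have le: "canon us x' t \<le> t" by (rule canon_props)
  show "us ! canon us x' t = us ! t" by (rule canon_props)
  show "x (canon us x' t) = x t" using assms[OF le] assms[of t] canon_props(2)[of x' us t] by simp
  fix s' assume s: "s' < canon us x' t" "us ! s' = us ! t"
  then have "x' s' \<noteq> x' t" using canon_least[of us s' t x'] by auto
  then show "x s' \<noteq> x t" using assms[of s'] assms[of t] s le by simp
qed

lemma canon_canon: "canon us (canon us x) t = canon us x t"
proof (rule canon_eqI)
  show "canon us x (canon us x t) = canon us x t"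
    using canon_eq_iff[of us "canon us x t" t x] canon_props[where us = us and x = x and t = t] by simp
  fix s' assume s: "s' < canon us x t" "us ! s' = us ! t"
  then show "canon us x s' \<noteq> canon us x t"
    using canon_eq_iff[of us s' t x] canon_least[of us s' t x] by auto
qed (rule canon_props)

text \<open>For a canonical \<open>r\<close> these are the times of first visits, so they count
  vertices; \<open>older\<close> below counts the vertices of the same fibre that are already
  taken.\<close>

definition fresh :: "(nat \<Rightarrow> nat) \<Rightarrow> nat \<Rightarrow> nat set" where
  "fresh r m = {t. t < m \<and> r t = t}"

definition older :: "nat list \<Rightarrow> (nat \<Rightarrow> nat) \<Rightarrow> nat \<Rightarrow> nat" where
  "older us r t = card {s. s < t \<and> r s = s \<and> us ! s = us ! t}"

lemma finite_fresh [simp]: "finite (fresh r m)"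
  by (simp add: fresh_def)

lemma older_le: "older us r t \<le> t"
proof -
  have "older us r t \<le> card {..<t}" unfolding older_def by (intro card_mono) auto
  then show ?thesis by simp
qed

text \<open>The values of x are chosen in order of time: a first visit picks a point of the fibre
  that has not been used, and every other value is forced.\<close>

lemma card_pattern:
  assumes "\<And>t. t < m \<Longrightarrow> canon us r t = r t" "m \<le> N"
  shows "real (card {x \<in> {..<m} \<rightarrow>\<^sub>E {..<N}. \<forall>t<m. canon us x t = r t}) =
     (\<Prod>t\<in>fresh r m. real N - real (older us r t))"
  using assms
proof (induction m)
  case 0
  then show ?case by (simp add: fresh_def)
next
  case (Suc m)
  define X where "X = {x \<in> {..<m} \<rightarrow>\<^sub>E {..<N}. \<forall>t<m. canon us x t = r t}"
  define X' where "X' = {x \<in> {..<Suc m} \<rightarrow>\<^sub>E {..<N}. \<forall>t<Suc m. canon us x t = r t}"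
  define Ch where "Ch y = (if r m = m then {..<N} - y ` {s. s < m \<and> us ! s = us ! m} else {y (r m)})" for y
  have finX: "finite X" unfolding X_def by (rule finite_subset[of _ "{..<m} \<rightarrow>\<^sub>E {..<N}"]) (auto intro!: finite_PiE)
  have rm: "r m \<le> m" "us ! r m = us ! m" "r (r m) = r m"
    using canon_props[where us = us and x = r and t = m] Suc.prems(1)[of m] by auto
  have ch: "canon us (y(m := a)) m = r m \<and> a < N \<longleftrightarrow> a \<in> Ch y" if y: "y \<in> X" for y a
  proof (cases "r m = m")
    case True
    have "canon us (y(m := a)) m = m \<longleftrightarrow> a \<notin> y ` {s. s < m \<and> us ! s = us ! m}"
    proof
      assume c: "canon us (y(m := a)) m = m"
      show "a \<notin> y ` {s. s < m \<and> us ! s = us ! m}"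
      proof
        assume "a \<in> y ` {s. s < m \<and> us ! s = us ! m}"
        then obtain s where "s < m" "us ! s = us ! m" "y s = a" by auto
        then show False using canon_least[of us s m "y(m := a)"] c by auto
      qed
    next
      assume "a \<notin> y ` {s. s < m \<and> us ! s = us ! m}"
      then show "canon us (y(m := a)) m = m" by (intro canon_eqI) auto
    qed
    then show ?thesis using True by (auto simp: Ch_def)
  next
    case False
    then have lt: "r m < m" using rm by simp
    have cy: "canon us y (r m) = r m" using y lt rm(3) by (auto simp: X_def)
    have yN: "y (r m) < N" using y lt by (auto simp: X_def)
    have "canon us (y(m := a)) m = r m \<longleftrightarrow> a = y (r m)"
    proof
      assume "canon us (y(m := a)) m = r m"
      then show "a = y (r m)" using canon_props(2)[of "y(m := a)" us m] lt by simp
    next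
      assume a: "a = y (r m)"
      show "canon us (y(m := a)) m = r m"
      proof (rule canon_eqI)
        fix s' assume s: "s' < r m" "us ! s' = us ! m"
        have "y s' \<noteq> y (r m)" using canon_least[of us s' "r m" y] cy s rm(2) by auto
        then show "(y(m := a)) s' \<noteq> (y(m := a)) m" using s lt a by simp
      qed (use rm lt a in auto)
    qed
    then show ?thesis using False yN by (auto simp: Ch_def)
  qed
  have cardCh: "real (card (Ch y)) = (if r m = m then real N - real (older us r m) else 1)" if y: "y \<in> X" for y
  proof (cases "r m = m")
    case True
    define Q where "Q = {s. s < m \<and> r s = s \<and> us ! s = us ! m}"
    have cy: "canon us y s = r s" if "s < m" for s using y that by (auto simp: X_def)
    have img: "y ` {s. s < m \<and> us ! s = us ! m} = y ` Q"
    proof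
      show "y ` {s. s < m \<and> us ! s = us ! m} \<subseteq> y ` Q"
      proof (rule image_subsetI)
        fix s assume s: "s \<in> {s. s < m \<and> us ! s = us ! m}"
        have rs: "r s \<le> s" "us ! r s = us ! s" "r (r s) = r s"
          using canon_props[where us = us and x = r and t = s] Suc.prems(1)[of s] s by auto
        then have "r s \<in> Q" using s by (auto simp: Q_def)
        moreover have "y s = y (r s)" using canon_props(2)[of y us s] cy[of s] s by simp
        ultimately show "y s \<in> y ` Q" by blast
      qed
    qed (auto simp: Q_def)
    have inj: "inj_on y Q"
    proof (rule inj_onI)
      fix s t assume st: "s \<in> Q" "t \<in> Q" "y s = y t"
      then have "canon us y s = canon us y t" by (intro canon_eq_iff[THEN iffD2]) (auto simp: Q_def)
      then show "s = t" using st cy by (auto simp: Q_def)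
    qed
    have sub: "y ` Q \<subseteq> {..<N}" using y by (auto simp: X_def Q_def)
    have "card (Ch y) = N - card (y ` Q)"
      using True sub by (simp add: Ch_def img card_Diff_subset finite_subset[OF sub])
    also have "card (y ` Q) = older us r m" using inj by (simp add: card_image older_def Q_def)
    finally show ?thesis using True older_le[of us r m] Suc.prems(2) by (simp add: of_nat_diff)
  qed (simp add: Ch_def)
  have "card X' = card (SIGMA y:X. Ch y)"
  proof (rule bij_betw_same_card[of "\<lambda>x. (restrict x {..<m}, x m)"], rule bij_betwI[where g = "\<lambda>(y, a). y(m := a)"])
    show "(\<lambda>x. (restrict x {..<m}, x m)) \<in> X' \<rightarrow> (SIGMA y:X. Ch y)"
    proof
      fix x assume x: "x \<in> X'"
      have cr: "canon us (restrict x {..<m}) t = canon us x t" if "t < m" for t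
        using that by (intro canon_cong) auto
      have y: "restrict x {..<m} \<in> X" using x by (auto simp: X_def X'_def cr)
      have up: "canon us ((restrict x {..<m})(m := x m)) m = canon us x m"
        by (intro canon_cong) auto
      have "x m \<in> Ch (restrict x {..<m})"
        using ch[OF y, of "x m"] up x by (auto simp: X'_def)
      then show "(restrict x {..<m}, x m) \<in> (SIGMA y:X. Ch y)" using y by simp
    qed
    show "(\<lambda>(y, a). y(m := a)) \<in> (SIGMA y:X. Ch y) \<rightarrow> X'"
    proof
      fix z assume z: "z \<in> (SIGMA y:X. Ch y)"
      obtain y a where ya: "z = (y, a)" by (cases z)
      have y: "y \<in> X" "a \<in> Ch y" using z ya by auto
      have c1: "canon us (y(m := a)) m = r m" "a < N" using ch[OF y(1), of a] y(2) by auto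
      have c2: "canon us (y(m := a)) t = r t" if "t < m" for t
      proof -
        have "canon us (y(m := a)) t = canon us y t" using that by (intro canon_cong) auto
        then show ?thesis using y(1) that by (simp add: X_def)
      qed
      have "y(m := a) \<in> {..<Suc m} \<rightarrow>\<^sub>E {..<N}"
        using y(1) c1(2) unfolding X_def lessThan_Suc by (auto intro!: PiE_fun_upd)
      then show "(case z of (y, a) \<Rightarrow> y(m := a)) \<in> X'"
        using c1(1) c2 by (auto simp: ya X'_def less_Suc_eq)
    qed
    fix x assume x: "x \<in> X'"
    show "(case (restrict x {..<m}, x m) of (y, a) \<Rightarrow> y(m := a)) = x"
    proof
      fix t
      have "x t = undefined" if "t > m"
        using x that by (intro PiE_arb[of x "{..<Suc m}"]) (auto simp: X'_def)
      then show "(case (restrict x {..<m}, x m) of (y, a) \<Rightarrow> y(m := a)) t = x t" by auto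
    qed
  next
    fix z assume z: "z \<in> (SIGMA y:X. Ch y)"
    obtain y a where ya: "z = (y, a)" by (cases z)
    have "y \<in> {..<m} \<rightarrow>\<^sub>E {..<N}" using z ya by (auto simp: X_def)
    then have "restrict (y(m := a)) {..<m} = y"
      by (intro ext) (auto simp: restrict_def PiE_arb[of y "{..<m}"])
    then show "(\<lambda>x. (restrict x {..<m}, x m)) (case z of (y, a) \<Rightarrow> y(m := a)) = z" by (simp add: ya)
  qed
  also have "real \<dots> = (\<Sum>y\<in>X. real (card (Ch y)))"
    using finX by (simp add: Ch_def card_SigmaI)
  also have "\<dots> = real (card X) * (if r m = m then real N - real (older us r m) else 1)"
    using cardCh by simp
  also have "real (card X) = (\<Prod>t\<in>fresh r m. real N - real (older us r t))"
    unfolding X_def using Suc by simp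
  finally have *: "real (card X') = (\<Prod>t\<in>fresh r m. real N - real (older us r t)) *
      (if r m = m then real N - real (older us r m) else 1)" .
  have "fresh r (Suc m) = (if r m = m then insert m (fresh r m) else fresh r m)" "m \<notin> fresh r m"
    by (auto simp: fresh_def less_Suc_eq)
  then show ?case using * unfolding X'_def by simp
qed

context label_model
begin

text \<open>Only coincidences matter: which constraints over the same edge share a source or a
  target. This allows a trajectory to be replaced by its pattern.\<close>

lemma probability_value_cong:
  assumes e: "\<And>i. i \<in> I \<Longrightarrow> cedge (c i) = cedge (c' i)" and l: "\<And>i. i \<in> I \<Longrightarrow> clab (c i) = clab (c' i)"
    and s: "\<And>i j. i \<in> I \<Longrightarrow> j \<in> I \<Longrightarrow> cedge (c i) = cedge (c j) \<Longrightarrow> csrc (c i) = csrc (c j) \<longleftrightarrow> csrc (c' i) = csrc (c' j)"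
    and t: "\<And>i j. i \<in> I \<Longrightarrow> j \<in> I \<Longrightarrow> cedge (c i) = cedge (c j) \<Longrightarrow> ctgt (c i) = ctgt (c j) \<longleftrightarrow> ctgt (c' i) = ctgt (c' j)"
  shows "probability_value N (c ` I) = probability_value N (c' ` I)" "card (c ` I) = card (c' ` I)"
proof -
  have eq: "c i = c j \<longleftrightarrow> c' i = c' j" if ij: "i \<in> I" "j \<in> I" for i j
  proof -
    have "c i = c j \<longleftrightarrow> cedge (c i) = cedge (c j) \<and> csrc (c i) = csrc (c j) \<and> ctgt (c i) = ctgt (c j) \<and> clab (c i) = clab (c j)"
      by (metis prod_eqI)
    also have "\<dots> \<longleftrightarrow> cedge (c' i) = cedge (c' j) \<and> csrc (c' i) = csrc (c' j) \<and> ctgt (c' i) = ctgt (c' j) \<and> clab (c' i) = clab (c' j)"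
      using e[OF ij(1)] e[OF ij(2)] l[OF ij(1)] l[OF ij(2)] s[OF ij] t[OF ij] by metis
    also have "\<dots> \<longleftrightarrow> c' i = c' j" by (metis prod_eqI)
    finally show ?thesis .
  qed
  define h where "h z = c' (inv_into I c z)" for z
  have h: "h (c i) = c' i" if "i \<in> I" for i
  proof -
    have "inv_into I c (c i) \<in> I" "c (inv_into I c (c i)) = c i"
      using that by (auto intro: inv_into_into f_inv_into_f)
    then show ?thesis unfolding h_def using eq that by metis
  qed
  have inj: "inj_on h (c ` I)" using h eq by (auto simp: inj_on_def)
  have img: "h ` (c ` I) = c' ` I" using h by (auto simp: image_iff)
  show "card (c ` I) = card (c' ` I)" using card_image[OF inj] img by simp
  have cons: "consistent (c ` I) \<longleftrightarrow> consistent (c' ` I)"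
    unfolding consistent_def ball_simps
    using e s t eq by (metis (no_types, lifting))
  have ec: "edge_constraints (c' ` I) a = h ` edge_constraints (c ` I) a" for a
    unfolding edge_constraints_def img[symmetric] 
  proof (rule equalityI; rule subsetI)
    fix z assume "z \<in> {z \<in> h ` c ` I. cedge z = a}"
    then obtain i where i: "i \<in> I" "z = h (c i)" "cedge (h (c i)) = a" by blast
    then have "cedge (c i) = a" using h e by simp
    then show "z \<in> h ` {z \<in> c ` I. cedge z = a}" using i by blast
  next
    fix z assume "z \<in> h ` {z \<in> c ` I. cedge z = a}"
    then obtain i where i: "i \<in> I" "z = h (c i)" "cedge (c i) = a" by blast
    then have "cedge (h (c i)) = a" using h e by simp
    then show "z \<in> {z \<in> h ` c ` I. cedge z = a}" using i by blast
  qed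
  have "card (edge_constraints (c ` I) a) = card (edge_constraints (c' ` I) a)" for a
    unfolding ec by (rule card_image[symmetric], rule inj_on_subset[OF inj]) (auto simp: edge_constraints_def)
  moreover have "(\<Prod>z\<in>c' ` I. w (clab z)) = (\<Prod>z\<in>c ` I. w (clab z))"
    unfolding img[symmetric] using inj
  proof (subst prod.reindex)
    show "prod ((\<lambda>z. w (clab z)) \<circ> h) (c ` I) = (\<Prod>z\<in>c ` I. w (clab z))"
      by (intro prod.cong refl) (auto simp: h l)
  qed auto
  ultimately show "probability_value N (c ` I) = probability_value N (c' ` I)"
    using cons by (simp add: probability_value_def)
qed

lemma arc_simps:
  "clab (arc us x lb t) = lb t"
  "cedge (arc us x lb t) = (min (us ! t) (us ! Suc t), max (us ! t) (us ! Suc t))"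
  by (auto simp: arc_def min_def max_def)

lemma probability_value_canon:
  assumes nb: "us \<in> nbwords d n"
  shows "probability_value N (arc us x lb ` {..<n}) = probability_value N (arc us (canon us x) lb ` {..<n})"
proof (rule probability_value_cong)
  fix i j assume ij: "i \<in> {..<n}" "j \<in> {..<n}" "cedge (arc us x lb i) = cedge (arc us x lb j)"
  have ne: "us ! i \<noteq> us ! Suc i" "us ! j \<noteq> us ! Suc j" using nbword_nth[OF nb] ij by auto
  consider "us ! i < us ! Suc i" "us ! j < us ! Suc j" "us ! i = us ! j" "us ! Suc i = us ! Suc j"
    | "us ! i < us ! Suc i" "us ! Suc j < us ! j" "us ! i = us ! Suc j" "us ! Suc i = us ! j"
    | "us ! Suc i < us ! i" "us ! j < us ! Suc j" "us ! Suc i = us ! j" "us ! i = us ! Suc j"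
    | "us ! Suc i < us ! i" "us ! Suc j < us ! j" "us ! Suc i = us ! Suc j" "us ! i = us ! j"
    using ij(3) ne by (auto simp: arc_simps min_def max_def split: if_splits)
  then have "(csrc (arc us x lb i) = csrc (arc us x lb j) \<longleftrightarrow>
      csrc (arc us (canon us x) lb i) = csrc (arc us (canon us x) lb j)) \<and>
    (ctgt (arc us x lb i) = ctgt (arc us x lb j) \<longleftrightarrow>
      ctgt (arc us (canon us x) lb i) = ctgt (arc us (canon us x) lb j))"
  proof cases
    case 1
    then show ?thesis using canon_eq_iff[OF 1(3), of x] canon_eq_iff[OF 1(4), of x] by (auto simp: arc_def)
  next
    case 2
    then show ?thesis using canon_eq_iff[OF 2(3), of x] canon_eq_iff[OF 2(4), of x] by (auto simp: arc_def)
  next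
    case 3
    then show ?thesis using canon_eq_iff[OF 3(3), of x] canon_eq_iff[OF 3(4), of x] by (auto simp: arc_def)
  next
    case 4
    then show ?thesis using canon_eq_iff[OF 4(3), of x] canon_eq_iff[OF 4(4), of x] by (auto simp: arc_def)
  qed
  then show "csrc (arc us x lb i) = csrc (arc us x lb j) \<longleftrightarrow>
      csrc (arc us (canon us x) lb i) = csrc (arc us (canon us x) lb j)"
    "ctgt (arc us x lb i) = ctgt (arc us x lb j) \<longleftrightarrow>
      ctgt (arc us (canon us x) lb i) = ctgt (arc us (canon us x) lb j)" by blast+
qed (auto simp: arc_simps)

definition label_trace :: "(nat \<Rightarrow> 'l) \<Rightarrow> nat \<Rightarrow> real" where
  "label_trace lb n = (\<Sum>i<k. of_bool (relabel pm lb n i = i))"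

definition patterns :: "nat list \<Rightarrow> nat \<Rightarrow> (nat \<Rightarrow> nat) set" where
  "patterns us n = {r \<in> {..<Suc n} \<rightarrow>\<^sub>E {..<Suc n}. (\<forall>t<Suc n. canon us r t = r t) \<and> r n = r 0}"

lemma finite_patterns [simp]: "finite (patterns us n)"
  unfolding patterns_def by (rule finite_subset[of _ "{..<Suc n} \<rightarrow>\<^sub>E {..<Suc n}"]) (auto intro!: finite_PiE)

definition label_words :: "nat \<Rightarrow> (nat \<Rightarrow> 'l) set" where
  "label_words n = {..<n} \<rightarrow>\<^sub>E \<Lambda>"

lemma finite_label_words [simp]: "finite (label_words n)"
  unfolding label_words_def using fin\<Lambda> by (intro finite_PiE) auto

lemma arc_constraint:
  assumes "us \<in> nbwords d n" "t < n" "x t < N" "x (Suc t) < N" "lb \<in> label_words n"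
  shows "cedge (arc us x lb t) \<in> edges \<and> csrc (arc us x lb t) < N \<and> ctgt (arc us x lb t) < N \<and> clab (arc us x lb t) \<in> \<Lambda>"
  using nbword_nth[OF assms(1), of t] nbword_nth(1)[OF assms(1), of "Suc t"] assms(2-5)
  by (auto simp: arc_def edges_def label_words_def)

text \<open>Trajectories with the same pattern have the same probability. Grouping them leaves a sum
  whose index set does not depend on N, with the number of trajectories of each pattern as a
  factor.\<close>

lemma expect_fixcount:
  assumes us: "us \<in> closed_nbwords d n" and N: "N > n"
  shows "expect N (\<lambda>\<omega>. complete_lift.fixcount (fiber N) (lift \<omega>) us) =
    (\<Sum>lb\<in>label_words n. \<Sum>r\<in>patterns us n. label_trace lb n *
       (probability_value N (arc us r lb ` {..<n}) * (\<Prod>t\<in>fresh r (Suc n). real N - real (older us r t))))"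
proof -
  have nb: "us \<in> nbwords d n" and cl: "last us = hd us" using us by (auto simp: closed_nbwords_def)
  have len: "length us = Suc n" using nb by (simp add: nbwords_def)
  have u0n: "us ! n = us ! 0" using cl len last_conv_nth[of us] hd_conv_nth[of us] by (cases "us = []") auto
  define X where "X = {..<Suc n} \<rightarrow>\<^sub>E {..<N}"
  have X: "{..n} \<rightarrow>\<^sub>E {..<N} = X" by (simp add: X_def lessThan_Suc_atMost)
  have finX: "finite X" unfolding X_def by (intro finite_PiE) auto
  define \<Phi> where "\<Phi> lb x = probability_value N (arc us x lb ` {..<n}) * (of_bool (x n = x 0) * label_trace lb n)" for lb x
  have "expect N (\<lambda>\<omega>. complete_lift.fixcount (fiber N) (lift \<omega>) us) =
      expect N (\<lambda>\<omega>. \<Sum>x\<in>X. \<Sum>lb\<in>label_words n.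
         of_bool (x n = x 0) * label_trace lb n * of_bool (\<forall>c\<in>arc us x lb ` {..<n}. holds \<omega> c))"
  proof (rule expect_cong)
    fix \<omega> assume \<omega>: "\<omega> \<in> samples N"
    interpret L: complete_lift d "fiber N" "lift \<omega>" by (rule complete_lift_lift) fact
    have "L.fixcount us = (\<Sum>y\<in>fiber N. of_bool (transport (lift \<omega>) us y = y))"
      unfolding L.fixcount_def by (subst sum_of_bool_eq) (auto simp: fiber_def Int_def)
    also have "\<dots> = (\<Sum>a<N. \<Sum>i<k. of_bool (transport (lift \<omega>) us (a, i) = (a, i)))"
      unfolding fiber_def by (subst sum.cartesian_product) (simp add: case_prod_unfold)
    also have "\<dots> = (\<Sum>x\<in>X. \<Sum>lb\<in>label_words n. of_bool (\<forall>c\<in>arc us x lb ` {..<n}. holds \<omega> c) *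
        (\<Sum>i<k. of_bool ((x n, relabel pm lb n i) = (x 0, i))))"
      using trajectory_sum[OF \<omega> nb, of "\<lambda>a i z. of_bool (z = (a, i))"] by (simp only: X label_words_def)
    also have "\<dots> = (\<Sum>x\<in>X. \<Sum>lb\<in>label_words n.
         of_bool (x n = x 0) * label_trace lb n * of_bool (\<forall>c\<in>arc us x lb ` {..<n}. holds \<omega> c))"
      by (intro sum.cong refl) (simp add: label_trace_def of_bool_conj)
    finally show "L.fixcount us = \<dots>" .
  qed
  also have "\<dots> = (\<Sum>x\<in>X. \<Sum>lb\<in>label_words n. \<Phi> lb x)"
    unfolding expect_sum expect_scale
  proof (intro sum.cong refl)
    fix x lb assume x: "x \<in> X" and lb: "lb \<in> label_words n"
    have "expect N (\<lambda>\<omega>. of_bool (\<forall>c\<in>arc us x lb ` {..<n}. holds \<omega> c)) = probability_value N (arc us x lb ` {..<n})"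
    proof (rule expect_holds)
      fix c assume "c \<in> arc us x lb ` {..<n}"
      then obtain t where t: "t < n" "c = arc us x lb t" by auto
      have "x t \<in> {..<N}" "x (Suc t) \<in> {..<N}"
        using t(1) by (intro PiE_mem[OF x[unfolded X_def]]; simp)+
      then have xN: "x t < N" "x (Suc t) < N" by simp_all
      show "cedge c \<in> edges \<and> csrc c < N \<and> ctgt c < N \<and> clab c \<in> \<Lambda>"
        unfolding t(2) by (rule arc_constraint[OF nb t(1) xN lb])
    qed simp
    then show "of_bool (x n = x 0) * label_trace lb n * expect N (\<lambda>\<omega>. of_bool (\<forall>c\<in>arc us x lb ` {..<n}. holds \<omega> c)) = \<Phi> lb x"
      by (simp add: \<Phi>_def)
  qed
  also have "\<dots> = (\<Sum>lb\<in>label_words n. \<Sum>x\<in>X. \<Phi> lb x)" by (rule sum.swap)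
  also have "\<dots> = (\<Sum>lb\<in>label_words n. \<Sum>r\<in>patterns us n. label_trace lb n *
       (probability_value N (arc us r lb ` {..<n}) * (\<Prod>t\<in>fresh r (Suc n). real N - real (older us r t))))"
  proof (rule sum.cong[OF refl])
    fix lb assume lb: "lb \<in> label_words n"
    define cr where "cr x = restrict (canon us x) {..<Suc n}" for x
    define R where "R = {r \<in> {..<Suc n} \<rightarrow>\<^sub>E {..<Suc n}. \<forall>t<Suc n. canon us r t = r t}"
    have finR: "finite R" unfolding R_def
      by (rule finite_subset[of _ "{..<Suc n} \<rightarrow>\<^sub>E {..<Suc n}"]) (auto intro!: finite_PiE)
    have crR: "cr x \<in> R" for x
    proof -
      have "canon us (cr x) t = cr x t" if "t < Suc n" for t
      proof -
        have "canon us (cr x) t = canon us (canon us x) t"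
          using that by (intro canon_cong) (auto simp: cr_def)
        then show ?thesis using that by (simp add: canon_canon cr_def)
      qed
      moreover have "canon us x t < Suc n" if "t < Suc n" for t
        using canon_props(3)[of us x t] that by simp
      ultimately show ?thesis by (auto simp: R_def cr_def)
    qed
    have \<Phi>cr: "\<Phi> lb x = \<Phi> lb (cr x)" for x
    proof -
      have "arc us (cr x) lb t = arc us (canon us x) lb t" if "t < n" for t
        using that by (simp add: arc_def cr_def)
      then have "arc us (cr x) lb ` {..<n} = arc us (canon us x) lb ` {..<n}" by (intro image_cong) auto
      moreover have "x n = x 0 \<longleftrightarrow> cr x n = cr x 0" using canon_eq_iff[OF u0n, of x] by (simp add: cr_def)
      ultimately show ?thesis unfolding \<Phi>_def using probability_value_canon[OF nb] by simp
    qed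
    have "(\<Sum>x\<in>X. \<Phi> lb x) = (\<Sum>r\<in>R. \<Sum>x\<in>{x \<in> X. cr x = r}. \<Phi> lb x)"
      by (rule sum.group[OF finX finR, symmetric]) (use crR in auto)
    also have "\<dots> = (\<Sum>r\<in>R. real (card {x \<in> X. cr x = r}) * \<Phi> lb r)"
    proof (intro sum.cong refl)
      fix r
      have "\<Phi> lb x = \<Phi> lb r" if "x \<in> {x \<in> X. cr x = r}" for x
        by (subst \<Phi>cr) (use that in simp)
      then show "(\<Sum>x\<in>{x \<in> X. cr x = r}. \<Phi> lb x) = real (card {x \<in> X. cr x = r}) * \<Phi> lb r"
        by simp
    qed
    also have "\<dots> = (\<Sum>r\<in>R. (\<Prod>t\<in>fresh r (Suc n). real N - real (older us r t)) * \<Phi> lb r)"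
    proof (intro sum.cong refl)
      fix r assume r: "r \<in> R"
      have "{x \<in> X. cr x = r} = {x \<in> {..<Suc n} \<rightarrow>\<^sub>E {..<N}. \<forall>t<Suc n. canon us x t = r t}"
      proof -
        have "cr x = r \<longleftrightarrow> (\<forall>t<Suc n. canon us x t = r t)" for x
        proof
          assume "\<forall>t<Suc n. canon us x t = r t"
          then show "cr x = r" using r unfolding R_def cr_def
            by (intro ext) (auto simp: restrict_def PiE_arb[of r "{..<Suc n}"])
        qed (auto simp: cr_def)
        then show ?thesis by (simp add: X_def)
      qed
      then show "real (card {x \<in> X. cr x = r}) * \<Phi> lb r =
          (\<Prod>t\<in>fresh r (Suc n). real N - real (older us r t)) * \<Phi> lb r"
        using card_pattern[of "Suc n" us r N] r N by (simp add: R_def)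
    qed
    also have "\<dots> = (\<Sum>r\<in>R. if r n = r 0 then label_trace lb n *
       (probability_value N (arc us r lb ` {..<n}) * (\<Prod>t\<in>fresh r (Suc n). real N - real (older us r t))) else 0)"
      by (intro sum.cong refl) (simp add: \<Phi>_def)
    also have "\<dots> = (\<Sum>r\<in>patterns us n. label_trace lb n *
       (probability_value N (arc us r lb ` {..<n}) * (\<Prod>t\<in>fresh r (Suc n). real N - real (older us r t))))"
    proof -
      have "patterns us n = {r \<in> R. r n = r 0}" by (auto simp: patterns_def R_def)
      then show ?thesis using finR by (simp only: sum.inter_filter)
    qed
    finally show "(\<Sum>x\<in>X. \<Phi> lb x) = \<dots>" .
  qed
  finally show ?thesis .
qed

end

section \<open>Expected walk counts as rational functions of N\<close>

lemma (in periodic_walk) common_endpoint: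
  assumes "card (range P) = card (range A)" "a \<in> range A" "b \<in> range A" "a \<noteq> b" "p \<in> ends a" "p \<in> ends b"
  shows "\<exists>t. {a, b} = {A t, A (Suc t)}"
proof -
  have "p \<in> range P" using assms(2,5) by (auto simp: ends)
  then obtain t where p: "p = P (Suc t)" using P_shift by blast
  have "a \<in> incident p" "b \<in> incident p" using assms by (auto simp: incident_def)
  then have "a \<in> {A t, A (Suc t)}" "b \<in> {A t, A (Suc t)}" using incident_eq[OF assms(1), of t] p by auto
  then show ?thesis using assms(4) by blast
qed

lemma sum_PiE_Suc:
  fixes g :: "(nat \<Rightarrow> 'a) \<Rightarrow> real"
  shows "(\<Sum>f\<in>{..<Suc n} \<rightarrow>\<^sub>E B. g f) = (\<Sum>f\<in>{..<n} \<rightarrow>\<^sub>E B. \<Sum>b\<in>B. g (f(n := b)))"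
proof -
  have "(\<Sum>f\<in>{..<n} \<rightarrow>\<^sub>E B. \<Sum>b\<in>B. g (f(n := b))) = (\<Sum>(f, b)\<in>({..<n} \<rightarrow>\<^sub>E B) \<times> B. g (f(n := b)))"
    by (rule sum.cartesian_product)
  also have "\<dots> = (\<Sum>f\<in>{..<Suc n} \<rightarrow>\<^sub>E B. g f)"
  proof (rule sum.reindex_bij_witness[of _ "\<lambda>f. (restrict f {..<n}, f n)" "\<lambda>(f, b). f(n := b)"])
    fix z assume z: "z \<in> ({..<n} \<rightarrow>\<^sub>E B) \<times> B"
    obtain f b where fb: "z = (f, b)" by (cases z)
    have f: "f \<in> {..<n} \<rightarrow>\<^sub>E B" "b \<in> B" using z fb by auto
    have "restrict (f(n := b)) {..<n} = f"
      using f(1) by (intro ext) (auto simp: restrict_def PiE_arb[of f "{..<n}"])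
    then show "(restrict (case z of (f, b) \<Rightarrow> f(n := b)) {..<n}, (case z of (f, b) \<Rightarrow> f(n := b)) n) = z"
      by (simp add: fb)
    show "(case z of (f, b) \<Rightarrow> f(n := b)) \<in> {..<Suc n} \<rightarrow>\<^sub>E B"
      using f by (simp add: fb lessThan_Suc PiE_fun_upd)
    show "g (case z of (f, b) \<Rightarrow> f(n := b)) = (case z of (f, b) \<Rightarrow> g (f(n := b)))" by (simp add: fb)
  next
    fix f assume f: "f \<in> {..<Suc n} \<rightarrow>\<^sub>E B"
    have "(restrict f {..<n})(n := f n) = f"
      using f by (intro ext) (auto simp: restrict_def PiE_arb[of f "{..<Suc n}"])
    then show "(case (restrict f {..<n}, f n) of (f, b) \<Rightarrow> f(n := b)) = f" by simp
    show "(restrict f {..<n}, f n) \<in> ({..<n} \<rightarrow>\<^sub>E B) \<times> B"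
      using f by (auto simp: PiE_iff)
  qed
  finally show ?thesis ..
qed

lemma card_nbwords_le:
  assumes "d \<ge> 3"
  shows "real (card (nbwords d (Suc n))) \<le> (real d + 1) * real d * (real d - 1) ^ n"
proof (induction n)
  case 0
  have "nbwords d (Suc 0) \<subseteq> (\<lambda>(u, v). [u, v]) ` (SIGMA u:{..d}. {..d} - {u})"
    by (auto simp: nbwords_def length_Suc_conv nonbacktracking_def image_iff)
  then have "card (nbwords d (Suc 0)) \<le> card (SIGMA u:{..d}. {..d} - {u})"
    by (meson surj_card_le finite_SigmaI finite_atMost finite_Diff)
  also have "\<dots> = (d + 1) * d" by (simp add: card_SigmaI)
  finally show ?case by (metis mult.right_neutral of_nat_1 of_nat_add of_nat_le_iff of_nat_mult power_0)
next
  case (Suc n)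
  define B where "B us = {..d} - {last us, us ! n}" for us :: "nat list"
  have "nbwords d (Suc (Suc n)) \<subseteq> (\<lambda>(us, v). us @ [v]) ` (SIGMA us:nbwords d (Suc n). B us)"
  proof
    fix ws assume ws: "ws \<in> nbwords d (Suc (Suc n))"
    then have "ws \<noteq> []" by (auto simp: nbwords_def)
    then obtain us v where usv: "ws = us @ [v]" by (metis rev_exhaust)
    have l: "length us = Suc (Suc n)" using ws by (simp add: nbwords_def usv)
    have "us \<in> nbwords d (Suc n)" "v \<in> B us"
      using ws l unfolding usv nbwords_def B_def by (auto simp: nonbacktracking_snoc)
    then show "ws \<in> (\<lambda>(us, v). us @ [v]) ` (SIGMA us:nbwords d (Suc n). B us)"
      unfolding usv by (intro image_eqI[of _ _ "(us, v)"]) auto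
  qed
  then have "card (nbwords d (Suc (Suc n))) \<le> card (SIGMA us:nbwords d (Suc n). B us)"
    by (intro surj_card_le) (auto simp: B_def)
  also have "\<dots> = (\<Sum>us\<in>nbwords d (Suc n). card (B us))"
    by (intro card_SigmaI) (auto simp: B_def)
  also have "\<dots> = (\<Sum>us\<in>nbwords d (Suc n). d - 1)"
  proof (intro sum.cong refl)
    fix us assume us: "us \<in> nbwords d (Suc n)"
    then have l: "length us = Suc (Suc n)" and sub: "set us \<subseteq> {..d}" and nb: "nonbacktracking us"
      by (auto simp: nbwords_def)
    have "last us = us ! Suc n" using l last_conv_nth[of us] by (cases "us = []") auto
    moreover have "us ! n \<in> set us" "us ! Suc n \<in> set us" using l by auto
    moreover have "us ! n \<noteq> us ! Suc n" using nb l by (simp add: nonbacktracking_def)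
    ultimately have "card {last us, us ! n} = 2" "{last us, us ! n} \<subseteq> {..d}" using sub by auto
    then show "card (B us) = d - 1" by (simp add: B_def card_Diff_subset)
  qed
  finally have "card (nbwords d (Suc (Suc n))) \<le> card (nbwords d (Suc n)) * (d - 1)" by simp
  then have "real (card (nbwords d (Suc (Suc n)))) \<le> real (card (nbwords d (Suc n)) * (d - 1))"
    by (rule of_nat_mono)
  also have "\<dots> = real (card (nbwords d (Suc n))) * (real d - 1)" using assms by (simp add: of_nat_diff)
  also have "\<dots> \<le> (real d + 1) * real d * (real d - 1) ^ n * (real d - 1)"
    using Suc assms by (intro mult_right_mono) auto
  finally show ?case by (simp add: mult_ac)
qed

context label_model
begin

text \<open>With \<open>z = 1 / N\<close>, multiplying by this common denominator makes the expectation of every walk count of length at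
  most \<open>q\<close> a polynomial in \<open>z\<close>.\<close>

definition denominator :: "nat \<Rightarrow> real \<Rightarrow> real" where
  "denominator q z = (\<Prod>e\<in>edges. \<Prod>j<q. 1 - real j * z)"

text \<open>Probability and multiplicity of one pattern times the common denominator. Taking a
  factor N out of each vertex choice and of each falling factor leaves z to the power arcs minus
  vertices; the last product is the part of the denominator that does not cancel.\<close>

definition term_poly :: "nat \<Rightarrow> 'l constraint set \<Rightarrow> nat list \<Rightarrow> (nat \<Rightarrow> nat) \<Rightarrow> nat set \<Rightarrow> real poly" where
  "term_poly q S us r F = (if consistent S then
     Polynomial.smult (\<Prod>c\<in>S. w (clab c)) (Polynomial.monom 1 (card S - card F) * (\<Prod>t\<in>F. [:1, - real (older us r t):])
       * (\<Prod>e\<in>edges. \<Prod>j\<in>{card (edge_constraints S e)..<q}. [:1, - real j:])) else 0)"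

lemma falling_scale: "N > 0 \<Longrightarrow> falling N m = real N ^ m * (\<Prod>j<m. 1 - real j / real N)"
proof (induction m)
  case (Suc m)
  then show ?case by (simp add: falling_def field_simps)
qed (simp add: falling_def)

lemma denominator_pos:
  assumes "q < N"
  shows "denominator q (1 / real N) > 0"
  unfolding denominator_def using assms by (intro prod_pos) (auto simp: field_simps)

lemma sum_card_edge_constraints:
  assumes "finite S" "cedge ` S \<subseteq> edges"
  shows "(\<Sum>e\<in>edges. card (edge_constraints S e)) = card S"
proof -
  have "card S = (\<Sum>c\<in>S. 1)" by simp
  also have "\<dots> = (\<Sum>e\<in>edges. \<Sum>c\<in>{c \<in> S. cedge c = e}. 1)"
    by (rule sum.group[symmetric]) (use assms in auto)
  finally show ?thesis by (simp add: edge_constraints_def)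
qed

lemma poly_term_poly:
  assumes S: "finite S" "cedge ` S \<subseteq> edges" "card S \<le> q" and F: "finite F" "card F \<le> card S" and N: "q < N"
  shows "probability_value N S * (\<Prod>t\<in>F. real N - real (older us r t)) * denominator q (1 / real N)
    = poly (term_poly q S us r F) (1 / real N)"
proof (cases "consistent S")
  case True
  define z where "z = 1 / real N"
  have N0: "real N > 0" using N by simp
  define m where "m e = card (edge_constraints S e)" for e
  have mq: "m e \<le> q" for e
    unfolding m_def using S by (intro order_trans[OF card_mono S(3)]) (auto simp: edge_constraints_def)
  define D where "D e = (\<Prod>j<m e. 1 - real j / real N)" for e
  have D0: "D e > 0" for e unfolding D_def using mq[of e] N by (intro prod_pos) (auto simp: field_simps)
  have "(\<Prod>e\<in>edges. falling N (m e)) = (\<Prod>e\<in>edges. real N ^ m e) * (\<Prod>e\<in>edges. D e)"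
    using N0 by (simp add: falling_scale D_def prod.distrib)
  also have "(\<Prod>e\<in>edges. real N ^ m e) = real N ^ card S"
    using sum_card_edge_constraints[OF S(1,2)] by (simp add: m_def flip: power_sum)
  finally have fall: "(\<Prod>e\<in>edges. falling N (m e)) = real N ^ card S * (\<Prod>e\<in>edges. D e)" .
  have fr: "(\<Prod>t\<in>F. real N - real (older us r t)) = real N ^ card F * (\<Prod>t\<in>F. 1 - real (older us r t) * z)"
  proof -
    have "(\<Prod>t\<in>F. real N - real (older us r t)) = (\<Prod>t\<in>F. real N * (1 - real (older us r t) * z))"
      using N0 by (intro prod.cong refl) (simp add: z_def field_simps)
    then show ?thesis by (simp add: prod.distrib)
  qed
  have den: "denominator q z = (\<Prod>e\<in>edges. D e) * (\<Prod>e\<in>edges. \<Prod>j\<in>{m e..<q}. 1 - real j * z)"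
    unfolding denominator_def prod.distrib[symmetric]
  proof (intro prod.cong refl)
    fix e
    have "{..<q} = {..<m e} \<union> {m e..<q}" using mq[of e] by auto
    then have "(\<Prod>j<q. 1 - real j * z) = (\<Prod>j<m e. 1 - real j * z) * (\<Prod>j\<in>{m e..<q}. 1 - real j * z)"
      by (metis (no_types, lifting) finite_lessThan finite_atLeastLessThan ivl_disj_int_one(2) prod.union_disjoint)
    then show "(\<Prod>j<q. 1 - real j * z) = D e * (\<Prod>j\<in>{m e..<q}. 1 - real j * z)"
      by (simp add: D_def z_def)
  qed
  have Dprod: "(\<Prod>e\<in>edges. D e) > 0" using D0 by (intro prod_pos) auto
  have pw: "real N ^ card F / real N ^ card S = z ^ (card S - card F)"
    using F(2) N0 by (simp add: z_def power_diff power_divide)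
  define W where "W = (\<Prod>c\<in>S. w (clab c))"
  have "probability_value N S = W / (real N ^ card S * (\<Prod>e\<in>edges. D e))"
    using True fall by (simp add: probability_value_def W_def m_def)
  then have "probability_value N S * (\<Prod>t\<in>F. real N - real (older us r t)) * denominator q z =
     W * (real N ^ card F / real N ^ card S) * (\<Prod>t\<in>F. 1 - real (older us r t) * z)
       * (\<Prod>e\<in>edges. \<Prod>j\<in>{m e..<q}. 1 - real j * z)"
    unfolding fr den using Dprod N0 by (simp add: less_imp_neq[THEN not_sym] del: prod_zero_iff)
  also have "\<dots> = poly (term_poly q S us r F) z"
    using True unfolding pw
    by (simp add: term_poly_def W_def m_def poly_monom poly_prod algebra_simps)
  finally show ?thesis by (simp add: z_def)
qed (simp add: probability_value_def term_poly_def)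

lemma degree_term_poly:
  assumes S: "finite S" "card S \<le> q" and F: "finite F" "card F \<le> card S"
  shows "degree (term_poly q S us r F) \<le> (card edges + 1) * q"
proof (cases "consistent S")
  case True
  have lin: "degree [:1, - real a:] \<le> 1" for a by simp
  have p1: "degree (\<Prod>t\<in>F. [:1, - real (older us r t):]) \<le> card F"
  proof -
    have "degree (\<Prod>t\<in>F. [:1, - real (older us r t):]) \<le> (\<Sum>t\<in>F. degree [:1, - real (older us r t):])"
      using degree_prod_sum_le[OF F(1), of "\<lambda>t. [:1, - real (older us r t):]"] by (simp add: o_def)
    also have "\<dots> \<le> (\<Sum>t\<in>F. 1)" by (intro sum_mono lin)
    finally show ?thesis by simp
  qed
  have p2: "degree (\<Prod>j\<in>{a..<q}. [:1, - real j:]) \<le> q" for a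
  proof -
    have "degree (\<Prod>j\<in>{a..<q}. [:1, - real j:]) \<le> (\<Sum>j\<in>{a..<q}. degree [:1, - real j:])"
      using degree_prod_sum_le[of "{a..<q}" "\<lambda>j. [:1, - real j:]"] by (simp add: o_def)
    also have "\<dots> \<le> (\<Sum>j\<in>{a..<q}. 1)" by (intro sum_mono lin)
    finally show ?thesis by simp
  qed
  have p3: "degree (\<Prod>e\<in>edges. \<Prod>j\<in>{card (edge_constraints S e)..<q}. [:1, - real j:]) \<le> card edges * q"
  proof -
    have "degree (\<Prod>e\<in>edges. \<Prod>j\<in>{card (edge_constraints S e)..<q}. [:1, - real j:])
      \<le> (\<Sum>e\<in>edges. degree (\<Prod>j\<in>{card (edge_constraints S e)..<q}. [:1, - real j:]))"
      using degree_prod_sum_le[OF finite_edges, of "\<lambda>e. \<Prod>j\<in>{card (edge_constraints S e)..<q}. [:1, - real j:]"]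
      by (simp add: o_def)
    also have "\<dots> \<le> (\<Sum>e\<in>edges. q)" by (intro sum_mono p2)
    finally show ?thesis by simp
  qed
  have "degree (term_poly q S us r F) \<le> degree (Polynomial.monom (1::real) (card S - card F)
      * (\<Prod>t\<in>F. [:1, - real (older us r t):]) * (\<Prod>e\<in>edges. \<Prod>j\<in>{card (edge_constraints S e)..<q}. [:1, - real j:]))"
    using True by (simp only: term_poly_def if_True) (rule degree_smult_le)
  also have "\<dots> \<le> (card S - card F) + card F + card edges * q"
    by (intro order_trans[OF degree_mult_le] add_mono p1 p3) (simp add: degree_monom_le)
  also have "\<dots> \<le> (card edges + 1) * q" using S F by simp
  finally show ?thesis .
qed (simp add: term_poly_def)

lemma poly_term_poly_0:
  assumes "card F \<le> card S"
  shows "poly (term_poly q S us r F) 0 = (if consistent S \<and> card F = card S then \<Prod>c\<in>S. w (clab c) else 0)"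
  using assms by (auto simp: term_poly_def poly_monom poly_prod)

definition arc_ends :: "'l constraint \<Rightarrow> (nat \<times> nat) set" where
  "arc_ends c = {(fst (cedge c), csrc c), (snd (cedge c), ctgt c)}"

lemma arc_ends_arc: "arc_ends (arc us r lb t) = {(us ! t, r t), (us ! Suc t, r (Suc t))}"
  by (auto simp: arc_ends_def arc_def)

definition walk_vertex :: "nat list \<Rightarrow> (nat \<Rightarrow> nat) \<Rightarrow> nat \<Rightarrow> nat \<Rightarrow> nat \<times> nat" where
  "walk_vertex us r n t = (us ! (t mod n), r (t mod n))"

definition walk_arc :: "nat list \<Rightarrow> (nat \<Rightarrow> nat) \<Rightarrow> (nat \<Rightarrow> 'l) \<Rightarrow> nat \<Rightarrow> nat \<Rightarrow> 'l constraint" where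
  "walk_arc us r lb n t = arc us r lb (t mod n)"

context
  fixes us :: "nat list" and n :: nat and r :: "nat \<Rightarrow> nat"
  assumes us: "us \<in> cyclic_nbwords d n" and n: "n \<ge> 1" and r: "r \<in> patterns us n"
begin

lemma word: "us \<in> nbwords d n" "us ! n = us ! 0" "us ! 1 \<noteq> us ! (n - 1)" "length us = Suc n"
proof -
  show nb: "us \<in> nbwords d n" using us by (auto simp: cyclic_nbwords_def closed_nbwords_def)
  show len: "length us = Suc n" using nb by (simp add: nbwords_def)
  have "last us = hd us" using us by (auto simp: cyclic_nbwords_def closed_nbwords_def)
  then show "us ! n = us ! 0"
    using len last_conv_nth[of us] hd_conv_nth[of us] by (cases "us = []") auto
  show "us ! 1 \<noteq> us ! (n - 1)" using us by (auto simp: cyclic_nbwords_def)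
qed

lemma pattern_props:
  assumes "t \<le> n"
  shows "r t \<le> t" "us ! r t = us ! t" "r (r t) = r t"
  using canon_props[where us = us and x = r and t = t] r assms by (auto simp: patterns_def)

lemma pattern_0n: "r n = r 0" "r 0 = 0"
  using r pattern_props(1)[of 0] by (auto simp: patterns_def)

lemma shift_mod: "us ! (Suc t mod n) = us ! Suc (t mod n)" "r (Suc t mod n) = r (Suc (t mod n))"
  using word(2) pattern_0n(1) by (auto simp: mod_Suc)

lemma periodic: "periodic_walk (walk_vertex us r n) (walk_arc us r lb n) arc_ends fst n"
proof
  show "0 < n" using n by simp
  fix t
  show "walk_vertex us r n (t + n) = walk_vertex us r n t" by (simp add: walk_vertex_def)
  show "walk_arc us r lb n (t + n) = walk_arc us r lb n t" by (simp add: walk_arc_def)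
  have a: "t mod n < n" using n by simp
  show "arc_ends (walk_arc us r lb n t) = {walk_vertex us r n t, walk_vertex us r n (Suc t)}"
    by (simp add: walk_arc_def walk_vertex_def arc_ends_arc shift_mod)
  show "fst (walk_vertex us r n t) \<noteq> fst (walk_vertex us r n (Suc t))"
    using nbword_nth(2)[OF word(1) a] by (simp add: walk_vertex_def shift_mod)
  show "fst (walk_vertex us r n t) \<noteq> fst (walk_vertex us r n (Suc (Suc t)))"
  proof (cases "Suc (t mod n) < n")
    case True
    then have "Suc t mod n = Suc (t mod n)" by (simp add: mod_Suc)
    then show ?thesis using nbword_nth(3)[OF word(1) True] by (simp add: walk_vertex_def shift_mod)
  next
    \<comment> \<open>At the wrap-around the two neighbours of the base point are compared, which is
      the condition that defines \<open>cyclic_nbwords\<close>.\<close>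
    case False
    then have "t mod n = n - 1" using a by simp
    moreover from this have "Suc t mod n = 0" using n by (simp add: mod_Suc)
    ultimately show ?thesis using word(3) by (simp add: walk_vertex_def shift_mod)
  qed
qed

lemma range_walk_arc: "range (walk_arc us r lb n) = arc us r lb ` {..<n}"
proof -
  interpret W: periodic_walk "walk_vertex us r n" "walk_arc us r lb n" arc_ends fst n by (rule periodic)
  show ?thesis unfolding W.range_A by (intro image_cong) (auto simp: walk_arc_def)
qed

lemma fresh_eq: "fresh r (Suc n) = fresh r n"
  using pattern_0n n by (auto simp: fresh_def less_Suc_eq)

lemma card_range_walk_vertex: "card (range (walk_vertex us r n)) = card (fresh r (Suc n))"
proof -
  interpret W: periodic_walk "walk_vertex us r n" "walk_arc us r lb n" arc_ends fst n for lb :: "nat \<Rightarrow> 'l" by (rule periodic)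
  have "range (walk_vertex us r n) = (\<lambda>t. (us ! t, r t)) ` {..<n}"
    unfolding W.range_P by (intro image_cong) (auto simp: walk_vertex_def)
  also have "\<dots> = (\<lambda>t. (us ! t, t)) ` fresh r n"
  proof (intro equalityI subsetI)
    fix z assume "z \<in> (\<lambda>t. (us ! t, r t)) ` {..<n}"
    then obtain t where t: "t < n" "z = (us ! t, r t)" by auto
    then show "z \<in> (\<lambda>t. (us ! t, t)) ` fresh r n"
      using pattern_props[of t] by (intro image_eqI[of _ _ "r t"]) (auto simp: fresh_def)
  next
    fix z assume "z \<in> (\<lambda>t. (us ! t, t)) ` fresh r n"
    then obtain t where "t \<in> fresh r n" "z = (us ! t, t)" by auto
    then show "z \<in> (\<lambda>t. (us ! t, r t)) ` {..<n}"
      by (intro image_eqI[of _ _ t]) (auto simp: fresh_def)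
  qed
  finally show ?thesis unfolding fresh_eq by (simp add: card_image inj_on_def)
qed

lemma card_fresh_le: "card (fresh r (Suc n)) \<le> card (arc us r lb ` {..<n})" for lb :: "nat \<Rightarrow> 'l"
proof -
  interpret W: periodic_walk "walk_vertex us r n" "walk_arc us r lb n" arc_ends fst n by (rule periodic)
  show ?thesis using W.card_vertices_le_arcs by (simp add: range_walk_arc card_range_walk_vertex)
qed

text \<open>On a cycle two arcs with a common end are successive, and successive arcs lie over
  different base edges because the word does not backtrack; so constraints over one edge cannot
  compete.\<close>

lemma unicyclic_consistent:
  fixes lb :: "nat \<Rightarrow> 'l"
  assumes uni: "card (fresh r (Suc n)) = card (arc us r lb ` {..<n})"
  shows "consistent (arc us r lb ` {..<n})"
proof -
  interpret W: periodic_walk "walk_vertex us r n" "walk_arc us r lb n" arc_ends fst n by (rule periodic)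
  have uni': "card (range (walk_vertex us r n)) = card (range (walk_arc us r lb n))"
    using uni by (simp add: range_walk_arc card_range_walk_vertex)
  show ?thesis unfolding consistent_def range_walk_arc[symmetric]
  proof (intro ballI impI)
    fix c c' assume c: "c \<in> range (walk_arc us r lb n)" "c' \<in> range (walk_arc us r lb n)"
      and e: "cedge c = cedge c'" and st: "csrc c = csrc c' \<or> ctgt c = ctgt c'"
    show "c = c'"
    proof (rule ccontr)
      assume ne: "c \<noteq> c'"
      obtain p where "p \<in> arc_ends c" "p \<in> arc_ends c'"
        using e st by (auto simp: arc_ends_def)
      then obtain t where t: "{c, c'} = {walk_arc us r lb n t, walk_arc us r lb n (Suc t)}"
        using W.common_endpoint[OF uni' c ne] by blast
      then have "cedge (walk_arc us r lb n t) = cedge (walk_arc us r lb n (Suc t))"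
        using e by (metis doubleton_eq_iff)
      then have *: "{us ! (t mod n), us ! Suc (t mod n)} = {us ! (Suc t mod n), us ! Suc (Suc t mod n)}"
        unfolding walk_arc_def arc_simps by (auto simp: min_def max_def split: if_splits)
      have "us ! (t mod n) \<noteq> us ! (Suc t mod n)" "us ! (t mod n) \<noteq> us ! Suc (Suc t mod n)"
        using W.ty1[of t] W.ty2[of t] by (simp_all add: walk_vertex_def shift_mod)
      then show False using * by blast
    qed
  qed
qed

text \<open>Letters, pattern and labels repeat with the length l of the cycle; each arc occurs once
  in the set of constraints, so the weight counts the labels of a single period.\<close>

lemma unicyclic_structure:
  fixes lb :: "nat \<Rightarrow> 'l"
  assumes uni: "card (fresh r (Suc n)) = card (arc us r lb ` {..<n})"
  obtains l where "l > 0" "l dvd n" "\<And>t. t \<le> n \<Longrightarrow> r t = t mod l" "\<And>t. t \<le> n \<Longrightarrow> us ! t = us ! (t mod l)"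
    "\<And>t. t < n \<Longrightarrow> lb t = lb (t mod l)" "(\<Prod>c\<in>arc us r lb ` {..<n}. w (clab c)) = (\<Prod>t<l. w (lb t))"
proof -
  interpret W: periodic_walk "walk_vertex us r n" "walk_arc us r lb n" arc_ends fst n by (rule periodic)
  have uni': "card (range (walk_vertex us r n)) = card (range (walk_arc us r lb n))"
    using uni by (simp add: range_walk_arc card_range_walk_vertex)
  obtain l where l: "l > 0" "l dvd n" and iff: "\<And>a b. walk_vertex us r n a = walk_vertex us r n b \<longleftrightarrow> a mod l = b mod l"
    and A: "\<And>a b. a mod l = b mod l \<Longrightarrow> walk_arc us r lb n a = walk_arc us r lb n b"
    and cl: "l = card (range (walk_vertex us r n))"
    using W.cycle_structure[OF uni'] by blast
  have ln: "l \<le> n" using l n by (simp add: dvd_imp_le)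
  have r_lt: "r t = t mod l" if "t < n" for t
  proof -
    have "canon us r t = t mod l"
    proof (rule canon_eqI)
      have "t mod l < n" using l ln by (meson mod_less_divisor less_le_trans)
      moreover have "walk_vertex us r n (t mod l) = walk_vertex us r n t" by (simp add: iff)
      ultimately show "us ! (t mod l) = us ! t" "r (t mod l) = r t" using that by (auto simp: walk_vertex_def)
      fix s' assume s: "s' < t mod l" "us ! s' = us ! t"
      have "s' < t" using s by (meson less_le_trans mod_less_eq_dividend)
      moreover have "s' mod l \<noteq> t mod l" using s l by (metis less_irrefl less_trans mod_less mod_less_divisor)
      ultimately show "r s' \<noteq> r t" using iff[of s' t] s that by (auto simp: walk_vertex_def)
    qed
    then show ?thesis using r that by (auto simp: patterns_def)
  qed
  have us_lt: "us ! t = us ! (t mod l)" if "t < n" for t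
  proof -
    have "t mod l < n" using l ln by (meson mod_less_divisor less_le_trans)
    moreover have "walk_vertex us r n (t mod l) = walk_vertex us r n t" by (simp add: iff)
    ultimately show ?thesis using that by (auto simp: walk_vertex_def)
  qed
  have arcs: "arc us r lb ` {..<n} = walk_arc us r lb n ` {..<l}"
  proof -
    have "walk_arc us r lb n a \<in> walk_arc us r lb n ` {..<l}" for a
      using l A[of a "a mod l"] by (intro image_eqI[of _ _ "a mod l"]) auto
    then show ?thesis unfolding range_walk_arc[symmetric] by auto
  qed
  have inj: "inj_on (walk_arc us r lb n) {..<l}"
    using uni' cl arcs unfolding range_walk_arc by (intro eq_card_imp_inj_on) auto
  show ?thesis
  proof (rule that[OF l])
    show "r t = t mod l" if "t \<le> n" for t
      using r_lt[of t] that pattern_0n l(2) by (cases "t = n") auto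
    show "us ! t = us ! (t mod l)" if "t \<le> n" for t
      using us_lt[of t] that word(2) l(2) by (cases "t = n") auto
    show "lb t = lb (t mod l)" if "t < n" for t
    proof -
      have "t mod l < n" using l ln by (meson mod_less_divisor less_le_trans)
      moreover have "walk_arc us r lb n t = walk_arc us r lb n (t mod l)" by (rule A) simp
      then have "clab (walk_arc us r lb n t) = clab (walk_arc us r lb n (t mod l))" by simp
      ultimately show ?thesis using that unfolding walk_arc_def arc_simps by simp
    qed
    show "(\<Prod>c\<in>arc us r lb ` {..<n}. w (clab c)) = (\<Prod>t<l. w (lb t))"
      unfolding arcs using inj ln by (subst prod.reindex) (auto simp: walk_arc_def arc_simps intro!: prod.cong)
  qed
qed

end

text \<open>As \<open>N\<close> grows, only walks that visit as many vertices as arcs survive; these run around one cycle.\<close>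

definition limit_C :: "nat \<Rightarrow> real" where
  "limit_C n = (\<Sum>us\<in>cyclic_nbwords d n. \<Sum>lb\<in>label_words n. \<Sum>r\<in>patterns us n. label_trace lb n *
     (if card (fresh r (Suc n)) = card (arc us r lb ` {..<n}) then \<Prod>c\<in>arc us r lb ` {..<n}. w (clab c) else 0))"

theorem expect_C_rational:
  assumes n: "n \<ge> 1" "n \<le> q"
  obtains Q where "degree Q \<le> (card edges + 1) * q" "poly Q 0 = limit_C n"
    "\<And>N. q < N \<Longrightarrow> expect N (\<lambda>\<omega>. complete_lift.C d (fiber N) (lift \<omega>) n) * denominator q (1 / real N) = poly Q (1 / real N)"
proof -
  define tp where "tp us lb r = term_poly q (arc us r lb ` {..<n}) us r (fresh r (Suc n))" for us lb r
  define Q where "Q = (\<Sum>us\<in>cyclic_nbwords d n. \<Sum>lb\<in>label_words n. \<Sum>r\<in>patterns us n.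
     Polynomial.smult (label_trace lb n) (tp us lb r))"
  have card_le: "card (arc us r lb ` {..<n}) \<le> q" for us r and lb :: "nat \<Rightarrow> 'l"
    using card_image_le[of "{..<n}" "arc us r lb"] n by simp
  show ?thesis
  proof (rule that[of Q])
    show "degree Q \<le> (card edges + 1) * q"
      unfolding Q_def tp_def
      by (intro degree_sum_le finite_cyclic_nbwords finite_label_words finite_patterns
          order_trans[OF degree_smult_le] degree_term_poly card_le card_fresh_le) (use n in auto)
    show "poly Q 0 = limit_C n"
      unfolding Q_def limit_C_def poly_sum poly_smult
    proof (intro sum.cong refl arg_cong2[of _ _ _ _ "(*)"])
      fix us lb r assume h: "us \<in> cyclic_nbwords d n" "r \<in> patterns us n"
      show "poly (tp us lb r) 0 = (if card (fresh r (Suc n)) = card (arc us r lb ` {..<n})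
          then \<Prod>c\<in>arc us r lb ` {..<n}. w (clab c) else 0)"
        unfolding tp_def using unicyclic_consistent[OF h(1) n(1) h(2)]
        by (subst poly_term_poly_0) (auto intro!: card_fresh_le h n)
    qed
    fix N assume N: "q < N"
    have "expect N (\<lambda>\<omega>. complete_lift.C d (fiber N) (lift \<omega>) n) =
      expect N (\<lambda>\<omega>. \<Sum>us\<in>cyclic_nbwords d n. complete_lift.fixcount (fiber N) (lift \<omega>) us)"
      by (intro expect_cong) (simp add: complete_lift.C_def[OF complete_lift_lift])
    also have "\<dots> = (\<Sum>us\<in>cyclic_nbwords d n. expect N (\<lambda>\<omega>. complete_lift.fixcount (fiber N) (lift \<omega>) us))"
      by (rule expect_sum)
    finally have "expect N (\<lambda>\<omega>. complete_lift.C d (fiber N) (lift \<omega>) n) * denominator q (1 / real N) =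
      (\<Sum>us\<in>cyclic_nbwords d n. expect N (\<lambda>\<omega>. complete_lift.fixcount (fiber N) (lift \<omega>) us) * denominator q (1 / real N))"
      by (simp add: sum_distrib_right)
    also have "\<dots> = poly Q (1 / real N)"
      unfolding Q_def poly_sum
    proof (rule sum.cong[OF refl])
      fix us assume us: "us \<in> cyclic_nbwords d n"
      have cl: "us \<in> closed_nbwords d n" "us \<in> nbwords d n" using us by (auto simp: cyclic_nbwords_def closed_nbwords_def)
      have ed: "cedge ` arc us r lb ` {..<n} \<subseteq> edges" for r and lb :: "nat \<Rightarrow> 'l"
      proof (rule image_subsetI, elim imageE)
        fix c t assume t: "c = arc us r lb t" "t \<in> {..<n}"
        have "us ! t \<le> d" "us ! Suc t \<le> d" "us ! t \<noteq> us ! Suc t"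
          using nbword_nth[OF cl(2)] t(2) by auto
        then show "cedge c \<in> edges"
          unfolding t(1) arc_simps edges_def by (auto simp: min_def max_def)
      qed
      have Nn: "n < N" using N n by simp
      show "expect N (\<lambda>\<omega>. complete_lift.fixcount (fiber N) (lift \<omega>) us) * denominator q (1 / real N) =
         (\<Sum>lb\<in>label_words n. \<Sum>r\<in>patterns us n. poly (Polynomial.smult (label_trace lb n) (tp us lb r)) (1 / real N))"
        unfolding expect_fixcount[OF cl(1) Nn] sum_distrib_right poly_smult
      proof (intro sum.cong refl)
        fix lb :: "nat \<Rightarrow> 'l" and r assume "r \<in> patterns us n"
        then have le: "card (fresh r (Suc n)) \<le> card (arc us r lb ` {..<n})" by (rule card_fresh_le[OF us n(1)])
        show "label_trace lb n * (probability_value N (arc us r lb ` {..<n}) *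
            (\<Prod>t\<in>fresh r (Suc n). real N - real (older us r t))) * denominator q (1 / real N) =
            label_trace lb n * poly (tp us lb r) (1 / real N)"
          unfolding tp_def using poly_term_poly[OF _ ed card_le finite_fresh le N] by (simp add: mult.assoc)
      qed
    qed
    finally show "expect N (\<lambda>\<omega>. complete_lift.C d (fiber N) (lift \<omega>) n) * denominator q (1 / real N) = poly Q (1 / real N)" .
  qed
qed

end

section \<open>Spectral bounds from traces\<close>

lemma monic_splits:
  fixes p :: "real poly"
  assumes "size (proots p) = degree p" "lead_coeff p = 1"
  shows "\<exists>as. p = (\<Prod>a\<leftarrow>as. [:- a, 1:])"
  using assms
proof (induction "degree p" arbitrary: p)
  case 0
  then obtain a where "p = [:a:]" by (metis degree_eq_zeroE)
  then have "p = 1" using 0 by (simp add: one_pCons)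
  then show ?case by (intro exI[of _ "[]"]) simp
next
  case (Suc n)
  then have p0: "p \<noteq> 0" by auto
  have "proots p \<noteq> {#}" using Suc by auto
  then obtain x where "x \<in># proots p" by blast
  then have "poly p x = 0" using p0 by simp
  then obtain r where r: "p = [:- x, 1:] * r" by (metis dvdE poly_eq_0_iff_dvd)
  have r0: "r \<noteq> 0" using r p0 by auto
  have "degree p = Suc (degree r)" unfolding r using r0 by (subst degree_mult_eq) auto
  moreover have "proots p = {#x#} + proots r"
    unfolding r using r0 by (subst proots_mult) auto
  moreover have "lead_coeff p = lead_coeff r" unfolding r lead_coeff_mult by simp
  ultimately have "\<exists>as. r = (\<Prod>a\<leftarrow>as. [:- a, 1:])" using Suc by (intro Suc.hyps) auto
  then obtain as where "r = (\<Prod>a\<leftarrow>as. [:- a, 1:])" by blast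
  then show ?case using r by (intro exI[of _ "x # as"]) simp
qed

lemma member_le_sum_list_nonneg:
  fixes h :: "'a \<Rightarrow> real"
  assumes "x \<in> set xs" "\<And>y. y \<in> set xs \<Longrightarrow> h y \<ge> 0"
  shows "h x \<le> (\<Sum>y\<leftarrow>xs. h y)"
  using assms
proof (induction xs)
  case (Cons a xs)
  have "(\<Sum>y\<leftarrow>xs. h y) \<ge> 0" using Cons.prems by (intro sum_list_nonneg) auto
  then show ?case using Cons by force
qed simp

lemma sum_diag_commute:
  fixes X Y :: "real mat"
  assumes "X \<in> carrier_mat n n" "Y \<in> carrier_mat n n"
  shows "(\<Sum>i<n. (X * Y) $$ (i, i)) = (\<Sum>i<n. (Y * X) $$ (i, i))"
proof -
  have *: "(\<Sum>i<n. (X * Y) $$ (i, i)) = (\<Sum>i<n. \<Sum>j<n. X $$ (i, j) * Y $$ (j, i))"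
    if "X \<in> carrier_mat n n" "Y \<in> carrier_mat n n" for X Y :: "real mat"
    using that by (intro sum.cong refl) (simp add: scalar_prod_def atLeast0LessThan)
  show ?thesis unfolding *[OF assms] *[OF assms(2,1)]
    by (subst sum.swap) (simp add: mult.commute)
qed

text \<open>A characteristic polynomial with n real roots permits a real Schur form, and the powers
  of a triangular matrix carry the powers of its diagonal.\<close>

lemma sum_diag_pow_eq_sum_eigenvalues:
  fixes A :: "real mat"
  assumes A: "A \<in> carrier_mat n n" and size: "size (proots (char_poly A)) = n"
  shows "(\<Sum>i<n. (A ^\<^sub>m m) $$ (i, i)) = (\<Sum>a\<in>#proots (char_poly A). a ^ m)"
proof -
  have "degree (char_poly A) = n" "lead_coeff (char_poly A) = 1"
    using degree_monic_char_poly[OF A] by auto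
  then obtain as where "char_poly A = (\<Prod>a\<leftarrow>as. [:- a, 1:])"
    using monic_splits[of "char_poly A"] size by auto
  then obtain B where B: "B \<in> carrier_mat n n" "upper_triangular B" "similar_mat A B"
    using schur_decomposition_exists[OF A] by blast
  have cp: "char_poly A = (\<Prod>a\<leftarrow>diag_mat B. [:- a, 1:])"
    using char_poly_similar[OF B(3)] char_poly_upper_triangular[OF B(1,2)] by simp
  have pr: "proots (\<Prod>a\<leftarrow>xs. [:- a, 1:]) = mset xs" for xs :: "real list"
  proof (induction xs)
    case (Cons x xs)
    have "(\<Prod>a\<leftarrow>xs. [:- a, 1:]) \<noteq> 0" by (auto simp: prod_list_zero_iff)
    then show ?case using Cons by (simp add: proots_mult del: mult_pCons_left)
  qed simp
  have eigs: "(\<Sum>a\<in>#proots (char_poly A). a ^ m) = (\<Sum>i<n. (B $$ (i, i)) ^ m)"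
  proof -
    have "proots (char_poly A) = mset (map (\<lambda>i. B $$ (i, i)) [0..<n])"
      unfolding cp pr using B(1) by (simp add: diag_mat_def)
    then show ?thesis
      by (simp add: sum_mset_sum_list o_def sum_list_distinct_conv_sum_set atLeast0LessThan flip: mset_map)
  qed
  have Bpow: "B ^\<^sub>m m \<in> carrier_mat n n \<and> upper_triangular (B ^\<^sub>m m) \<and> (\<forall>i<n. (B ^\<^sub>m m) $$ (i, i) = (B $$ (i, i)) ^ m)"
  proof (induction m)
    case 0
    then show ?case using B by auto
  next
    case (Suc m)
    define X where "X = B ^\<^sub>m m"
    have X: "X \<in> carrier_mat n n" "upper_triangular X" "\<And>i. i < n \<Longrightarrow> X $$ (i, i) = (B $$ (i, i)) ^ m"
      using Suc by (auto simp: X_def)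
    have ent: "(X * B) $$ (i, j) = (\<Sum>l<n. X $$ (i, l) * B $$ (l, j))" if "i < n" "j < n" for i j
      using that X B by (simp add: scalar_prod_def atLeast0LessThan)
    have "(X * B) $$ (i, j) = 0" if "j < i" "i < n" for i j
      unfolding ent[OF that(2) less_trans[OF that]]
    proof (intro sum.neutral ballI)
      fix l assume "l \<in> {..<n}"
      then show "X $$ (i, l) * B $$ (l, j) = 0"
        using upper_triangularD[OF X(2), of l i] upper_triangularD[OF B(2), of j l] that X(1) B(1)
        by (cases "l < i") auto
    qed
    moreover have "(X * B) $$ (i, i) = (B $$ (i, i)) ^ Suc m" if i: "i < n" for i
    proof -
      have "(X * B) $$ (i, i) = (\<Sum>l<n. if l = i then X $$ (i, i) * B $$ (i, i) else 0)"
        unfolding ent[OF i i]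
      proof (intro sum.cong refl)
        fix l assume "l \<in> {..<n}"
        then show "X $$ (i, l) * B $$ (l, i) = (if l = i then X $$ (i, i) * B $$ (i, i) else 0)"
          using upper_triangularD[OF X(2), of l i] upper_triangularD[OF B(2), of i l] i X(1) B(1)
          by (cases l i rule: linorder_cases) auto
      qed
      then show ?thesis using i X(3) by simp
    qed
    ultimately show ?case using X(1) B(1) by (auto simp: X_def upper_triangular_def)
  qed
  obtain P Q where wit: "similar_mat_wit A B P Q" using B(3) by (auto simp: similar_mat_def)
  have "similar_mat_wit (A ^\<^sub>m m) (B ^\<^sub>m m) P Q" by (rule similar_mat_wit_pow[OF wit])
  from similar_mat_witD2[OF pow_carrier_mat[OF A] this]
  have *: "A ^\<^sub>m m = P * B ^\<^sub>m m * Q" "Q * P = 1\<^sub>m n" "P \<in> carrier_mat n n" "Q \<in> carrier_mat n n" by auto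
  have Bm: "B ^\<^sub>m m \<in> carrier_mat n n" using Bpow by blast
  have "(\<Sum>i<n. (A ^\<^sub>m m) $$ (i, i)) = (\<Sum>i<n. (P * (B ^\<^sub>m m * Q)) $$ (i, i))"
    unfolding *(1) using *(3,4) Bm by (simp add: assoc_mult_mat[of _ n n _ n _ n])
  also have "\<dots> = (\<Sum>i<n. (B ^\<^sub>m m * Q * P) $$ (i, i))"
    using *(3,4) Bm by (intro sum_diag_commute) auto
  also have "B ^\<^sub>m m * Q * P = B ^\<^sub>m m"
    using *(2-4) Bm right_mult_one_mat[OF Bm] by (simp add: assoc_mult_mat[of _ n n _ n _ n])
  also have "(\<Sum>i<n. (B ^\<^sub>m m) $$ (i, i)) = (\<Sum>i<n. (B $$ (i, i)) ^ m)"
    using Bpow by simp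
  finally show ?thesis using eigs by simp
qed

section \<open>The spectrum of a lift\<close>

context complete_lift
begin

text \<open>Neighbours of a vertex lie over different base vertices, so the lift is a simple
  d-regular graph. The enumeration \<open>dec\<close> moves it to natural numbers, where the matrix
  powers represent the powers of \<open>adj\<close>.\<close>

theorem lift_graph:
  obtains G :: "nat pair_pre_digraph" where "pair_graph G" "regular_graph d G" "card (pverts G) = (d + 1) * card F"
    "\<And>p. trace p = (\<Sum>x\<leftarrow>adjacency_eigenvalues G. poly p x)"
proof -
  define V where "V = {..d} \<times> F"
  define n where "n = card V"
  have finV: "finite V" using finF by (simp add: V_def)
  have n: "n = (d + 1) * card F" by (simp add: n_def V_def card_cartesian_product)
  obtain dec where dec: "bij_betw dec {..<n} V"
    using ex_bij_betw_nat_finite[OF finV] unfolding n_def atLeast0LessThan by blast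
  have decV: "dec a \<in> V" if "a < n" for a using dec that by (auto simp: bij_betw_def)
  define nb where "nb x z \<longleftrightarrow> fst x \<noteq> fst z \<and> snd z = \<phi> (fst x) (fst z) (snd x)" for x z :: "nat \<times> 'f"
  have nb_sym: "nb z x" if "nb x z" "x \<in> V" "z \<in> V" for x z
    using that \<phi>_inv[of "fst x" "fst z" "snd x"] by (auto simp: nb_def V_def)
  define G where "G = \<lparr>pverts = {..<n}, parcs = {(a, b). a < n \<and> b < n \<and> nb (dec a) (dec b)}\<rparr>"
  have pv: "pverts G = {..<n}" and pa: "(a, b) \<in> parcs G \<longleftrightarrow> a < n \<and> b < n \<and> nb (dec a) (dec b)" for a b
    by (auto simp: G_def)
  have G: "pair_graph G"
  proof
    show "finite (pverts G)" by (simp add: pv)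
    show "finite (parcs G)" by (rule finite_subset[of _ "{..<n} \<times> {..<n}"]) (auto simp: G_def)
    show "symmetric (with_proj G)"
      using nb_sym decV by (auto simp: symmetric_def sym_def pa)
    fix e assume "e \<in> parcs G"
    then show "fst e \<in> pverts G" "snd e \<in> pverts G" "fst e \<noteq> snd e"
      by (cases e; auto simp: pa pv nb_def)+
  qed
  have nbset: "{z \<in> V. nb x z} = (\<lambda>v. (v, \<phi> (fst x) v (snd x))) ` ({..d} - {fst x})" if "x \<in> V" for x
    using that by (auto simp: nb_def V_def image_iff intro!: \<phi>_in)
  have reg: "regular_graph d G"
    unfolding regular_graph_def
  proof
    fix a assume "a \<in> pverts G"
    then have a: "a < n" by (simp add: pv)
    have inj: "inj_on dec {..<n}" using dec by (simp add: bij_betw_def)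
    have "out_arcs (with_proj G) a = Pair a ` {b. b < n \<and> nb (dec a) (dec b)}"
      using a by (auto simp: out_arcs_def pa)
    then have "out_degree (with_proj G) a = card {b. b < n \<and> nb (dec a) (dec b)}"
      by (simp add: out_degree_def card_image inj_on_def)
    also have "\<dots> = card (dec ` {b. b < n \<and> nb (dec a) (dec b)})"
      by (rule card_image[symmetric]) (rule inj_on_subset[OF inj], auto)
    also have "dec ` {b. b < n \<and> nb (dec a) (dec b)} = {z \<in> V. nb (dec a) z}"
    proof (intro equalityI subsetI)
      fix z assume z: "z \<in> {z \<in> V. nb (dec a) z}"
      then obtain b where "b < n" "z = dec b" using dec by (auto simp: bij_betw_def)
      then show "z \<in> dec ` {b. b < n \<and> nb (dec a) (dec b)}" using z by blast
    qed (use decV in auto)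
    also have "card \<dots> = d"
      using decV[OF a] unfolding nbset[OF decV[OF a]] by (subst card_image) (auto simp: inj_on_def V_def)
    finally show "out_degree (with_proj G) a = d" .
  qed
  define A where "A = adjacency_matrix G"
  have A: "A \<in> carrier_mat n n" using adjacency_matrix_carrier[of G] by (simp add: A_def pv)
  have Aent: "A $$ (a, b) = (if nb (dec a) (dec b) then 1 else 0)" if "a < n" "b < n" for a b
    using that by (simp add: A_def adjacency_matrix_def pv pa lessThan_atLeast0 Let_def)
  have adjA: "adj f (fst (dec a)) (snd (dec a)) = (\<Sum>b<n. A $$ (a, b) * f (fst (dec b)) (snd (dec b)))" if a: "a < n" for a f
  proof -
    have "(\<Sum>b<n. A $$ (a, b) * f (fst (dec b)) (snd (dec b))) =
        (\<Sum>b<n. if nb (dec a) (dec b) then f (fst (dec b)) (snd (dec b)) else 0)"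
      using a by (intro sum.cong refl) (auto simp: Aent)
    also have "\<dots> = (\<Sum>z\<in>V. if nb (dec a) z then f (fst z) (snd z) else 0)"
      by (rule sum.reindex_bij_betw[OF dec])
    also have "\<dots> = (\<Sum>z\<in>{z \<in> V. nb (dec a) z}. f (fst z) (snd z))"
      by (rule sum.inter_filter[symmetric, OF finV])
    also have "\<dots> = adj f (fst (dec a)) (snd (dec a))"
      unfolding nbset[OF decV[OF a]] adj_def by (subst sum.reindex) (auto simp: inj_on_def)
    finally show ?thesis ..
  qed
  have powA: "(adj ^^ i) f (fst (dec a)) (snd (dec a)) = (\<Sum>b<n. (A ^\<^sub>m i) $$ (a, b) * f (fst (dec b)) (snd (dec b)))" if a: "a < n" for a f i
  proof (induction i arbitrary: f)
    case 0
    have "(\<Sum>b<n. (A ^\<^sub>m 0) $$ (a, b) * f (fst (dec b)) (snd (dec b))) =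
       (\<Sum>b<n. if b = a then f (fst (dec b)) (snd (dec b)) else 0)"
      using a A by (intro sum.cong refl) auto
    then show ?case using a by simp
  next
    case (Suc i)
    have Ai: "A ^\<^sub>m i \<in> carrier_mat n n" using A by (rule pow_carrier_mat)
    have "(adj ^^ Suc i) f (fst (dec a)) (snd (dec a)) = (adj ^^ i) (adj f) (fst (dec a)) (snd (dec a))"
      by (simp add: funpow_Suc_right del: funpow.simps)
    also have "\<dots> = (\<Sum>b<n. (A ^\<^sub>m i) $$ (a, b) * (\<Sum>c<n. A $$ (b, c) * f (fst (dec c)) (snd (dec c))))"
      unfolding Suc by (intro sum.cong refl) (simp add: adjA)
    also have "\<dots> = (\<Sum>b<n. \<Sum>c<n. (A ^\<^sub>m i) $$ (a, b) * A $$ (b, c) * f (fst (dec c)) (snd (dec c)))"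
      by (simp add: sum_distrib_left mult.assoc)
    also have "\<dots> = (\<Sum>c<n. \<Sum>b<n. (A ^\<^sub>m i) $$ (a, b) * A $$ (b, c) * f (fst (dec c)) (snd (dec c)))"
      by (rule sum.swap)
    also have "\<dots> = (\<Sum>c<n. (A ^\<^sub>m Suc i) $$ (a, c) * f (fst (dec c)) (snd (dec c)))"
      using a A Ai by (intro sum.cong refl) (simp add: scalar_prod_def atLeast0LessThan sum_distrib_right)
    finally show ?case .
  qed
  have size: "size (proots (char_poly A)) = n"
    using length_adjacency_eigenvalues[OF G] by (simp add: adjacency_eigenvalues_def A_def pv flip: size_mset)
  have eigs: "(\<Sum>x\<leftarrow>adjacency_eigenvalues G. h x) = (\<Sum>x\<in>#proots (char_poly A). h x)" for h :: "real \<Rightarrow> real"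
    by (simp add: adjacency_eigenvalues_def A_def sum_mset_sum_list[symmetric] mset_map)
  have tr: "trace p = (\<Sum>x\<leftarrow>adjacency_eigenvalues G. poly p x)" for p
  proof -
    have "trace p = (\<Sum>z\<in>V. opoly p (point (fst z) (snd z)) (fst z) (snd z))"
      unfolding trace_def V_def by (subst sum.cartesian_product) (simp add: case_prod_unfold)
    also have "\<dots> = (\<Sum>a<n. opoly p (point (fst (dec a)) (snd (dec a))) (fst (dec a)) (snd (dec a)))"
      by (rule sum.reindex_bij_betw[OF dec, symmetric])
    also have "\<dots> = (\<Sum>a<n. \<Sum>i\<le>degree p. coeff p i * (A ^\<^sub>m i) $$ (a, a))"
      unfolding opoly_def
    proof (intro sum.cong refl arg_cong2[of _ _ _ _ "(*)"])
      fix a i assume "a \<in> {..<n}"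
      then have a: "a < n" by simp
      have "(adj ^^ i) (point (fst (dec a)) (snd (dec a))) (fst (dec a)) (snd (dec a)) =
          (\<Sum>b<n. if b = a then (A ^\<^sub>m i) $$ (a, a) else 0)"
        unfolding powA[OF a]
      proof (intro sum.cong refl)
        fix b assume "b \<in> {..<n}"
        then have "dec b = dec a \<longleftrightarrow> b = a" using dec a by (auto simp: bij_betw_def inj_on_def)
        then show "(A ^\<^sub>m i) $$ (a, b) * point (fst (dec a)) (snd (dec a)) (fst (dec b)) (snd (dec b)) =
            (if b = a then (A ^\<^sub>m i) $$ (a, a) else 0)"
          by (auto simp: point_def prod_eq_iff)
      qed
      then show "(adj ^^ i) (point (fst (dec a)) (snd (dec a))) (fst (dec a)) (snd (dec a)) = (A ^\<^sub>m i) $$ (a, a)"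
        using a by simp
    qed
    also have "\<dots> = (\<Sum>i\<le>degree p. coeff p i * (\<Sum>a<n. (A ^\<^sub>m i) $$ (a, a)))"
      by (subst sum.swap) (simp add: sum_distrib_left)
    also have "\<dots> = (\<Sum>i\<le>degree p. coeff p i * (\<Sum>x\<leftarrow>adjacency_eigenvalues G. x ^ i))"
      unfolding sum_diag_pow_eq_sum_eigenvalues[OF A size] eigs ..
    also have "\<dots> = (\<Sum>x\<leftarrow>adjacency_eigenvalues G. \<Sum>i\<le>degree p. coeff p i * x ^ i)"
    proof -
      have "(\<Sum>i\<le>degree p. coeff p i * (\<Sum>x\<leftarrow>xs. x ^ i)) = (\<Sum>x\<leftarrow>xs. \<Sum>i\<le>degree p. coeff p i * x ^ i)" for xs
        by (induction xs) (simp_all add: distrib_left sum.distrib)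
      then show ?thesis .
    qed
    finally show ?thesis by (simp add: poly_altdef)
  qed
  show ?thesis by (rule that[OF G reg _ tr]) (simp add: pv n)
qed

definition ip :: "(nat \<Rightarrow> 'f \<Rightarrow> real) \<Rightarrow> (nat \<Rightarrow> 'f \<Rightarrow> real) \<Rightarrow> real" where
  "ip f g = (\<Sum>u\<le>d. \<Sum>y\<in>F. f u y * g u y)"

lemma adj_symmetric: "ip (adj f) g = ip f (adj g)"
proof -
  have "ip (adj f) g = (\<Sum>u\<le>d. \<Sum>v\<in>{..d} - {u}. \<Sum>y\<in>F. f v (\<phi> u v y) * g u y)"
    unfolding ip_def adj_def sum_distrib_right by (rule sum.cong[OF refl], rule sum.swap)
  also have "\<dots> = (\<Sum>u\<le>d. \<Sum>v\<in>{..d} - {u}. \<Sum>y\<in>F. f v y * g u (\<phi> v u y))"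
  proof (rule sum.cong[OF refl], rule sum.cong[OF refl])
    fix u v assume "u \<in> {..d}" "v \<in> {..d} - {u}"
    then have uv: "u \<le> d" "v \<le> d" "u \<noteq> v" by auto
    show "(\<Sum>y\<in>F. f v (\<phi> u v y) * g u y) = (\<Sum>y\<in>F. f v y * g u (\<phi> v u y))"
      by (rule sum.reindex_bij_witness[of _ "\<phi> v u" "\<phi> u v"]) (use uv in \<open>auto intro!: \<phi>_in simp: \<phi>_inv\<close>)
  qed
  also have "\<dots> = (\<Sum>u\<le>d. \<Sum>v\<le>d. if u \<noteq> v then \<Sum>y\<in>F. f v y * g u (\<phi> v u y) else 0)"
  proof (rule sum.cong[OF refl])
    fix u assume "u \<in> {..d}"
    have "{..d} - {u} = {v \<in> {..d}. u \<noteq> v}" by auto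
    then show "(\<Sum>v\<in>{..d} - {u}. \<Sum>y\<in>F. f v y * g u (\<phi> v u y)) =
       (\<Sum>v\<le>d. if u \<noteq> v then \<Sum>y\<in>F. f v y * g u (\<phi> v u y) else 0)"
      by (simp only: sum.inter_filter finite_atMost)
  qed
  also have "\<dots> = (\<Sum>v\<le>d. \<Sum>u\<le>d. if u \<noteq> v then \<Sum>y\<in>F. f v y * g u (\<phi> v u y) else 0)"
    by (rule sum.swap)
  also have "\<dots> = (\<Sum>v\<le>d. \<Sum>u\<in>{..d} - {v}. \<Sum>y\<in>F. f v y * g u (\<phi> v u y))"
  proof (rule sum.cong[OF refl])
    fix v assume "v \<in> {..d}"
    have "{..d} - {v} = {u \<in> {..d}. u \<noteq> v}" by auto
    then show "(\<Sum>u\<le>d. if u \<noteq> v then \<Sum>y\<in>F. f v y * g u (\<phi> v u y) else 0) =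
      (\<Sum>u\<in>{..d} - {v}. \<Sum>y\<in>F. f v y * g u (\<phi> v u y))"
      by (simp only: sum.inter_filter finite_atMost)
  qed
  also have "\<dots> = ip f (adj g)"
    unfolding ip_def adj_def sum_distrib_left by (rule sum.cong[OF refl], rule sum.swap)
  finally show ?thesis .
qed

lemma ip_opoly: "ip (opoly p f) g = ip f (opoly p g)"
proof -
  have sym: "ip a b = ip b a" for a b by (simp add: ip_def mult.commute)
  have pow: "ip ((adj ^^ i) f) g = ip f ((adj ^^ i) g)" for i
  proof (induction i arbitrary: g)
    case (Suc i)
    have "ip ((adj ^^ Suc i) f) g = ip ((adj ^^ i) f) (adj g)" by (simp add: adj_symmetric)
    also have "\<dots> = ip f ((adj ^^ i) (adj g))" by (rule Suc)
    finally show ?case by (simp add: funpow_swap1)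
  qed simp
  have lin: "ip (opoly p f) g = (\<Sum>i\<le>degree p. coeff p i * ip ((adj ^^ i) f) g)" for f g
  proof -
    have "ip (opoly p f) g = (\<Sum>u\<le>d. \<Sum>y\<in>F. \<Sum>i\<le>degree p. coeff p i * ((adj ^^ i) f u y * g u y))"
      by (simp add: ip_def opoly_def sum_distrib_right mult.assoc)
    also have "\<dots> = (\<Sum>u\<le>d. \<Sum>i\<le>degree p. \<Sum>y\<in>F. coeff p i * ((adj ^^ i) f u y * g u y))"
      by (intro sum.cong refl) (rule sum.swap)
    also have "\<dots> = (\<Sum>i\<le>degree p. \<Sum>u\<le>d. \<Sum>y\<in>F. coeff p i * ((adj ^^ i) f u y * g u y))"
      by (rule sum.swap)
    finally show ?thesis by (simp add: ip_def sum_distrib_left)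
  qed
  have "ip (opoly p f) g = (\<Sum>i\<le>degree p. coeff p i * ip ((adj ^^ i) g) f)"
    unfolding lin[of f g] by (intro sum.cong refl) (simp add: pow sym[of _ f])
  also have "\<dots> = ip f (opoly p g)" unfolding lin[of g f, symmetric] by (rule sym)
  finally show ?thesis .
qed

lemma ip_nonneg: "ip f f \<ge> 0"
  unfolding ip_def by (intro sum_nonneg) simp

lemma ip_cauchy_schwarz: "(ip f g)\<^sup>2 \<le> ip f f * ip g g"
proof -
  define G P where "G = ip g g" and "P = ip f g"
  have "0 \<le> ip (\<lambda>u y. G * f u y - P * g u y) (\<lambda>u y. G * f u y - P * g u y)" by (rule ip_nonneg)
  also have "\<dots> = G * G * ip f f - 2 * (G * P) * ip f g + P * P * ip g g"
    unfolding ip_def by (simp add: sum_distrib_left sum_subtractf sum.distrib algebra_simps)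
  also have "\<dots> = G * (ip f f * ip g g - P\<^sup>2)" by (simp add: G_def P_def power2_eq_square algebra_simps)
  finally have *: "0 \<le> G * (ip f f * ip g g - P\<^sup>2)" .
  show ?thesis
  proof (cases "G = 0")
    case True
    have "g u y = 0" if "u \<le> d" "y \<in> F" for u y
    proof -
      have "\<forall>u\<in>{..d}. (\<Sum>y\<in>F. g u y * g u y) = 0"
        using True unfolding G_def ip_def by (subst (asm) sum_nonneg_eq_0_iff) (auto intro!: sum_nonneg)
      then have "(\<Sum>y\<in>F. g u y * g u y) = 0" using that by simp
      then have "\<forall>y\<in>F. g u y * g u y = 0" using finF by (subst (asm) sum_nonneg_eq_0_iff) auto
      then show ?thesis using that by simp
    qed
    then show ?thesis by (simp add: ip_def)
  next
    case False
    then have "G > 0" using ip_nonneg[of g] by (simp add: G_def)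
    then show ?thesis using * by (simp add: zero_le_mult_iff P_def)
  qed
qed

text \<open>Very lossy, but applied to the powers \<open>g ^ 2 ^ r\<close> it gives the sharp spectral bound in the limit.\<close>

lemma ip_opoly_le_trace: "ip (opoly p f) (opoly p f) \<le> ip f f * trace (p * p)"
proof -
  have pt: "ip (point u y) h = h u y" if "u \<le> d" "y \<in> F" for u y h
  proof -
    have "ip (point u y) h = (\<Sum>v\<le>d. \<Sum>z\<in>F. if v = u then if z = y then h v z else 0 else 0)"
      unfolding ip_def by (intro sum.cong refl) (auto simp: point_def)
    also have "\<dots> = (\<Sum>v\<le>d. if v = u then h u y else 0)"
      using that finF by (intro sum.cong refl) auto
    finally show ?thesis using that by simp
  qed
  have "ip (opoly p f) (opoly p f) = (\<Sum>u\<le>d. \<Sum>y\<in>F. (ip f (opoly p (point u y)))\<^sup>2)"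
  proof -
    have "opoly p f u y = ip f (opoly p (point u y))" if "u \<le> d" "y \<in> F" for u y
    proof -
      have "opoly p f u y = ip (point u y) (opoly p f)" using pt[OF that] by simp
      also have "\<dots> = ip (opoly p (point u y)) f" by (simp add: ip_opoly)
      finally show ?thesis by (simp add: ip_def mult.commute)
    qed
    then show ?thesis by (subst ip_def) (auto intro!: sum.cong simp: power2_eq_square)
  qed
  also have "\<dots> \<le> (\<Sum>u\<le>d. \<Sum>y\<in>F. ip f f * ip (opoly p (point u y)) (opoly p (point u y)))"
    by (intro sum_mono ip_cauchy_schwarz)
  also have "\<dots> = (\<Sum>u\<le>d. \<Sum>y\<in>F. ip f f * opoly (p * p) (point u y) u y)"
    by (intro sum.cong refl) (simp add: ip_opoly pt opoly_mult)
  finally show ?thesis by (simp add: trace_def sum_distrib_left)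
qed

text \<open>Taking 2^r-th roots makes the constant c disappear as r grows.\<close>

lemma power_ratio_bound:
  fixes a s c :: real
  assumes "s \<ge> 0" "\<And>r. a ^ 2 ^ r \<le> c * s ^ 2 ^ r"
  shows "a \<le> s"
proof (rule ccontr)
  assume as: "\<not> a \<le> s"
  then have a: "a > 0" using assms(1) by simp
  define x where "x = a / s"
  show False
  proof (cases "s = 0")
    case True
    then show False using assms(2)[of 0] a by simp
  next
    case False
    then have s: "s > 0" using assms(1) by simp
    have "x > 1" using as s by (simp add: x_def)
    then obtain m where m: "c < x ^ m" using real_arch_pow by blast
    have "x ^ m \<le> x ^ 2 ^ m" using \<open>x > 1\<close> by (intro power_increasing less_imp_le[OF less_exp]) auto
    also have "\<dots> \<le> c" using assms(2)[of m] s by (simp add: x_def power_divide field_simps)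
    finally show False using m by simp
  qed
qed

text \<open>Instead of diagonalising, Cauchy-Schwarz is iterated to compare the form of g with that
  of g^(2^r). There the crude trace bound loses only a factor \<open>length eigs\<close>, which
  \<open>power_ratio_bound\<close> removes.\<close>

lemma spectral_bound:
  assumes tr: "\<And>p. trace p = (\<Sum>x\<leftarrow>eigs. poly p x)" and b: "\<And>x. x \<in> set eigs \<Longrightarrow> \<bar>poly g x\<bar> \<le> b" and b0: "b \<ge> 0"
  shows "\<bar>ip f (opoly g f)\<bar> \<le> b * ip f f"
proof -
  have sq: "(ip f (opoly g f)) ^ 2 ^ Suc r \<le> ip f f ^ (2 ^ Suc r - 1) * (ip f (opoly (g ^ 2 ^ Suc r) f))" for r
  proof (induction r)
    case 0
    have "(ip f (opoly g f))\<^sup>2 \<le> ip f f * ip (opoly g f) (opoly g f)" by (rule ip_cauchy_schwarz)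
    then show ?case by (simp add: ip_opoly opoly_mult power2_eq_square)
  next
    case (Suc r)
    define h where "h = g ^ 2 ^ Suc r"
    have hh: "h * h = g ^ 2 ^ Suc (Suc r)"
      by (simp add: h_def mult_2 flip: power_add)
    define c where "c = ip f f"
    have c: "c \<ge> 0" by (simp add: c_def ip_nonneg)
    have "(ip f (opoly g f)) ^ 2 ^ Suc (Suc r) = ((ip f (opoly g f)) ^ 2 ^ Suc r)\<^sup>2"
      by (simp add: mult.commute flip: power_mult)
    also have "\<dots> \<le> (c ^ (2 ^ Suc r - 1) * ip f (opoly h f))\<^sup>2"
      using Suc unfolding h_def c_def by (intro power_mono) auto
    also have "\<dots> = (c ^ (2 ^ Suc r - 1))\<^sup>2 * (ip f (opoly h f))\<^sup>2" by (rule power_mult_distrib)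
    also have "\<dots> \<le> (c ^ (2 ^ Suc r - 1))\<^sup>2 * (c * ip (opoly h f) (opoly h f))"
      using ip_cauchy_schwarz[of f "opoly h f"] by (intro mult_left_mono) (auto simp: c_def)
    also have "\<dots> = c ^ (2 ^ Suc (Suc r) - 1) * ip f (opoly (h * h) f)"
    proof -
      have "(2 ^ Suc r - 1) * 2 + 1 = (2 ^ Suc (Suc r) - 1 :: nat)"
      proof -
        have "(x - 1) * 2 + 1 = 2 * x - 1" if "x \<ge> 1" for x :: nat using that by linarith
        from this[of "2 ^ Suc r"] show ?thesis by simp
      qed
      then have "(c ^ (2 ^ Suc r - 1))\<^sup>2 * c = c ^ (2 ^ Suc (Suc r) - 1)"
        by (metis power_add power_mult power_one_right)
      then show ?thesis by (simp add: ip_opoly opoly_mult mult.assoc[symmetric])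
    qed
    finally show ?case by (simp only: hh c_def)
  qed
  define c where "c = ip f f"
  have c: "c \<ge> 0" by (simp add: c_def ip_nonneg)
  show ?thesis
  proof (cases "c = 0")
    case True
    have "(ip f (opoly g f))\<^sup>2 \<le> 0" using ip_cauchy_schwarz[of f "opoly g f"] True by (simp add: c_def)
    then show ?thesis using True by (simp add: c_def)
  next
    case False
    then have c0: "c > 0" using c by simp
    define a where "a = \<bar>ip f (opoly g f)\<bar> / c"
    have "a\<^sup>2 \<le> b\<^sup>2"
    proof (rule power_ratio_bound[of _ _ "real (length eigs)"])
      fix r :: nat
      define h where "h = g ^ 2 ^ r"
      have "(ip f (opoly g f)) ^ 2 ^ Suc r \<le> c ^ (2 ^ Suc r - 1) * ip (opoly h f) (opoly h f)"
      proof -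
        have hh: "h * h = g ^ 2 ^ Suc r" by (simp add: h_def mult_2 flip: power_add)
        show ?thesis using sq[of r] unfolding c_def hh[symmetric] opoly_mult by (simp only: ip_opoly)
      qed
      also have "\<dots> \<le> c ^ (2 ^ Suc r - 1) * (c * trace (h * h))"
        using ip_opoly_le_trace[of h f] c by (intro mult_left_mono) (auto simp: c_def)
      also have "\<dots> = c ^ 2 ^ Suc r * trace (h * h)"
      proof -
        have "c ^ (2 ^ Suc r - 1) * c = c ^ 2 ^ Suc r" by (rule power_minus_mult) simp
        then show ?thesis by (simp only: mult.assoc[symmetric])
      qed
      also have "trace (h * h) \<le> real (length eigs) * (b\<^sup>2) ^ 2 ^ r"
      proof -
        have "poly (h * h) x \<le> (b\<^sup>2) ^ 2 ^ r" if "x \<in> set eigs" for x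
        proof -
          have "poly (h * h) x = (\<bar>poly g x\<bar>\<^sup>2) ^ 2 ^ r"
            by (simp add: h_def poly_power power2_eq_square power_mult_distrib)
          also have "\<dots> \<le> (b\<^sup>2) ^ 2 ^ r" using b[OF that] by (intro power_mono) auto
          finally show ?thesis .
        qed
        then have "(\<Sum>x\<leftarrow>eigs. poly (h * h) x) \<le> (\<Sum>x\<leftarrow>eigs. (b\<^sup>2) ^ 2 ^ r)"
          by (intro sum_list_mono) auto
        then show ?thesis by (simp add: tr sum_list_triv)
      qed
      finally have "(ip f (opoly g f)) ^ 2 ^ Suc r \<le> c ^ 2 ^ Suc r * (real (length eigs) * (b\<^sup>2) ^ 2 ^ r)"
        using c by (simp add: mult_left_mono)
      moreover have "(ip f (opoly g f)) ^ 2 ^ Suc r = (a\<^sup>2) ^ 2 ^ r * c ^ 2 ^ Suc r"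
        using c0 by (simp add: a_def power_divide power_mult)
      ultimately show "(a\<^sup>2) ^ 2 ^ r \<le> real (length eigs) * (b\<^sup>2) ^ 2 ^ r"
        using c0 by (simp add: mult.commute)
    qed simp
    then have "a \<le> b" using b0 by (simp add: power2_le_iff_abs_le a_def c abs_le_square_iff[symmetric])
    then show ?thesis using c0 by (simp add: a_def c_def field_simps)
  qed
qed

text \<open>An even power x^m of one eigenvalue is at most the trace of that power, which is at most
  the number of vertices times d^m because each vertex has d neighbours. Taking roots removes the
  number of vertices.\<close>

lemma eigenvalue_abs_le:
  assumes tr: "\<And>p. trace p = (\<Sum>x\<leftarrow>eigs. poly p x)" and x: "x \<in> set eigs"
  shows "\<bar>x\<bar> \<le> real d"
proof -
  have adjb: "\<bar>(adj ^^ i) f u y\<bar> \<le> real d ^ i"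
    if "\<And>u y. u \<le> d \<Longrightarrow> y \<in> F \<Longrightarrow> \<bar>f u y\<bar> \<le> 1" "u \<le> d" "y \<in> F" for i f u y
    using that(2,3)
  proof (induction i arbitrary: u y)
    case (Suc i)
    have "\<bar>(adj ^^ Suc i) f u y\<bar> \<le> (\<Sum>v\<in>{..d} - {u}. real d ^ i)"
      unfolding funpow.simps comp_apply adj_def[of "(adj ^^ i) f"]
      using Suc by (intro order_trans[OF sum_abs] sum_mono Suc.IH \<phi>_in) auto
    then show ?case using Suc.prems by simp
  qed (use that in auto)
  have "x\<^sup>2 \<le> (real d)\<^sup>2"
  proof (rule power_ratio_bound[of _ _ "real ((d + 1) * card F)"])
    fix r :: nat
    define m where "m = (2::nat) * 2 ^ r"
    have "x ^ m \<le> (\<Sum>x\<leftarrow>eigs. x ^ m)"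
      using x by (intro member_le_sum_list_nonneg) (auto simp: m_def power_mult)
    also have "\<dots> = trace (Polynomial.monom 1 m)" by (simp add: tr poly_monom)
    also have "\<dots> \<le> (\<Sum>u\<le>d. \<Sum>y\<in>F. real d ^ m)"
      unfolding trace_def
    proof (intro sum_mono)
      fix u y assume "u \<in> {..d}" "y \<in> F"
      have "opoly (Polynomial.monom 1 m) (point u y) u y = (\<Sum>i\<le>m. if i = m then (adj ^^ i) (point u y) u y else 0)"
        unfolding opoly_altdef[OF degree_monom_le] by (intro sum.cong refl) auto
      also have "\<dots> = (adj ^^ m) (point u y) u y" by simp
      also have "\<dots> \<le> real d ^ m"
      proof -
        have "\<bar>(adj ^^ m) (point u y) u y\<bar> \<le> real d ^ m"
          using \<open>u \<in> {..d}\<close> \<open>y \<in> F\<close> by (intro adjb) (auto simp: point_def)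
        then show ?thesis by linarith
      qed
      finally show "opoly (Polynomial.monom 1 m) (point u y) u y \<le> real d ^ m" .
    qed
    finally show "(x\<^sup>2) ^ 2 ^ r \<le> real ((d + 1) * card F) * ((real d)\<^sup>2) ^ 2 ^ r"
      by (simp add: m_def power_mult algebra_simps)
  qed simp
  then show ?thesis using power2_le_iff_abs_le[of "real d" x] by simp
qed

end

section \<open>Limits of expected traces\<close>

context label_model
begin

definition label_weight :: "(nat \<Rightarrow> 'l) \<Rightarrow> nat \<Rightarrow> real" where
  "label_weight lb n = (\<Prod>t<n. w (lb t))"

lemma label_weight_nonneg: "lb \<in> label_words n \<Longrightarrow> m \<le> n \<Longrightarrow> label_weight lb m \<ge> 0"
  unfolding label_weight_def label_words_def
proof (rule prod_nonneg)
  fix t assume lb: "lb \<in> {..<n} \<rightarrow>\<^sub>E \<Lambda>" "m \<le> n" and t: "t \<in> {..<m}"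
  then have "lb t \<in> \<Lambda>" by (intro PiE_mem[OF lb(1)]) simp
  then show "0 \<le> w (lb t)" by (rule w_nonneg)
qed

lemma sum_label_weight: "(\<Sum>lb\<in>label_words n. label_weight lb n) = 1"
proof -
  have "(\<Sum>lb\<in>label_words n. label_weight lb n) = (\<Prod>t<n. \<Sum>l\<in>\<Lambda>. w l)"
    unfolding label_words_def label_weight_def using fin\<Lambda> by (intro prod_sum_PiE[symmetric]) auto
  then show ?thesis by (simp add: w_sum)
qed

lemma label_trace_bounds: "0 \<le> label_trace lb n" "label_trace lb n \<le> real k"
proof -
  show "0 \<le> label_trace lb n" unfolding label_trace_def by (intro sum_nonneg) auto
  have "label_trace lb n \<le> (\<Sum>i<k. 1)" unfolding label_trace_def by (intro sum_mono) auto
  then show "label_trace lb n \<le> real k" by simp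
qed

text \<open>By independence of the labels this is the trace of the n-th power of the averaged label
  operator.\<close>

definition label_moment :: "nat \<Rightarrow> real" where
  "label_moment n = (\<Sum>lb\<in>label_words n. label_weight lb n * label_trace lb n)"

definition unicyclic_value :: "nat list \<Rightarrow> nat \<Rightarrow> (nat \<Rightarrow> 'l) \<Rightarrow> (nat \<Rightarrow> nat) \<Rightarrow> real" where
  "unicyclic_value us n lb r = label_trace lb n *
     (if card (fresh r (Suc n)) = card (arc us r lb ` {..<n}) then \<Prod>c\<in>arc us r lb ` {..<n}. w (clab c) else 0)"

text \<open>The pattern of a walk of length n around a cycle with l vertices; l = n is the walk that
  runs around once.\<close>

definition cycle_pattern :: "nat \<Rightarrow> nat \<Rightarrow> nat \<Rightarrow> nat" where
  "cycle_pattern n l = restrict (\<lambda>t. t mod l) {..<Suc n}"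

lemma fresh_cycle_pattern: "0 < l \<Longrightarrow> l \<le> n \<Longrightarrow> fresh (cycle_pattern n l) (Suc n) = {..<l}"
proof -
  assume l: "0 < l" "l \<le> n"
  have "t mod l = t \<longleftrightarrow> t < l" for t using l(1) by (metis mod_less mod_less_divisor)
  then have "(t < Suc n \<and> cycle_pattern n l t = t) = (t < l)" for t
    using l(2) by (cases "t < Suc n") (simp_all add: cycle_pattern_def)
  then show "fresh (cycle_pattern n l) (Suc n) = {..<l}" by (simp add: fresh_def lessThan_def)
qed

lemma cycle_pattern_in_patterns:
  assumes "us \<in> cyclic_nbwords d n" "n \<ge> 1"
  shows "cycle_pattern n n \<in> patterns us n"
proof -
  have cl: "us ! n = us ! 0"
    using assms last_conv_nth[of us] hd_conv_nth[of us]
    by (cases "us = []") (auto simp: cyclic_nbwords_def closed_nbwords_def nbwords_def)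
  have v: "cycle_pattern n n t = (if t < n then t else 0)" if "t \<le> n" for t
    using that by (auto simp: cycle_pattern_def)
  have "canon us (cycle_pattern n n) t = cycle_pattern n n t" if t: "t < Suc n" for t
  proof (rule canon_eqI)
    show "us ! cycle_pattern n n t = us ! t" using v[of t] t cl by (cases "t = n") auto
    show "cycle_pattern n n (cycle_pattern n n t) = cycle_pattern n n t" using v[of t] v[of 0] t assms(2) by auto
    fix s' assume "s' < cycle_pattern n n t"
    then show "cycle_pattern n n s' \<noteq> cycle_pattern n n t" using v[of t] v[of s'] t by (auto split: if_splits)
  qed
  then show ?thesis using assms(2) v by (auto simp: patterns_def cycle_pattern_def)
qed

lemma unicyclic_value_full:
  assumes us: "us \<in> cyclic_nbwords d n" and n: "n \<ge> 1"
  shows "unicyclic_value us n lb (cycle_pattern n n) = label_weight lb n * label_trace lb n"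
proof -
  note r = cycle_pattern_in_patterns[OF us n]
  have cf: "card (fresh (cycle_pattern n n) (Suc n)) = n" using n by (simp add: fresh_cycle_pattern)
  have "card (fresh (cycle_pattern n n) (Suc n)) \<le> card (arc us (cycle_pattern n n) lb ` {..<n})"
    by (rule card_fresh_le[OF us n r])
  moreover have "card (arc us (cycle_pattern n n) lb ` {..<n}) \<le> n" using card_image_le[of "{..<n}"] by force
  ultimately have uni: "card (fresh (cycle_pattern n n) (Suc n)) = card (arc us (cycle_pattern n n) lb ` {..<n})"
    using cf by simp
  obtain l where l: "l > 0" "l dvd n" "\<And>t. t \<le> n \<Longrightarrow> cycle_pattern n n t = t mod l"
    "(\<Prod>c\<in>arc us (cycle_pattern n n) lb ` {..<n}. w (clab c)) = (\<Prod>t<l. w (lb t))"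
    using unicyclic_structure[OF us n r uni] by metis
  have "l = n"
  proof (rule ccontr)
    assume "l \<noteq> n"
    moreover have "l \<le> n" using l(2) n by (intro dvd_imp_le) auto
    ultimately have ln: "l < n" by simp
    then have "cycle_pattern n n l = l" by (simp add: cycle_pattern_def)
    then show False using l(3)[of l] l(1) ln by simp
  qed
  then show ?thesis using l(4) uni by (simp add: unicyclic_value_def label_weight_def)
qed

text \<open>A non-injective unicyclic pattern repeats a word of length at most half of \<open>n\<close>, and there are
  only few such words.\<close>

lemma limit_C_estimate:
  assumes n: "n \<ge> 1"
  shows "\<bar>limit_C n - real (card (cyclic_nbwords d n)) * label_moment n\<bar>
    \<le> real k * ((real d + 1) * real d) * real n * sqrt (real d - 1) ^ n"
proof -
  define Cy where "Cy = cyclic_nbwords d n"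
  define Z where "Z = {(us, lb, r). us \<in> Cy \<and> lb \<in> label_words n \<and> r \<in> patterns us n - {cycle_pattern n n} \<and>
     card (fresh r (Suc n)) = card (arc us r lb ` {..<n})}"
  define val where "val us lb r = unicyclic_value us n lb r" for us lb r
  have "limit_C n = (\<Sum>us\<in>Cy. \<Sum>lb\<in>label_words n. \<Sum>r\<in>patterns us n. val us lb r)"
    by (simp add: limit_C_def Cy_def val_def unicyclic_value_def)
  also have "\<dots> = (\<Sum>us\<in>Cy. \<Sum>lb\<in>label_words n. label_weight lb n * label_trace lb n
      + (\<Sum>r\<in>patterns us n - {cycle_pattern n n}. val us lb r))"
  proof (intro sum.cong refl)
    fix us lb assume "us \<in> Cy"
    then show "(\<Sum>r\<in>patterns us n. val us lb r) = label_weight lb n * label_trace lb n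
      + (\<Sum>r\<in>patterns us n - {cycle_pattern n n}. val us lb r)"
      using unicyclic_value_full[of us n lb] cycle_pattern_in_patterns[of us n] n
      by (subst sum.remove[of _ "cycle_pattern n n"]) (auto simp: Cy_def val_def)
  qed
  also have "\<dots> = real (card Cy) * label_moment n
      + (\<Sum>us\<in>Cy. \<Sum>lb\<in>label_words n. \<Sum>r\<in>patterns us n - {cycle_pattern n n}. val us lb r)"
    by (simp add: sum.distrib label_moment_def)
  also have "(\<Sum>us\<in>Cy. \<Sum>lb\<in>label_words n. \<Sum>r\<in>patterns us n - {cycle_pattern n n}. val us lb r)
      = (\<Sum>(us, lb, r)\<in>(SIGMA us:Cy. SIGMA lb:label_words n. patterns us n - {cycle_pattern n n}). val us lb r)"
    by (subst sum.Sigma; (subst sum.Sigma)?) (auto simp: Cy_def)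
  also have "\<dots> = (\<Sum>(us, lb, r)\<in>Z. val us lb r)"
    by (rule sum.mono_neutral_right) (auto simp: Z_def Cy_def val_def unicyclic_value_def)
  finally have eq: "limit_C n - real (card Cy) * label_moment n = (\<Sum>(us, lb, r)\<in>Z. val us lb r)" by simp
  have str: "\<exists>l. 0 < l \<and> l \<le> n div 2 \<and> (\<forall>t\<le>n. us ! t = us ! (t mod l)) \<and> (\<forall>t<n. lb t = lb (t mod l)) \<and>
      r = cycle_pattern n l \<and> val us lb r = label_trace lb n * label_weight lb l \<and> l = card (fresh r (Suc n))"
    if z: "(us, lb, r) \<in> Z" for us lb r
  proof -
    have h: "us \<in> cyclic_nbwords d n" "r \<in> patterns us n" "r \<noteq> cycle_pattern n n"
      "card (fresh r (Suc n)) = card (arc us r lb ` {..<n})" using z by (auto simp: Z_def Cy_def)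
    obtain l where l: "l > 0" "l dvd n" "\<And>t. t \<le> n \<Longrightarrow> r t = t mod l" "\<And>t. t \<le> n \<Longrightarrow> us ! t = us ! (t mod l)"
      "\<And>t. t < n \<Longrightarrow> lb t = lb (t mod l)" "(\<Prod>c\<in>arc us r lb ` {..<n}. w (clab c)) = (\<Prod>t<l. w (lb t))"
      using unicyclic_structure[OF h(1) n h(2,4)] by metis
    have rl: "r = cycle_pattern n l"
    proof
      fix t show "r t = cycle_pattern n l t"
        using l(3)[of t] PiE_arb[of r "{..<Suc n}" "\<lambda>_. {..<Suc n}" t] h(2)
        by (cases "t \<le> n") (auto simp: cycle_pattern_def patterns_def)
    qed
    then have "l \<noteq> n" using h(3) by auto
    obtain c where c: "n = l * c" using l(2) by (auto simp: dvd_def)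
    have "c \<ge> 2" using c \<open>l \<noteq> n\<close> n by (cases c; cases "c - 1") auto
    then have "l * 2 \<le> n" unfolding c by (rule mult_le_mono2)
    then have "l \<le> n div 2" by simp
    have cl: "card (fresh r (Suc n)) = l"
      using \<open>l * 2 \<le> n\<close> l(1) unfolding rl by (subst fresh_cycle_pattern) auto
    have "val us lb r = label_trace lb n * label_weight lb l"
      unfolding val_def unicyclic_value_def label_weight_def using h(4) l(6) by simp
    then show ?thesis
      using l(1,4,5) rl cl \<open>l \<le> n div 2\<close> by (intro exI[of _ l] conjI allI impI) (assumption | rule refl | simp)+
  qed
  define L where "L r = card (fresh r (Suc n))" for r
  \<comment> \<open>A repeated walk is determined by its first period: length, letters and labels.
    Its weight is that of these labels, so summing over the labels leaves at most k for each
    word.\<close>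
  define key where "key = (\<lambda>(us :: nat list, lb :: nat \<Rightarrow> 'l, r). (L r, take (Suc (L r)) us, restrict lb {..<L r}))"
  define T where "T = (SIGMA l:{1..n div 2}. nbwords d l \<times> label_words l)"
  have finT: "finite T" by (auto simp: T_def)
  have keyT: "key z \<in> T \<and> (case z of (us, lb, r) \<Rightarrow> 0 \<le> val us lb r \<and> val us lb r \<le> (case key z of (l, us', lb') \<Rightarrow> real k * label_weight lb' l))"
    if z: "z \<in> Z" for z
  proof -
    obtain us lb r where ulr: "z = (us, lb, r)" by (cases z)
    obtain l where l: "0 < l" "l \<le> n div 2" "val us lb r = label_trace lb n * label_weight lb l" "l = L r"
      using str z unfolding ulr L_def by blast
    have us: "us \<in> nbwords d n" and lb: "lb \<in> label_words n"
      using z by (auto simp: ulr Z_def Cy_def cyclic_nbwords_def closed_nbwords_def)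
    have ln: "l \<le> n" using l(2) by linarith
    have "take (Suc l) us \<in> nbwords d l"
      using us ln set_take_subset[of "Suc l" us] by (auto simp: nbwords_def nonbacktracking_def)
    moreover have "lb t \<in> \<Lambda>" if "t < l" for t
      using that ln lb[unfolded label_words_def] by (intro PiE_mem[of lb "{..<n}" "\<lambda>_. \<Lambda>" t]) simp_all
    then have "restrict lb {..<l} \<in> label_words l"
      unfolding label_words_def restrict_PiE_iff by simp
    ultimately have k1: "key z \<in> T" using l by (auto simp: T_def key_def ulr)
    have lw: "label_weight (restrict lb {..<l}) l = label_weight lb l" by (simp add: label_weight_def)
    have "0 \<le> label_weight lb l" by (rule label_weight_nonneg[OF lb ln])
    then have "0 \<le> val us lb r" "val us lb r \<le> real k * label_weight lb l"
      unfolding l(3) using label_trace_bounds[of lb n] by (auto intro: mult_right_mono)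
    then show ?thesis using k1 l(4) lw by (simp add: ulr key_def)
  qed
  have inj: "inj_on key Z"
  proof (rule inj_onI)
    fix z z' assume z: "z \<in> Z" "z' \<in> Z" "key z = key z'"
    obtain us lb r where ulr: "z = (us, lb, r)" by (cases z)
    obtain us' lb' r' where ulr': "z' = (us', lb', r')" by (cases z')
    obtain l where l: "0 < l" "l \<le> n div 2" "\<And>t. t \<le> n \<Longrightarrow> us ! t = us ! (t mod l)" "\<And>t. t < n \<Longrightarrow> lb t = lb (t mod l)"
      "r = cycle_pattern n l" "l = L r"
      using str z(1) unfolding ulr L_def by blast
    obtain l' where l': "\<And>t. t \<le> n \<Longrightarrow> us' ! t = us' ! (t mod l')" "\<And>t. t < n \<Longrightarrow> lb' t = lb' (t mod l')"
      "r' = cycle_pattern n l'" "l' = L r'"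
      using str z(2) unfolding ulr' L_def by blast
    have ll: "l' = l" and tk: "take (Suc l) us = take (Suc l) us'" and rs: "restrict lb {..<l} = restrict lb' {..<l}"
      using z(3) l(6) l'(4) by (auto simp: key_def ulr ulr')
    have len: "length us = Suc n" "length us' = Suc n"
      using z by (auto simp: ulr ulr' Z_def Cy_def cyclic_nbwords_def closed_nbwords_def nbwords_def)
    have ml: "t mod l < l" for t using l(1) by simp
    have "us = us'"
    proof (rule nth_equalityI)
      fix t assume t: "t < length us"
      have "us ! (t mod l) = take (Suc l) us ! (t mod l)" using ml[of t] by simp
      also have "\<dots> = us' ! (t mod l)" unfolding tk using ml[of t] by simp
      finally show "us ! t = us' ! t" using l(3)[of t] l'(1)[of t] t len ll by simp
    qed (simp add: len)
    moreover have "lb = lb'"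
    proof
      fix t
      have "lb (t mod l) = lb' (t mod l)" using fun_cong[OF rs, of "t mod l"] ml[of t] by simp
      then show "lb t = lb' t"
        using l(4)[of t] l'(2)[of t] ll z(1,2) PiE_arb[of lb "{..<n}" "\<lambda>_. \<Lambda>" t] PiE_arb[of lb' "{..<n}" "\<lambda>_. \<Lambda>" t]
        by (cases "t < n") (auto simp: ulr ulr' Z_def label_words_def)
    qed
    ultimately show "z = z'" using l(5) l'(3) ll by (simp add: ulr ulr')
  qed
  have s1: "sqrt (real d - 1) \<ge> 1" using d by simp
  have "(\<Sum>(us, lb, r)\<in>Z. val us lb r) \<le> (\<Sum>z\<in>Z. case key z of (l, us', lb') \<Rightarrow> real k * label_weight lb' l)"
    by (rule sum_mono) (use keyT in force)
  also have "\<dots> = (\<Sum>(l, us', lb')\<in>key ` Z. real k * label_weight lb' l)"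
    by (subst sum.reindex[OF inj]) simp
  also have "\<dots> \<le> (\<Sum>(l, us', lb')\<in>T. real k * label_weight lb' l)"
  proof (rule sum_mono2[OF finT])
    show "key ` Z \<subseteq> T" using keyT by blast
    fix z assume "z \<in> T - key ` Z"
    moreover obtain l us' lb' where "z = (l, us', lb')" by (cases z)
    ultimately show "0 \<le> (case z of (l, us', lb') \<Rightarrow> real k * label_weight lb' l)"
      using label_weight_nonneg[of lb' l l] by (simp add: T_def)
  qed
  also have "\<dots> = (\<Sum>l\<in>{1..n div 2}. \<Sum>us'\<in>nbwords d l. \<Sum>lb'\<in>label_words l. real k * label_weight lb' l)"
    unfolding T_def sum.cartesian_product by (rule sum.Sigma[symmetric]) auto
  also have "\<dots> = (\<Sum>l\<in>{1..n div 2}. real (card (nbwords d l)) * real k)"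
    by (simp add: sum_label_weight flip: sum_distrib_left)
  also have "\<dots> \<le> (\<Sum>l\<in>{1..n div 2}. (real d + 1) * real d * sqrt (real d - 1) ^ n * real k)"
  proof (intro sum_mono mult_right_mono)
    fix l assume l: "l \<in> {1..n div 2}"
    then obtain m where m: "l = Suc m" by (cases l) auto
    have "real (card (nbwords d l)) \<le> (real d + 1) * real d * (real d - 1) ^ m"
      unfolding m by (rule card_nbwords_le[OF d])
    also have "(real d - 1) ^ m = sqrt (real d - 1) ^ (2 * m)" using d by (simp add: power_mult)
    also have "(real d + 1) * real d * sqrt (real d - 1) ^ (2 * m) \<le> (real d + 1) * real d * sqrt (real d - 1) ^ n"
      using l m s1 by (intro mult_left_mono power_increasing) auto
    finally show "real (card (nbwords d l)) \<le> (real d + 1) * real d * sqrt (real d - 1) ^ n" .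
  qed simp
  also have "\<dots> = real (n div 2) * ((real d + 1) * real d * sqrt (real d - 1) ^ n * real k)" by simp
  also have "\<dots> \<le> real n * ((real d + 1) * real d * sqrt (real d - 1) ^ n * real k)"
    using s1 by (intro mult_right_mono) auto
  finally have up: "(\<Sum>(us, lb, r)\<in>Z. val us lb r) \<le> real k * ((real d + 1) * real d) * real n * sqrt (real d - 1) ^ n"
    by (simp add: mult_ac)
  have "0 \<le> (\<Sum>(us, lb, r)\<in>Z. val us lb r)" by (rule sum_nonneg) (use keyT in force)
  then show ?thesis using up eq by (simp add: Cy_def)
qed

end

text \<open>The vectors \<open>\<xi> j\<close> form an orthonormal eigenbasis of the averaged label operator.  The walks that run once around a
  cycle contribute \<open>(\<Sum>j<k. \<alpha> j ^ n)\<close> to the limit of the traces, which puts an eigenvalue at \<open>\<alpha> j + s / \<alpha> j\<close>.\<close>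

locale spectral_label_model = label_model +
  fixes \<xi> :: "nat \<Rightarrow> nat \<Rightarrow> real" and \<tau> :: "nat \<Rightarrow> real"
  assumes eigvec: "\<And>i j. i < k \<Longrightarrow> j < k \<Longrightarrow> (\<Sum>l\<in>\<Lambda>. w l * \<xi> j (pm l i)) = \<tau> j * \<xi> j i"
    and complete: "\<And>i i'. i < k \<Longrightarrow> i' < k \<Longrightarrow> (\<Sum>j<k. \<xi> j i * \<xi> j i') = (if i = i' then 1 else 0)"
    and normalized: "\<And>j. j < k \<Longrightarrow> (\<Sum>i<k. (\<xi> j i)\<^sup>2) = 1"
    and \<tau>_le: "\<And>j. j < k \<Longrightarrow> \<tau> j \<le> 1"
    and \<tau>_gt: "\<And>j. j < k \<Longrightarrow> sqrt (real d - 1) < \<tau> j * (real d - 1)"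
begin

definition s :: real where "s = real d - 1"

definition \<alpha> :: "nat \<Rightarrow> real" where "\<alpha> j = \<tau> j * s"

definition outlier :: "nat \<Rightarrow> real" where "outlier j = \<alpha> j + s / \<alpha> j"

lemma s_ge_2: "s \<ge> 2" using d by (simp add: s_def)

lemma \<alpha>_bounds: "j < k \<Longrightarrow> sqrt s < \<alpha> j" "j < k \<Longrightarrow> \<alpha> j \<le> s" "j < k \<Longrightarrow> \<alpha> j > 0"
proof -
  assume j: "j < k"
  show "sqrt s < \<alpha> j" using \<tau>_gt[OF j] by (simp add: \<alpha>_def s_def)
  then show "\<alpha> j > 0" using s_ge_2 by (meson less_trans real_sqrt_gt_zero less_le_trans zero_less_numeral)
  show "\<alpha> j \<le> s" using \<tau>_le[OF j] s_ge_2 by (simp add: \<alpha>_def mult_left_le_one_le)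
qed

lemma \<beta>_bounds: "j < k \<Longrightarrow> 0 < s / \<alpha> j" "j < k \<Longrightarrow> s / \<alpha> j < sqrt s"
proof -
  assume j: "j < k"
  show "0 < s / \<alpha> j" using \<alpha>_bounds[OF j] s_ge_2 by simp
  have "s = sqrt s * sqrt s" using s_ge_2 by simp
  also have "\<dots> < sqrt s * \<alpha> j" using \<alpha>_bounds(1)[OF j] s_ge_2 by (intro mult_strict_left_mono) auto
  finally show "s / \<alpha> j < sqrt s" using \<alpha>_bounds[OF j] by (simp add: field_simps)
qed

lemma outlier_bounds: "j < k \<Longrightarrow> 2 * sqrt s < outlier j" "j < k \<Longrightarrow> outlier j \<le> real d"
proof -
  assume j: "j < k"
  note a = \<alpha>_bounds[OF j]
  have "0 < (\<alpha> j - sqrt s)\<^sup>2" using a by simp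
  also have "\<dots> = \<alpha> j * (outlier j - 2 * sqrt s)"
    using a s_ge_2 by (simp add: outlier_def power2_eq_square field_simps)
  finally show "2 * sqrt s < outlier j" using a by (simp add: zero_less_mult_iff)
  have "(s - \<alpha> j) * (\<alpha> j - 1) \<ge> 0"
  proof -
    have "1 \<le> sqrt s" using s_ge_2 by simp
    then show ?thesis using a by (intro mult_nonneg_nonneg) linarith+
  qed
  also have "(s - \<alpha> j) * (\<alpha> j - 1) = \<alpha> j * (s + 1 - outlier j)"
    using a by (simp add: outlier_def field_simps)
  finally show "outlier j \<le> real d" using a by (simp add: zero_le_mult_iff s_def)
qed

lemma relabel_less: "lb \<in> label_words n \<Longrightarrow> m \<le> n \<Longrightarrow> i < k \<Longrightarrow> relabel pm lb m i < k"
proof (induction m)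
  case (Suc m)
  have "lb m \<in> \<Lambda>" using Suc.prems by (intro PiE_mem[of lb "{..<n}" "\<lambda>_. \<Lambda>"]) (simp_all add: label_words_def)
  then show ?case using Suc by (simp add: pm_in)
qed simp

lemma sum_label_words_eigvec:
  assumes "i < k" "j < k"
  shows "(\<Sum>lb\<in>label_words n. label_weight lb n * \<xi> j (relabel pm lb n i)) = \<tau> j ^ n * \<xi> j i"
proof (induction n)
  case 0
  then show ?case by (simp add: label_words_def label_weight_def)
next
  case (Suc n)
  have "(\<Sum>lb\<in>label_words (Suc n). label_weight lb (Suc n) * \<xi> j (relabel pm lb (Suc n) i)) =
    (\<Sum>lb\<in>label_words n. \<Sum>l\<in>\<Lambda>. label_weight (lb(n := l)) (Suc n) * \<xi> j (relabel pm (lb(n := l)) (Suc n) i))"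
    unfolding label_words_def by (rule sum_PiE_Suc)
  also have "\<dots> = (\<Sum>lb\<in>label_words n. label_weight lb n * (\<Sum>l\<in>\<Lambda>. w l * \<xi> j (pm l (relabel pm lb n i))))"
  proof (intro sum.cong refl)
    fix lb
    have "relabel pm (lb(n := l)) n i = relabel pm lb n i" for l by (rule relabel_cong) simp
    then show "(\<Sum>l\<in>\<Lambda>. label_weight (lb(n := l)) (Suc n) * \<xi> j (relabel pm (lb(n := l)) (Suc n) i)) =
        label_weight lb n * (\<Sum>l\<in>\<Lambda>. w l * \<xi> j (pm l (relabel pm lb n i)))"
      by (simp add: label_weight_def sum_distrib_left mult.assoc)
  qed
  also have "\<dots> = (\<Sum>lb\<in>label_words n. \<tau> j * (label_weight lb n * \<xi> j (relabel pm lb n i)))"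
    using assms relabel_less by (intro sum.cong refl) (simp add: eigvec)
  also have "\<dots> = \<tau> j ^ Suc n * \<xi> j i" using Suc by (simp flip: sum_distrib_left)
  finally show ?case .
qed

text \<open>The \<xi> j resolve the identity, so the trace is the sum of their quadratic forms, and
  each further label multiplies \<xi> j by \<tau> j on average.\<close>

lemma label_moment_eq: "label_moment n = (\<Sum>j<k. \<tau> j ^ n)"
proof -
  have lt: "label_trace lb n = (\<Sum>i<k. \<Sum>j<k. \<xi> j i * \<xi> j (relabel pm lb n i))" if "lb \<in> label_words n" for lb
    unfolding label_trace_def using that relabel_less by (intro sum.cong refl) (auto simp: complete)
  have "label_moment n = (\<Sum>lb\<in>label_words n. \<Sum>i<k. \<Sum>j<k. \<xi> j i * (label_weight lb n * \<xi> j (relabel pm lb n i)))"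
    unfolding label_moment_def by (intro sum.cong refl) (simp add: lt sum_distrib_left mult_ac)
  also have "\<dots> = (\<Sum>i<k. \<Sum>lb\<in>label_words n. \<Sum>j<k. \<xi> j i * (label_weight lb n * \<xi> j (relabel pm lb n i)))"
    by (rule sum.swap)
  also have "\<dots> = (\<Sum>i<k. \<Sum>j<k. \<Sum>lb\<in>label_words n. \<xi> j i * (label_weight lb n * \<xi> j (relabel pm lb n i)))"
    by (rule sum.cong[OF refl], rule sum.swap)
  also have "\<dots> = (\<Sum>i<k. \<Sum>j<k. \<tau> j ^ n * (\<xi> j i)\<^sup>2)"
    by (intro sum.cong refl) (simp add: sum_label_words_eigvec power2_eq_square flip: sum_distrib_left)
  also have "\<dots> = (\<Sum>j<k. \<Sum>i<k. \<tau> j ^ n * (\<xi> j i)\<^sup>2)" by (rule sum.swap)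
  also have "\<dots> = (\<Sum>j<k. \<tau> j ^ n)"
    by (intro sum.cong refl) (simp add: normalized flip: sum_distrib_left)
  finally show ?thesis .
qed

text \<open>The main term s^n \<tau>_j^n = \<alpha>_j^n is one of the two summands of the Dickson
  value; the other one, (s/\<alpha>_j)^n, is below (sqrt s)^n. With the errors of the word count and
  of the repeated walks this makes three contributions, whence the factor 3.\<close>

lemma limit_C_dickson:
  assumes n: "n \<ge> 1"
  shows "\<bar>limit_C n - (\<Sum>j<k. poly (dickson s n) (outlier j))\<bar> \<le> 3 * real k * (real d + 2)\<^sup>2 * real n * sqrt s ^ n"
proof -
  have s1: "sqrt s \<ge> 1" using s_ge_2 by simp
  have tpow: "0 \<le> \<tau> j ^ n" "\<tau> j ^ n \<le> 1" if "j < k" for j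
  proof -
    have "0 < \<tau> j" using \<alpha>_bounds(3)[OF that] s_ge_2 by (simp add: \<alpha>_def zero_less_mult_iff)
    then show "0 \<le> \<tau> j ^ n" "\<tau> j ^ n \<le> 1" using \<tau>_le[OF that] by (auto intro: power_le_one)
  qed
  have m: "0 \<le> label_moment n" "label_moment n \<le> real k"
    unfolding label_moment_eq using tpow sum_mono[of "{..<k}" "\<lambda>j. \<tau> j ^ n" "\<lambda>_. 1"] by (auto intro!: sum_nonneg)
  have dk: "poly (dickson s n) (outlier j) = s ^ n * \<tau> j ^ n + (s / \<alpha> j) ^ n" if "j < k" for j
    using poly_dickson_add[of "\<alpha> j" "s / \<alpha> j" s n] \<alpha>_bounds(3)[OF that]
    by (simp add: outlier_def) (simp add: \<alpha>_def power_mult_distrib mult.commute)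
  have "(\<Sum>j<k. poly (dickson s n) (outlier j)) = s ^ n * label_moment n + (\<Sum>j<k. (s / \<alpha> j) ^ n)"
    by (simp add: dk label_moment_eq sum.distrib sum_distrib_left)
  moreover have "0 \<le> (\<Sum>j<k. (s / \<alpha> j) ^ n)" "(\<Sum>j<k. (s / \<alpha> j) ^ n) \<le> real k * sqrt s ^ n"
  proof -
    show "0 \<le> (\<Sum>j<k. (s / \<alpha> j) ^ n)" by (intro sum_nonneg zero_le_power less_imp_le \<beta>_bounds) auto
    have "(\<Sum>j<k. (s / \<alpha> j) ^ n) \<le> (\<Sum>j<k. sqrt s ^ n)"
      by (intro sum_mono power_mono less_imp_le \<beta>_bounds) auto
    then show "(\<Sum>j<k. (s / \<alpha> j) ^ n) \<le> real k * sqrt s ^ n" by simp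
  qed
  moreover have "\<bar>real (card (cyclic_nbwords d n)) * label_moment n - s ^ n * label_moment n\<bar> \<le> (real d + 2)\<^sup>2 * sqrt s ^ n * real k"
  proof -
    have "real (card (cyclic_nbwords d n)) * label_moment n - s ^ n * label_moment n =
        (real (card (cyclic_nbwords d n)) - s ^ n) * label_moment n" by (simp add: algebra_simps)
    also have "\<bar>\<dots>\<bar> \<le> (real d + 2)\<^sup>2 * sqrt s ^ n * real k"
      unfolding abs_mult using card_cyclic_nbwords[OF d n] m s1 by (intro mult_mono) (auto simp: s_def)
    finally show ?thesis .
  qed
  moreover note limit_C_estimate[OF n, folded s_def]
  ultimately have "\<bar>limit_C n - (\<Sum>j<k. poly (dickson s n) (outlier j))\<bar> \<le>
     real k * ((real d + 1) * real d) * real n * sqrt s ^ n + (real d + 2)\<^sup>2 * sqrt s ^ n * real k + real k * sqrt s ^ n"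
    by linarith
  also have "\<dots> = real k * sqrt s ^ n * ((real d + 1) * real d * real n + (real d + 2)\<^sup>2 * 1 + 1 * 1)"
    by (simp add: algebra_simps)
  also have "\<dots> \<le> real k * sqrt s ^ n * ((real d + 2)\<^sup>2 * real n + (real d + 2)\<^sup>2 * real n + (real d + 2)\<^sup>2 * real n)"
  proof (intro mult_left_mono add_mono mult_right_mono mult_mono)
    show "(real d + 1) * real d \<le> (real d + 2)\<^sup>2" by (simp add: power2_eq_square algebra_simps)
    show "1 \<le> (real d + 2)\<^sup>2" by (rule one_le_power) simp
  qed (use n s1 in auto)
  finally show ?thesis by (simp add: algebra_simps)
qed

end

section \<open>Effective estimates for expected traces\<close>

context label_model
begin

abbreviation lift_trace :: "nat \<Rightarrow> real poly \<Rightarrow> 'l sample \<Rightarrow> real" where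
  "lift_trace N g \<omega> \<equiv> complete_lift.trace d (fiber N) (lift \<omega>) g"

abbreviation lift_C :: "nat \<Rightarrow> nat \<Rightarrow> 'l sample \<Rightarrow> real" where
  "lift_C N n \<omega> \<equiv> complete_lift.C d (fiber N) (lift \<omega>) n"

lemma card_fiber: "card (fiber N) = N * k"
  by (simp add: fiber_def)

lemma denominator_le_1:
  assumes "q < N"
  shows "denominator q (1 / real N) \<le> 1"
  unfolding denominator_def using assms by (intro prod_le_1 conjI prod_nonneg) (auto simp: field_simps)

lemma denominator_ge:
  assumes "q < N"
  shows "1 - real (card edges) * real q ^ 2 / real N \<le> denominator q (1 / real N)"
proof -
  have "1 + real (q * card edges) * (- (real q / real N)) \<le> (1 + - (real q / real N)) ^ (q * card edges)"
    using assms by (intro Bernoulli_inequality) (simp add: field_simps)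
  also have "\<dots> = (\<Prod>e\<in>edges. \<Prod>j<q. 1 - real q / real N)" by (simp add: power_mult)
  also have "\<dots> \<le> denominator q (1 / real N)"
    unfolding denominator_def
  proof (intro prod_mono conjI prod_nonneg)
    fix j assume "j \<in> {..<q}"
    then show "1 - real q / real N \<le> 1 - real j * (1 / real N)" "0 \<le> 1 - real q / real N"
      using assms by (auto simp: field_simps)
  qed (use assms in \<open>auto simp: field_simps\<close>)
  finally show ?thesis by (simp add: power2_eq_square field_simps)
qed

lemma lift_trace_le:
  assumes \<omega>: "\<omega> \<in> samples N" and g: "\<And>x. \<bar>x\<bar> \<le> real d \<Longrightarrow> \<bar>poly g x\<bar> \<le> S"
  shows "\<bar>lift_trace N g \<omega>\<bar> \<le> real (d + 1) * real (N * k) * S"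
proof -
  interpret L: complete_lift d "fiber N" "lift \<omega>" by (rule complete_lift_lift) fact
  obtain G :: "nat pair_pre_digraph" where G: "pair_graph G" "card (pverts G) = (d + 1) * card (fiber N)"
    "\<And>p. L.trace p = (\<Sum>x\<leftarrow>adjacency_eigenvalues G. poly p x)"
    using L.lift_graph by metis
  have "\<bar>L.trace g\<bar> \<le> (\<Sum>x\<leftarrow>adjacency_eigenvalues G. \<bar>poly g x\<bar>)"
    unfolding G(3) by (rule order_trans[OF sum_list_abs]) (simp add: o_def)
  also have "\<dots> \<le> (\<Sum>x\<leftarrow>adjacency_eigenvalues G. S)"
    by (intro sum_list_mono g L.eigenvalue_abs_le[OF G(3)])
  also have "\<dots> = real (d + 1) * real (N * k) * S"
    using length_adjacency_eigenvalues[OF G(1)] G(2) by (simp add: sum_list_triv card_fiber algebra_simps)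
  finally show ?thesis .
qed

end

context spectral_label_model
begin

text \<open>By \<open>trace_dickson\<close> the terms proportional to the number of vertices are the
  same for every sample; only the cyclic counts are random.\<close>

lemma lift_trace_expansion:
  assumes \<omega>: "\<omega> \<in> samples N" and b: "g = (\<Sum>n\<le>q. Polynomial.smult (b n) (dickson s n))"
  shows "lift_trace N g \<omega> = real (d + 1) * real (N * k) * (2 * b 0 - (\<Sum>n=1..q. b n * (if even n then s - 1 else 0)))
    + (\<Sum>n=1..q. b n * lift_C N n \<omega>)"
proof -
  interpret L: complete_lift d "fiber N" "lift \<omega>" by (rule complete_lift_lift) fact
  have s: "L.s = s" by (simp add: L.s_def s_def)
  define V where "V = real (d + 1) * real (N * k)"
  have "L.trace g = (\<Sum>n\<le>q. b n * L.trace (dickson s n))"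
    unfolding b L.trace_sum L.trace_smult ..
  also have "{..q} = insert 0 {1..q}" by auto
  also have "(\<Sum>n\<in>insert 0 {1..q}. b n * L.trace (dickson s n)) = b 0 * L.trace (dickson s 0) + (\<Sum>n=1..q. b n * L.trace (dickson s n))"
    by simp
  also have "L.trace (dickson s 0) = 2 * V" by (simp add: L.trace_const card_fiber V_def)
  also have "(\<Sum>n=1..q. b n * L.trace (dickson s n)) = (\<Sum>n=1..q. b n * L.C n - V * (b n * (if even n then s - 1 else 0)))"
  proof (intro sum.cong refl)
    fix n assume "n \<in> {1..q}"
    then have "L.trace (dickson s n) = L.C n - (if even n then (s - 1) * V else 0)"
      using L.trace_dickson[of n] by (simp add: s card_fiber V_def)
    then have "L.trace (dickson s n) = L.C n - V * (if even n then s - 1 else 0)" by (simp only: mult.commute) auto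
    then show "b n * L.trace (dickson s n) = b n * L.C n - V * (b n * (if even n then s - 1 else 0))"
      by (simp only: right_diff_distrib mult_ac)
  qed
  also have "\<dots> = (\<Sum>n=1..q. b n * L.C n) - V * (\<Sum>n=1..q. b n * (if even n then s - 1 else 0))"
    by (simp only: sum_subtractf sum_distrib_left)
  finally show ?thesis by (simp add: V_def algebra_simps)
qed

text \<open>The polynomial method: up to \<open>denominator\<close>, the expected trace is a polynomial in \<open>1 / N\<close> that is bounded a priori
  at all \<open>1 / N\<close>, so Markov's inequality controls its deviation from its value at \<open>0\<close>.\<close>

theorem expected_trace:
  obtains B :: real where "B \<ge> 1" "\<And>q g S S' N. q \<ge> 1 \<Longrightarrow> degree g \<le> q \<Longrightarrow>
      (\<And>x. \<bar>x\<bar> \<le> 2 * sqrt s \<Longrightarrow> \<bar>poly g x\<bar> \<le> S) \<Longrightarrow>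
      (\<And>x. \<bar>x\<bar> \<le> real d \<Longrightarrow> \<bar>poly g x\<bar> \<le> S') \<Longrightarrow> S \<le> S' \<Longrightarrow> B * real q ^ 15 \<le> real N \<Longrightarrow>
      \<bar>expect N (lift_trace N g) - (\<Sum>j<k. poly g (outlier j))\<bar> \<le> B * real q ^ 15 * (real N * S + S' / real N)"
proof -
  define E where "E = card edges"
  \<comment> \<open>The numerators have degree at most (E + 1) q, and multiplying by z adds one, so
    e q bounds the degree of \<open>P\<close>.\<close>
  define e where "e = E + 2"
  define K where "K = real k"
  define dd where "dd = real d"
  define c where "c = 3 * K * (dd + 2)\<^sup>2"
  \<comment> \<open>4096 = 32 * 64 * 2: the constant of \<open>inverse_nat_extrapolation\<close>,
    the 8^2 from M^2 with M = 8 (e q)^3, and the 2 in \<open>S1\<close>. The powers of q add up to 6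
    + 6 + 1 = 13; the common denominator contributes q^2 more, which explains q^15.\<close>
  define c1 where "c1 = 4096 * real e ^ 12 * (dd * (dd + 1) * K)"
  define B where "B = c1 + 2 * real E * (3 * K + c + c1) + (c + 2 * K + (dd + 1) * K * dd) + 8 * real e ^ 3"
  have nn: "K \<ge> 0" "dd \<ge> 3" "c \<ge> 0" "c1 \<ge> 0"
    using d by (auto simp: K_def dd_def c_def c1_def)
  have e2: "real e \<ge> 2" by (simp add: e_def)
  have Bp: "c1 + 2 * real E * (3 * K + c + c1) \<le> B" "c + 2 * K + (dd + 1) * K * dd \<le> B" "8 * real e ^ 3 \<le> B" "1 \<le> B"
  proof -
    have "0 \<le> 2 * real E * (3 * K + c + c1)" "0 \<le> (dd + 1) * K * dd" "1 \<le> real e ^ 3"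
      using nn e2 by (auto intro: one_le_power)
    then show "c1 + 2 * real E * (3 * K + c + c1) \<le> B" "c + 2 * K + (dd + 1) * K * dd \<le> B" "8 * real e ^ 3 \<le> B" "1 \<le> B"
      using nn unfolding B_def by linarith+
  qed
  have s1: "sqrt s \<ge> 1" using s_ge_2 by simp
  show ?thesis
  proof (rule that[OF Bp(4)])
    fix q g S S' N
    assume q: "q \<ge> 1" and deg: "degree g \<le> q" and S: "\<And>x. \<bar>x\<bar> \<le> 2 * sqrt s \<Longrightarrow> \<bar>poly g x\<bar> \<le> S"
      and S': "\<And>x. \<bar>x\<bar> \<le> real d \<Longrightarrow> \<bar>poly g x\<bar> \<le> S'" and SS: "S \<le> S'" and N: "B * real q ^ 15 \<le> real N"
    define rq where "rq = real q"
    have rq: "rq \<ge> 1" using q by (simp add: rq_def)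
    have S0: "S \<ge> 0" using S[of 0] s1 by fastforce
    obtain b where b: "g = (\<Sum>n\<le>q. Polynomial.smult (b n) (dickson s n))" using dickson_expansion[OF deg] by blast
    have bS: "\<bar>b n\<bar> * sqrt s ^ n \<le> S" if "n \<le> q" for n
      using s_ge_2 by (intro dickson_coeff_bound[OF _ b S that]) auto
    have bS1: "\<bar>b n\<bar> \<le> S" if "n \<le> q" for n
    proof -
      have "\<bar>b n\<bar> * 1 \<le> \<bar>b n\<bar> * sqrt s ^ n" using s1 by (intro mult_left_mono one_le_power) auto
      then show ?thesis using bS[OF that] by simp
    qed
    \<comment> \<open>The mean of g under the spectral law of the infinite d-regular tree, hence the
      term of order N. A bound is enough because g is small on the bulk.\<close>
    define a0 where "a0 = 2 * b 0 - (\<Sum>n=1..q. b n * (if even n then s - 1 else 0))"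
    have a0: "\<bar>a0\<bar> \<le> dd * rq * S"
    proof -
      have "\<bar>\<Sum>n=1..q. b n * (if even n then s - 1 else 0)\<bar> \<le> (\<Sum>n=1..q. S * (s - 1))"
      proof (rule order_trans[OF sum_abs], rule sum_mono)
        fix n assume "n \<in> {1..q}"
        then show "\<bar>b n * (if even n then s - 1 else 0)\<bar> \<le> S * (s - 1)"
          unfolding abs_mult using bS1[of n] s_ge_2 S0 by (intro mult_mono) auto
      qed
      then have "\<bar>a0\<bar> \<le> 2 * S + rq * (S * (s - 1))"
        using bS1[of 0] unfolding a0_def rq_def by simp
      also have "\<dots> \<le> 2 * (rq * S) + rq * (S * (s - 1))"
        using rq S0 mult_right_mono[of 1 rq S] by simp
      also have "\<dots> = dd * rq * S" by (simp add: s_def dd_def algebra_simps)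
      finally show ?thesis .
    qed
    define EC where "EC N = (\<Sum>n=1..q. b n * expect N (lift_C N n))" for N
    define V where "V N = (dd + 1) * (real N * K)" for N :: nat
    have Etr: "expect N (lift_trace N g) = V N * a0 + EC N" for N
    proof -
      have "expect N (lift_trace N g) = expect N (\<lambda>\<omega>. V N * a0 + (\<Sum>n=1..q. b n * lift_C N n \<omega>))"
        by (intro expect_cong) (simp only: lift_trace_expansion[OF _ b] V_def a0_def dd_def K_def of_nat_mult of_nat_add of_nat_1)
      also have "\<dots> = V N * a0 + EC N"
        unfolding expect_add expect_const expect_sum expect_scale EC_def ..
      finally show ?thesis .
    qed
    have "\<exists>Q. degree Q \<le> (E + 1) * q \<and> poly Q 0 = limit_C n \<and>
      (\<forall>N>q. expect N (lift_C N n) * denominator q (1 / real N) = poly Q (1 / real N))" if "n \<in> {1..q}" for n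
      using expect_C_rational[of n q] that unfolding E_def by (metis atLeastAtMost_iff)
    then obtain Q where Q: "\<And>n. n \<in> {1..q} \<Longrightarrow> degree (Q n) \<le> (E + 1) * q" "\<And>n. n \<in> {1..q} \<Longrightarrow> poly (Q n) 0 = limit_C n"
      "\<And>n N. n \<in> {1..q} \<Longrightarrow> N > q \<Longrightarrow> expect N (lift_C N n) * denominator q (1 / real N) = poly (Q n) (1 / real N)"
      by metis
    define R where "R = (\<Sum>n=1..q. Polynomial.smult (b n) (Q n))"
    define L where "L = (\<Sum>n=1..q. b n * limit_C n)"
    have R0: "poly R 0 = L" by (simp add: R_def L_def poly_sum Q(2))
    have RN: "poly R (1 / real N) = EC N * denominator q (1 / real N)" if "N > q" for N
      unfolding R_def EC_def poly_sum sum_distrib_right using that by (intro sum.cong refl) (simp add: Q(3)[symmetric])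
    have degR: "degree R \<le> (E + 1) * q"
      unfolding R_def by (intro degree_sum_le order_trans[OF degree_smult_le] Q(1)) auto
    \<comment> \<open>The a priori bound on \<open>EC N\<close> is of order N, so it does not bound
      R at the points 1/N; it does bound z R(z), whose derivative at 0 is the wanted R(0) =
      L.\<close>
    define P where "P = pCons 0 R"
    define D where "D = e * q"
    define M where "M = 8 * D ^ 3"
    have D1: "D \<ge> 1" using q by (simp add: D_def e_def)
    have degP: "degree P \<le> D"
    proof -
      have "degree P \<le> Suc (degree R)" unfolding P_def by (rule degree_pCons_le)
      also have "\<dots> \<le> Suc ((E + 1) * q)" using degR by simp
      also have "\<dots> \<le> D" using q by (simp add: D_def e_def)
      finally show ?thesis .
    qed
    have qM: "q < M"
    proof -
      have "q < 8 * (e * q)" using q by (simp add: e_def)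
      also have "\<dots> \<le> M" using D1 self_le_power[of D 3] by (simp add: M_def D_def)
      finally show ?thesis .
    qed
    have M_real: "real M = 8 * real e ^ 3 * rq ^ 3" by (simp add: M_def D_def rq_def power_mult_distrib)
    have NM: "M \<le> N"
    proof -
      have "real M \<le> B * rq ^ 3" unfolding M_real using Bp(3) rq by (intro mult_right_mono) auto
      also have "\<dots> \<le> B * rq ^ 15" using Bp(4) rq by (intro mult_left_mono power_increasing) auto
      finally show ?thesis using N unfolding rq_def by simp
    qed
    have N0: "real N > 0" using NM qM by simp
    define S1 where "S1 = 2 * dd * (dd + 1) * K * rq * S'"
    have Pb: "\<bar>poly P (1 / real N')\<bar> \<le> S1" if "N' \<ge> M" for N'
    proof -
      have qN: "q < N'" using that qM by simp
      then have N'0: "real N' > 0" by simp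
      have "\<bar>expect N' (lift_trace N' g)\<bar> \<le> V N' * S'"
        by (intro expect_abs_le) (use lift_trace_le[OF _ S'] in \<open>simp add: V_def dd_def K_def add.commute\<close>)
      moreover have "\<bar>V N' * a0\<bar> \<le> V N' * (dd * rq * S)"
        unfolding abs_mult using a0 nn by (intro mult_mono) (auto simp: V_def)
      ultimately have "\<bar>EC N'\<bar> \<le> V N' * S' + V N' * (dd * rq * S)" using Etr[of N'] by linarith
      also have "\<dots> \<le> V N' * (dd * rq * S') + V N' * (dd * rq * S')"
      proof (intro add_mono mult_left_mono SS)
        have "1 * S' \<le> dd * rq * S'" using nn rq SS S0 mult_mono[of 1 dd 1 rq] by (intro mult_right_mono) auto
        then show "S' \<le> dd * rq * S'" by simp
      qed (use nn rq in \<open>auto simp: V_def\<close>)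
      also have "\<dots> = real N' * S1" by (simp add: S1_def V_def algebra_simps)
      finally have EC: "\<bar>EC N'\<bar> \<le> real N' * S1" .
      have "\<bar>poly P (1 / real N')\<bar> = 1 / real N' * (\<bar>EC N'\<bar> * denominator q (1 / real N'))"
        using denominator_pos[OF qN] by (simp add: P_def RN[OF qN] abs_mult)
      also have "\<dots> \<le> 1 / real N' * (real N' * S1 * 1)"
        using EC denominator_le_1[OF qN] denominator_pos[OF qN] by (intro mult_left_mono mult_mono) auto
      finally show ?thesis using N'0 by simp
    qed
    have S10: "S1 \<ge> 0" using Pb[OF NM] by linarith
    define \<epsilon> where "\<epsilon> = 32 * real M ^ 2 * real D ^ 6 * S1 / real N"
    have "\<bar>real N * poly P (1 / real N) - poly (pderiv P) 0\<bar> \<le> \<epsilon>"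
      unfolding \<epsilon>_def by (rule inverse_nat_extrapolation[OF degP D1 _ _ Pb NM]) (auto simp: M_def P_def)
    moreover have "poly (pderiv P) 0 = L" by (simp add: P_def pderiv_pCons R0)
    moreover have qN: "q < N" using qM NM by simp
    moreover define G where "G = denominator q (1 / real N)"
    ultimately have Y: "\<bar>EC N * G - L\<bar> \<le> \<epsilon>" using RN[OF qN] N0 by (simp add: P_def G_def)
    have G: "0 < G" "G \<le> 1" "1 - real E * rq ^ 2 / real N \<le> G"
      using denominator_pos[OF qN] denominator_le_1[OF qN] denominator_ge[OF qN] by (auto simp: G_def E_def rq_def)
    have G2: "1 / 2 \<le> G"
    proof -
      have "2 * (real E * rq ^ 2) \<le> 8 * real e ^ 3 * rq ^ 3"
      proof -
        have "2 * real E \<le> 8 * real e ^ 3"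
        proof -
          have "real E \<le> real e" "real e \<le> real e ^ 3" using e2 self_le_power[of "real e" 3] by (auto simp: e_def)
          then show ?thesis by linarith
        qed
        moreover have "rq ^ 2 \<le> rq ^ 3" using rq by (intro power_increasing) auto
        ultimately have "2 * real E * rq ^ 2 \<le> 8 * real e ^ 3 * rq ^ 3" using rq by - (rule mult_mono, auto)
        then show ?thesis by simp
      qed
      also have "\<dots> = real M" by (simp add: M_real)
      also have "\<dots> \<le> real N" using NM by simp
      finally have "real E * rq ^ 2 / real N \<le> 1 / 2" using N0 by (simp add: field_simps)
      then show ?thesis using G(3) by linarith
    qed
    have \<epsilon>0: "\<epsilon> \<ge> 0" using S10 by (simp add: \<epsilon>_def)
    have EC2: "\<bar>EC N - L\<bar> \<le> \<epsilon> + 2 * (\<bar>L\<bar> + \<epsilon>) * (real E * rq ^ 2 / real N)"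
    proof -
      have "\<bar>EC N\<bar> * (1 / 2) \<le> \<bar>EC N\<bar> * G" using G2 by (intro mult_left_mono) auto
      also have "\<dots> = \<bar>EC N * G\<bar>" using G by (simp add: abs_mult)
      also have "\<dots> \<le> \<bar>L\<bar> + \<epsilon>" using Y by linarith
      finally have "\<bar>EC N\<bar> \<le> 2 * (\<bar>L\<bar> + \<epsilon>)" by simp
      then have "\<bar>EC N\<bar> * (1 - G) \<le> 2 * (\<bar>L\<bar> + \<epsilon>) * (real E * rq ^ 2 / real N)"
        using G \<epsilon>0 by (intro mult_mono) auto
      moreover have "\<bar>EC N - L\<bar> \<le> \<bar>EC N * G - L\<bar> + \<bar>EC N\<bar> * (1 - G)"
      proof -
        have "EC N - L = (EC N * G - L) + EC N * (1 - G)" by (simp add: algebra_simps)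
        moreover have "\<bar>EC N * (1 - G)\<bar> = \<bar>EC N\<bar> * (1 - G)" using G by (simp add: abs_mult)
        ultimately show ?thesis by linarith
      qed
      ultimately show ?thesis using Y by linarith
    qed
    have Lg: "\<bar>L - (\<Sum>j<k. poly g (outlier j) - 2 * b 0)\<bar> \<le> c * rq ^ 2 * S"
    proof -
      have "poly g x = 2 * b 0 + (\<Sum>n=1..q. b n * poly (dickson s n) x)" for x
      proof -
        have "{..q} = insert 0 {1..q}" by auto
        then show ?thesis unfolding b by (simp add: poly_sum)
      qed
      then have "(\<Sum>j<k. poly g (outlier j) - 2 * b 0) = (\<Sum>j<k. \<Sum>n=1..q. b n * poly (dickson s n) (outlier j))" by simp
      also have "\<dots> = (\<Sum>n=1..q. \<Sum>j<k. b n * poly (dickson s n) (outlier j))" by (rule sum.swap)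
      finally have "L - (\<Sum>j<k. poly g (outlier j) - 2 * b 0) =
          (\<Sum>n=1..q. b n * (limit_C n - (\<Sum>j<k. poly (dickson s n) (outlier j))))"
        by (simp add: L_def right_diff_distrib sum_subtractf sum_distrib_left)
      also have "\<bar>\<dots>\<bar> \<le> (\<Sum>n=1..q. c * rq * S)"
      proof (rule order_trans[OF sum_abs], rule sum_mono)
        fix n assume n: "n \<in> {1..q}"
        have "\<bar>b n * (limit_C n - (\<Sum>j<k. poly (dickson s n) (outlier j)))\<bar>
            \<le> \<bar>b n\<bar> * (c * real n * sqrt s ^ n)"
          unfolding abs_mult using limit_C_dickson[of n] n by (intro mult_left_mono) (auto simp: c_def K_def dd_def)
        also have "\<dots> = c * real n * (\<bar>b n\<bar> * sqrt s ^ n)" by simp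
        also have "\<dots> \<le> c * rq * S" using n bS[of n] nn S0 s1 by (intro mult_mono) (auto simp: rq_def)
        finally show "\<bar>b n * (limit_C n - (\<Sum>j<k. poly (dickson s n) (outlier j)))\<bar> \<le> c * rq * S" .
      qed
      finally show ?thesis by (simp add: rq_def power2_eq_square algebra_simps)
    qed
    have b0k: "\<bar>(\<Sum>j<k. poly g (outlier j) - 2 * b 0) - (\<Sum>j<k. poly g (outlier j))\<bar> \<le> 2 * K * S"
    proof -
      have "(\<Sum>j<k. poly g (outlier j) - 2 * b 0) - (\<Sum>j<k. poly g (outlier j)) = - (K * (2 * b 0))"
        by (simp add: sum_subtractf K_def)
      then show ?thesis using bS1[of 0] nn by (simp add: abs_mult mult_left_mono)
    qed
    have gout: "\<bar>\<Sum>j<k. poly g (outlier j)\<bar> \<le> K * S'"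
    proof -
      have "\<bar>poly g (outlier j)\<bar> \<le> S'" if "j < k" for j
      proof (rule S')
        have "0 < outlier j" using outlier_bounds(1)[OF that] s_ge_2 by (meson less_trans mult_pos_pos real_sqrt_gt_zero less_le_trans zero_less_numeral)
        then show "\<bar>outlier j\<bar> \<le> real d" using outlier_bounds(2)[OF that] by simp
      qed
      then have "\<bar>\<Sum>j<k. poly g (outlier j)\<bar> \<le> (\<Sum>j<k. S')"
        by (intro order_trans[OF sum_abs] sum_mono) auto
      then show ?thesis by (simp add: K_def)
    qed
    have q2: "1 \<le> rq ^ 2" using rq by (rule one_le_power)
    have Lb: "\<bar>L\<bar> \<le> (3 * K + c) * rq ^ 2 * S'"
    proof -
      have "\<bar>L\<bar> \<le> c * rq ^ 2 * S + 2 * K * S + K * S'" using Lg b0k gout by linarith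
      also have "\<dots> \<le> c * rq ^ 2 * S' + 2 * K * (rq ^ 2 * S') + K * (rq ^ 2 * S')"
      proof -
        have "S' \<le> rq ^ 2 * S'" using q2 S0 SS mult_right_mono[of 1 "rq ^ 2" S'] by simp
        then show ?thesis using nn SS q2 by (intro add_mono mult_left_mono) auto
      qed
      finally show ?thesis by (simp add: algebra_simps)
    qed
    have \<epsilon>_eq: "\<epsilon> = c1 * rq ^ 13 * S' / real N"
      by (simp add: \<epsilon>_def M_real S1_def c1_def D_def rq_def power_mult_distrib power2_eq_square eval_nat_numeral)
    have S'0: "S' \<ge> 0" using S0 SS by simp
    have \<epsilon>_le: "\<epsilon> \<le> c1 * rq ^ 13 * S'"
    proof -
      have "1 \<le> real N" using N0 by simp
      moreover have "0 \<le> c1 * rq ^ 13 * S'" using nn rq S'0 by simp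
      ultimately show ?thesis unfolding \<epsilon>_eq using mult_left_mono[of 1 "real N" "c1 * rq ^ 13 * S'"] N0
        by (simp add: divide_le_eq)
    qed
    have "\<bar>expect N (lift_trace N g) - (\<Sum>j<k. poly g (outlier j))\<bar> \<le>
        \<bar>EC N - L\<bar> + c * rq ^ 2 * S + 2 * K * S + \<bar>V N * a0\<bar>"
      unfolding Etr using Lg b0k by linarith
    also have "\<bar>EC N - L\<bar> \<le> (c1 + 2 * real E * (3 * K + c + c1)) * rq ^ 15 * (S' / real N)"
    proof -
      have "\<bar>L\<bar> + \<epsilon> \<le> (3 * K + c) * rq ^ 13 * S' + c1 * rq ^ 13 * S'"
      proof (rule add_mono[OF order_trans[OF Lb] \<epsilon>_le])
        show "(3 * K + c) * rq ^ 2 * S' \<le> (3 * K + c) * rq ^ 13 * S'"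
          using nn rq S'0 by (intro mult_right_mono mult_left_mono power_increasing) auto
      qed
      also have "\<dots> = (3 * K + c + c1) * rq ^ 13 * S'" by (simp add: algebra_simps)
      finally have "2 * (\<bar>L\<bar> + \<epsilon>) * (real E * rq ^ 2 / real N) \<le>
          2 * ((3 * K + c + c1) * rq ^ 13 * S') * (real E * rq ^ 2 / real N)"
        using rq by (intro mult_right_mono mult_left_mono) auto
      also have "\<dots> = 2 * real E * (3 * K + c + c1) * rq ^ 15 * (S' / real N)"
        by (simp add: eval_nat_numeral)
      finally have "2 * (\<bar>L\<bar> + \<epsilon>) * (real E * rq ^ 2 / real N) \<le> 2 * real E * (3 * K + c + c1) * rq ^ 15 * (S' / real N)" .
      moreover have "\<epsilon> \<le> c1 * rq ^ 15 * (S' / real N)"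
      proof -
        have "c1 * rq ^ 13 * (S' / real N) \<le> c1 * rq ^ 15 * (S' / real N)"
          using nn rq S'0 by (intro mult_right_mono mult_left_mono power_increasing) auto
        then show ?thesis by (simp add: \<epsilon>_eq)
      qed
      ultimately show ?thesis using EC2 by (simp only: distrib_right)
    qed
    also have "\<bar>V N * a0\<bar> \<le> (dd + 1) * K * dd * (rq ^ 15 * (real N * S))"
    proof -
      have "\<bar>V N * a0\<bar> \<le> V N * (dd * rq * S)"
        unfolding abs_mult using a0 nn by (intro mult_mono) (auto simp: V_def)
      also have "\<dots> = (dd + 1) * K * dd * (rq ^ 1 * (real N * S))" by (simp add: V_def)
      also have "\<dots> \<le> (dd + 1) * K * dd * (rq ^ 15 * (real N * S))"
        using nn rq S0 by (intro mult_left_mono mult_right_mono power_increasing) auto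
      finally show ?thesis .
    qed
    also have "c * rq ^ 2 * S \<le> c * (rq ^ 15 * (real N * S))"
    proof -
      have "rq ^ 2 * S \<le> rq ^ 15 * (real N * S)"
        using rq S0 N0 mult_right_mono[of 1 "real N" S] by (intro mult_mono power_increasing) auto
      then show ?thesis using nn by (simp add: mult.assoc mult_left_mono)
    qed
    also have "2 * K * S \<le> 2 * K * (rq ^ 15 * (real N * S))"
    proof -
      have "1 * S \<le> rq ^ 15 * (real N * S)"
        using rq S0 N0 mult_right_mono[of 1 "real N" S] by (intro mult_mono one_le_power) auto
      then show ?thesis using nn by (intro mult_left_mono) auto
    qed
    also have "(c1 + 2 * real E * (3 * K + c + c1)) * rq ^ 15 * (S' / real N) + c * (rq ^ 15 * (real N * S))
        + 2 * K * (rq ^ 15 * (real N * S)) + (dd + 1) * K * dd * (rq ^ 15 * (real N * S))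
      = (c1 + 2 * real E * (3 * K + c + c1)) * (rq ^ 15 * (S' / real N))
        + (c + 2 * K + (dd + 1) * K * dd) * (rq ^ 15 * (real N * S))"
      by (simp add: algebra_simps)
    also have "\<dots> \<le> B * (rq ^ 15 * (S' / real N)) + B * (rq ^ 15 * (real N * S))"
      using rq S0 S'0 by (intro add_mono mult_right_mono Bp) auto
    also have "\<dots> = B * real q ^ 15 * (real N * S + S' / real N)"
      by (simp add: rq_def algebra_simps)
    finally show "\<bar>expect N (lift_trace N g) - (\<Sum>j<k. poly g (outlier j))\<bar> \<le> B * real q ^ 15 * (real N * S + S' / real N)"
      by simp
  qed
qed

end

section \<open>Concentration of quadratic forms\<close>

lemma arc_ends_in:
  fixes lb :: "nat \<Rightarrow> 'l"
  assumes "t < m"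
  shows "csrc (arc us x lb t) \<in> x ` {..m}" "ctgt (arc us x lb t) \<in> x ` {..m}"
  using assms by (auto simp: arc_def)

text \<open>For an injective trajectory a shared endpoint forces equal or successive times, and two
  successive arcs over the same base edge would be a backtracking step.\<close>

lemma arc_determined:
  fixes lb :: "nat \<Rightarrow> 'l"
  assumes us: "us \<in> nbwords d m" and x: "inj_on x {..m}" and t: "t < m" "t' < m"
    and eq: "cedge (arc us x lb t) = cedge (arc us x lb t')"
      "csrc (arc us x lb t) = csrc (arc us x lb t') \<or> ctgt (arc us x lb t) = ctgt (arc us x lb t')"
  shows "t = t'"
proof -
  have ne2: "Suc t < m \<Longrightarrow> us ! t \<noteq> us ! Suc (Suc t)" "Suc t' < m \<Longrightarrow> us ! t' \<noteq> us ! Suc (Suc t')"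
    using us t by (auto simp: nbwords_def nonbacktracking_def)
  have i: "x t = x t' \<longleftrightarrow> t = t'" "x (Suc t) = x (Suc t') \<longleftrightarrow> t = t'"
    "x t = x (Suc t') \<longleftrightarrow> t = Suc t'" "x (Suc t) = x t' \<longleftrightarrow> Suc t = t'"
    using t by (auto simp: inj_on_eq_iff[OF x])
  show ?thesis
  proof (cases "us ! t < us ! Suc t"; cases "us ! t' < us ! Suc t'")
    assume a: "us ! t < us ! Suc t" "us ! t' < us ! Suc t'"
    then show ?thesis using eq i by (simp add: arc_def)
  next
    assume a: "us ! t < us ! Suc t" "\<not> us ! t' < us ! Suc t'"
    then have e: "us ! t = us ! Suc t'" "us ! Suc t = us ! t'" and "t = Suc t' \<or> Suc t = t'"
      using eq i by (auto simp: arc_def)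
    then show ?thesis using ne2 t by auto
  next
    assume a: "\<not> us ! t < us ! Suc t" "us ! t' < us ! Suc t'"
    then have e: "us ! t = us ! Suc t'" "us ! Suc t = us ! t'" and "t = Suc t' \<or> Suc t = t'"
      using eq i by (auto simp: arc_def)
    then show ?thesis using ne2 t by auto
  next
    assume a: "\<not> us ! t < us ! Suc t" "\<not> us ! t' < us ! Suc t'"
    then show ?thesis using eq i by (simp add: arc_def)
  qed
qed

lemma falling_le_power: "m \<le> N \<Longrightarrow> falling N m \<le> real N ^ m"
  unfolding falling_def using prod_mono[of "{..<m}" "\<lambda>j. real N - real j" "\<lambda>_. real N"] by simp

context label_model
begin

definition pair_arcs :: "nat list \<Rightarrow> nat \<Rightarrow> (bool \<Rightarrow> nat \<Rightarrow> nat) \<Rightarrow> (bool \<Rightarrow> nat \<Rightarrow> 'l) \<Rightarrow> 'l constraint set" where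
  "pair_arcs us m x lb = (\<lambda>(b, t). arc us (x b) (lb b) t) ` (UNIV \<times> {..<m})"

definition pair_denominator :: "nat list \<Rightarrow> nat \<Rightarrow> nat \<Rightarrow> real" where
  "pair_denominator us m N = (\<Prod>e\<in>edges. falling N (card {z \<in> UNIV \<times> {..<m} :: (bool \<times> nat) set.
     (min (us ! snd z) (us ! Suc (snd z)), max (us ! snd z) (us ! Suc (snd z))) = e}))"

definition disjoint_walks :: "nat \<Rightarrow> (bool \<Rightarrow> nat \<Rightarrow> nat) \<Rightarrow> bool" where
  "disjoint_walks m x \<longleftrightarrow> inj_on (x True) {..m} \<and> inj_on (x False) {..m} \<and> x True ` {..m} \<inter> x False ` {..m} = {}"

lemma pair_denominator_bounds:
  assumes us: "us \<in> nbwords d m" and N: "2 * m \<le> N" "1 \<le> N"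
  shows "0 < pair_denominator us m N" "pair_denominator us m N \<le> real N ^ (2 * m)"
proof -
  define I where "I = (UNIV \<times> {..<m} :: (bool \<times> nat) set)"
  define ce where "ce z = (min (us ! snd z) (us ! Suc (snd z)), max (us ! snd z) (us ! Suc (snd z)))" for z :: "bool \<times> nat"
  define c where "c e = card {z \<in> I. ce z = e}" for e
  have finI: "finite I" and cI: "card I = 2 * m" by (auto simp: I_def card_cartesian_product)
  have cle: "c e \<le> N" for e
    unfolding c_def by (rule order_trans[OF card_mono[OF finI]]) (use N cI in auto)
  have "ce ` I \<subseteq> edges"
  proof
    fix e assume "e \<in> ce ` I"
    then obtain b t where t: "t < m" "e = ce (b, t)" by (auto simp: I_def)
    show "e \<in> edges"
      using nbword_nth(1)[OF us, of t] nbword_nth(1)[OF us, of "Suc t"] nbword_nth(2)[OF us, of t] t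
      by (auto simp: edges_def ce_def min_def max_def)
  qed
  then have "(\<Sum>e\<in>edges. c e) = 2 * m"
    using sum.group[OF finI finite_edges, of ce "\<lambda>_. 1 :: nat"] cI by (simp add: c_def)
  then have "(\<Prod>e\<in>edges. real N ^ c e) = real N ^ (2 * m)" by (simp flip: power_sum)
  moreover have "(\<Prod>e\<in>edges. falling N (c e)) \<le> (\<Prod>e\<in>edges. real N ^ c e)"
    using falling_le_power[OF cle] falling_pos[OF cle] by (intro prod_mono conjI) (auto intro: less_imp_le)
  moreover have "0 < (\<Prod>e\<in>edges. falling N (c e))" using falling_pos[OF cle] by (intro prod_pos) auto
  ultimately show "0 < pair_denominator us m N" "pair_denominator us m N \<le> real N ^ (2 * m)"
    by (simp_all add: pair_denominator_def c_def ce_def I_def)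
qed

text \<open>The 2m constraints are distinct and consistent, and the denominator depends only on
  \<open>us\<close>. So the probability is a product over the two label words: the labels of the two
  walks are independent.\<close>

lemma probability_value_disjoint_walks:
  assumes us: "us \<in> nbwords d m" and x: "disjoint_walks m x"
  shows "probability_value N (pair_arcs us m x lb) =
    label_weight (lb True) m * label_weight (lb False) m / pair_denominator us m N"
proof -
  define I where "I = (UNIV \<times> {..<m} :: (bool \<times> nat) set)"
  define ar where "ar z = arc us (x (fst z)) (lb (fst z)) (snd z)" for z
  have S: "pair_arcs us m x lb = ar ` I" by (simp add: pair_arcs_def I_def ar_def case_prod_unfold)
  have det: "z = z'" if z: "z \<in> I" "z' \<in> I" "cedge (ar z) = cedge (ar z')"
    "csrc (ar z) = csrc (ar z') \<or> ctgt (ar z) = ctgt (ar z')" for z z'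
  proof -
    obtain b t b' t' where zt: "z = (b, t)" "z' = (b', t')" by (cases z; cases z')
    have t: "t < m" "t' < m" using z by (auto simp: I_def zt)
    have "b = b'"
    proof (rule ccontr)
      assume "b \<noteq> b'"
      then have "x b ` {..m} \<inter> x b' ` {..m} = {}" using x by (cases b; cases b') (auto simp: disjoint_walks_def)
      moreover note arc_ends_in[OF t(1), of us "x b" "lb b"] arc_ends_in[OF t(2), of us "x b'" "lb b'"]
      ultimately show False using z(4) unfolding ar_def zt fst_conv snd_conv by (metis disjoint_iff)
    qed
    moreover have "inj_on (x b) {..m}" using x by (cases b) (auto simp: disjoint_walks_def)
    from arc_determined[OF us this t, of "lb b"] have "t = t'" using z(3,4) calculation by (simp add: ar_def zt)
    ultimately show ?thesis by (simp add: zt)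
  qed
  have inj: "inj_on ar I" by (rule inj_onI) (use det in auto)
  have cons: "consistent (ar ` I)" unfolding consistent_def using det by blast
  have "edge_constraints (ar ` I) e = ar ` {z \<in> I. cedge (ar z) = e}" for e by (auto simp: edge_constraints_def)
  then have ce: "card (edge_constraints (ar ` I) e) = card {z \<in> I. cedge (ar z) = e}" for e
    using inj by (simp add: card_image inj_on_subset[OF inj])
  have cd: "cedge (ar z) = (min (us ! snd z) (us ! Suc (snd z)), max (us ! snd z) (us ! Suc (snd z)))" for z
    unfolding ar_def by (rule arc_simps)
  have "(\<Prod>c\<in>ar ` I. w (clab c)) = (\<Prod>z\<in>I. w (lb (fst z) (snd z)))"
    by (subst prod.reindex[OF inj]) (simp add: ar_def arc_simps)
  also have "\<dots> = (\<Prod>b\<in>UNIV. \<Prod>t<m. w (lb b t))"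
    unfolding I_def prod.cartesian_product by (simp add: case_prod_unfold)
  also have "\<dots> = label_weight (lb True) m * label_weight (lb False) m"
    by (simp add: label_weight_def UNIV_bool mult.commute)
  finally show ?thesis
    unfolding S using cons ce by (simp add: probability_value_def pair_denominator_def I_def cd)
qed

lemma sum_pairs_bool:
  fixes f :: "(bool \<Rightarrow> 'b) \<Rightarrow> real"
  shows "(\<Sum>x\<in>UNIV \<rightarrow>\<^sub>E A. f x) = (\<Sum>y\<in>A. \<Sum>z\<in>A. f (\<lambda>b. if b then y else z))"
proof -
  have "(\<Sum>y\<in>A. \<Sum>z\<in>A. f (\<lambda>b. if b then y else z)) = (\<Sum>(y, z)\<in>A \<times> A. f (\<lambda>b. if b then y else z))"
    by (rule sum.cartesian_product)
  also have "\<dots> = (\<Sum>x\<in>UNIV \<rightarrow>\<^sub>E A. f x)"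
    by (rule sum.reindex_bij_witness[of _ "\<lambda>x. (x True, x False)" "\<lambda>(y, z) b. if b then y else z"])
      (auto simp: fun_eq_iff split: if_splits)
  finally show ?thesis ..
qed

lemma card_disjoint_walks:
  assumes N: "2 * m + 2 \<le> N"
  shows "real (N - (2 * m + 2)) ^ (2 * m + 2) \<le>
    real (card {x \<in> UNIV \<rightarrow>\<^sub>E ({..m} \<rightarrow>\<^sub>E {..<N}). disjoint_walks m x})"
proof -
  define M where "M = N - (2 * m + 2)"
  define J where "J C = {f \<in> {..m} \<rightarrow>\<^sub>E C. inj_on f {..m}}" for C :: "nat set"
  have finJ: "finite (J C)" if "finite C" for C
    unfolding J_def using that by (auto intro!: finite_subset[OF _ finite_PiE[of "{..m}" "\<lambda>_. C"]])
  have J: "M ^ (m + 1) \<le> card (J C)" if C: "finite C" "N - (m + 1) \<le> card C" for C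
  proof -
    have "card (J C) = (\<Prod>i\<in>{0..<m+1}. card C - i)"
      unfolding J_def using card_inj_on_subset_funcset[of "{..m}" C "{..m}"] C by simp
    also have "\<dots> \<ge> (\<Prod>i\<in>{0..<m+1}. M)"
      using C(2) N by (intro prod_mono) (auto simp: M_def)
    finally show ?thesis by simp
  qed
  define S where "S = (SIGMA f:J {..<N}. J ({..<N} - f ` {..m}))"
  have "M ^ (2 * m + 2) = M ^ (m + 1) * M ^ (m + 1)" by (simp add: mult_2 flip: power_add)
  also have "\<dots> \<le> card (J {..<N}) * M ^ (m + 1)" using J[of "{..<N}"] by (intro mult_right_mono) auto
  also have "\<dots> = (\<Sum>f\<in>J {..<N}. M ^ (m + 1))" by simp
  also have "\<dots> \<le> (\<Sum>f\<in>J {..<N}. card (J ({..<N} - f ` {..m})))"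
  proof (rule sum_mono)
    fix f assume f: "f \<in> J {..<N}"
    then have "f ` {..m} \<subseteq> {..<N}" by (auto simp: J_def)
    moreover have "card (f ` {..m}) = m + 1" using f by (simp add: J_def card_image)
    ultimately have "card ({..<N} - f ` {..m}) = N - (m + 1)" by (simp add: card_Diff_subset)
    then show "M ^ (m + 1) \<le> card (J ({..<N} - f ` {..m}))" by (intro J) auto
  qed
  also have "\<dots> = card S" unfolding S_def using finJ by (subst card_SigmaI) auto
  also have "\<dots> \<le> card {x \<in> UNIV \<rightarrow>\<^sub>E ({..m} \<rightarrow>\<^sub>E {..<N}). disjoint_walks m x}"
  proof (rule card_inj_on_le[of "\<lambda>(y, z) b. if b then y else z"])
    show "inj_on (\<lambda>(y, z) b. if b then y else z) S"
    proof (rule inj_onI)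
      fix p q assume pq: "(case p of (y, z) \<Rightarrow> \<lambda>b. if b then y else z) = (case q of (y, z) \<Rightarrow> \<lambda>b. if b then y else z)"
      show "p = q" using fun_cong[OF pq, of True] fun_cong[OF pq, of False] by (cases p; cases q) simp
    qed
    show "(\<lambda>(y, z) b. if b then y else z) ` S \<subseteq> {x \<in> UNIV \<rightarrow>\<^sub>E ({..m} \<rightarrow>\<^sub>E {..<N}). disjoint_walks m x}"
    proof (rule image_subsetI)
      fix p assume "p \<in> S"
      then obtain y z where p: "p = (y, z)" and yz: "y \<in> {..m} \<rightarrow>\<^sub>E {..<N}" "z \<in> {..m} \<rightarrow>\<^sub>E ({..<N} - y ` {..m})"
        "inj_on y {..m}" "inj_on z {..m}" by (auto simp: S_def J_def)
      have "z \<in> {..m} \<rightarrow>\<^sub>E {..<N}" using yz(2) by (auto simp: PiE_iff)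
      then have "(\<lambda>b. if b then y else z) \<in> UNIV \<rightarrow>\<^sub>E ({..m} \<rightarrow>\<^sub>E {..<N})"
        using yz(1) by (intro PiE_I) auto
      moreover have "z ` {..m} \<subseteq> {..<N} - y ` {..m}" using yz(2) by auto
      ultimately show "(case p of (y, z) \<Rightarrow> \<lambda>b. if b then y else z) \<in> {x \<in> UNIV \<rightarrow>\<^sub>E ({..m} \<rightarrow>\<^sub>E {..<N}). disjoint_walks m x}"
        unfolding p prod.case mem_Collect_eq disjoint_walks_def using yz(3,4) by auto
    qed
    have "finite (UNIV \<rightarrow>\<^sub>E ({..m} \<rightarrow>\<^sub>E {..<N}) :: (bool \<Rightarrow> nat \<Rightarrow> nat) set)"
      by (intro finite_PiE) (auto intro!: finite_PiE)
    then show "finite {x \<in> UNIV \<rightarrow>\<^sub>E ({..m} \<rightarrow>\<^sub>E {..<N}). disjoint_walks m x}" by simp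
  qed
  finally have "real (M ^ (2 * m + 2)) \<le> real (card {x \<in> UNIV \<rightarrow>\<^sub>E ({..m} \<rightarrow>\<^sub>E {..<N}). disjoint_walks m x})"
    by (rule of_nat_mono)
  then show ?thesis unfolding M_def of_nat_power .
qed

end

context spectral_label_model
begin

lemma \<xi>_abs_le: "i < k \<Longrightarrow> j < k \<Longrightarrow> \<bar>\<xi> j i\<bar> \<le> 1"
proof -
  assume ij: "i < k" "j < k"
  have "(\<xi> j i)\<^sup>2 \<le> (\<Sum>i<k. (\<xi> j i)\<^sup>2)" using ij by (intro member_le_sum) auto
  then have "(\<xi> j i)\<^sup>2 \<le> 1" using normalized ij by simp
  then show ?thesis by (simp add: abs_square_le_1)
qed

lemma \<tau>_pos: "j < k \<Longrightarrow> 0 < \<tau> j"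
  using \<alpha>_bounds(3)[of j] s_ge_2 by (simp add: \<alpha>_def zero_less_mult_iff)

definition walk_correlation :: "nat \<Rightarrow> nat \<Rightarrow> nat list \<Rightarrow> 'a sample \<Rightarrow> real" where
  "walk_correlation j N us \<omega> = (\<Sum>a<N. \<Sum>i<k. \<xi> j i * \<xi> j (snd (transport (lift \<omega>) us (a, i))))"

text \<open>Two walks that together visit \<open>2 * m + 2\<close> different points carry independent labels, so they do not
  contribute to the variance; all other pairs of walks have total mass \<open>O(N)\<close>.\<close>

lemma walk_correlation_second_moment:
  assumes j: "j < k" and us: "us \<in> nbwords d m" and N: "2 * m + 2 \<le> N"
  shows "expect N (\<lambda>\<omega>. (walk_correlation j N us \<omega> - \<tau> j ^ m * real N)\<^sup>2) \<le> (real k + 1)\<^sup>2 * (2 * real m + 2)\<^sup>2 * real N"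
proof -
  \<comment> \<open>The deviation caused by one label word. It has mean zero under the label
    weights, so a pair of walks with independent labels contributes nothing.\<close>
  define G where "G lb = (\<Sum>i<k. \<xi> j i * \<xi> j (relabel pm lb m i)) - \<tau> j ^ m" for lb
  define X where "X = {..m} \<rightarrow>\<^sub>E {..<N}"
  define X2 where "X2 = (UNIV \<rightarrow>\<^sub>E X :: (bool \<Rightarrow> nat \<Rightarrow> nat) set)"
  define L2 where "L2 = (UNIV \<rightarrow>\<^sub>E label_words m :: (bool \<Rightarrow> nat \<Rightarrow> 'a) set)"
  define ind where "ind x lb \<omega> = (of_bool (\<forall>c\<in>arc us x lb ` {..<m}. holds \<omega> c) :: real)" for x and lb :: "nat \<Rightarrow> 'a" and \<omega>
  have finX2: "finite X2" unfolding X2_def X_def by (intro finite_PiE) (auto intro!: finite_PiE)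
  have traj: "(\<Sum>a<N. \<Sum>i<k. g a i (transport (lift \<omega>) us (a, i))) =
     (\<Sum>x\<in>X. \<Sum>lb\<in>label_words m. ind x lb \<omega> * (\<Sum>i<k. g (x 0) i (x m, relabel pm lb m i)))"
    if "\<omega> \<in> samples N" for g \<omega>
    unfolding X_def label_words_def ind_def by (rule trajectory_sum[OF that us])
  have total: "(\<Sum>x\<in>X. \<Sum>lb\<in>label_words m. ind x lb \<omega>) = real N" if "\<omega> \<in> samples N" for \<omega>
    using traj[OF that, of "\<lambda>a i z. (\<xi> j i)\<^sup>2"] by (simp add: normalized[OF j])
  have dev: "walk_correlation j N us \<omega> - \<tau> j ^ m * real N = (\<Sum>x\<in>X. \<Sum>lb\<in>label_words m. ind x lb \<omega> * G lb)"
    if "\<omega> \<in> samples N" for \<omega>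
    unfolding walk_correlation_def traj[OF that, of "\<lambda>a i z. \<xi> j i * \<xi> j (snd z)"] total[OF that, symmetric]
    by (simp add: G_def right_diff_distrib sum_subtractf sum_distrib_left mult.commute)
  have square: "(\<Sum>x\<in>X. \<Sum>lb\<in>label_words m. ind x lb \<omega> * H lb)\<^sup>2 =
    (\<Sum>x\<in>X2. \<Sum>lb\<in>L2. H (lb True) * H (lb False) * of_bool (\<forall>c\<in>pair_arcs us m x lb. holds \<omega> c))" for H \<omega>
  proof -
    have "(\<Sum>x\<in>X. \<Sum>lb\<in>label_words m. ind x lb \<omega> * H lb)\<^sup>2 =
      (\<Sum>x\<in>X. \<Sum>y\<in>X. \<Sum>l\<in>label_words m. \<Sum>l'\<in>label_words m. (ind x l \<omega> * H l) * (ind y l' \<omega> * H l'))"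
      unfolding power2_eq_square sum_product ..
    also have "\<dots> = (\<Sum>x\<in>X2. \<Sum>lb\<in>L2. (ind (x True) (lb True) \<omega> * H (lb True)) * (ind (x False) (lb False) \<omega> * H (lb False)))"
      unfolding X2_def L2_def sum_pairs_bool by simp
    also have "\<dots> = (\<Sum>x\<in>X2. \<Sum>lb\<in>L2. H (lb True) * H (lb False) * of_bool (\<forall>c\<in>pair_arcs us m x lb. holds \<omega> c))"
    proof (intro sum.cong refl)
      fix x lb
      have "(\<forall>c\<in>pair_arcs us m x lb. holds \<omega> c) \<longleftrightarrow>
        (\<forall>c\<in>arc us (x True) (lb True) ` {..<m}. holds \<omega> c) \<and> (\<forall>c\<in>arc us (x False) (lb False) ` {..<m}. holds \<omega> c)"
        by (auto simp: pair_arcs_def all_bool_eq)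
      then show "(ind (x True) (lb True) \<omega> * H (lb True)) * (ind (x False) (lb False) \<omega> * H (lb False)) =
        H (lb True) * H (lb False) * of_bool (\<forall>c\<in>pair_arcs us m x lb. holds \<omega> c)"
        by (simp add: ind_def of_bool_conj)
    qed
    finally show ?thesis .
  qed
  define PV where "PV x lb = probability_value N (pair_arcs us m x lb)" for x lb
  have PV: "expect N (\<lambda>\<omega>. of_bool (\<forall>c\<in>pair_arcs us m x lb. holds \<omega> c)) = PV x lb" if xl: "x \<in> X2" "lb \<in> L2" for x lb
    unfolding PV_def
  proof (rule expect_holds)
    fix c assume "c \<in> pair_arcs us m x lb"
    then obtain b t where t: "t < m" "c = arc us (x b) (lb b) t" by (auto simp: pair_arcs_def)
    have xb: "x b \<in> {..m} \<rightarrow>\<^sub>E {..<N}" and lbb: "lb b \<in> label_words m"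
      using xl by (auto simp: X2_def X_def L2_def PiE_iff)
    have "x b t \<in> {..<N}" "x b (Suc t) \<in> {..<N}" using t(1) by (intro PiE_mem[OF xb]; simp)+
    then show "cedge c \<in> edges \<and> csrc c < N \<and> ctgt c < N \<and> clab c \<in> \<Lambda>"
      unfolding t(2) by (intro arc_constraint[OF us t(1) _ _ lbb]) simp_all
  qed (simp add: pair_arcs_def)
  have PV0: "0 \<le> PV x lb" if "x \<in> X2" "lb \<in> L2" for x lb
    using expect_mono[of N "\<lambda>_. 0"] expect_const[of N 0] unfolding PV[OF that, symmetric] by fastforce
  have moment: "expect N (\<lambda>\<omega>. (\<Sum>x\<in>X. \<Sum>lb\<in>label_words m. ind x lb \<omega> * H lb)\<^sup>2) =
    (\<Sum>x\<in>X2. \<Sum>lb\<in>L2. H (lb True) * H (lb False) * PV x lb)" for H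
    unfolding square expect_sum expect_scale by (intro sum.cong refl) (simp add: PV)
  define P where "P x = (\<Sum>lb\<in>L2. PV x lb)" for x
  \<comment> \<open>Every starting point has exactly one trajectory, so all pairs have total mass
    N^2. Subtracting the disjoint pairs leaves a mass bounded by a multiple of N.\<close>
  have Ptotal: "(\<Sum>x\<in>X2. P x) = (real N)\<^sup>2"
  proof -
    have "(\<Sum>x\<in>X2. P x) = expect N (\<lambda>\<omega>. (\<Sum>x\<in>X. \<Sum>lb\<in>label_words m. ind x lb \<omega> * 1)\<^sup>2)"
      unfolding moment by (simp add: P_def)
    also have "\<dots> = expect N (\<lambda>\<omega>. (real N)\<^sup>2)" by (rule expect_cong) (simp add: total)
    finally show ?thesis by (simp add: expect_const)
  qed
  define D where "D = pair_denominator us m N"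
  have D: "0 < D" "D \<le> real N ^ (2 * m)" using pair_denominator_bounds[OF us] N by (simp_all add: D_def)
  have Gsum: "(\<Sum>lb\<in>label_words m. label_weight lb m * G lb) = 0"
  proof -
    have "(\<Sum>lb\<in>label_words m. label_weight lb m * G lb) =
      (\<Sum>lb\<in>label_words m. \<Sum>i<k. \<xi> j i * (label_weight lb m * \<xi> j (relabel pm lb m i))) - \<tau> j ^ m"
      using sum_label_weight[of m]
      by (simp add: G_def right_diff_distrib sum_subtractf sum_distrib_left mult_ac flip: sum_distrib_left[of "\<tau> j ^ m"])
    also have "\<dots> = (\<Sum>i<k. \<Sum>lb\<in>label_words m. \<xi> j i * (label_weight lb m * \<xi> j (relabel pm lb m i))) - \<tau> j ^ m"
      by (subst sum.swap) simp
    also have "\<dots> = (\<Sum>i<k. \<tau> j ^ m * (\<xi> j i)\<^sup>2) - \<tau> j ^ m"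
      using j by (simp add: sum_label_words_eigvec power2_eq_square mult_ac flip: sum_distrib_left)
    also have "\<dots> = 0" using normalized[OF j] by (simp flip: sum_distrib_left)
    finally show ?thesis .
  qed
  have PV_disjoint: "(\<Sum>lb\<in>L2. H (lb True) * H (lb False) * PV x lb) =
      (\<Sum>lb\<in>label_words m. label_weight lb m * H lb)\<^sup>2 / D" if "disjoint_walks m x" for H x
    unfolding PV_def probability_value_disjoint_walks[OF us that] L2_def sum_pairs_bool D_def power2_eq_square sum_product
    by (simp add: sum_divide_distrib mult_ac)
  have Gb: "\<bar>G lb\<bar> \<le> real k + 1" if lb: "lb \<in> label_words m" for lb
  proof -
    have "\<bar>\<Sum>i<k. \<xi> j i * \<xi> j (relabel pm lb m i)\<bar> \<le> (\<Sum>i<k. 1)"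
    proof (rule order_trans[OF sum_abs], rule sum_mono)
      fix i assume "i \<in> {..<k}"
      then show "\<bar>\<xi> j i * \<xi> j (relabel pm lb m i)\<bar> \<le> 1"
        using \<xi>_abs_le[of i j] \<xi>_abs_le[of "relabel pm lb m i" j] relabel_less[OF lb order_refl, of i] j
        by (simp add: abs_mult mult_le_one)
    qed
    moreover have "\<bar>\<tau> j ^ m\<bar> \<le> 1" using \<tau>_pos[OF j] \<tau>_le[OF j] by (simp add: power_le_one)
    ultimately show ?thesis unfolding G_def by (simp add: abs_le_iff)
  qed
  define W where "W = {x \<in> X2. disjoint_walks m x}"
  have "expect N (\<lambda>\<omega>. (walk_correlation j N us \<omega> - \<tau> j ^ m * real N)\<^sup>2) =
      expect N (\<lambda>\<omega>. (\<Sum>x\<in>X. \<Sum>lb\<in>label_words m. ind x lb \<omega> * G lb)\<^sup>2)"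
    by (rule expect_cong) (simp only: dev)
  also have "\<dots> = (\<Sum>x\<in>X2. \<Sum>lb\<in>L2. G (lb True) * G (lb False) * PV x lb)" by (rule moment)
  also have "\<dots> \<le> (\<Sum>x\<in>X2. if x \<in> W then 0 else (real k + 1)\<^sup>2 * P x)"
  proof (rule sum_mono)
    fix x assume x: "x \<in> X2"
    show "(\<Sum>lb\<in>L2. G (lb True) * G (lb False) * PV x lb) \<le> (if x \<in> W then 0 else (real k + 1)\<^sup>2 * P x)"
    proof (cases "x \<in> W")
      case True
      then show ?thesis using PV_disjoint[of x G] Gsum by (simp add: W_def)
    next
      case False
      have "(\<Sum>lb\<in>L2. G (lb True) * G (lb False) * PV x lb) \<le> (\<Sum>lb\<in>L2. (real k + 1)\<^sup>2 * PV x lb)"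
      proof (intro sum_mono mult_right_mono PV0 x)
        fix lb assume "lb \<in> L2"
        then have "lb True \<in> label_words m" "lb False \<in> label_words m" by (auto simp: L2_def PiE_iff)
        then have "\<bar>G (lb True) * G (lb False)\<bar> \<le> (real k + 1) * (real k + 1)"
          unfolding abs_mult by (intro mult_mono Gb) auto
        then show "G (lb True) * G (lb False) \<le> (real k + 1)\<^sup>2" by (simp add: power2_eq_square)
      qed
      then show ?thesis using False by (simp add: P_def sum_distrib_left)
    qed
  qed
  also have "\<dots> = (real k + 1)\<^sup>2 * (\<Sum>x\<in>X2 - W. P x)"
    using finX2 by (simp add: sum.If_cases sum_distrib_left Diff_eq Compl_eq)
  also have "(\<Sum>x\<in>X2 - W. P x) = (real N)\<^sup>2 - (\<Sum>x\<in>W. P x)"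
    using sum_diff[OF finX2, of W P] Ptotal by (simp add: W_def)
  also have "(\<Sum>x\<in>W. P x) = real (card W) / D"
    using PV_disjoint[of _ "\<lambda>_. 1"] sum_label_weight[of m] by (simp add: W_def P_def)
  also have "(real N)\<^sup>2 - real (card W) / D \<le> (2 * real m + 2)\<^sup>2 * real N"
  proof -
    define M where "M = 2 * m + 2"
    have N0: "real N > 0" using N by simp
    have "real N * (real N - real M * real M) = (real N)\<^sup>2 * (1 + real M * (- (real M / real N)))"
      using N0 by (simp add: field_simps power2_eq_square)
    also have "\<dots> \<le> (real N)\<^sup>2 * (1 + - (real M / real N)) ^ M"
      using N N0 by (intro mult_left_mono Bernoulli_inequality) (auto simp: M_def)
    also have "(1 + - (real M / real N)) = real (N - M) / real N"
      using N by (simp add: M_def of_nat_diff diff_divide_distrib)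
    also have "(real N)\<^sup>2 * (real (N - M) / real N) ^ M = real (N - M) ^ M / real N ^ (2 * m)"
      using N0 by (simp add: M_def power_divide power_add power2_eq_square)
    also have "\<dots> \<le> real (card W) / D"
      using card_disjoint_walks[OF N] D by (intro frac_le) (auto simp: M_def W_def X2_def X_def)
    finally show ?thesis by (simp add: M_def power2_eq_square algebra_simps)
  qed
  finally show ?thesis by (simp add: mult.assoc)
qed

end

section \<open>Limits of the quadratic forms\<close>

lemma sum_power2_le_card_mult:
  fixes f :: "'a \<Rightarrow> real"
  shows "(\<Sum>i\<in>I. f i)\<^sup>2 \<le> real (card I) * (\<Sum>i\<in>I. (f i)\<^sup>2)"
proof -
  have "(\<Sum>i\<in>I. f i)\<^sup>2 = (\<Sum>i\<in>I. \<Sum>j\<in>I. f i * f j)" by (simp add: power2_eq_square sum_product)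
  also have "\<dots> \<le> (\<Sum>i\<in>I. \<Sum>j\<in>I. ((f i)\<^sup>2 + (f j)\<^sup>2) / 2)"
  proof (intro sum_mono)
    fix i j
    show "f i * f j \<le> ((f i)\<^sup>2 + (f j)\<^sup>2) / 2" using sum_squares_bound[of "f i" "f j"] by simp
  qed
  also have "\<dots> = real (card I) * (\<Sum>i\<in>I. (f i)\<^sup>2)"
    by (simp add: sum.distrib add_divide_distrib flip: sum_divide_distrib sum_distrib_left)
  finally show ?thesis .
qed

text \<open>The constant function on the trivial lift is an eigenvector for d, so counting the words
  amounts to evaluating \<open>nbpoly\<close> at d.\<close>

lemma card_nbwords:
  assumes "d \<ge> 3"
  shows "real (card (nbwords d (Suc n))) = (real d + 1) * real d * (real d - 1) ^ n"
proof -
  interpret L: complete_lift d "{0 :: nat}" "\<lambda>_ _ y. y" by unfold_locales (use assms in auto)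
  define one where "one = (\<lambda>(u :: nat) (y :: nat). 1 :: real)"
  have p: "poly (nbpoly L.s (Suc n)) (real d) = real d * L.s ^ n"
  proof (induction n rule: less_induct)
    case (less n)
    consider "n = 0" | "n = 1" | m where "n = Suc (Suc m)" by (metis One_nat_def not0_implies_Suc)
    then show ?case
    proof cases
      case 3
      then have "poly (nbpoly L.s (Suc n)) (real d) = real d * (real d * L.s ^ Suc m) - L.s * (real d * L.s ^ m)"
        using less.IH[of m] less.IH[of "Suc m"] by simp
      also have "\<dots> = real d * L.s ^ Suc m * (real d - 1)" by (simp add: algebra_simps)
      also have "\<dots> = real d * L.s ^ n" by (simp add: 3 L.s_def)
      finally show ?thesis .
    qed (auto simp: L.s_def algebra_simps)
  qed
  have "real (card (nbwords d (Suc n))) = (\<Sum>us\<in>nbwords d (Suc n). 1)" by simp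
  also have "\<dots> = (\<Sum>u\<le>d. \<Sum>us | us \<in> nbwords d (Suc n) \<and> hd us = u. 1)"
    by (rule sum.group[symmetric]) (auto dest: L.nbwordsD)
  also have "\<dots> = (\<Sum>u\<le>d. L.nbsum (Suc n) one u 0)"
    by (simp add: L.nbsum_def one_def)
  also have "\<dots> = (\<Sum>u\<le>d. L.opoly (nbpoly L.s (Suc n)) one u 0)"
    by (intro sum.cong refl L.opoly_nbpoly[symmetric]) auto
  also have "\<dots> = (\<Sum>u\<le>d. real d * L.s ^ n)"
  proof (intro sum.cong refl)
    fix u assume u: "u \<in> {..d}"
    have "L.opoly (nbpoly L.s (Suc n)) one u 0 = poly (nbpoly L.s (Suc n)) (real d) * one u 0"
      by (rule L.opoly_eigen) (use u in \<open>auto simp: L.adj_def one_def\<close>)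
    then show "L.opoly (nbpoly L.s (Suc n)) one u 0 = real d * L.s ^ n" by (simp add: p one_def)
  qed
  finally show ?thesis by (simp add: L.s_def algebra_simps)
qed

lemma prod_list_abs_le:
  fixes c x :: real
  assumes "\<And>a. a \<in> set rs \<Longrightarrow> \<bar>x - a\<bar> \<le> c" "c \<ge> 1"
  shows "(\<Prod>a\<leftarrow>rs. \<bar>x - a\<bar>) \<le> c ^ length rs"
    and "a \<in> set rs \<Longrightarrow> (\<Prod>a\<leftarrow>rs. \<bar>x - a\<bar>) \<le> \<bar>x - a\<bar> * c ^ length rs"
proof -
  have nn: "0 \<le> (\<Prod>a\<leftarrow>rs. \<bar>x - a\<bar>)" for rs by (induction rs) auto
  have le: "(\<Prod>a\<leftarrow>rs. \<bar>x - a\<bar>) \<le> c ^ length rs"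
    if "\<And>a. a \<in> set rs \<Longrightarrow> \<bar>x - a\<bar> \<le> c" for rs
    using that
  proof (induction rs)
    case (Cons b rs)
    then have "\<bar>x - b\<bar> * (\<Prod>a\<leftarrow>rs. \<bar>x - a\<bar>) \<le> c * c ^ length rs"
      using nn assms(2) by (intro mult_mono) auto
    then show ?case by simp
  qed simp
  show "(\<Prod>a\<leftarrow>rs. \<bar>x - a\<bar>) \<le> c ^ length rs" by (rule le[OF assms(1)])
  show "(\<Prod>a\<leftarrow>rs. \<bar>x - a\<bar>) \<le> \<bar>x - a\<bar> * c ^ length rs" if "a \<in> set rs" 
    using that assms(1)
  proof (induction rs)
    case (Cons b rs)
    show ?case
    proof (cases "a = b")
      case True
      have "(\<Prod>a\<leftarrow>rs. \<bar>x - a\<bar>) \<le> c ^ length rs" using Cons.prems by (intro le) auto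
      also have "\<dots> \<le> c ^ Suc (length rs)" using assms(2) by (intro power_increasing) auto
      finally show ?thesis using True by (simp add: mult_left_mono)
    next
      case False
      then have "(\<Prod>a\<leftarrow>rs. \<bar>x - a\<bar>) \<le> \<bar>x - a\<bar> * c ^ length rs" using Cons by auto
      then have "\<bar>x - b\<bar> * (\<Prod>a\<leftarrow>rs. \<bar>x - a\<bar>) \<le> c * (\<bar>x - a\<bar> * c ^ length rs)"
        using nn assms(2) Cons.prems(2)[of b] by (intro mult_mono) auto
      then show ?thesis by (simp add: mult_ac)
    qed
  qed simp
qed

lemma poly_linear_factors: "poly (\<Prod>a\<leftarrow>rs. [:- a, 1:]) x = (\<Prod>a\<leftarrow>rs. x - a :: real)"
  by (induction rs) (simp_all add: left_diff_distrib)

lemma abs_prod_list: "\<bar>\<Prod>a\<leftarrow>rs. x - a\<bar> = (\<Prod>a\<leftarrow>rs. \<bar>x - a\<bar> :: real)"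
  by (induction rs) (simp_all add: abs_mult)

context spectral_label_model
begin

definition test_vector :: "nat \<Rightarrow> nat \<Rightarrow> nat \<times> nat \<Rightarrow> real" where
  "test_vector j u y = \<xi> j (snd y)"

text \<open>The squared norm of the test vector is (d + 1) N, while the form is divided by N only;
  hence the factors d + 1 in the bounds below.\<close>

definition quadratic_form :: "nat \<Rightarrow> nat \<Rightarrow> real poly \<Rightarrow> 'a sample \<Rightarrow> real" where
  "quadratic_form j N g \<omega> = complete_lift.ip d (fiber N) (test_vector j)
     (complete_lift.opoly d (lift \<omega>) g (test_vector j)) / real N"

lemma ip_test_vector:
  assumes "j < k" "\<omega> \<in> samples N"
  shows "complete_lift.ip d (fiber N) (test_vector j) (test_vector j) = (real d + 1) * real N"
proof -
  interpret L: complete_lift d "fiber N" "lift \<omega>" by (rule complete_lift_lift) fact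
  have "(\<Sum>y\<in>fiber N. test_vector j u y * test_vector j u y) = (\<Sum>a<N. \<Sum>i<k. (\<xi> j i)\<^sup>2)" for u
    unfolding fiber_def sum.cartesian_product by (simp add: test_vector_def power2_eq_square case_prod_unfold)
  then show ?thesis unfolding L.ip_def by (simp add: normalized[OF assms(1)] algebra_simps)
qed

lemma quadratic_form_add:
  assumes "\<omega> \<in> samples N"
  shows "quadratic_form j N (p + q) \<omega> = quadratic_form j N p \<omega> + quadratic_form j N q \<omega>"
proof -
  interpret L: complete_lift d "fiber N" "lift \<omega>" by (rule complete_lift_lift) fact
  show ?thesis
    unfolding quadratic_form_def L.ip_def by (simp add: L.opoly_add distrib_left sum.distrib add_divide_distrib)
qed

lemma quadratic_form_smult:
  assumes "\<omega> \<in> samples N"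
  shows "quadratic_form j N (Polynomial.smult c p) \<omega> = c * quadratic_form j N p \<omega>"
proof -
  interpret L: complete_lift d "fiber N" "lift \<omega>" by (rule complete_lift_lift) fact
  show ?thesis
    unfolding quadratic_form_def L.ip_def by (simp add: L.opoly_smult sum_distrib_left sum_divide_distrib mult_ac)
qed

lemma quadratic_form_nbpoly:
  assumes "\<omega> \<in> samples N"
  shows "quadratic_form j N (nbpoly s m) \<omega> = (\<Sum>us\<in>nbwords d m. walk_correlation j N us \<omega>) / real N"
proof -
  interpret L: complete_lift d "fiber N" "lift \<omega>" by (rule complete_lift_lift) fact
  have s: "L.s = s" by (simp add: L.s_def s_def)
  have "L.ip (test_vector j) (L.opoly (nbpoly s m) (test_vector j)) =
      (\<Sum>u\<le>d. \<Sum>y\<in>fiber N. test_vector j u y * L.nbsum m (test_vector j) u y)"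
    unfolding L.ip_def using L.opoly_nbpoly[unfolded s] by (intro sum.cong refl) auto
  also have "\<dots> = (\<Sum>u\<le>d. \<Sum>us | us \<in> nbwords d m \<and> hd us = u. \<Sum>y\<in>fiber N. \<xi> j (snd y) * \<xi> j (snd (transport (lift \<omega>) us y)))"
    unfolding L.nbsum_def test_vector_def sum_distrib_left by (intro sum.cong[OF refl] sum.swap)
  also have "\<dots> = (\<Sum>us\<in>nbwords d m. \<Sum>y\<in>fiber N. \<xi> j (snd y) * \<xi> j (snd (transport (lift \<omega>) us y)))"
    by (rule sum.group) (auto dest: L.nbwordsD)
  also have "\<dots> = (\<Sum>us\<in>nbwords d m. walk_correlation j N us \<omega>)"
    unfolding walk_correlation_def fiber_def sum.cartesian_product by (simp add: case_prod_unfold)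
  finally show ?thesis by (simp add: quadratic_form_def)
qed

definition concentrates :: "nat \<Rightarrow> real poly \<Rightarrow> real \<Rightarrow> bool" where
  "concentrates j g v \<longleftrightarrow> (\<lambda>N. expect N (\<lambda>\<omega>. (quadratic_form j N g \<omega> - v)\<^sup>2)) \<longlonglongrightarrow> 0"

lemma expect_power2_nonneg: "0 \<le> expect N (\<lambda>\<omega>. (f \<omega>)\<^sup>2)"
  using expect_mono[of N "\<lambda>_. 0" "\<lambda>\<omega>. (f \<omega>)\<^sup>2"] by (simp add: expect_const)

text \<open>The number of words is fixed, so Cauchy-Schwarz reduces to a single word, whose second
  moment is O(N); dividing by N^2 leaves O(1/N).\<close>

lemma concentrates_nbpoly:
  assumes j: "j < k"
  shows "concentrates j (nbpoly s m) (real (card (nbwords d m)) * \<tau> j ^ m)"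
proof -
  define c where "c = real (card (nbwords d m))"
  define K where "K = c * (c * ((real k + 1)\<^sup>2 * (2 * real m + 2)\<^sup>2))"
  have "\<forall>\<^sub>F N in sequentially. expect N (\<lambda>\<omega>. (quadratic_form j N (nbpoly s m) \<omega> - c * \<tau> j ^ m)\<^sup>2) \<le> K / real N"
    using eventually_ge_at_top[of "2 * m + 2"]
  proof eventually_elim
    case (elim N)
    then have N0: "real N > 0" by simp
    define V where "V us \<omega> = (walk_correlation j N us \<omega> - \<tau> j ^ m * real N)\<^sup>2" for us \<omega>
    have "expect N (\<lambda>\<omega>. (quadratic_form j N (nbpoly s m) \<omega> - c * \<tau> j ^ m)\<^sup>2) \<le>
        expect N (\<lambda>\<omega>. c / (real N)\<^sup>2 * (\<Sum>us\<in>nbwords d m. V us \<omega>))"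
    proof (rule expect_mono)
      fix \<omega> assume \<omega>: "\<omega> \<in> samples N"
      have "quadratic_form j N (nbpoly s m) \<omega> - c * \<tau> j ^ m =
          (\<Sum>us\<in>nbwords d m. walk_correlation j N us \<omega> - \<tau> j ^ m * real N) / real N"
        using N0 by (simp add: quadratic_form_nbpoly[OF \<omega>] sum_subtractf c_def field_simps)
      then show "(quadratic_form j N (nbpoly s m) \<omega> - c * \<tau> j ^ m)\<^sup>2 \<le> c / (real N)\<^sup>2 * (\<Sum>us\<in>nbwords d m. V us \<omega>)"
        using sum_power2_le_card_mult[of "\<lambda>us. walk_correlation j N us \<omega> - \<tau> j ^ m * real N" "nbwords d m"]
        by (simp add: V_def c_def power_divide divide_right_mono)
    qed
    also have "\<dots> = c / (real N)\<^sup>2 * (\<Sum>us\<in>nbwords d m. expect N (V us))"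
      unfolding expect_scale expect_sum ..
    also have "\<dots> \<le> c / (real N)\<^sup>2 * (\<Sum>us\<in>nbwords d m. (real k + 1)\<^sup>2 * (2 * real m + 2)\<^sup>2 * real N)"
      unfolding V_def using j elim
      by (intro mult_left_mono sum_mono walk_correlation_second_moment) (auto simp: c_def)
    also have "\<dots> = K / real N" using N0 by (simp add: K_def c_def power2_eq_square)
    finally show ?case .
  qed
  moreover have "(\<lambda>N. K / real N) \<longlonglongrightarrow> 0" by (rule lim_const_over_n)
  ultimately show ?thesis
    unfolding concentrates_def c_def[symmetric]
    by (rule tendsto_sandwich[OF always_eventually[OF allI[OF expect_power2_nonneg]] _ tendsto_const])
qed

lemma concentrates_smult:
  assumes "concentrates j g v"
  shows "concentrates j (Polynomial.smult c g) (c * v)"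
proof -
  have "expect N (\<lambda>\<omega>. (quadratic_form j N (Polynomial.smult c g) \<omega> - c * v)\<^sup>2) =
      c\<^sup>2 * expect N (\<lambda>\<omega>. (quadratic_form j N g \<omega> - v)\<^sup>2)" for N
    unfolding expect_scale[symmetric]
    by (intro expect_cong) (simp add: quadratic_form_smult power2_eq_square algebra_simps)
  then show ?thesis using tendsto_mult_right_zero[of _ sequentially "c\<^sup>2"] assms by (simp add: concentrates_def)
qed

lemma concentrates_add:
  assumes "concentrates j g v" "concentrates j g' v'"
  shows "concentrates j (g + g') (v + v')"
proof -
  have le: "expect N (\<lambda>\<omega>. (quadratic_form j N (g + g') \<omega> - (v + v'))\<^sup>2) \<le>
      2 * expect N (\<lambda>\<omega>. (quadratic_form j N g \<omega> - v)\<^sup>2) + 2 * expect N (\<lambda>\<omega>. (quadratic_form j N g' \<omega> - v')\<^sup>2)" for N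
    unfolding expect_scale[symmetric] expect_add[symmetric]
  proof (rule expect_mono)
    fix \<omega> assume \<omega>: "\<omega> \<in> samples N"
    define x y where "x = quadratic_form j N g \<omega> - v" and "y = quadratic_form j N g' \<omega> - v'"
    have "(x + y)\<^sup>2 \<le> 2 * x\<^sup>2 + 2 * y\<^sup>2" using sum_squares_bound[of x y] by (simp add: power2_sum)
    then show "(quadratic_form j N (g + g') \<omega> - (v + v'))\<^sup>2 \<le>
        2 * (quadratic_form j N g \<omega> - v)\<^sup>2 + 2 * (quadratic_form j N g' \<omega> - v')\<^sup>2"
      by (simp add: quadratic_form_add[OF \<omega>] x_def y_def algebra_simps)
  qed
  have "(\<lambda>N. 2 * expect N (\<lambda>\<omega>. (quadratic_form j N g \<omega> - v)\<^sup>2) + 2 * expect N (\<lambda>\<omega>. (quadratic_form j N g' \<omega> - v')\<^sup>2))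
      \<longlonglongrightarrow> 2 * 0 + 2 * 0"
    using assms unfolding concentrates_def by (intro tendsto_intros)
  then have lim: "(\<lambda>N. 2 * expect N (\<lambda>\<omega>. (quadratic_form j N g \<omega> - v)\<^sup>2) + 2 * expect N (\<lambda>\<omega>. (quadratic_form j N g' \<omega> - v')\<^sup>2))
      \<longlonglongrightarrow> 0" by simp
  show ?thesis
    unfolding concentrates_def
    by (rule tendsto_sandwich[OF always_eventually[OF allI[OF expect_power2_nonneg]]
          always_eventually[OF allI[OF le]] tendsto_const lim])
qed

text \<open>On polynomials \<open>nbpoly s n * R\<close> with \<open>n\<close> larger than the degree of \<open>R\<close>, the limiting functional of the
  test vector is a multiple of the evaluation of \<open>R\<close> at the outlier, because \<open>\<alpha> ^ n\<close> satisfies the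
  recursion of the polynomials \<open>nbpoly s n\<close>.\<close>

lemma concentrates_product:
  assumes j: "j < k"
  shows "n > length rs \<Longrightarrow> concentrates j (nbpoly s n * (\<Prod>a\<leftarrow>rs. [:- a, 1:]))
     ((\<Prod>a\<leftarrow>rs. outlier j - a) * ((real d + 1) * real d / s * \<alpha> j ^ n))"
proof (induction rs arbitrary: n)
  case Nil
  then obtain m where m: "n = Suc m" by (cases n) auto
  have "real (card (nbwords d n)) * \<tau> j ^ n = (real d + 1) * real d / s * \<alpha> j ^ n"
    using card_nbwords[OF d, of m] s_ge_2 by (simp add: m \<alpha>_def power_mult_distrib s_def[symmetric])
  then show ?case using concentrates_nbpoly[OF j, of n] by simp
next
  case (Cons a rs)
  then obtain m where m: "n = Suc (Suc m)" "m \<ge> length rs" by (cases n; cases "n - 1") auto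
  define R V where "R = (\<Prod>a\<leftarrow>rs. [:- a, 1:])" and "V n = (\<Prod>a\<leftarrow>rs. outlier j - a) * ((real d + 1) * real d / s * \<alpha> j ^ n)" for n
  have IH: "concentrates j (nbpoly s n * R) (V n)" if "n > length rs" for n
    unfolding R_def V_def by (rule Cons.IH[OF that])
  have pe: "poly (nbpoly s n * (\<Prod>a\<leftarrow>a # rs. [:- a, 1:])) = poly (nbpoly s (Suc n) * R +
      (Polynomial.smult s (nbpoly s (Suc m) * R) + Polynomial.smult (- a) (nbpoly s n * R)))"
  proof
    fix x
    have e: "poly (nbpoly s (Suc n)) x = x * poly (nbpoly s n) x - s * poly (nbpoly s (Suc m)) x" by (simp add: m)
    show "poly (nbpoly s n * (\<Prod>a\<leftarrow>a # rs. [:- a, 1:])) x = poly (nbpoly s (Suc n) * R +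
      (Polynomial.smult s (nbpoly s (Suc m) * R) + Polynomial.smult (- a) (nbpoly s n * R))) x"
      unfolding list.map prod_list.Cons R_def[symmetric] poly_mult poly_add poly_smult e by (simp add: algebra_simps)
  qed
  have "concentrates j (nbpoly s (Suc n) * R + (Polynomial.smult s (nbpoly s (Suc m) * R) + Polynomial.smult (- a) (nbpoly s n * R)))
      (V (Suc n) + (s * V (Suc m) + - a * V n))"
    using m by (intro concentrates_add concentrates_smult IH) auto
  \<comment> \<open>\<alpha>^(n+1) + s \<alpha>^(n-1) - a \<alpha>^n is \<alpha>^n times (\<alpha> +
    s/\<alpha> - a): the recursion evaluates the new linear factor at the outlier.\<close>
  moreover have "V (Suc n) + (s * V (Suc m) + - a * V n) =
      (\<Prod>a\<leftarrow>a # rs. outlier j - a) * ((real d + 1) * real d / s * \<alpha> j ^ n)"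
    using \<alpha>_bounds(3)[OF j] s_ge_2 by (simp add: V_def m outlier_def field_simps)
  ultimately show ?case unfolding pe[unfolded poly_eq_poly_eq_iff] by simp
qed

end

section \<open>Graphs with prescribed outliers\<close>

lemma add_divide_strict_mono:
  fixes a b s :: real
  assumes s: "0 < s" and ab: "sqrt s < a" "a < b"
  shows "a + s / a < b + s / b" "2 * sqrt s < a + s / a"
proof -
  have a0: "0 < sqrt s" "0 < a" "0 < b" using assms real_sqrt_gt_zero[OF s] by linarith+
  have "s = sqrt s * sqrt s" using s by simp
  also have "\<dots> < a * b" using ab a0 by (intro mult_strict_mono) auto
  finally have "0 < (b - a) * (a * b - s)" using ab by simp
  also have "(b - a) * (a * b - s) = a * b * ((b + s / b) - (a + s / a))" using a0 by (simp add: field_simps)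
  finally have "0 < (b + s / b) - (a + s / a)" by (rule zero_less_mult_pos) (use a0 in simp)
  then show "a + s / a < b + s / b" by simp
  have "0 < (a - sqrt s)\<^sup>2" using ab by simp
  also have "\<dots> = a * (a + s / a - 2 * sqrt s)" using a0 s by (simp add: power2_eq_square field_simps)
  finally show "2 * sqrt s < a + s / a" using a0 by (simp add: zero_less_mult_iff)
qed

lemma finite_positive_lower_bound:
  fixes A :: "real set"
  assumes "finite A" "\<And>a. a \<in> A \<Longrightarrow> 0 < a"
  obtains e where "0 < e" "\<And>a. a \<in> A \<Longrightarrow> e < a"
proof -
  have "0 < Min (insert 1 A)" using assms by (subst Min_gr_iff) auto
  moreover have "Min (insert 1 A) \<le> a" if "a \<in> A" for a
    using assms(1) that by (intro Min_le) auto
  ultimately have "Min (insert 1 A) / 2 < a" if "a \<in> A" for a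
    using that by fastforce
  then show ?thesis using \<open>0 < Min (insert 1 A)\<close> by (intro that[of "Min (insert 1 A) / 2"]) auto
qed

text \<open>Entries that hit the k separated windows occur at increasing positions, and all of them
  are at least r. With at most k such entries these positions have to be 0, ..., k - 1.\<close>

lemma descending_list_windows:
  fixes L :: "real list" and c :: "nat \<Rightarrow> real"
  assumes L: "sorted (rev L)"
    and sep: "\<And>i j. i < j \<Longrightarrow> j < k \<Longrightarrow> c j + e < c i - e" and r: "\<And>j. j < k \<Longrightarrow> r \<le> c j - e"
    and hit: "\<And>j. j < k \<Longrightarrow> \<exists>x\<in>set L. \<bar>x - c j\<bar> \<le> e"
    and count: "length (filter (\<lambda>x. r \<le> x) L) \<le> k" and j: "j < k"
  shows "\<bar>L ! j - c j\<bar> \<le> e"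
proof -
  have "\<exists>i<length L. \<bar>L ! i - c j\<bar> \<le> e" if "j < k" for j
    using hit[OF that] by (metis in_set_conv_nth)
  then obtain t where t: "\<And>j. j < k \<Longrightarrow> t j < length L" "\<And>j. j < k \<Longrightarrow> \<bar>L ! t j - c j\<bar> \<le> e" by metis
  have mono: "L ! b \<le> L ! a" if "a \<le> b" "b < length L" for a b
    using sorted_rev_nth_mono[OF L that] .
  have less: "t i < t j" if ij: "i < j" "j < k" for i j
  proof (rule ccontr)
    assume "\<not> t i < t j"
    then have "L ! t i \<le> L ! t j" using mono[of "t j" "t i"] t(1)[of i] ij by simp
    then show False using t(2)[of i] t(2)[of j] sep[OF ij] ij by (simp add: abs_le_iff)
  qed
  have bound: "t j < k" if "j < k" for j
  proof -
    have "{..t j} \<subseteq> {i. i < length L \<and> r \<le> L ! i}"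
    proof
      fix i assume i: "i \<in> {..t j}"
      then have "L ! t j \<le> L ! i" using mono t(1)[OF that] by simp
      then show "i \<in> {i. i < length L \<and> r \<le> L ! i}"
        using i t[OF that] r[OF that] by (auto simp: abs_le_iff)
    qed
    then have "card {..t j} \<le> card {i. i < length L \<and> r \<le> L ! i}" by (intro card_mono) auto
    then show ?thesis using count by (simp add: length_filter_conv_card)
  qed
  have shift: "t j + m \<le> t (j + m)" if "j + m < k" for j m
    using that
  proof (induction m)
    case (Suc m)
    then show ?case using less[of "j + m" "j + Suc m"] by simp
  qed simp
  have "j \<le> t j" using shift[of 0 j] j by simp
  moreover have "t j + (k - 1 - j) \<le> k - 1" using shift[of j "k - 1 - j"] bound[of "k - 1"] j by simp
  ultimately have "t j = j" using j by simp
  then show ?thesis using t(2)[OF j] by simp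
qed

lemma linear_le_power2: "n \<ge> 9 \<Longrightarrow> 51 * n \<le> (2 :: nat) ^ n"
  by (induction n rule: dec_induct) auto

text \<open>31 = 15 + 16: the error of \<open>expected_trace\<close> contains q^15 N with q of order
  3^n and N = 3^(16n). The comparison rests on 3^31 \<le> 2^50.\<close>

lemma double_exponential_tendsto:
  "(\<lambda>n. (3 :: real) ^ (31 * n) * (1 / 2) ^ 2 ^ n) \<longlonglongrightarrow> 0"
proof (rule tendsto_sandwich[OF _ _ tendsto_const])
  show "\<forall>\<^sub>F n in sequentially. 0 \<le> (3 :: real) ^ (31 * n) * (1 / 2) ^ 2 ^ n" by simp
  show "\<forall>\<^sub>F n in sequentially. (3 :: real) ^ (31 * n) * (1 / 2) ^ 2 ^ n \<le> (1 / 2) ^ n"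
    using eventually_ge_at_top[of 9]
  proof eventually_elim
    case (elim n)
    have "(3 :: real) ^ (31 * n) \<le> 2 ^ (50 * n)"
      unfolding power_mult by (intro power_mono) (simp_all add: eval_nat_numeral)
    then have "(3 :: real) ^ (31 * n) * (1 / 2) ^ 2 ^ n \<le> 2 ^ (50 * n) * (1 / 2) ^ (51 * n)"
      using linear_le_power2[OF elim] by (intro mult_mono power_decreasing) auto
    also have "51 * n = 50 * n + n" by simp
    also have "(2 :: real) ^ (50 * n) * (1 / 2) ^ (50 * n + n) = (1 / 2) ^ n"
      unfolding power_add mult.assoc[symmetric] power_mult_distrib[symmetric] by simp
    finally show ?case .
  qed
  show "(\<lambda>n. (1 / 2 :: real) ^ n) \<longlonglongrightarrow> 0" by (intro LIMSEQ_power_zero) simp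
qed

section \<open>Test polynomials and the choice of a lift\<close>

context spectral_label_model
begin

text \<open>For \<open>nbpoly s n * R\<close>, where R vanishes at the other outliers, the limit of
  the form grows like \<alpha>_j^n, whereas \<open>nbpoly s n\<close> grows only like n \<gamma>^n
  on |x| \<le> \<gamma> + s/\<gamma>. After normalising the limit to 1 and taking n large, g is
  small wherever eigenvalues can be if none is close to outlier j.\<close>

lemma outlier_test_polynomial:
  assumes j: "j < k" and \<gamma>: "sqrt s < \<gamma>" "\<gamma> < \<alpha> j"
    and dist: "\<And>i. i < k \<Longrightarrow> i \<noteq> j \<Longrightarrow> outlier i \<noteq> outlier j"
  obtains g \<delta> where "concentrates j g 1" "\<delta> > 0"
    "\<And>x. \<bar>x\<bar> \<le> real d \<Longrightarrow> \<bar>x\<bar> \<le> \<gamma> + s / \<gamma> \<or> (\<exists>i<k. i \<noteq> j \<and> \<bar>x - outlier i\<bar> \<le> \<delta>) \<Longrightarrow> (real d + 1) * \<bar>poly g x\<bar> \<le> 1 / 2"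
proof -
  define rs where "rs = map outlier (filter (\<lambda>i. i \<noteq> j) [0..<k])"
  define R where "R = (\<Prod>a\<leftarrow>rs. [:- a, 1:])"
  define c where "c = (2 * real d) ^ length rs"
  define A where "A = \<bar>\<Prod>a\<leftarrow>rs. outlier j - a\<bar>"
  define V where "V n = (\<Prod>a\<leftarrow>rs. outlier j - a) * ((real d + 1) * real d / s * \<alpha> j ^ n)" for n
  have s0: "s > 0" "sqrt s \<ge> 1" using s_ge_2 by simp_all
  have d0: "2 * real d \<ge> 1" using d by simp
  have c1: "c \<ge> 1" unfolding c_def using d0 by (rule one_le_power)
  have \<alpha>0: "\<alpha> j > 0" "\<gamma> > 0" "\<gamma> \<ge> 1" using \<gamma> s0 by linarith+
  have "outlier j - a \<noteq> 0" if "a \<in> set rs" for a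
    using that dist unfolding rs_def by fastforce
  then have "(\<Prod>a\<leftarrow>rs. outlier j - a) \<noteq> 0" by (auto simp: prod_list_zero_iff)
  then have A0: "A > 0" by (simp add: A_def)
  have Vabs: "\<bar>V n\<bar> = A * ((real d + 1) * real d / s * \<alpha> j ^ n)" for n
    using s0 \<alpha>0 by (simp add: V_def A_def abs_mult)
  have Vn: "V n \<noteq> 0" for n
  proof -
    have "0 < (real d + 1) * real d / s * \<alpha> j ^ n"
      using s0 \<alpha>0 d by (intro mult_pos_pos divide_pos_pos zero_less_power) auto
    from mult_pos_pos[OF A0 this] show ?thesis using Vabs[of n] by auto
  qed
  have rx: "\<bar>x - a\<bar> \<le> 2 * real d" if x: "\<bar>x\<bar> \<le> real d" and a: "a \<in> set rs" for x a
  proof -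
    obtain i where i: "i < k" "a = outlier i" using a by (auto simp: rs_def)
    have "0 < outlier i" "outlier i \<le> real d" using outlier_bounds[OF i(1)] s0 by linarith+
    then show ?thesis using x unfolding i(2) by linarith
  qed
  have R1: "\<bar>poly R x\<bar> \<le> c" if "\<bar>x\<bar> \<le> real d" for x
    unfolding R_def poly_linear_factors abs_prod_list c_def by (rule prod_list_abs_le(1)[OF rx[OF that] d0])
  have R2: "\<bar>poly R x\<bar> \<le> \<bar>x - a\<bar> * c" if "\<bar>x\<bar> \<le> real d" "a \<in> set rs" for x a
    unfolding R_def poly_linear_factors abs_prod_list c_def by (rule prod_list_abs_le(2)[OF rx[OF that(1)] d0 that(2)])
  define \<eta> where "\<eta> = A * (real d / s) / (2 * c)"
  have \<eta>0: "\<eta> > 0" using A0 s0 c1 d by (simp add: \<eta>_def)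
  have "(\<lambda>n. (2 * real n + 4) * (\<gamma> / \<alpha> j) ^ n) \<longlonglongrightarrow> 0"
  proof -
    have q: "norm (\<gamma> / \<alpha> j) < 1" using \<gamma> \<alpha>0 by simp
    have "(\<lambda>n. 2 * (real n * (\<gamma> / \<alpha> j) ^ n) + 4 * (\<gamma> / \<alpha> j) ^ n) \<longlonglongrightarrow> 2 * 0 + 4 * 0"
      by (intro tendsto_intros powser_times_n_limit_0[OF q] LIMSEQ_power_zero[OF q])
    then show ?thesis by (simp add: algebra_simps)
  qed
  then have "\<forall>\<^sub>F n in sequentially. (2 * real n + 4) * (\<gamma> / \<alpha> j) ^ n < \<eta>"
    using \<eta>0 by (rule order_tendstoD(2))
  then have "\<forall>\<^sub>F n in sequentially. (2 * real n + 4) * (\<gamma> / \<alpha> j) ^ n < \<eta> \<and> n > length rs"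
    using eventually_gt_at_top by (rule eventually_conj)
  then obtain n where n: "(2 * real n + 4) * (\<gamma> / \<alpha> j) ^ n < \<eta>" "n > length rs"
    using eventually_happens'[OF sequentially_bot] by blast
  have key: "(2 * real n + 4) * \<gamma> ^ n * c \<le> \<bar>V n\<bar> / (2 * (real d + 1))"
  proof -
    have "(2 * real n + 4) * \<gamma> ^ n = (2 * real n + 4) * (\<gamma> / \<alpha> j) ^ n * \<alpha> j ^ n" using \<alpha>0 by (simp add: power_divide)
    also have "\<dots> \<le> \<eta> * \<alpha> j ^ n" using n(1) \<alpha>0 by (intro mult_right_mono) auto
    finally have "(2 * real n + 4) * \<gamma> ^ n * c \<le> \<eta> * \<alpha> j ^ n * c" using c1 by (intro mult_right_mono) auto
    also have "\<dots> = A * (real d / s * \<alpha> j ^ n) / 2" using c1 unfolding \<eta>_def by simp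
    also have "\<dots> = (real d + 1) * (A * (real d / s * \<alpha> j ^ n)) / ((real d + 1) * 2)"
      by (subst mult_divide_mult_cancel_left) auto
    also have "\<dots> = \<bar>V n\<bar> / (2 * (real d + 1))" unfolding Vabs by (simp only: times_divide_eq_right times_divide_eq_left mult_ac)
    finally show ?thesis .
  qed
  define M where "M = (2 * real n + 4) * s ^ n * c"
  \<comment> \<open>Chosen after n: near another outlier \<open>nbpoly s n\<close> may be of size n
    s^n, and only the small linear factor in R compensates this.\<close>
  define \<delta> where "\<delta> = \<bar>V n\<bar> / (2 * (real d + 1)) / M"
  have M0: "M > 0" using s0 c1 by (simp add: M_def)
  have \<delta>0: "\<delta> > 0" using Vn[of n] M0 by (simp add: \<delta>_def)
  define g where "g = Polynomial.smult (1 / V n) (nbpoly s n * R)"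
  show ?thesis
  proof (rule that[of g \<delta>])
    have "concentrates j g (1 / V n * V n)"
      unfolding g_def V_def R_def by (intro concentrates_smult concentrates_product j n)
    then show "concentrates j g 1" using Vn by simp
    fix x assume x: "\<bar>x\<bar> \<le> real d" "\<bar>x\<bar> \<le> \<gamma> + s / \<gamma> \<or> (\<exists>i<k. i \<noteq> j \<and> \<bar>x - outlier i\<bar> \<le> \<delta>)"
    have "\<bar>poly (nbpoly s n) x\<bar> * \<bar>poly R x\<bar> \<le> \<bar>V n\<bar> / (2 * (real d + 1))"
      using x(2)
    proof
      assume "\<bar>x\<bar> \<le> \<gamma> + s / \<gamma>"
      then have "\<bar>poly (nbpoly s n) x\<bar> \<le> (2 * real n + 4) * \<gamma> ^ n"
        using nbpoly_growth[of s \<gamma> x n] s0 \<gamma> \<alpha>0 by simp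
      then have "\<bar>poly (nbpoly s n) x\<bar> * \<bar>poly R x\<bar> \<le> (2 * real n + 4) * \<gamma> ^ n * c"
        using R1[OF x(1)] \<alpha>0 by (intro mult_mono) auto
      then show ?thesis using key by simp
    next
      assume "\<exists>i<k. i \<noteq> j \<and> \<bar>x - outlier i\<bar> \<le> \<delta>"
      then obtain i where i: "i < k" "i \<noteq> j" "\<bar>x - outlier i\<bar> \<le> \<delta>" by blast
      then have "outlier i \<in> set rs" by (auto simp: rs_def)
      from R2[OF x(1) this] have Rx: "\<bar>poly R x\<bar> \<le> \<delta> * c"
        using mult_right_mono[OF i(3), of c] c1 by linarith
      have "s \<ge> sqrt s"
      proof -
        have "sqrt s * 1 \<le> sqrt s * sqrt s" using s0 by (intro mult_left_mono) auto
        then show ?thesis using s0 by simp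
      qed
      then have "\<bar>poly (nbpoly s n) x\<bar> \<le> (2 * real n + 4) * s ^ n"
        using nbpoly_growth[of s s x n] s_ge_2 x(1) by (simp add: s_def)
      then have "\<bar>poly (nbpoly s n) x\<bar> * \<bar>poly R x\<bar> \<le> (2 * real n + 4) * s ^ n * (\<delta> * c)"
        using Rx s0 by (intro mult_mono) auto
      also have "\<dots> = M * \<delta>" by (simp add: M_def)
      also have "\<dots> = \<bar>V n\<bar> / (2 * (real d + 1))" using M0 by (simp add: \<delta>_def)
      finally show ?thesis .
    qed
    then have "(real d + 1) * (\<bar>poly (nbpoly s n) x\<bar> * \<bar>poly R x\<bar>) \<le> \<bar>V n\<bar> / 2" by (simp add: field_simps)
    then show "(real d + 1) * \<bar>poly g x\<bar> \<le> 1 / 2" using Vn[of n] by (simp add: g_def abs_mult field_simps)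
  qed (rule \<delta>0)
qed

lemma quadratic_form_abs_le:
  assumes \<omega>: "\<omega> \<in> samples N" and j: "j < k"
    and tr: "\<And>p. complete_lift.trace d (fiber N) (lift \<omega>) p = (\<Sum>x\<leftarrow>eigs. poly p x)"
    and g: "\<And>x. x \<in> set eigs \<Longrightarrow> (real d + 1) * \<bar>poly g x\<bar> \<le> b" and b: "b \<ge> 0"
  shows "\<bar>quadratic_form j N g \<omega>\<bar> \<le> b"
proof -
  interpret L: complete_lift d "fiber N" "lift \<omega>" by (rule complete_lift_lift) fact
  have "\<bar>L.ip (test_vector j) (L.opoly g (test_vector j))\<bar> \<le> b / (real d + 1) * L.ip (test_vector j) (test_vector j)"
    by (rule L.spectral_bound[OF tr]) (use g b in \<open>auto simp: field_simps\<close>)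
  also have "\<dots> = b * real N" using ip_test_vector[OF j \<omega>] by simp
  finally show ?thesis
    using b unfolding quadratic_form_def abs_divide by (cases "N = 0") (simp_all add: divide_le_eq)
qed

text \<open>\<open>\<Theta>\<close> combines the number of eigenvalues outside the bulk, a penalty for those far from all prescribed values, and the
  fluctuations of the test forms.  Its mean is close to \<open>k\<close>, so some lift has exactly one eigenvalue near each of them.\<close>

theorem outlier_graph:
  assumes k: "k \<ge> 1" and decr: "\<And>i j. i < j \<Longrightarrow> j < k \<Longrightarrow> outlier j < outlier i" and \<delta>: "\<delta> > 0"
  obtains G :: "nat pair_pre_digraph" where "pair_graph G" "regular_graph d G" "k \<le> card (pverts G)"
    "\<And>j. j < k \<Longrightarrow> \<bar>graph_eigenvalue (Suc j) G - outlier j\<bar> < \<delta>"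
proof -
  have s0: "s > 0" "sqrt s > 0" using s_ge_2 by simp_all
  obtain \<gamma> where \<gamma>: "sqrt s < \<gamma>" "\<And>j. j < k \<Longrightarrow> \<gamma> < \<alpha> j"
  proof -
    obtain e where e: "e > 0" "\<And>a. a \<in> (\<lambda>j. \<alpha> j - sqrt s) ` {..<k} \<Longrightarrow> e < a"
      using finite_positive_lower_bound[of "(\<lambda>j. \<alpha> j - sqrt s) ` {..<k}"] \<alpha>_bounds(1) by (metis (no_types, lifting) finite_imageI finite_lessThan imageE lessThan_iff diff_gt_0_iff_gt)
    have "sqrt s + e < \<alpha> j" if "j < k" for j using e(2)[of "\<alpha> j - sqrt s"] that by simp
    then show ?thesis using e(1) by (intro that[of "sqrt s + e"]) auto
  qed
  \<comment> \<open>The threshold beyond which eigenvalues are counted, strictly between the bulk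
    and all outliers.\<close>
  define \<rho> where "\<rho> = \<gamma> + s / \<gamma>"
  have \<rho>: "2 * sqrt s < \<rho>" "\<And>j. j < k \<Longrightarrow> \<rho> < outlier j"
    using add_divide_strict_mono[OF s0(1) \<gamma>(1) \<gamma>(2)] k by (auto simp: \<rho>_def outlier_def)
  have \<rho>d: "\<rho> \<le> real d" using \<rho>(2)[of 0] outlier_bounds(2)[of 0] k by simp
  have "\<exists>g e. concentrates j g 1 \<and> e > 0 \<and> (\<forall>x. \<bar>x\<bar> \<le> real d \<longrightarrow> \<bar>x\<bar> \<le> \<rho> \<or> (\<exists>i<k. i \<noteq> j \<and> \<bar>x - outlier i\<bar> \<le> e) \<longrightarrow> (real d + 1) * \<bar>poly g x\<bar> \<le> 1 / 2)"
    if j: "j < k" for j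
  proof -
    have "outlier i \<noteq> outlier j" if "i < k" "i \<noteq> j" for i
      using decr[of i j] decr[of j i] that j by (cases "i < j") auto
    from outlier_test_polynomial[OF j \<gamma>(1) \<gamma>(2)[OF j] this] show ?thesis unfolding \<rho>_def by metis
  qed
  then obtain g e where ge: "\<And>j. j < k \<Longrightarrow> concentrates j (g j) 1" "\<And>j. j < k \<Longrightarrow> e j > 0"
    "\<And>j x. j < k \<Longrightarrow> \<bar>x\<bar> \<le> real d \<Longrightarrow> \<bar>x\<bar> \<le> \<rho> \<or> (\<exists>i<k. i \<noteq> j \<and> \<bar>x - outlier i\<bar> \<le> e j) \<Longrightarrow> (real d + 1) * \<bar>poly (g j) x\<bar> \<le> 1 / 2"
    by metis
  obtain \<eta> where \<eta>: "\<eta> > 0" "\<eta> < \<delta>" "\<And>j. j < k \<Longrightarrow> \<eta> < e j" "\<And>j. j < k \<Longrightarrow> \<rho> < outlier j - \<eta>"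
    "\<And>i j. i < j \<Longrightarrow> j < k \<Longrightarrow> outlier j + \<eta> < outlier i - \<eta>"
  proof -
    define A where "A = insert \<delta> (e ` {..<k} \<union> (\<lambda>j. outlier j - \<rho>) ` {..<k} \<union> (\<lambda>(i, j). (outlier i - outlier j) / 2) ` {(i, j). i < j \<and> j < k})"
    have "finite {(i, j). i < j \<and> j < k}" by (rule finite_subset[of _ "{..<k} \<times> {..<k}"]) auto
    then have finA: "finite A" by (simp add: A_def)
    have "0 < a" if "a \<in> A" for a
      using that \<delta> ge(2) \<rho>(2) decr by (auto simp: A_def)
    then obtain \<eta> where \<eta>: "\<eta> > 0" "\<And>a. a \<in> A \<Longrightarrow> \<eta> < a" using finite_positive_lower_bound[OF finA] by metis
    show ?thesis
    proof (rule that[of \<eta>])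
      show "\<rho> < outlier j - \<eta>" if "j < k" for j using \<eta>(2)[of "outlier j - \<rho>"] that by (simp add: A_def)
      show "outlier j + \<eta> < outlier i - \<eta>" if "i < j" "j < k" for i j
      proof -
        have "(outlier i - outlier j) / 2 \<in> A" unfolding A_def using that by (intro insertI2 UnI2 image_eqI[of _ _ "(i, j)"]) auto
        then show ?thesis using \<eta>(2) by fastforce
      qed
    qed (use \<eta> in \<open>auto simp: A_def\<close>)
  qed
  define os where "os = map outlier [0..<k]"
  have os: "length os = k" "set os = outlier ` {..<k}" by (auto simp: os_def)
  define R where "R = (\<Prod>a\<leftarrow>os. [:- a, 1:])"
  have R_abs: "\<bar>poly R x\<bar> = (\<Prod>a\<leftarrow>os. \<bar>x - a\<bar>)" for x
    unfolding R_def poly_linear_factors abs_prod_list ..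
  \<comment> \<open>Squared, so that the trace of \<open>h n * P\<close> is a sum of nonnegative
    penalties. It vanishes at every outlier, so the expected penalty is only an error term.\<close>
  define P where "P = R * R"
  have P0: "poly P x \<ge> 0" for x by (simp add: P_def)
  have Pout: "poly P (outlier j) = 0" if "j < k" for j
  proof -
    have "outlier j \<in> set os" using that by (simp add: os)
    then have "poly R (outlier j) = 0" unfolding R_def poly_linear_factors prod_list_zero_iff by force
    then show ?thesis by (simp add: P_def)
  qed
  have Pfar: "\<eta> ^ k * \<eta> ^ k \<le> poly P x" if "\<And>i. i < k \<Longrightarrow> \<eta> < \<bar>x - outlier i\<bar>" for x
  proof -
    have "\<eta> ^ length xs \<le> (\<Prod>a\<leftarrow>xs. \<bar>x - a\<bar>)" if "\<And>a. a \<in> set xs \<Longrightarrow> \<eta> < \<bar>x - a\<bar>" for xs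
      using that
    proof (induction xs)
      case (Cons a xs)
      have "\<eta> \<le> \<bar>x - a\<bar>" using Cons.prems[of a] by simp
      moreover have "\<eta> ^ length xs \<le> (\<Prod>a\<leftarrow>xs. \<bar>x - a\<bar>)" using Cons by simp
      ultimately have "\<eta> * \<eta> ^ length xs \<le> \<bar>x - a\<bar> * (\<Prod>a\<leftarrow>xs. \<bar>x - a\<bar>)"
        using \<eta>(1) by (intro mult_mono) auto
      then show ?case by simp
    qed simp
    from this[of os] have "\<eta> ^ k \<le> \<bar>poly R x\<bar>"
      using that by (auto simp: os R_abs)
    then have "\<eta> ^ k * \<eta> ^ k \<le> \<bar>poly R x\<bar> * \<bar>poly R x\<bar>" using \<eta>(1) by (intro mult_mono) auto
    then show ?thesis by (simp add: P_def)
  qed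
  define C where "C = (2 * real d) ^ k * (2 * real d) ^ k"
  have C1: "C \<ge> 1" using d by (simp add: C_def one_le_power mult_ge1_I)
  have PC: "poly P x \<le> C" if x: "\<bar>x\<bar> \<le> real d" for x
  proof -
    have "\<bar>x - a\<bar> \<le> 2 * real d" if a: "a \<in> set os" for a
    proof -
      obtain i where i: "i < k" "a = outlier i" using a by (auto simp: os)
      have "0 < outlier i" "outlier i \<le> real d" using outlier_bounds[OF i(1)] s0 by linarith+
      then show ?thesis using x i by (auto simp: abs_le_iff)
    qed
    then have "\<bar>poly R x\<bar> \<le> (2 * real d) ^ length os"
      unfolding R_abs by (rule prod_list_abs_le(1)) (use d in auto)
    then have "\<bar>poly R x\<bar> * \<bar>poly R x\<bar> \<le> C" unfolding C_def os by (intro mult_mono) auto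
    then show ?thesis by (simp add: P_def)
  qed
  have degP: "degree P \<le> 2 * k"
  proof -
    have "degree (\<Prod>a\<leftarrow>xs. [:- a, 1 :: real:]) \<le> length xs" for xs
    proof (induction xs)
      case (Cons a xs)
      then show ?case using degree_mult_le[of "[:- a, 1:]" "\<Prod>a\<leftarrow>xs. [:- a, 1:]"] by (simp del: mult_pCons_left)
    qed simp
    from this[of os] have "degree R \<le> k" by (simp add: R_def os)
    then show ?thesis using degree_mult_le[of R R] by (simp add: P_def)
  qed
  obtain D h where h: "\<And>n. degree (h n) \<le> D * 3 ^ n"
    "\<And>n x. \<bar>x\<bar> \<le> real d \<Longrightarrow> 0 \<le> poly (h n) x \<and> poly (h n) x \<le> 1"
    "\<And>n x. \<bar>x\<bar> \<le> 2 * sqrt s \<Longrightarrow> poly (h n) x \<le> (1 / 2) ^ 2 ^ n"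
    "\<And>n x. \<rho> \<le> \<bar>x\<bar> \<Longrightarrow> \<bar>x\<bar> \<le> real d \<Longrightarrow> poly (h n) x \<ge> 1 - (1 / 2) ^ 2 ^ n"
    using step_polynomials[OF _ \<rho>(1) \<rho>d] s0 by (metis mult_pos_pos zero_less_numeral)
  obtain B where B: "B \<ge> 1" "\<And>q g S S' N. q \<ge> 1 \<Longrightarrow> degree g \<le> q \<Longrightarrow>
      (\<And>x. \<bar>x\<bar> \<le> 2 * sqrt s \<Longrightarrow> \<bar>poly g x\<bar> \<le> S) \<Longrightarrow>
      (\<And>x. \<bar>x\<bar> \<le> real d \<Longrightarrow> \<bar>poly g x\<bar> \<le> S') \<Longrightarrow> S \<le> S' \<Longrightarrow> B * real q ^ 15 \<le> real N \<Longrightarrow>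
      \<bar>expect N (lift_trace N g) - (\<Sum>j<k. poly g (outlier j))\<bar> \<le> B * real q ^ 15 * (real N * S + S' / real N)"
    using expected_trace by blast
  define E where "E = D + 2 * k + 1"
  \<comment> \<open>The degree q is of order 3^n, so q^15 / N tends to 0 because 16 > 15; the other
    term q^15 N S tends to 0 because S is doubly exponentially small in n.\<close>
  define N where "N n = (3 :: nat) ^ (16 * n)" for n
  define err where "err n = B * real (E * 3 ^ n) ^ 15 * (real (N n) * (C * (1 / 2) ^ 2 ^ n) + C / real (N n))" for n
  have N_top: "filterlim N at_top sequentially"
  proof (rule filterlim_at_top_mono[OF filterlim_ident])
    show "\<forall>\<^sub>F n in sequentially. n \<le> N n"
    proof (rule always_eventually, rule allI)
      fix n :: nat
      have "n < 2 ^ n" by (rule less_exp)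
      also have "(2 :: nat) ^ n \<le> 3 ^ n" by (rule power_mono) auto
      also have "(3 :: nat) ^ n \<le> N n" unfolding N_def by (intro power_increasing) auto
      finally show "n \<le> N n" by simp
    qed
  qed
  have err_lim: "err \<longlonglongrightarrow> 0"
  proof -
    have "err = (\<lambda>n. B * real E ^ 15 * C * (3 ^ (31 * n) * (1 / 2) ^ 2 ^ n + (1 / 3) ^ n))"
    proof
      fix n
      define z :: real where "z = 3 ^ n"
      have z: "z > 0" "(3 :: real) ^ (31 * n) = z ^ 31" "real (N n) = z ^ 16" "(1 / 3 :: real) ^ n = 1 / z"
        by (simp_all add: z_def N_def power_one_over mult.commute flip: power_mult)
      have "z ^ 31 = z ^ 15 * z ^ 16" "z ^ 15 * (C / z ^ 16) = C * (1 / z)"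
        using z(1) by (simp_all add: field_simps flip: power_add power_Suc)
      then have e: "z ^ 15 * (z ^ 16 * (C * (1 / 2) ^ 2 ^ n) + C / z ^ 16) = C * (z ^ 31 * (1 / 2) ^ 2 ^ n + 1 / z)"
        by (simp only: distrib_left mult_ac)
      have "err n = B * real E ^ 15 * (z ^ 15 * (z ^ 16 * (C * (1 / 2) ^ 2 ^ n) + C / z ^ 16))"
        unfolding err_def z(3) by (simp add: power_mult_distrib z_def mult.assoc)
      then show "err n = B * real E ^ 15 * C * (3 ^ (31 * n) * (1 / 2) ^ 2 ^ n + (1 / 3) ^ n)"
        unfolding z(2,4) e by (simp only: mult.assoc)
    qed
    moreover have "(\<lambda>n. B * real E ^ 15 * C * (3 ^ (31 * n) * (1 / 2) ^ 2 ^ n + (1 / 3) ^ n)) \<longlonglongrightarrow> B * real E ^ 15 * C * (0 + 0)"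
      by (intro tendsto_intros double_exponential_tendsto LIMSEQ_power_zero) simp
    ultimately show ?thesis by simp
  qed
  have "\<forall>\<^sub>F n in sequentially. B * real E ^ 15 \<le> 3 ^ n"
  proof -
    have "filterlim (\<lambda>n. (3 :: real) ^ n) at_top sequentially"
    proof (rule filterlim_at_top_mono[OF filterlim_real_sequentially], rule always_eventually, rule allI)
      fix n :: nat
      have "real n < 2 ^ n" by (rule of_nat_less_two_power)
      also have "(2 :: real) ^ n \<le> 3 ^ n" by (rule power_mono) auto
      finally show "real n \<le> 3 ^ n" by simp
    qed
    then show ?thesis by (simp add: filterlim_at_top)
  qed
  then have ev1: "\<forall>\<^sub>F n in sequentially. B * real (E * 3 ^ n) ^ 15 \<le> real (N n)"
  proof eventually_elim
    case (elim n)
    have "B * real (E * 3 ^ n) ^ 15 = B * real E ^ 15 * 3 ^ (15 * n)" by (simp add: power_mult_distrib mult.commute flip: power_mult)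
    also have "\<dots> \<le> 3 ^ n * 3 ^ (15 * n)" using elim by (intro mult_right_mono) auto
    also have "\<dots> = real (N n)" by (simp add: N_def flip: power_add)
    finally show ?case .
  qed
  \<comment> \<open>One eigenvalue beyond \<rho> at distance more than \<eta> from all outliers adds
    at least half of \<eta>^(2k) to the trace of \<open>h n * P\<close>. The factor K raises this to
    k + 1, above the bound k + 1/4 for \<Theta>.\<close>
  define K where "K = 2 * (real k + 1) / (\<eta> ^ k * \<eta> ^ k)"
  have K0: "K > 0" using \<eta>(1) by (simp add: K_def)
  define dev where "dev j M = expect M (\<lambda>\<omega>. (quadratic_form j M (g j) \<omega> - 1)\<^sup>2)" for j M
  \<comment> \<open>If outlier j is missed, its form is at most 1/2 and its square term is at least
    4(k + 1)/4 = k + 1, again too much.\<close>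
  define \<Theta> where "\<Theta> n \<omega> = lift_trace (N n) (h n) \<omega> + K * lift_trace (N n) (h n * P) \<omega>
     + (\<Sum>j<k. 4 * (real k + 1) * (quadratic_form j (N n) (g j) \<omega> - 1)\<^sup>2)" for n \<omega>
  have "(\<lambda>n. real k + err n + K * err n + (\<Sum>j<k. 4 * (real k + 1) * dev j (N n))) \<longlonglongrightarrow>
      real k + 0 + K * 0 + (\<Sum>j<k. 4 * (real k + 1) * 0)"
  proof (intro tendsto_intros err_lim)
    fix j assume "j \<in> {..<k}"
    then have "(\<lambda>M. dev j M) \<longlonglongrightarrow> 0" using ge(1)[of j] unfolding concentrates_def dev_def by simp
    then show "(\<lambda>n. dev j (N n)) \<longlonglongrightarrow> 0" by (rule filterlim_compose[OF _ N_top])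
  qed
  then have "\<forall>\<^sub>F n in sequentially. real k + err n + K * err n + (\<Sum>j<k. 4 * (real k + 1) * dev j (N n)) < real k + 1 / 4"
    by (rule order_tendstoD(2)) simp
  moreover have "\<forall>\<^sub>F n in sequentially. (1 / 2 :: real) ^ 2 ^ n < 1 / (4 * (real k + 1))"
  proof (rule order_tendstoD(2))
    have "filterlim (\<lambda>n. (2 :: nat) ^ n) at_top sequentially"
      by (rule filterlim_at_top_mono[OF filterlim_ident]) (simp add: less_imp_le)
    moreover have "(\<lambda>n. (1 / 2 :: real) ^ n) \<longlonglongrightarrow> 0" by (intro LIMSEQ_power_zero) simp
    ultimately show "(\<lambda>n. (1 / 2 :: real) ^ 2 ^ n) \<longlonglongrightarrow> 0" by (rule filterlim_compose[rotated])
  qed simp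
  ultimately have "\<forall>\<^sub>F n in sequentially. B * real (E * 3 ^ n) ^ 15 \<le> real (N n) \<and>
      real k + err n + K * err n + (\<Sum>j<k. 4 * (real k + 1) * dev j (N n)) < real k + 1 / 4 \<and>
      (1 / 2 :: real) ^ 2 ^ n < 1 / (4 * (real k + 1))"
    by (intro eventually_conj ev1)
  then obtain n where n: "B * real (E * 3 ^ n) ^ 15 \<le> real (N n)"
      "real k + err n + K * err n + (\<Sum>j<k. 4 * (real k + 1) * dev j (N n)) < real k + 1 / 4"
      "(1 / 2 :: real) ^ 2 ^ n < 1 / (4 * (real k + 1))"
    using eventually_happens'[OF sequentially_bot] by blast
  have hsmall: "\<bar>poly (h n) x\<bar> \<le> (1 / 2) ^ 2 ^ n" if "\<bar>x\<bar> \<le> 2 * sqrt s" for x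
    using h(2)[of x n] h(3)[OF that, of n] that \<rho>(1) \<rho>d by simp
  have q1: "E * 3 ^ n \<ge> 1" using mult_le_mono[of 1 E 1 "3 ^ n"] by (simp add: E_def)
  have E1: "\<bar>expect (N n) (lift_trace (N n) (h n)) - (\<Sum>j<k. poly (h n) (outlier j))\<bar> \<le> err n"
    unfolding err_def
  proof (rule B(2)[OF q1 _ _ _ _ n(1)])
    show "degree (h n) \<le> E * 3 ^ n" by (rule order_trans[OF h(1)]) (simp add: E_def algebra_simps)
    show "\<bar>poly (h n) x\<bar> \<le> C * (1 / 2) ^ 2 ^ n" if "\<bar>x\<bar> \<le> 2 * sqrt s" for x
    proof -
      have "1 * (1 / 2) ^ 2 ^ n \<le> C * (1 / 2) ^ 2 ^ n" using C1 by (intro mult_right_mono) auto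
      then show ?thesis using hsmall[OF that] by linarith
    qed
    show "\<bar>poly (h n) x\<bar> \<le> C" if "\<bar>x\<bar> \<le> real d" for x using h(2)[OF that, of n] C1 by simp
    show "C * (1 / 2) ^ 2 ^ n \<le> C" using C1 by (simp add: power_le_one mult_left_le)
  qed
  have E2: "\<bar>expect (N n) (lift_trace (N n) (h n * P)) - (\<Sum>j<k. poly (h n * P) (outlier j))\<bar> \<le> err n"
    unfolding err_def
  proof (rule B(2)[OF q1 _ _ _ _ n(1)])
    have "degree (h n * P) \<le> D * 3 ^ n + 2 * k"
      using degree_mult_le[of "h n" P] h(1)[of n] degP by linarith
    also have "\<dots> \<le> D * 3 ^ n + 2 * k * 3 ^ n" by simp
    also have "\<dots> \<le> E * 3 ^ n" by (simp add: E_def algebra_simps)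
    finally show "degree (h n * P) \<le> E * 3 ^ n" .
    show "\<bar>poly (h n * P) x\<bar> \<le> C * (1 / 2) ^ 2 ^ n" if "\<bar>x\<bar> \<le> 2 * sqrt s" for x
    proof -
      have "\<bar>poly (h n) x\<bar> * \<bar>poly P x\<bar> \<le> (1 / 2) ^ 2 ^ n * C"
        using hsmall[OF that] PC[of x] P0[of x] that \<rho>(1) \<rho>d by (intro mult_mono) auto
      then show ?thesis by (simp add: abs_mult mult.commute)
    qed
    show "\<bar>poly (h n * P) x\<bar> \<le> C" if "\<bar>x\<bar> \<le> real d" for x
    proof -
      have "\<bar>poly (h n) x\<bar> * \<bar>poly P x\<bar> \<le> 1 * C"
        using h(2)[OF that, of n] PC[OF that] P0[of x] by (intro mult_mono) auto
      then show ?thesis by (simp add: abs_mult)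
    qed
    show "C * (1 / 2) ^ 2 ^ n \<le> C" using C1 by (simp add: power_le_one mult_left_le)
  qed
  have "expect (N n) (\<Theta> n) = expect (N n) (lift_trace (N n) (h n)) + K * expect (N n) (lift_trace (N n) (h n * P))
     + (\<Sum>j<k. 4 * (real k + 1) * dev j (N n))"
    unfolding \<Theta>_def expect_add expect_sum expect_scale dev_def ..
  also have "\<dots> \<le> real k + err n + K * err n + (\<Sum>j<k. 4 * (real k + 1) * dev j (N n))"
  proof -
    have "(\<Sum>j<k. poly (h n) (outlier j)) \<le> (\<Sum>j<k. 1)"
    proof (rule sum_mono)
      fix j assume "j \<in> {..<k}"
      then have "2 * sqrt s < outlier j" "outlier j \<le> real d" using outlier_bounds[of j] by simp_all
      then have "\<bar>outlier j\<bar> \<le> real d" using s0 by linarith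
      then show "poly (h n) (outlier j) \<le> 1" using h(2)[of "outlier j" n] by simp
    qed
    moreover have "(\<Sum>j<k. poly (h n * P) (outlier j)) = 0" by (intro sum.neutral) (simp add: Pout)
    then have "K * expect (N n) (lift_trace (N n) (h n * P)) \<le> K * err n" using E2 K0 by (intro mult_left_mono) auto
    ultimately show ?thesis using E1 by simp
  qed
  also note n(2)
  finally have "expect (N n) (\<Theta> n) < real k + 1 / 4" .
  moreover obtain \<omega> where \<omega>: "\<omega> \<in> samples (N n)" "\<Theta> n \<omega> \<le> expect (N n) (\<Theta> n)" using expect_exists_le by blast
  ultimately have \<Theta>: "\<Theta> n \<omega> < real k + 1 / 4" by simp
  interpret L: complete_lift d "fiber (N n)" "lift \<omega>" by (rule complete_lift_lift) fact
  obtain G :: "nat pair_pre_digraph" where G: "pair_graph G" "regular_graph d G" "card (pverts G) = (d + 1) * card (fiber (N n))"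
    "\<And>p. L.trace p = (\<Sum>x\<leftarrow>adjacency_eigenvalues G. poly p x)"
    using L.lift_graph by metis
  define eigs where "eigs = adjacency_eigenvalues G"
  have abs_d: "\<bar>x\<bar> \<le> real d" if "x \<in> set eigs" for x
    using L.eigenvalue_abs_le[OF G(4)] that by (simp add: eigs_def)
  have hx: "0 \<le> poly (h n) x" "poly (h n) x \<le> 1" if "x \<in> set eigs" for x using h(2)[OF abs_d[OF that]] by auto
  have nonneg: "0 \<le> (\<Sum>x\<leftarrow>eigs. poly (h n) x)" "0 \<le> (\<Sum>x\<leftarrow>eigs. poly (h n * P) x)"
    using hx P0 by (auto intro!: sum_list_nonneg)
  have sq: "0 \<le> (\<Sum>j<k. 4 * (real k + 1) * (quadratic_form j (N n) (g j) \<omega> - 1)\<^sup>2)" by (intro sum_nonneg) auto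
  have \<Theta>_eq: "(\<Sum>x\<leftarrow>eigs. poly (h n) x) + K * (\<Sum>x\<leftarrow>eigs. poly (h n * P) x)
     + (\<Sum>j<k. 4 * (real k + 1) * (quadratic_form j (N n) (g j) \<omega> - 1)\<^sup>2) < real k + 1 / 4"
    using \<Theta> unfolding \<Theta>_def G(4) eigs_def .
  have Kn: "0 \<le> K * (\<Sum>x\<leftarrow>eigs. poly (h n * P) x)" using K0 nonneg by simp
  define \<epsilon> where "\<epsilon> = (1 / 2 :: real) ^ 2 ^ n"
  have \<epsilon>: "0 < \<epsilon>" "(real k + 1) * \<epsilon> < 1 / 4" "\<epsilon> < 1 / 2"
  proof -
    show "0 < \<epsilon>" by (simp add: \<epsilon>_def)
    show e: "(real k + 1) * \<epsilon> < 1 / 4" using n(3) by (simp add: \<epsilon>_def field_simps)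
    have "1 * \<epsilon> \<le> (real k + 1) * \<epsilon>" by (intro mult_right_mono) (auto simp: \<epsilon>_def)
    then show "\<epsilon> < 1 / 2" using e by simp
  qed
  have count: "length (filter (\<lambda>x. \<rho> \<le> \<bar>x\<bar>) eigs) \<le> k"
  proof (rule ccontr)
    assume "\<not> ?thesis"
    then have "real k + 1 \<le> real (length (filter (\<lambda>x. \<rho> \<le> \<bar>x\<bar>) eigs))" by linarith
    \<comment> \<open>k + 1 eigenvalues beyond \<rho> would give more than k + 1 - 1/4 in the first
      trace.\<close>
    then have "(real k + 1) * (1 - \<epsilon>) \<le> real (length (filter (\<lambda>x. \<rho> \<le> \<bar>x\<bar>) eigs)) * (1 - \<epsilon>)"
      using \<epsilon> by (intro mult_right_mono) auto
    also have "\<dots> \<le> (\<Sum>x\<leftarrow>eigs. poly (h n) x)"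
    proof -
      have "real (length (filter (\<lambda>x. \<rho> \<le> \<bar>x\<bar>) xs)) * (1 - \<epsilon>) \<le> (\<Sum>x\<leftarrow>xs. poly (h n) x)" if "set xs \<subseteq> set eigs" for xs
        using that
      proof (induction xs)
        case (Cons x xs)
        then have "x \<in> set eigs" by simp
        then show ?case using Cons hx[of x] h(4)[of x n] abs_d[of x] by (auto simp: \<epsilon>_def algebra_simps)
      qed simp
      then show ?thesis by simp
    qed
    also have "\<dots> < real k + 1 / 4" using \<Theta>_eq Kn sq by linarith
    finally show False using \<epsilon> by (simp add: algebra_simps)
  qed
  have near: "\<exists>i<k. \<bar>x - outlier i\<bar> \<le> \<eta>" if x: "x \<in> set eigs" "\<rho> \<le> \<bar>x\<bar>" for x
  proof (rule ccontr)
    assume "\<not> ?thesis"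
    then have "\<eta> ^ k * \<eta> ^ k \<le> poly P x" by (intro Pfar) (auto simp: not_le)
    moreover have "1 / 2 \<le> poly (h n) x" using h(4)[OF x(2) abs_d[OF x(1)], of n] \<epsilon> by (simp add: \<epsilon>_def)
    ultimately have "1 / 2 * (\<eta> ^ k * \<eta> ^ k) \<le> poly (h n * P) x"
      unfolding poly_mult using \<eta>(1) P0 by (intro mult_mono) auto
    also have "\<dots> \<le> (\<Sum>x\<leftarrow>eigs. poly (h n * P) x)"
      using x(1) hx P0 by (intro member_le_sum_list_nonneg) auto
    finally have "K * (1 / 2 * (\<eta> ^ k * \<eta> ^ k)) \<le> K * (\<Sum>x\<leftarrow>eigs. poly (h n * P) x)"
      using K0 by (intro mult_left_mono) auto
    also have "\<dots> < real k + 1 / 4" using \<Theta>_eq nonneg sq by linarith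
    finally show False using \<eta>(1) by (simp add: K_def)
  qed
  have hit: "\<exists>x\<in>set eigs. \<bar>x - outlier j\<bar> \<le> \<eta>" if j: "j < k" for j
  proof (rule ccontr)
    assume no: "\<not> ?thesis"
    have "\<bar>quadratic_form j (N n) (g j) \<omega>\<bar> \<le> 1 / 2"
    proof (rule quadratic_form_abs_le[OF \<omega>(1) j G(4)])
      fix x assume x: "x \<in> set (adjacency_eigenvalues G)"
      have "\<bar>x\<bar> \<le> \<rho> \<or> (\<exists>i<k. i \<noteq> j \<and> \<bar>x - outlier i\<bar> \<le> e j)"
      proof (cases "\<bar>x\<bar> \<le> \<rho>")
        case False
        then obtain i where i: "i < k" "\<bar>x - outlier i\<bar> \<le> \<eta>" using near[of x] x by (auto simp: eigs_def)
        moreover have "i \<noteq> j" using no i x by (auto simp: eigs_def)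
        ultimately show ?thesis using \<eta>(3)[OF j] by (intro disjI2 exI[of _ i]) auto
      qed simp
      then show "(real d + 1) * \<bar>poly (g j) x\<bar> \<le> 1 / 2" using ge(3)[OF j] abs_d x by (simp add: eigs_def)
    qed simp
    then have "(1 / 2)\<^sup>2 \<le> (quadratic_form j (N n) (g j) \<omega> - 1)\<^sup>2"
      by (intro abs_le_square_iff[THEN iffD1]) (auto simp: abs_le_iff)
    then have "4 * (real k + 1) * (1 / 2)\<^sup>2 \<le> 4 * (real k + 1) * (quadratic_form j (N n) (g j) \<omega> - 1)\<^sup>2"
      by (intro mult_left_mono) auto
    moreover have "4 * (real k + 1) * (1 / 2)\<^sup>2 = real k + 1" by (simp add: power2_eq_square)
    ultimately have "real k + 1 \<le> 4 * (real k + 1) * (quadratic_form j (N n) (g j) \<omega> - 1)\<^sup>2" by (simp only:)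
    also have "\<dots> \<le> (\<Sum>j<k. 4 * (real k + 1) * (quadratic_form j (N n) (g j) \<omega> - 1)\<^sup>2)"
      using j by (intro member_le_sum) auto
    also have "\<dots> < real k + 1 / 4" using \<Theta>_eq Kn nonneg by linarith
    finally show False by simp
  qed
  show ?thesis
  proof (rule that[OF G(1,2)])
    have "1 * (1 * k) \<le> (d + 1) * (N n * k)" by (intro mult_le_mono) (auto simp: N_def)
    then show "k \<le> card (pverts G)" by (simp add: G(3) card_fiber)
    fix j assume j: "j < k"
    have "\<bar>eigs ! j - outlier j\<bar> \<le> \<eta>"
    proof (rule descending_list_windows[OF _ \<eta>(5) _ hit _ j])
      show "sorted (rev eigs)" by (simp add: eigs_def adjacency_eigenvalues_def)
      show "\<rho> \<le> outlier j - \<eta>" if "j < k" for j using \<eta>(4)[OF that] by simp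
      have "length (filter (\<lambda>x. \<rho> \<le> x) xs) \<le> length (filter (\<lambda>x. \<rho> \<le> \<bar>x\<bar>) xs)" for xs
        by (induction xs) auto
      then show "length (filter (\<lambda>x. \<rho> \<le> x) eigs) \<le> k" using count order_trans by blast
    qed
    then show "\<bar>graph_eigenvalue (Suc j) G - outlier j\<bar> < \<delta>" using \<eta>(2) by (simp add: graph_eigenvalue_def eigs_def)
  qed
qed

end

section \<open>Labels with a prescribed averaging operator\<close>

text \<open>For the label (l, a) this is i -> a - i modulo l on the first l points. Reflections
  replace shifts since labels must be involutions; adding l keeps the subtraction from being
  truncated.\<close>

definition reflection :: "nat \<times> nat \<Rightarrow> nat \<Rightarrow> nat" where
  "reflection p i = (if i < fst p then (snd p + fst p - i) mod fst p else i)"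

lemma reflection_less: "fst p \<le> k \<Longrightarrow> i < k \<Longrightarrow> reflection p i < k"
  unfolding reflection_def by (auto intro: less_le_trans[OF mod_less_divisor])

lemma reflection_eq: "i < l \<Longrightarrow> a + l = (a + l - i) div l * l + reflection (l, a) i + i"
  using div_mult_mod_eq[of "a + l - i" l] by (simp add: reflection_def)

lemma reflection_reflection: "reflection p (reflection p i) = i"
proof (cases "i < fst p")
  case True
  obtain l a where p: "p = (l, a)" by (cases p)
  define r where "r = reflection (l, a) i"
  have l: "i < l" "r < l" using True by (auto simp: p r_def reflection_def)
  have "a + l - r = (a + l - i) div l * l + i" using reflection_eq[OF l(1), of a] by (simp add: r_def)
  then have "(a + l - r) mod l = i" using l by simp
  then show ?thesis using l by (simp add: p reflection_def[of _ r] flip: r_def)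
qed (simp add: reflection_def)

text \<open>For fixed i the residues a - i run once through all classes modulo l, so averaging over
  a replaces f(i) by the mean of f over the first l points.\<close>

lemma bij_betw_reflection:
  assumes "i < l"
  shows "bij_betw (\<lambda>a. reflection (l, a) i) {..<l} {..<l}"
proof -
  have "(reflection (l, a) i + i) mod l = a" if "a < l" for a
  proof -
    have "(reflection (l, a) i + i) mod l = ((a + l - i) div l * l + (reflection (l, a) i + i)) mod l"
      by simp
    also have "\<dots> = (a + l) mod l" using reflection_eq[OF assms, of a] by (simp only: add.assoc)
    finally show ?thesis using that by simp
  qed
  then have "inj_on (\<lambda>a. reflection (l, a) i) {..<l}" by (intro inj_onI) (metis lessThan_iff)
  moreover have "(\<lambda>a. reflection (l, a) i) ` {..<l} \<subseteq> {..<l}" using assms by (auto simp: reflection_def)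
  ultimately show ?thesis by (simp add: bij_betw_def endo_inj_surj)
qed

text \<open>Averaging over the first \<open>l\<close> coordinates is the mean of the involutions \<open>reflection (l, a)\<close>, \<open>a < l\<close>. Helmert's
  orthogonal basis, that is, the constant vector and \<open>helmert m\<close> for \<open>1 \<le> m < k\<close>, diagonalises all these averages.\<close>

definition helmert :: "nat \<Rightarrow> nat \<Rightarrow> real" where
  "helmert m i = (if i < m then 1 else if i = m then - real m else 0)"

lemma sum_helmert: "m < l \<Longrightarrow> (\<Sum>i<l. helmert m i) = 0"
proof -
  assume "m < l"
  then have "(\<Sum>i<l. helmert m i) = (\<Sum>i\<in>{..<Suc m}. helmert m i)"
    by (intro sum.mono_neutral_right) (auto simp: helmert_def)
  also have "\<dots> = 0" by (simp add: helmert_def)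
  finally show ?thesis .
qed

lemma sum_helmert_power2: "m < l \<Longrightarrow> (\<Sum>i<l. (helmert m i)\<^sup>2) = real m * (real m + 1)"
proof -
  assume "m < l"
  then have "(\<Sum>i<l. (helmert m i)\<^sup>2) = (\<Sum>i\<in>{..<Suc m}. (helmert m i)\<^sup>2)"
    by (intro sum.mono_neutral_right) (auto simp: helmert_def)
  also have "\<dots> = real m * (real m + 1)" by (simp add: helmert_def power2_eq_square algebra_simps)
  finally show ?thesis .
qed

text \<open>The 1/k on the right belongs to the constant vector. Enlarging k adds one vector, which
  contributes 1/(k(k + 1)) at old points and so turns 1/k into 1/(k + 1).\<close>

lemma helmert_complete:
  assumes "i < k" "i' < k"
  shows "(\<Sum>m=1..<k. helmert m i * helmert m i' / (real m * (real m + 1))) = (if i = i' then 1 else 0) - 1 / real k"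
  using assms
proof (induction k)
  case (Suc k)
  show ?case
  proof (cases "k = 0")
    case False
    then have sp: "{1..<Suc k} = insert k {1..<k}" by auto
    have z: "(\<Sum>m=1..<k. helmert m i * helmert m i' / (real m * (real m + 1))) = 0" if "i = k \<or> i' = k"
      using that by (intro sum.neutral) (auto simp: helmert_def)
    have e: "1 / (real k * (real k + 1)) = 1 / real k - 1 / real (Suc k)"
      using False by (simp add: divide_simps)
    have e': "real k * real k / (real k * (real k + 1)) = 1 - 1 / real (Suc k)" "real k / (real k * (real k + 1)) = 1 / real (Suc k)"
      using False by (simp_all add: divide_simps)
    consider "i < k" "i' < k" | "i = k" "i' = k" | "i = k" "i' < k" | "i < k" "i' = k" using Suc.prems by linarith
    then show ?thesis
    proof cases
      case 1
      then have "helmert k i = 1" "helmert k i' = 1" by (simp_all add: helmert_def)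
      then show ?thesis unfolding sp using Suc.IH 1 e by simp
    next
      case 2
      then have "helmert k i = - real k" "helmert k i' = - real k" by (simp_all add: helmert_def)
      then show ?thesis unfolding sp using z 2 e' by simp
    next
      case 3
      then have "helmert k i = - real k" "helmert k i' = 1" by (simp_all add: helmert_def)
      then show ?thesis unfolding sp using z 3 e' by simp
    next
      case 4
      then have "helmert k i = 1" "helmert k i' = - real k" by (simp_all add: helmert_def)
      then show ?thesis unfolding sp using z 4 e' by simp
    qed
  qed (use Suc.prems in simp)
qed simp

text \<open>On the first l \<le> m points \<open>helmert m\<close> is constant, so averaging them
  keeps it; for m < l these points contain its whole support, on which it sums to zero.\<close>

lemma helmert_average:
  "(if i < l then (\<Sum>t<l. helmert m t) / real l else helmert m i) = (if l \<le> m then helmert m i else 0)"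
  using sum_helmert[of m l] by (auto simp: helmert_def)

text \<open>\<open>helmert m\<close> survives exactly the averages of length at most m, so its
  eigenvalue grows with m; the reversed index k - j makes the eigenvalues decrease in j.\<close>

definition basis_vector :: "nat \<Rightarrow> nat \<Rightarrow> nat \<Rightarrow> real" where
  "basis_vector k j i = (if j = 0 then 1 / sqrt (real k) else helmert (k - j) i / sqrt (real (k - j) * (real (k - j) + 1)))"

definition mixing_labels :: "nat \<Rightarrow> (nat \<times> nat) set" where
  "mixing_labels k = (SIGMA l:{1..k}. {..<l})"

text \<open>The average of length l gets total weight \<tau>(k - l) - \<tau>(k - l + 1), with
  \<tau>(k) read as 0, shared equally by its l reflections. Sums over l \<le> m telescope to
  \<tau>(k - m), and the weights are nonnegative when \<tau> is decreasing and nonnegative.\<close>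

definition mixing_weight :: "nat \<Rightarrow> (nat \<Rightarrow> real) \<Rightarrow> nat \<times> nat \<Rightarrow> real" where
  "mixing_weight k \<tau> p = (\<tau> (k - fst p) - (if fst p = 1 then 0 else \<tau> (k - fst p + 1))) / real (fst p)"

lemma sum_mixing:
  assumes "i < k"
  shows "(\<Sum>p\<in>mixing_labels k. mixing_weight k \<tau> p * f (reflection p i)) =
    (\<Sum>l=1..k. (\<tau> (k - l) - (if l = 1 then 0 else \<tau> (k - l + 1))) * (if i < l then (\<Sum>t<l. f t) / real l else f i))"
proof -
  define c where "c l = \<tau> (k - l) - (if l = 1 then 0 else \<tau> (k - l + 1))" for l
  have "(\<Sum>p\<in>mixing_labels k. mixing_weight k \<tau> p * f (reflection p i)) =
      (\<Sum>l=1..k. \<Sum>a<l. c l / real l * f (reflection (l, a) i))"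
    unfolding mixing_labels_def by (subst sum.Sigma) (auto simp: mixing_weight_def c_def case_prod_unfold)
  also have "\<dots> = (\<Sum>l=1..k. c l * (if i < l then (\<Sum>t<l. f t) / real l else f i))"
  proof (rule sum.cong[OF refl])
    fix l assume l: "l \<in> {1..k}"
    show "(\<Sum>a<l. c l / real l * f (reflection (l, a) i)) = c l * (if i < l then (\<Sum>t<l. f t) / real l else f i)"
    proof (cases "i < l")
      case True
      have "(\<Sum>a<l. f (reflection (l, a) i)) = (\<Sum>t<l. f t)"
        by (rule sum.reindex_bij_betw[OF bij_betw_reflection[OF True]])
      then show ?thesis using True unfolding sum_distrib_left[symmetric] by simp
    next
      case False
      then show ?thesis using l by (simp add: reflection_def)
    qed
  qed
  finally show ?thesis by (simp add: c_def)
qed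

lemma telescoping_mixing:
  fixes \<tau> :: "nat \<Rightarrow> real"
  shows "1 \<le> m \<Longrightarrow> m \<le> k \<Longrightarrow> (\<Sum>l=1..m. \<tau> (k - l) - (if l = 1 then 0 else \<tau> (k - l + 1))) = \<tau> (k - m)"
proof (induction m rule: dec_induct)
  case (step m)
  then have "k - Suc m + 1 = k - m" by simp
  then show ?case using step by simp
qed simp

lemma spectral_label_model_exists:
  assumes d: "d \<ge> 3" and k: "k \<ge> 1" and \<tau>0: "\<tau> 0 = 1" and decr: "\<And>i j. i \<le> j \<Longrightarrow> j < k \<Longrightarrow> \<tau> j \<le> \<tau> i"
    and gt: "\<And>j. j < k \<Longrightarrow> sqrt (real d - 1) < \<tau> j * (real d - 1)"
  shows "spectral_label_model d k (mixing_labels k) (mixing_weight k \<tau>) reflection (basis_vector k) \<tau>"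
proof
  have \<tau>_pos: "0 \<le> \<tau> j" if "j < k" for j
  proof -
    have "0 \<le> sqrt (real d - 1)" using d by simp
    then have "0 < \<tau> j * (real d - 1)" using gt[OF that] by linarith
    then show ?thesis using d by (simp add: zero_less_mult_iff)
  qed
  define c where "c l = \<tau> (k - l) - (if l = 1 then 0 else \<tau> (k - l + 1))" for l
  have tele: "(\<Sum>l=1..m. c l) = \<tau> (k - m)" if "1 \<le> m" "m \<le> k" for m
    unfolding c_def by (rule telescoping_mixing[OF that])
  show "d \<ge> 3" by fact
  show "finite (mixing_labels k)" by (simp add: mixing_labels_def)
  show "0 \<le> mixing_weight k \<tau> p" if "p \<in> mixing_labels k" for p
  proof -
    have p: "1 \<le> fst p" "fst p \<le> k" using that by (auto simp: mixing_labels_def)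
    have "0 \<le> c (fst p)"
    proof (cases "fst p = 1")
      case True
      then show ?thesis using \<tau>_pos[of "k - 1"] k by (simp add: c_def)
    next
      case False
      then show ?thesis using decr[of "k - fst p" "k - fst p + 1"] p by (simp add: c_def)
    qed
    then show ?thesis by (simp add: mixing_weight_def c_def)
  qed
  show "(\<Sum>p\<in>mixing_labels k. mixing_weight k \<tau> p) = 1"
    using sum_mixing[of 0 k \<tau> "\<lambda>_. 1"] tele[of k] k \<tau>0 by (simp add: c_def)
  show "reflection p i < k" if "p \<in> mixing_labels k" "i < k" for p i
    using that by (intro reflection_less) (auto simp: mixing_labels_def)
  show "reflection p (reflection p i) = i" for p i by (rule reflection_reflection)
  show "(\<Sum>p\<in>mixing_labels k. mixing_weight k \<tau> p * basis_vector k j (reflection p i)) = \<tau> j * basis_vector k j i"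
    if ij: "i < k" "j < k" for i j
  proof (cases "j = 0")
    case True
    have "(\<Sum>p\<in>mixing_labels k. mixing_weight k \<tau> p * basis_vector k j (reflection p i)) = (\<Sum>l=1..k. c l * (1 / sqrt (real k)))"
      unfolding sum_mixing[OF ij(1)] by (intro sum.cong refl) (auto simp: True c_def basis_vector_def)
    also have "\<dots> = (\<Sum>l=1..k. c l) * (1 / sqrt (real k))" by (rule sum_distrib_right[symmetric])
    finally show ?thesis using tele[of k] k True by (simp add: basis_vector_def)
  next
    case False
    define m where "m = k - j"
    define z where "z = sqrt (real m * (real m + 1))"
    have m: "1 \<le> m" "m < k" "k - m = j" using ij False by (auto simp: m_def)
    have bv: "basis_vector k j t = helmert m t / z" for t using False by (simp add: basis_vector_def m_def z_def)
    have av: "(if i < l then (\<Sum>t<l. basis_vector k j t) / real l else basis_vector k j i) = (if l \<le> m then 1 else 0) * (helmert m i / z)" for l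
    proof -
      have "(if i < l then (\<Sum>t<l. basis_vector k j t) / real l else basis_vector k j i) =
          (if i < l then (\<Sum>t<l. helmert m t) / real l else helmert m i) / z"
        by (simp add: bv mult.commute flip: sum_divide_distrib)
      then show ?thesis unfolding helmert_average by simp
    qed
    have "(\<Sum>p\<in>mixing_labels k. mixing_weight k \<tau> p * basis_vector k j (reflection p i)) =
        (\<Sum>l=1..k. (if l \<le> m then c l else 0) * (helmert m i / z))"
      unfolding sum_mixing[OF ij(1)] av by (intro sum.cong refl) (auto simp: c_def)
    also have "\<dots> = (\<Sum>l=1..k. if l \<le> m then c l else 0) * (helmert m i / z)" by (rule sum_distrib_right[symmetric])
    also have "(\<Sum>l=1..k. if l \<le> m then c l else 0) = (\<Sum>l=1..m. c l)"
      using m by (intro sum.mono_neutral_cong_right) auto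
    finally show ?thesis using tele[of m] m by (simp add: bv)
  qed
  show "(\<Sum>j<k. basis_vector k j i * basis_vector k j i') = (if i = i' then 1 else 0)" if ii: "i < k" "i' < k" for i i'
  proof -
    have "{..<k} = insert 0 {1..<k}" using k by auto
    then have "(\<Sum>j<k. basis_vector k j i * basis_vector k j i') = 1 / real k + (\<Sum>j=1..<k. basis_vector k j i * basis_vector k j i')"
      by (simp add: basis_vector_def)
    also have "(\<Sum>j=1..<k. basis_vector k j i * basis_vector k j i') =
        (\<Sum>m=1..<k. helmert m i * helmert m i' / (real m * (real m + 1)))"
      by (rule sum.reindex_bij_witness[of _ "\<lambda>m. k - m" "\<lambda>j. k - j"])
        (auto simp: basis_vector_def)
    finally show ?thesis using helmert_complete[OF ii] by simp
  qed
  show "(\<Sum>i<k. (basis_vector k j i)\<^sup>2) = 1" if j: "j < k" for j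
  proof (cases "j = 0")
    case False
    define m where "m = k - j"
    have m: "1 \<le> m" "m < k" using j False by (auto simp: m_def)
    have "(basis_vector k j i)\<^sup>2 = (helmert m i)\<^sup>2 / (real m * (real m + 1))" for i
      using False by (simp add: basis_vector_def m_def power_divide)
    then show ?thesis using sum_helmert_power2[OF m(2)] m(1) by (simp flip: sum_divide_distrib)
  qed (use k in \<open>simp add: basis_vector_def power_divide\<close>)
  show "\<tau> j \<le> 1" if "j < k" for j using decr[of 0 j] that \<tau>0 by simp
  show "sqrt (real d - 1) < \<tau> j * (real d - 1)" if "j < k" for j using gt[OF that] .
qed

section \<open>From prescribed outliers to prescribed limits\<close>

lemma prescribed_outliers_graph:
  fixes d k :: nat and c :: "nat \<Rightarrow> real"
  assumes d: "d \<ge> 3" and k: "k \<ge> 1" and c0: "c 0 = real d" and decr: "\<And>i j. i < j \<Longrightarrow> j < k \<Longrightarrow> c j < c i"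
    and gt: "\<And>j. j < k \<Longrightarrow> 2 * sqrt (real d - 1) < c j" and \<delta>: "\<delta> > 0"
  obtains G :: "nat pair_pre_digraph" where "pair_graph G" "regular_graph d G" "k \<le> card (pverts G)"
    "\<And>j. j < k \<Longrightarrow> \<bar>graph_eigenvalue (Suc j) G - c j\<bar> < \<delta>"
proof -
  define s where "s = real d - 1"
  have s: "s \<ge> 2" "s > 0" "sqrt s > 0" using d by (auto simp: s_def)
  have ss: "sqrt s < s"
  proof -
    have "sqrt s * 1 < sqrt s * sqrt s" using s by (intro mult_strict_left_mono) auto
    then show ?thesis using s by simp
  qed
  \<comment> \<open>The larger root of t^2 - c t + s = 0, the one above sqrt s; it solves t + s/t =
    c.\<close>
  define \<alpha> where "\<alpha> j = (c j + sqrt ((c j)\<^sup>2 - 4 * s)) / 2" for j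
  have \<alpha>: "sqrt s < \<alpha> j" "\<alpha> j + s / \<alpha> j = c j" if "j < k" for j
  proof -
    have cj: "2 * sqrt s < c j" using gt[OF that] by (simp add: s_def)
    have "(2 * sqrt s)\<^sup>2 \<le> (c j)\<^sup>2" using cj s by (intro power_mono) auto
    then have nn: "0 \<le> (c j)\<^sup>2 - 4 * s" using s by (simp add: power_mult_distrib)
    define r where "r = sqrt ((c j)\<^sup>2 - 4 * s)"
    have r: "0 \<le> r" "r * r = c j * c j - 4 * s" using nn by (simp_all add: r_def power2_eq_square)
    show a: "sqrt s < \<alpha> j" using cj r(1) by (simp add: \<alpha>_def flip: r_def)
    have "\<alpha> j * \<alpha> j + s = c j * \<alpha> j"
      using r(2) by (simp add: \<alpha>_def flip: r_def) (simp add: field_simps)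
    moreover have "\<alpha> j \<noteq> 0" using a s by linarith
    ultimately show "\<alpha> j + s / \<alpha> j = c j" by (simp add: field_simps)
  qed
  have mono: "a \<le> b" if "sqrt s < a" "sqrt s < b" "a + s / a \<le> b + s / b" for a b
    using add_divide_strict_mono(1)[OF s(2) that(2), of a] that(3) by (meson not_le)
  have \<alpha>0: "\<alpha> 0 = s"
  proof -
    have "s + s / s = c 0" using s c0 by (simp add: s_def)
    then show ?thesis using mono[of "\<alpha> 0" s] mono[of s "\<alpha> 0"] \<alpha>[of 0] ss k by simp
  qed
  define \<tau> where "\<tau> j = \<alpha> j / s" for j
  have "spectral_label_model d k (mixing_labels k) (mixing_weight k \<tau>) reflection (basis_vector k) \<tau>"
  proof (rule spectral_label_model_exists[OF d k])
    show "\<tau> 0 = 1" using \<alpha>0 s by (simp add: \<tau>_def)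
    show "\<tau> j \<le> \<tau> i" if ij: "i \<le> j" "j < k" for i j
    proof -
      have "c j \<le> c i" using decr[of i j] ij by (cases "i = j") auto
      then have "\<alpha> j \<le> \<alpha> i" using \<alpha>[of i] \<alpha>[of j] ij by - (rule mono, auto)
      then show ?thesis using s by (simp add: \<tau>_def divide_right_mono)
    qed
    show "sqrt (real d - 1) < \<tau> j * (real d - 1)" if "j < k" for j
      using \<alpha>(1)[OF that] s by (simp add: \<tau>_def flip: s_def)
  qed
  then interpret M: spectral_label_model d k "mixing_labels k" "mixing_weight k \<tau>" reflection "basis_vector k" \<tau> .
  have "M.s = s" by (simp add: M.s_def s_def)
  then have out: "M.outlier j = c j" if "j < k" for j
    using \<alpha>(2)[OF that] s by (simp add: M.outlier_def M.\<alpha>_def \<tau>_def)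
  show ?thesis
  proof (rule M.outlier_graph[OF k _ \<delta>])
    show "M.outlier j < M.outlier i" if "i < j" "j < k" for i j using decr[OF that] out that by simp
    fix G :: "nat pair_pre_digraph"
    assume G: "pair_graph G" "regular_graph d G" "k \<le> card (pverts G)"
      "\<And>j. j < k \<Longrightarrow> \<bar>graph_eigenvalue (Suc j) G - M.outlier j\<bar> < \<delta>"
    show thesis by (rule that[OF G(1-3)]) (use G(4) out in simp)
  qed
qed

theorem theorem1p2:
  fixes d k :: nat and \<mu> :: "nat \<Rightarrow> real"
  assumes "d \<ge> 3" and "k \<ge> 2"
    and "\<mu> 1 = real d"
    and "\<And>i j. 1 \<le> i \<Longrightarrow> i \<le> j \<Longrightarrow> j \<le> k \<Longrightarrow> \<mu> j \<le> \<mu> i"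
    and "\<mu> k \<ge> 2 * sqrt (real d - 1)"
  shows "\<exists>G :: nat \<Rightarrow> nat pair_pre_digraph.
           (\<forall>i. pair_graph (G i) \<and> regular_graph d (G i) \<and> k \<le> card (pverts (G i))) \<and>
           (\<forall>j \<in> {1..k}. (\<lambda>i. graph_eigenvalue j (G i)) \<longlonglongrightarrow> \<mu> j)"
proof -
  define r where "r = 2 * sqrt (real d - 1)"
  have r: "0 \<le> r" "r < real d"
  proof -
    show "0 \<le> r" using assms(1) by (simp add: r_def)
    have "0 < (sqrt (real d - 1) - 1)\<^sup>2" using assms(1) by simp
    also have "\<dots> = real d - r" using assms(1) by (simp add: r_def power2_diff)
    finally show "r < real d" by simp
  qed
  \<comment> \<open>Equally spaced values from d downwards, all above r. Mixing in a small share of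
    them makes the prescribed values strictly decreasing and larger than r, and keeps the first one
    equal to d.\<close>
  define \<kappa> where "\<kappa> j = real d - real j * ((real d - r) / real k)" for j
  have \<kappa>: "r < \<kappa> j" "\<kappa> j \<le> real d" if "j < k" for j
  proof -
    have "real j * ((real d - r) / real k) < real k * ((real d - r) / real k)"
      using that r assms(2) by (intro mult_strict_right_mono divide_pos_pos) auto
    then show "r < \<kappa> j" using assms(2) by (simp add: \<kappa>_def)
    show "\<kappa> j \<le> real d" using r by (simp add: \<kappa>_def)
  qed
  have \<kappa>_less: "\<kappa> j < \<kappa> i" if "i < j" for i j
    unfolding \<kappa>_def using that r assms(2) by (intro diff_strict_left_mono mult_strict_right_mono divide_pos_pos) auto
  have \<mu>: "r \<le> \<mu> (Suc j)" "\<mu> (Suc j) \<le> real d" if "j < k" for j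
    using assms(4)[of "Suc j" k] assms(4)[of 1 "Suc j"] assms(3,5) that by (auto simp: r_def)
  have approx: "\<exists>G :: nat pair_pre_digraph. pair_graph G \<and> regular_graph d G \<and> k \<le> card (pverts G) \<and>
      (\<forall>j\<in>{1..k}. \<bar>graph_eigenvalue j G - \<mu> j\<bar> < e)" if e: "0 < e" "e \<le> 1" for e
  proof -
    \<comment> \<open>All values lie in [0, d], so the mixing moves them by at most \<eta> d = e/2;
      the other half of e is left for the eigenvalues.\<close>
    define \<eta> where "\<eta> = e / (2 * real d)"
    have \<eta>: "0 < \<eta>" "\<eta> \<le> 1" "\<eta> * real d = e / 2" using e assms(1) by (auto simp: \<eta>_def field_simps)
    define c where "c j = (1 - \<eta>) * \<mu> (Suc j) + \<eta> * \<kappa> j" for j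
    obtain G :: "nat pair_pre_digraph" where G: "pair_graph G" "regular_graph d G" "k \<le> card (pverts G)"
      "\<And>j. j < k \<Longrightarrow> \<bar>graph_eigenvalue (Suc j) G - c j\<bar> < e / 2"
    proof (rule prescribed_outliers_graph[of d k c "e / 2"])
      show "c 0 = real d" using assms(3) by (simp add: c_def \<kappa>_def algebra_simps)
      show "c j < c i" if ij: "i < j" "j < k" for i j
      proof -
        have "(1 - \<eta>) * \<mu> (Suc j) \<le> (1 - \<eta>) * \<mu> (Suc i)"
          using assms(4)[of "Suc i" "Suc j"] ij \<eta>(2) by (intro mult_left_mono) auto
        moreover have "\<eta> * \<kappa> j < \<eta> * \<kappa> i" using \<kappa>_less[OF ij(1)] \<eta>(1) by simp
        ultimately show ?thesis by (simp add: c_def)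
      qed
      show "2 * sqrt (real d - 1) < c j" if j: "j < k" for j
      proof -
        have "(1 - \<eta>) * r \<le> (1 - \<eta>) * \<mu> (Suc j)" using \<mu>(1)[OF j] \<eta>(2) by (intro mult_left_mono) auto
        moreover have "\<eta> * r < \<eta> * \<kappa> j" using \<kappa>(1)[OF j] \<eta>(1) by simp
        ultimately show ?thesis by (simp add: c_def r_def[symmetric] algebra_simps)
      qed
    qed (use assms e in auto)
    have "\<bar>graph_eigenvalue (Suc j) G - \<mu> (Suc j)\<bar> < e" if j: "j < k" for j
    proof -
      have "c j - \<mu> (Suc j) = \<eta> * (\<kappa> j - \<mu> (Suc j))" by (simp add: c_def algebra_simps)
      moreover have "\<bar>\<kappa> j - \<mu> (Suc j)\<bar> \<le> real d" using \<kappa>[OF j] \<mu>[OF j] r by linarith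
      then have "\<eta> * \<bar>\<kappa> j - \<mu> (Suc j)\<bar> \<le> \<eta> * real d" using \<eta>(1) by (intro mult_left_mono) auto
      ultimately have "\<bar>c j - \<mu> (Suc j)\<bar> \<le> e / 2" using \<eta> by (simp add: abs_mult)
      then show ?thesis using G(4)[OF j] by linarith
    qed
    then have "\<bar>graph_eigenvalue j G - \<mu> j\<bar> < e" if "j \<in> {1..k}" for j
      using that by (cases j) auto
    then show ?thesis using G(1-3) by blast
  qed
  have "\<exists>G :: nat pair_pre_digraph. pair_graph G \<and> regular_graph d G \<and> k \<le> card (pverts G) \<and>
      (\<forall>j\<in>{1..k}. \<bar>graph_eigenvalue j G - \<mu> j\<bar> < inverse (real (Suc i)))" for i
    by (rule approx) (auto simp: field_simps)
  then obtain G :: "nat \<Rightarrow> nat pair_pre_digraph" where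
    G: "\<And>i. pair_graph (G i) \<and> regular_graph d (G i) \<and> k \<le> card (pverts (G i))"
      "\<And>i j. j \<in> {1..k} \<Longrightarrow> \<bar>graph_eigenvalue j (G i) - \<mu> j\<bar> < inverse (real (Suc i))"
    by metis
  have "(\<lambda>i. graph_eigenvalue j (G i)) \<longlonglongrightarrow> \<mu> j" if "j \<in> {1..k}" for j
  proof (rule LIM_zero_cancel, rule tendsto_0_le[OF LIMSEQ_inverse_real_of_nat])
    show "\<forall>\<^sub>F i in sequentially. norm (graph_eigenvalue j (G i) - \<mu> j) \<le> norm (inverse (real (Suc i))) * 1"
      using G(2)[OF that] by (intro always_eventually allI) (simp add: less_imp_le)
  qed
  then show ?thesis using G(1) by (intro exI[of _ G]) blast
qed

end
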